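(* Let $k\ge n\ge1$, let $\mathbb{B}(D)=\sum_{|\alpha|=k}\mathbb{B}_\alpha\partial^\alpha$ be a $k$-homogeneous linear differential operator with constant coefficients on $\mathbb{R}^n$ from $V$ to $W$, and assume that $\mathbb{B}(D)$ has constant rank. Let $\pi$ be the projection associated with $\mathbb{B}(D)$ (see context). Then there exists a constant $c>0$ such that $$\|D^{k-n}(u-\pi u)\|_{L^\infty}\le c\,\|\mathbb{B}(D)u\|_{L^1}\qquad\text{for all }u\in C_c^\infty(\mathbb{R}^n,V)$$ if and only if $$\int_{\mathbb{S}^{n-1}}\mathbb{B}^\dagger(\xi)w\otimes\xi^{\otimes(k-n)}\,d\mathscr{H}^{n-1}(\xi)=0\qquad\text{for all }w\in\bigcap_{\xi\in\mathbb{S}^{n-1}}\operatorname{im}\mathbb{B}(\xi).$$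
   Context: Operators. $V,W$ are finite-dimensional inner product spaces and $\mathbb{B}_\alpha\in\mathrm{Lin}(V,W)$ are linear maps for all multi-indices $\alpha$ with $|\alpha|=k$. The symbol map is $\mathbb{B}(\xi)=\sum_{|\alpha|=k}\xi^\alpha\mathbb{B}_\alpha\in\mathrm{Lin}(V,W)$ for $\xi\in\mathbb{R}^n$. The operator $\mathbb{B}(D)$ has constant rank if there is an integer $r$ with $\operatorname{rank}\mathbb{B}(\xi)=r$ for all $0\ne\xi\in\mathbb{R}^n$. Projection. The Fourier transform is $\hat u(\xi)=\int_{\mathbb{R}^n}e^{-i\xi\cdot x}u(x)\,dx$. $M^\dagger$ denotes the Moore–Penrose generalized inverse of a linear map $M$ between inner product spaces, and $\mathbb{B}^\dagger(\xi):=\mathbb{B}(\xi)^\dagger\in\mathrm{Lin}(W,V)$. The operator $\pi$ is the Fourier multiplier $\widehat{\pi u}(\xi)=[\mathrm{Id}_V-\mathbb{B}^\dagger(\xi)\mathbb{B}(\xi)]\hat u(\xi)$, where $\mathrm{Id}_V-\mathbb{B}^\dagger(\xi)\mathbb{B}(\xi)$ is the orthogonal projection of $V$ onto $\ker\mathbb{B}(\xi)$; that is, $\pi$ is the $L^2$-orthogonal projection onto the kernel of $\mathbb{B}(D)$. (If $V,W$ are real, the Fourier transform takes values in the complexification and linear maps are extended complex-linearly.) Notation. $D^l v$ denotes the tensor of all partial derivatives of $v$ of order $l$. $\xi^{\otimes m}$ is the $m$-fold tensor power of $\xi$ (so $\mathbb{B}^\dagger(\xi)w\otimes\xi^{\otimes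 0}=\mathbb{B}^\dagger(\xi)w$), and the integral takes values in $V\otimes(\mathbb{R}^n)^{\otimes(k-n)}$. $\mathscr{H}^{n-1}$ is the $(n-1)$-dimensional Hausdorff measure (counting measure on $\{\pm1\}$ if $n=1$). *)

theory Defs
  imports "HOL-Analysis.Analysis" "HOL-Probability.Essential_Supremum"
begin

section \<open>Partial derivatives and test functions\<close>

definition partial_deriv ::
    "'n::finite \<Rightarrow> (real^'n \<Rightarrow> 'e::real_normed_vector) \<Rightarrow> real^'n \<Rightarrow> 'e" where
  "partial_deriv i f x = vector_derivative (\<lambda>t. f (x + t *\<^sub>R axis i 1)) (at 0)"

definition partial_derivs ::
    "'n::finite list \<Rightarrow> (real^'n \<Rightarrow> 'e::real_normed_vector) \<Rightarrow> real^'n \<Rightarrow> 'e" where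
  "partial_derivs is f = foldr partial_deriv is f"

text \<open>If all iterated partial derivatives are differentiable, they are in particular all
  continuous, so this is the usual notion of a smooth function.\<close>

definition test_functions :: "(real^'n::finite \<Rightarrow> 'e::real_normed_vector) set" where
  "test_functions =
     {u. (\<forall>is. partial_derivs is u differentiable_on UNIV) \<and> compact (closure {x. u x \<noteq> 0})}"

type_synonym 'n multi_index = "'n \<Rightarrow> nat"

definition multi_indices :: "nat \<Rightarrow> 'n::finite multi_index set" where
  "multi_indices k = {\<alpha>. (\<Sum>i\<in>UNIV. \<alpha> i) = k}"

definition monomial :: "'n::finite multi_index \<Rightarrow> real^'n \<Rightarrow> real" where
  "monomial \<alpha> \<xi> = (\<Prod>i\<in>UNIV. (\<xi> $ i) ^ \<alpha> i)"

text \<open>The order in which the partial derivatives are taken is left open; it is irrelevant for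
  smooth functions.\<close>

definition multi_deriv ::
    "'n::finite multi_index \<Rightarrow> (real^'n \<Rightarrow> 'e::real_normed_vector) \<Rightarrow> real^'n \<Rightarrow> 'e" where
  "multi_deriv \<alpha> f = partial_derivs (SOME is. \<forall>i. count_list is i = \<alpha> i) f"


section \<open>Homogeneous differential operators\<close>

text \<open>The coefficients of an operator of order \<open>k\<close> are given by a function on all multi-indices,
  of which only the values on \<^term>\<open>multi_indices k\<close> are used.\<close>

definition diff_operator ::
    "nat \<Rightarrow> ('n::finite multi_index \<Rightarrow> 'v::euclidean_space \<Rightarrow> 'w::euclidean_space)
       \<Rightarrow> (real^'n \<Rightarrow> 'v) \<Rightarrow> real^'n \<Rightarrow> 'w" where
  "diff_operator k B u x = (\<Sum>\<alpha>\<in>multi_indices k. B \<alpha> (multi_deriv \<alpha> u x))"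

definition symbol ::
    "nat \<Rightarrow> ('n::finite multi_index \<Rightarrow> 'v::euclidean_space \<Rightarrow> 'w::euclidean_space)
       \<Rightarrow> real^'n \<Rightarrow> 'v \<Rightarrow> 'w" where
  "symbol k B \<xi> v = (\<Sum>\<alpha>\<in>multi_indices k. monomial \<alpha> \<xi> *\<^sub>R B \<alpha> v)"

definition constant_rank ::
    "nat \<Rightarrow> ('n::finite multi_index \<Rightarrow> 'v::euclidean_space \<Rightarrow> 'w::euclidean_space) \<Rightarrow> bool" where
  "constant_rank k B \<longleftrightarrow> (\<exists>r. \<forall>\<xi>. \<xi> \<noteq> 0 \<longrightarrow> dim (range (symbol k B \<xi>)) = r)"

definition moore_penrose ::
    "('v::euclidean_space \<Rightarrow> 'w::euclidean_space) \<Rightarrow> 'w \<Rightarrow> 'v" where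
  "moore_penrose M = (THE X. linear X \<and> M \<circ> X \<circ> M = M \<and> X \<circ> M \<circ> X = X \<and>
     adjoint (M \<circ> X) = M \<circ> X \<and> adjoint (X \<circ> M) = X \<circ> M)"


section \<open>Fourier multipliers and the projection\<close>

text \<open>A Hermitian inner product space is represented by its underlying real inner product space
  (with the real part of the Hermitian product) together with multiplication by the imaginary
  unit, an orthogonal map \<open>J\<close>. For complex-linear maps between such spaces the Moore--Penrose
  inverse is the same for the Hermitian and for the underlying real structure, and the
  complex rank is half the real one.\<close>

definition complex_structure :: "('e::euclidean_space \<Rightarrow> 'e) \<Rightarrow> bool" where
  "complex_structure J \<longleftrightarrow> orthogonal_transformation J \<and> (\<forall>v. J (J v) = - v)"

definition cscale :: "('e::euclidean_space \<Rightarrow> 'e) \<Rightarrow> complex \<Rightarrow> 'e \<Rightarrow> 'e" where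
  "cscale J z v = Re z *\<^sub>R v + Im z *\<^sub>R J v"

definition fourier ::
    "('e::euclidean_space \<Rightarrow> 'e) \<Rightarrow> (real^'n::finite \<Rightarrow> 'e) \<Rightarrow> real^'n \<Rightarrow> 'e" where
  "fourier J u \<xi> = (LINT x|lborel. cscale J (exp (- \<i> * complex_of_real (\<xi> \<bullet> x))) (u x))"

definition inverse_fourier ::
    "('e::euclidean_space \<Rightarrow> 'e) \<Rightarrow> (real^'n::finite \<Rightarrow> 'e) \<Rightarrow> real^'n \<Rightarrow> 'e" where
  "inverse_fourier J g x = (1 / (2 * pi) ^ CARD('n)) *\<^sub>R
     (LINT \<xi>|lborel. cscale J (exp (\<i> * complex_of_real (\<xi> \<bullet> x))) (g \<xi>))"

definition fourier_multiplier ::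
    "('e::euclidean_space \<Rightarrow> 'e) \<Rightarrow> (real^'n::finite \<Rightarrow> 'e \<Rightarrow> 'e)
       \<Rightarrow> (real^'n \<Rightarrow> 'e) \<Rightarrow> real^'n \<Rightarrow> 'e" where
  "fourier_multiplier J m u = inverse_fourier J (\<lambda>\<xi>. m \<xi> (fourier J u \<xi>))"

definition kernel_symbol ::
    "nat \<Rightarrow> ('n::finite multi_index \<Rightarrow> 'v::euclidean_space \<Rightarrow> 'w::euclidean_space)
       \<Rightarrow> real^'n \<Rightarrow> 'v \<Rightarrow> 'v" where
  "kernel_symbol k B \<xi> v = v - moore_penrose (symbol k B \<xi>) (symbol k B \<xi> v)"

definition complex_projection ::
    "('v \<Rightarrow> 'v) \<Rightarrow> nat \<Rightarrow> ('n::finite multi_index \<Rightarrow> 'v::euclidean_space \<Rightarrow> 'w::euclidean_space)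
       \<Rightarrow> (real^'n \<Rightarrow> 'v) \<Rightarrow> real^'n \<Rightarrow> 'v" where
  "complex_projection J k B u = fourier_multiplier J (kernel_symbol k B) u"

text \<open>The complexification of a real space \<open>'v\<close> is \<open>'v \<times> 'v\<close>, where \<open>(a, b)\<close> stands for
  \<open>a + \<i> b\<close>; \<open>'v\<close> is embedded by \<open>a \<mapsto> (a, 0)\<close>, and the complex-linear extension of a real-linear
  map \<open>L\<close> is \<^term>\<open>map_prod L L\<close>.\<close>

definition complexification_J :: "'v::euclidean_space \<times> 'v \<Rightarrow> 'v \<times> 'v" where
  "complexification_J = (\<lambda>(a, b). (- b, a))"

definition complexify :: "'v::euclidean_space \<Rightarrow> 'v \<times> 'v" where
  "complexify v = (v, 0)"

definition real_projection ::
    "nat \<Rightarrow> ('n::finite multi_index \<Rightarrow> 'v::euclidean_space \<Rightarrow> 'w::euclidean_space)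
       \<Rightarrow> (real^'n \<Rightarrow> 'v) \<Rightarrow> real^'n \<Rightarrow> 'v \<times> 'v" where
  "real_projection k B u = fourier_multiplier complexification_J
     (\<lambda>\<xi>. map_prod (kernel_symbol k B \<xi>) (kernel_symbol k B \<xi>)) (\<lambda>x. complexify (u x))"


section \<open>Tensors and norms\<close>

text \<open>An element of the tensor product of \<open>'v\<close> with the \<open>l\<close>-fold tensor power of
  \<^typ>\<open>real^'n\<close> is given by its \<open>'v\<close>-valued components with respect to the standard basis,
  indexed by the lists of length \<open>l\<close> over \<open>'n\<close>.\<close>

type_synonym ('n, 'v) tensor = "'n list \<Rightarrow> 'v"

definition tensor_norm :: "nat \<Rightarrow> ('n::finite, 'v::real_normed_vector) tensor \<Rightarrow> real" where
  "tensor_norm l T = sqrt (\<Sum>is | length is = l. (norm (T is))\<^sup>2)"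

definition deriv_tensor ::
    "(real^'n::finite \<Rightarrow> 'v::real_normed_vector) \<Rightarrow> real^'n \<Rightarrow> ('n, 'v) tensor" where
  "deriv_tensor v x = (\<lambda>is. partial_derivs is v x)"

definition tensor_power :: "'v::real_vector \<Rightarrow> real^'n::finite \<Rightarrow> ('n, 'v) tensor" where
  "tensor_power v \<xi> = (\<lambda>is. prod_list (map (\<lambda>i. \<xi> $ i) is) *\<^sub>R v)"

definition L1_norm :: "(real^'n::finite \<Rightarrow> 'v::euclidean_space) \<Rightarrow> real" where
  "L1_norm f = (LINT x|lborel. norm (f x))"

definition tensor_Linf_norm ::
    "nat \<Rightarrow> (real^'n::finite \<Rightarrow> ('n, 'v::euclidean_space) tensor) \<Rightarrow> ereal" where
  "tensor_Linf_norm l F = esssup lborel (\<lambda>x. ereal (tensor_norm l (F x)))"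


section \<open>Hausdorff measure\<close>

text \<open>The normalisation is such that the \<open>m\<close>-dimensional Hausdorff measure on an
  \<open>m\<close>-dimensional space is Lebesgue measure. Since \<open>0 ^ 0 = 1\<close>, for \<open>m = 0\<close> every nonempty
  covering set counts 1, which gives the counting measure. Boundedness is required because
  \<^const>\<open>diameter\<close> is unspecified for unbounded sets.\<close>

definition hausdorff_content :: "nat \<Rightarrow> 'a::metric_space set \<Rightarrow> ennreal" where
  "hausdorff_content m C =
     (if C = {} then 0 else ennreal (unit_ball_vol (real m) * (diameter C / 2) ^ m))"

definition hausdorff_pre :: "nat \<Rightarrow> real \<Rightarrow> 'a::metric_space set \<Rightarrow> ennreal" where
  "hausdorff_pre m \<delta> A =
     (INF C \<in> {C :: nat \<Rightarrow> 'a set. A \<subseteq> (\<Union>i. C i) \<and> (\<forall>i. bounded (C i) \<and> diameter (C i) \<le> \<delta>)}.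
        \<Sum>i. hausdorff_content m (C i))"

definition hausdorff_outer :: "nat \<Rightarrow> 'a::metric_space set \<Rightarrow> ennreal" where
  "hausdorff_outer m A = (SUP \<delta>\<in>{0<..}. hausdorff_pre m \<delta> A)"

definition hausdorff_measure :: "nat \<Rightarrow> 'a::metric_space measure" where
  "hausdorff_measure m = measure_of UNIV (sets borel) (hausdorff_outer m)"


section \<open>The cancellation condition\<close>

definition cancellation_condition ::
    "nat \<Rightarrow> ('n::finite multi_index \<Rightarrow> 'v::euclidean_space \<Rightarrow> 'w::euclidean_space) \<Rightarrow> bool" where
  "cancellation_condition k B \<longleftrightarrow>
     (\<forall>w \<in> (\<Inter>\<xi>\<in>sphere 0 1. range (symbol k B \<xi>)). \<forall>is. length is = k - CARD('n) \<longrightarrow>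
        (LINT \<xi>:sphere 0 1|hausdorff_measure (CARD('n) - 1).
           tensor_power (moore_penrose (symbol k B \<xi>) w) \<xi> is) = 0)"

end

theory Submission
  imports Defs "HOL-Probability.Sinc_Integral" "HOL-Probability.Characteristic_Functions"
begin

text \<open>By translation invariance the estimate only has to be shown at the origin, where
  \<open>D\<^sup>k\<^sup>-\<^sup>n (u - \<pi> u)\<close> is, up to constants, the integral of the kernel \<open>\<Omega>(\<xi>) w = \<xi>\<^sup>\<otimes>\<^sup>(\<^sup>k\<^sup>-\<^sup>n\<^sup>) \<otimes> B\<^sup>\<dagger>(\<xi>) w\<close> against
  the Fourier transform of \<open>f = B(D) u\<close>. This kernel is homogeneous of degree \<open>-n\<close>, and by constant
  rank it is smooth off the origin (Wedin's identity). Writing Lebesgue measure as a superposition of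
  the dilates of the annulus \<open>1 \<le> |z| \<le> 2\<close>, one finds that a kernel of degree \<open>-n\<close> with vanishing
  mean over the annulus has a bounded Fourier transform: the truncated integrals
  \<open>\<integral> e\<^sup>-\<^sup>i\<^sup>t\<^sup>x\<^sup>z dt / t\<close> equal \<open>- ln |x z|\<close> up to a bounded term and a constant independent of \<open>z\<close>.
  As the transform of \<open>f\<close> takes values in the range of \<open>B(\<xi>)\<close>, nothing changes if a kernel
  \<open>|\<xi>|\<^sup>-\<^sup>n T (w - B(\<xi>) B\<^sup>\<dagger>(\<xi>) w)\<close> is subtracted. The means of \<open>w - B(\<xi>) B\<^sup>\<dagger>(\<xi>) w\<close> vanish only for \<open>w\<close> in the
  intersection of the ranges, so under the cancellation condition a linear map \<open>T\<close> can be chosen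
  for which the corrected kernel has mean zero for all \<open>w\<close>.

  Conversely, let \<open>w\<close> lie in all ranges and apply the estimate to (cutoffs of) functions with
  \<open>B(D) u\<close> equal to the inverse transform of \<open>(\<chi>(\<xi>) - \<chi>(R \<xi>)) w\<close> for a bump function \<open>\<chi>\<close>. By scaling
  the right-hand side is bounded in \<open>R\<close>, while the left-hand side is at least a constant times
  \<open>ln R\<close> times the norm of the mean of \<open>\<Omega> w\<close>. The real case is reduced to the complex one by
  complexification.\<close>

section \<open>The Moore--Penrose inverse\<close>

text \<open>A kernel of degree -n is integrable neither at 0 nor at infinity, so absolute values
  give nothing. In the truncated integral the phase t (x . z) is therefore compared with t |x|,
  which does not depend on z: the mean-zero condition kills the comparison term, and the error is of
  size |ln (|x . z| / |x|)|, whose integral over the annulus is bounded uniformly in x by rotation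
  invariance. The map T exists because the mean of w - B(\<xi>) B^dagger(\<xi>) w is a positive
  semidefinite map G of w whose kernel is exactly the intersection of the ranges; T is the mean of
  \<Omega> composed with the pseudoinverse of G. For the converse, a function with prescribed B(D) u
  need not be compactly supported, and its cutoffs converge in L1 only, which bounds their
  transforms but gives no decay; averaging the estimate over translates with a Gaussian weight
  supplies it. Hausdorff measure enters through its invariance: a finite measure on the sphere
  giving equal mass to balls of equal radius is unique up to a factor, so the spherical integral can
  be traded for one over the annulus.\<close>

lemma linear_map_prod: "linear f \<Longrightarrow> linear (map_prod f f)"
  by (auto simp: linear_iff)

lemma adjoint_eq_self_iff:
  fixes f :: "'a::euclidean_space \<Rightarrow> 'a"
  assumes "linear f"
  shows "adjoint f = f \<longleftrightarrow> (\<forall>x y. f x \<bullet> y = x \<bullet> f y)"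
proof
  assume "adjoint f = f"
  then show "\<forall>x y. f x \<bullet> y = x \<bullet> f y" using adjoint_works[OF assms] by simp
qed (simp add: adjoint_unique)

text \<open>The four Penrose equations in pointwise form, with the two self-adjointness conditions
  written as symmetry for the inner product, so that they can be used by rewriting.\<close>

definition penrose :: "('v::euclidean_space \<Rightarrow> 'w::euclidean_space) \<Rightarrow> ('w \<Rightarrow> 'v) \<Rightarrow> bool" where
  "penrose M X \<longleftrightarrow> linear X \<and> (\<forall>v. M (X (M v)) = M v) \<and> (\<forall>w. X (M (X w)) = X w) \<and>
     (\<forall>w z. M (X w) \<bullet> z = w \<bullet> M (X z)) \<and> (\<forall>v u. X (M v) \<bullet> u = v \<bullet> X (M u))"

lemma penrose_iff:
  assumes "linear M"
  shows "(linear X \<and> M \<circ> X \<circ> M = M \<and> X \<circ> M \<circ> X = X \<and>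
     adjoint (M \<circ> X) = M \<circ> X \<and> adjoint (X \<circ> M) = X \<circ> M) \<longleftrightarrow> penrose M X"
proof (cases "linear X")
  case True
  then show ?thesis
    using adjoint_eq_self_iff[OF linear_compose[OF assms True]]
      adjoint_eq_self_iff[OF linear_compose[OF True assms]]
    by (auto simp: penrose_def fun_eq_iff)
qed (auto simp: penrose_def)

text \<open>For two solutions the symmetric maps X M and Y M absorb each other and therefore
  coincide, and likewise M X and M Y; then X = X M X = Y M Y.\<close>

lemma penrose_unique:
  assumes "penrose M X" "penrose M Y"
  shows "X = Y"
proof -
  have X: "M (X (M v)) = M v" "X (M (X w)) = X w" "M (X w) \<bullet> z = w \<bullet> M (X z)"
    "X (M v) \<bullet> u = v \<bullet> X (M u)" for v w z u
    using assms(1) by (simp_all add: penrose_def)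
  have Y: "M (Y (M v)) = M v" "Y (M (Y w)) = Y w" "M (Y w) \<bullet> z = w \<bullet> M (Y z)"
    "Y (M v) \<bullet> u = v \<bullet> Y (M u)" for v w z u
    using assms(2) by (simp_all add: penrose_def)
  have XM: "X (M v) = Y (M v)" for v
  proof (rule vector_eq_rdot[THEN iffD1], rule allI)
    fix u
    have "X (M v) \<bullet> u = v \<bullet> X (M (Y (M u)))" by (simp only: X Y)
    also have "\<dots> = Y (M (X (M v))) \<bullet> u" by (simp only: X(4)[symmetric] Y(4))
    also have "\<dots> = Y (M v) \<bullet> u" by (simp only: X)
    finally show "X (M v) \<bullet> u = Y (M v) \<bullet> u" .
  qed
  have MX: "M (X w) = M (Y w)" for w
  proof (rule vector_eq_rdot[THEN iffD1], rule allI)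
    fix z
    have "M (X w) \<bullet> z = M (Y (M (X w))) \<bullet> z" by (simp only: Y)
    also have "\<dots> = w \<bullet> M (X (M (Y z)))" by (simp only: Y(3) X(3))
    also have "\<dots> = M (Y w) \<bullet> z" by (simp only: X(1) Y(3))
    finally show "M (X w) \<bullet> z = M (Y w) \<bullet> z" .
  qed
  show ?thesis
  proof
    fix w
    have "X w = X (M (X w))" by (simp only: X)
    also have "\<dots> = Y (M (Y w))" by (simp only: MX XM)
    also have "\<dots> = Y w" by (simp only: Y)
    finally show "X w = Y w" .
  qed
qed

lemma moore_penrose_eqI: "linear M \<Longrightarrow> penrose M X \<Longrightarrow> moore_penrose M = X"
  unfolding moore_penrose_def by (rule the_equality) (auto simp: penrose_iff dest: penrose_unique)

text \<open>The inverse is built as the orthogonal projection \<open>p\<close> onto the range of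
  \<open>M\<close>, followed by a linear left inverse of \<open>M\<close> on the orthogonal
  complement \<open>U\<close> of its kernel. That the values of \<open>X\<close> lie in
  \<open>U\<close> gives the symmetry of X M.\<close>

lemma penrose_exists:
  fixes M :: "'v::euclidean_space \<Rightarrow> 'w::euclidean_space"
  assumes M: "linear M"
  shows "\<exists>X. penrose M X"
proof -
  define K where "K = {v. M v = 0}"
  define U where "U = {v. \<forall>x\<in>K. orthogonal x v}"
  have K: "subspace K" unfolding K_def by (rule linear_subspace_kernel[OF M])
  have U: "subspace U" unfolding U_def by (rule subspace_orthogonal_to_vectors)
  have R: "subspace (range M)" by (rule linear_subspace_image[OF M subspace_UNIV])
  have decomp: "\<exists>a b. a \<in> S \<and> (\<forall>x\<in>S. orthogonal b x) \<and> y = a + b" if "subspace S"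
    for y and S :: "'e::euclidean_space set"
  proof -
    obtain a b where "a \<in> span S" "\<And>w. w \<in> span S \<Longrightarrow> orthogonal b w" "y = a + b"
      using orthogonal_subspace_decomp_exists[of S y] by blast
    then show ?thesis using that by (auto simp: span_eq_iff[THEN iffD2])
  qed
  have "inj_on M U"
  proof (rule inj_onI)
    fix x y assume xy: "x \<in> U" "y \<in> U" "M x = M y"
    then have "x - y \<in> K" by (simp add: K_def linear_diff[OF M])
    moreover have "x - y \<in> U" using xy U by (simp add: subspace_diff)
    ultimately have "orthogonal (x - y) (x - y)" by (auto simp: U_def)
    then show "x = y" by (simp add: orthogonal_self)
  qed
  then obtain g where g: "linear g" "\<And>v. v \<in> U \<Longrightarrow> g (M v) = v"
    using linear_exists_left_inverse_on[OF M U] by blast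
  have surj: "\<exists>u\<in>U. M u = M v \<and> v - u \<in> K" for v
  proof -
    obtain a b where ab: "a \<in> K" "\<forall>x\<in>K. orthogonal b x" "v = a + b" using decomp[OF K] by blast
    then have "b \<in> U" by (auto simp: U_def orthogonal_commute)
    moreover have "M b = M v" using ab by (simp add: K_def linear_add[OF M])
    ultimately show ?thesis using ab by auto
  qed
  \<comment> \<open>The projection is chosen pointwise; its linearity comes from the uniqueness of
    the orthogonal decomposition, \<open>p_unique\<close>.\<close>
  define p where "p w = (SOME a. a \<in> range M \<and> (\<forall>x\<in>range M. orthogonal (w - a) x))" for w
  have p: "p w \<in> range M" "x \<in> range M \<Longrightarrow> orthogonal (w - p w) x" for w x
  proof -
    have "\<exists>a. a \<in> range M \<and> (\<forall>x\<in>range M. orthogonal (w - a) x)"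
    proof -
      obtain a b where "a \<in> range M" "\<forall>x\<in>range M. orthogonal b x" "w = a + b" using decomp[OF R] by blast
      then show ?thesis by (intro exI[of _ a]) simp
    qed
    from someI_ex[OF this]
    show "p w \<in> range M" "x \<in> range M \<Longrightarrow> orthogonal (w - p w) x" unfolding p_def by blast+
  qed
  have p_unique: "p w = a" if "a \<in> range M" "\<And>x. x \<in> range M \<Longrightarrow> orthogonal (w - a) x" for w a
  proof -
    have d: "a - p w \<in> range M" by (rule subspace_diff[OF R that(1) p(1)])
    have "orthogonal ((w - p w) - (w - a)) (a - p w)"
      using p(2)[OF d] that(2)[OF d] by (simp add: orthogonal_def inner_diff_left)
    then show ?thesis by (simp add: orthogonal_self)
  qed
  have "linear p"
  proof
    fix a b :: 'w and r :: real
    show "p (a + b) = p a + p b"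
    proof (rule p_unique)
      show "p a + p b \<in> range M" by (rule subspace_add[OF R p(1) p(1)])
      fix x assume "x \<in> range M"
      from p(2)[OF this, of a] p(2)[OF this, of b] show "orthogonal (a + b - (p a + p b)) x"
        by (simp add: orthogonal_def inner_diff_left inner_add_left)
    qed
    show "p (r *\<^sub>R a) = r *\<^sub>R p a"
    proof (rule p_unique)
      show "r *\<^sub>R p a \<in> range M" by (rule subspace_mul[OF R p(1)])
      fix x assume "x \<in> range M"
      from p(2)[OF this, of a] show "orthogonal (r *\<^sub>R a - r *\<^sub>R p a) x"
        by (simp add: orthogonal_def inner_diff_left)
    qed
  qed
  define X where "X = g \<circ> p"
  have X: "linear X" unfolding X_def by (intro linear_compose \<open>linear p\<close> g)
  have pM: "p (M v) = M v" for v by (rule p_unique) (auto simp: orthogonal_def)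
  have MX: "M (X w) = p w" for w
  proof -
    obtain v where "p w = M v" using p(1) by blast
    with surj[of v] obtain u where "u \<in> U" "p w = M u" by auto
    then show ?thesis using g by (simp add: X_def)
  qed
  have XU: "X w \<in> U" for w
  proof -
    obtain v where "p w = M v" using p(1) by blast
    with surj[of v] obtain u where "u \<in> U" "p w = M u" by auto
    then show ?thesis using g by (simp add: X_def)
  qed
  have XM: "X (M v) \<bullet> u = v \<bullet> X (M u)" for u v
  proof -
    have "M (v - X (M v)) = 0" "M (u - X (M u)) = 0" using MX pM by (simp_all add: linear_diff[OF M])
    then have "(v - X (M v)) \<bullet> X (M u) = 0" "(u - X (M u)) \<bullet> X (M v) = 0"
      using XU by (auto simp: U_def K_def orthogonal_def)
    then show ?thesis by (simp add: inner_diff_left inner_diff_right inner_commute)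
  qed
  have "p w \<bullet> z = w \<bullet> p z" for w z
    using p(2)[OF p(1), of w z] p(2)[OF p(1), of z w]
    by (simp add: orthogonal_def inner_diff_left inner_diff_right inner_commute)
  moreover have "X (p w) = X w" for w
  proof -
    have "p (p w) = p w" using p(1)[of w] pM by auto
    then show ?thesis by (simp add: X_def)
  qed
  ultimately have "penrose M X"
    unfolding penrose_def using X XM by (simp add: MX pM)
  then show ?thesis by blast
qed

lemma penrose_moore_penrose: "linear M \<Longrightarrow> penrose M (moore_penrose M)"
  using penrose_exists moore_penrose_eqI by metis

context
  fixes M :: "'v::euclidean_space \<Rightarrow> 'w::euclidean_space"
  assumes M: "linear M"
begin

lemma linear_moore_penrose: "linear (moore_penrose M)"
  and moore_penrose_MXM: "M (moore_penrose M (M v)) = M v"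
  and moore_penrose_XMX: "moore_penrose M (M (moore_penrose M w)) = moore_penrose M w"
  and moore_penrose_MX_sym: "M (moore_penrose M w) \<bullet> z = w \<bullet> M (moore_penrose M z)"
  and moore_penrose_XM_sym: "moore_penrose M (M v) \<bullet> u = v \<bullet> moore_penrose M (M u)"
  using penrose_moore_penrose[OF M] by (auto simp: penrose_def)

text \<open>X M is symmetric and idempotent, hence an orthogonal projection and a contraction. This
  and its companion for M X keep the Fourier multipliers bounded although the pseudoinverse of the
  symbol blows up at 0.\<close>

lemma norm_moore_penrose_XM: "norm (moore_penrose M (M v)) \<le> norm v"
proof -
  have "(norm (moore_penrose M (M v)))\<^sup>2 = v \<bullet> moore_penrose M (M v)"
    using moore_penrose_XM_sym[of v "moore_penrose M (M v)"] by (simp add: power2_norm_eq_inner moore_penrose_XMX)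
  also have "\<dots> \<le> norm v * norm (moore_penrose M (M v))" by (rule norm_cauchy_schwarz)
  finally show ?thesis
    by (cases "moore_penrose M (M v) = 0") (auto simp: power2_eq_square)
qed

lemma norm_moore_penrose_MX: "norm (M (moore_penrose M w)) \<le> norm w"
proof -
  have "(norm (M (moore_penrose M w)))\<^sup>2 = w \<bullet> M (moore_penrose M w)"
    using moore_penrose_MX_sym[of w "M (moore_penrose M w)"] by (simp add: power2_norm_eq_inner moore_penrose_MXM)
  also have "\<dots> \<le> norm w * norm (M (moore_penrose M w))" by (rule norm_cauchy_schwarz)
  finally show ?thesis
    by (cases "M (moore_penrose M w) = 0") (auto simp: power2_eq_square)
qed

lemma moore_penrose_range_iff: "w \<in> range M \<longleftrightarrow> M (moore_penrose M w) = w"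
  by (metis moore_penrose_MXM rangeE rangeI)

lemma moore_penrose_scaleR:
  assumes "c \<noteq> 0"
  shows "moore_penrose (\<lambda>v. c *\<^sub>R M v) = (\<lambda>w. (1 / c) *\<^sub>R moore_penrose M w)"
proof (rule moore_penrose_eqI)
  show "linear (\<lambda>v. c *\<^sub>R M v)" using M by (rule linear_compose_scale_right)
  show "penrose (\<lambda>v. c *\<^sub>R M v) (\<lambda>w. (1 / c) *\<^sub>R moore_penrose M w)"
    using assms linear_moore_penrose
    by (simp add: penrose_def linear_compose_scale_right linear_scale[OF M]
        linear_scale[OF linear_moore_penrose] moore_penrose_MXM moore_penrose_XMX
        moore_penrose_MX_sym moore_penrose_XM_sym)
qed

lemma moore_penrose_map_prod:
  "moore_penrose (map_prod M M) = map_prod (moore_penrose M) (moore_penrose M)"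
proof (rule moore_penrose_eqI)
  show "linear (map_prod M M)" by (rule linear_map_prod[OF M])
  show "penrose (map_prod M M) (map_prod (moore_penrose M) (moore_penrose M))"
    unfolding penrose_def
    by (auto simp: linear_map_prod linear_moore_penrose moore_penrose_MXM moore_penrose_XMX
        moore_penrose_MX_sym moore_penrose_XM_sym)
qed

end

text \<open>Wedin's identity, an exact formula for the difference of two pseudoinverses.\<close>

lemma moore_penrose_diff:
  fixes M N :: "'v::euclidean_space \<Rightarrow> 'w::euclidean_space"
  assumes M: "linear M" and N: "linear N"
  defines "X \<equiv> moore_penrose M" and "Y \<equiv> moore_penrose N"
  shows "Y w - X w =
    - Y (N (X w) - M (X w))
    + Y (adjoint Y (adjoint N (w - M (X w)) - adjoint M (w - M (X w))))
    + (adjoint N (adjoint X (X w)) - adjoint M (adjoint X (X w))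
       - Y (N (adjoint N (adjoint X (X w)) - adjoint M (adjoint X (X w)))))"
proof -
  have X: "linear X" and Y: "linear Y"
    unfolding X_def Y_def using linear_moore_penrose M N by auto
  \<comment> \<open>Facts 1 to 4 express that M X, X M, N Y and Y N are orthogonal projections; with
    them the adjoints on the right-hand side cancel and the sum telescopes.\<close>
  have 1: "adjoint M (w - M (X w)) = 0" 
  proof (rule vector_eq_ldot[THEN iffD1], rule allI)
    fix v
    have "M v \<bullet> M (X w) = M (X (M v)) \<bullet> w"
      using moore_penrose_MX_sym[OF M, of "M v" w] by (simp add: X_def)
    then show "v \<bullet> adjoint M (w - M (X w)) = v \<bullet> 0"
      by (simp add: adjoint_works[OF M] inner_diff_right X_def moore_penrose_MXM[OF M])
  qed
  have 2: "adjoint Y (adjoint N z) = N (Y z)" for z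
  proof (rule vector_eq_ldot[THEN iffD1], rule allI)
    fix v
    show "v \<bullet> adjoint Y (adjoint N z) = v \<bullet> N (Y z)"
      using moore_penrose_MX_sym[OF N, of v z, folded Y_def] by (simp add: adjoint_works[OF N] adjoint_works[OF Y])
  qed
  have 3: "adjoint M (adjoint X z) = X (M z)" for z
  proof (rule vector_eq_ldot[THEN iffD1], rule allI)
    fix v
    show "v \<bullet> adjoint M (adjoint X z) = v \<bullet> X (M z)"
      using moore_penrose_XM_sym[OF M, of v z, folded X_def] by (simp add: adjoint_works[OF M] adjoint_works[OF X])
  qed
  have 4: "Y (N (adjoint N z)) = adjoint N z" for z
  proof (rule vector_eq_ldot[THEN iffD1], rule allI)
    fix v
    show "v \<bullet> Y (N (adjoint N z)) = v \<bullet> adjoint N z"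
      using moore_penrose_XM_sym[OF N, of v "adjoint N z"]
      by (simp add: adjoint_works[OF N] moore_penrose_MXM[OF N] Y_def)
  qed
  have XMX: "X (M (X w)) = X w" by (simp add: X_def moore_penrose_XMX[OF M])
  have YNY: "Y (N (Y z)) = Y z" for z by (simp add: Y_def moore_penrose_XMX[OF N])
  show ?thesis
    by (simp add: 1 2 3 4 XMX YNY linear_diff[OF Y] linear_diff[OF N])
qed

text \<open>On \<open>U\<close>, the range of the pseudoinverse of \<open>M\<close>, the map
  \<open>M\<close> is bounded below by 1 / K, so the nearby \<open>N\<close> is bounded below by 1 /
  (2 K) there. Equality of ranks forces the image of \<open>U\<close> under \<open>N\<close> to be
  the whole range of \<open>N\<close>; hence every value of the pseudoinverse of \<open>N\<close> is
  the projection of a vector of \<open>U\<close> of controlled length. A jump of the rank would make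
  the pseudoinverse unbounded.\<close>

lemma moore_penrose_local_bound:
  fixes M N :: "'v::euclidean_space \<Rightarrow> 'w::euclidean_space"
  assumes M: "linear M" and N: "linear N" and rank: "dim (range M) = dim (range N)"
    and K: "K > 0" "\<And>w. norm (moore_penrose M w) \<le> K * norm w"
    and close: "\<And>v. norm (N v - M v) \<le> norm v / (2 * K)"
  shows "norm (moore_penrose N w) \<le> 2 * K * norm w"
proof -
  define X where "X = moore_penrose M"
  have X: "linear X" unfolding X_def by (rule linear_moore_penrose[OF M])
  define U where "U = range X"
  have U: "subspace U" unfolding U_def by (rule linear_subspace_image[OF X subspace_UNIV])
  have lowM: "norm v \<le> K * norm (M v)" if "v \<in> U" for v
  proof -
    have "X (M v) = v" using that moore_penrose_XMX[OF M] by (auto simp: U_def X_def)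
    then show ?thesis using K(2)[of "M v"] by (simp add: X_def)
  qed
  have lowN: "norm v \<le> 2 * K * norm (N v)" if "v \<in> U" for v
  proof -
    have "norm (M v) \<le> norm (N v) + norm (N v - M v)"
      using norm_triangle_ineq4[of "N v" "N v - M v"] by simp
    also have "\<dots> \<le> norm (N v) + norm v / (2 * K)" using close[of v] by simp
    finally have "K * norm (M v) \<le> K * (norm (N v) + norm v / (2 * K))" using K(1) by simp
    also have "\<dots> = K * norm (N v) + norm v / 2" using K(1) by (simp add: field_simps)
    finally show ?thesis using lowM[OF that] by simp
  qed
  have inj: "inj_on f U" if f: "linear f" and "\<And>v. v \<in> U \<Longrightarrow> norm v \<le> C * norm (f v)" for f C
  proof (rule inj_onI)
    fix x y assume "x \<in> U" "y \<in> U" "f x = f y"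
    then have "norm (x - y) \<le> C * norm (f (x - y))" using that(2) U by (blast intro: subspace_diff)
    with \<open>f x = f y\<close> show "x = y" by (simp add: linear_diff[OF f])
  qed
  have dimim: "dim (f ` U) = dim U" if "linear f" "inj_on f U" for f :: "'v \<Rightarrow> 'w"
    using that U by (metis dim_image_eq span_eq_iff)
  have "M ` U = range M"
  proof
    show "range M \<subseteq> M ` U"
    proof
      fix y assume "y \<in> range M"
      then have "y = M (X y)" using moore_penrose_range_iff[OF M] by (simp add: X_def)
      then show "y \<in> M ` U" unfolding U_def by (rule image_eqI) simp
    qed
  qed auto
  then have "dim (N ` U) = dim (range N)"
    using dimim[OF M inj[OF M lowM]] dimim[OF N inj[OF N lowN]] rank by simp
  then have NU: "N ` U = range N"
    by (intro subspace_dim_equal linear_subspace_image[OF N] U subspace_UNIV) auto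
  then obtain u where u: "u \<in> U" "N u = N (moore_penrose N w)" by (metis imageE rangeI)
  have "norm (moore_penrose N w) = norm (moore_penrose N (N u))"
    by (simp add: u moore_penrose_XMX[OF N])
  also have "\<dots> \<le> norm u" by (rule norm_moore_penrose_XM[OF N])
  also have "\<dots> \<le> 2 * K * norm (N (moore_penrose N w))" using lowN[OF u(1)] u(2) by simp
  also have "\<dots> \<le> 2 * K * norm w" using norm_moore_penrose_MX[OF N] K(1) by simp
  finally show ?thesis .
qed

section \<open>Smooth functions on open sets\<close>

lemma has_derivative_along_axis:
  fixes f :: "real^'n::finite \<Rightarrow> 'e::real_normed_vector"
  assumes "(f has_derivative f') (at x)"
  shows "((\<lambda>t. f (x + t *\<^sub>R axis i 1)) has_vector_derivative f' (axis i 1)) (at 0)"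
proof -
  have lin: "linear f'" using assms by (rule has_derivative_linear)
  have "((\<lambda>t. x + t *\<^sub>R axis i 1) has_derivative (\<lambda>t. t *\<^sub>R axis i 1)) (at (0::real))"
    by (auto intro!: derivative_eq_intros)
  from has_derivative_compose[OF this, of f f'] assms
  show ?thesis by (simp add: has_vector_derivative_def linear_scale[OF lin])
qed

lemma partial_deriv_eqI:
  assumes "(f has_derivative f') (at x)"
  shows "partial_deriv i f x = f' (axis i 1)"
  unfolding partial_deriv_def by (rule vector_derivative_at[OF has_derivative_along_axis[OF assms]])

lemma partial_deriv_works:
  assumes "f differentiable at x"
  shows "((\<lambda>t. f (x + t *\<^sub>R axis i 1)) has_vector_derivative partial_deriv i f x) (at 0)"
proof -
  obtain f' where f': "(f has_derivative f') (at x)" using assms unfolding differentiable_def by blast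
  show ?thesis using has_derivative_along_axis[OF f', of i] by (simp add: partial_deriv_eqI[OF f'])
qed

lemma partial_deriv_cong:
  assumes "open U" "x \<in> U" "\<And>y. y \<in> U \<Longrightarrow> f y = g y"
  shows "partial_deriv i f x = partial_deriv i g x"
  unfolding partial_deriv_def
proof (rule vector_derivative_cong_eq)
  have "((\<lambda>t. x + t *\<^sub>R axis i 1) \<longlongrightarrow> x + 0 *\<^sub>R axis i 1) (nhds (0::real))"
    by (intro tendsto_intros) (simp add: filterlim_ident)
  then have "eventually (\<lambda>t. x + t *\<^sub>R axis i 1 \<in> U) (nhds (0::real))"
    using assms by (intro topological_tendstoD) auto
  then show "eventually (\<lambda>t. t \<in> UNIV \<longrightarrow> f (x + t *\<^sub>R axis i 1) = g (x + t *\<^sub>R axis i 1)) (nhds (0::real))"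
    by eventually_elim (simp add: assms)
qed auto

text \<open>\<open>Ck U m\<close> asks that all derivatives of order below \<open>m\<close> be
  differentiable on \<open>U\<close>; only the conjunction over all \<open>m\<close> is smoothness
  in the usual sense. The recursion peels off the innermost derivative, which suits inductions that
  generalise over the function.\<close>

fun Ck :: "(real^'n) set \<Rightarrow> nat \<Rightarrow> (real^'n::finite \<Rightarrow> 'e::real_normed_vector) \<Rightarrow> bool" where
  "Ck U 0 f \<longleftrightarrow> True"
| "Ck U (Suc m) f \<longleftrightarrow> f differentiable_on U \<and> (\<forall>i. Ck U m (partial_deriv i f))"

definition smooth_on :: "(real^'n) set \<Rightarrow> (real^'n::finite \<Rightarrow> 'e::real_normed_vector) \<Rightarrow> bool" where
  "smooth_on U f \<longleftrightarrow> (\<forall>m. Ck U m f)"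

lemma differentiable_on_cong_open:
  assumes "open U" "\<And>y. y \<in> U \<Longrightarrow> f y = g y" "f differentiable_on U"
  shows "g differentiable_on U"
  unfolding differentiable_on_def
proof
  fix x assume x: "x \<in> U"
  then obtain f' where "(f has_derivative f') (at x within U)"
    using assms(3) by (auto simp: differentiable_on_def differentiable_def)
  then have "(g has_derivative f') (at x within U)"
    by (rule has_derivative_transform[rotated 2]) (use assms x in auto)
  then show "g differentiable at x within U" unfolding differentiable_def by blast
qed

text \<open>The differentiation rules give a formula for \<open>partial_deriv i f\<close> on
  \<open>U\<close> only, while \<open>partial_deriv i f\<close> is a total function. This lemma lets
  the inductions below pass from the derivative to its formula.\<close>

lemma Ck_cong:
  assumes "open U" "\<And>y. y \<in> U \<Longrightarrow> f y = g y" "Ck U m f"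
  shows "Ck U m g"
  using assms(2,3)
proof (induction m arbitrary: f g)
  case (Suc m)
  have "Ck U m (partial_deriv i g)" for i
  proof (rule Suc.IH[of "partial_deriv i f"])
    show "partial_deriv i f y = partial_deriv i g y" if y: "y \<in> U" for y
      using assms(1) that Suc.prems(1) by (rule partial_deriv_cong)
  qed (use Suc.prems in auto)
  then show ?case
    using differentiable_on_cong_open[OF assms(1) Suc.prems(1)] Suc.prems by auto
qed auto

lemma smooth_on_cong:
  "open U \<Longrightarrow> (\<And>y. y \<in> U \<Longrightarrow> f y = g y) \<Longrightarrow> smooth_on U f \<Longrightarrow> smooth_on U g"
  unfolding smooth_on_def using Ck_cong by blast

lemma Ck_Suc: "Ck U (Suc m) f \<Longrightarrow> Ck U m f"
proof (induction m arbitrary: f)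
  case (Suc m)
  then show ?case by (metis Ck.simps(2))
qed auto

lemma Ck_subset: "V \<subseteq> U \<Longrightarrow> Ck U m f \<Longrightarrow> Ck V m f"
  by (induction m arbitrary: f) (auto intro: differentiable_on_subset)

lemma smooth_on_subset: "V \<subseteq> U \<Longrightarrow> smooth_on U f \<Longrightarrow> smooth_on V f"
  unfolding smooth_on_def using Ck_subset by blast

lemma smooth_on_differentiable: "smooth_on U f \<Longrightarrow> f differentiable_on U"
  unfolding smooth_on_def by (metis Ck.simps(2))

lemma smooth_on_partial: "smooth_on U f \<Longrightarrow> smooth_on U (partial_deriv i f)"
  unfolding smooth_on_def by (metis Ck.simps(2))

lemma smooth_on_continuous: "smooth_on U f \<Longrightarrow> continuous_on U f"
  by (simp add: differentiable_imp_continuous_on smooth_on_differentiable)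

lemma partial_derivs_Nil [simp]: "partial_derivs [] f = f"
  and partial_derivs_Cons [simp]: "partial_derivs (i # is) f = partial_deriv i (partial_derivs is f)"
  and partial_derivs_snoc: "partial_derivs (is @ [i]) f = partial_derivs is (partial_deriv i f)"
  by (auto simp: partial_derivs_def)

lemma smooth_on_partial_derivs: "smooth_on U f \<Longrightarrow> smooth_on U (partial_derivs is f)"
  by (induction "is") (auto intro: smooth_on_partial)

lemma smooth_on_iff: "smooth_on U f \<longleftrightarrow> (\<forall>is. partial_derivs is f differentiable_on U)"
proof
  assume "smooth_on U f"
  then show "\<forall>is. partial_derivs is f differentiable_on U"
    by (blast intro: smooth_on_differentiable smooth_on_partial_derivs)
next
  have "Ck U m f" if "\<forall>is. partial_derivs is f differentiable_on U" for m
    using that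
  proof (induction m arbitrary: f)
    case (Suc m)
    then show ?case by (metis Ck.simps(2) partial_derivs_Nil partial_derivs_snoc)
  qed simp
  then show "\<forall>is. partial_derivs is f differentiable_on U \<Longrightarrow> smooth_on U f"
    by (simp add: smooth_on_def)
qed

context
  fixes U :: "(real^'n::finite) set"
  assumes U: "open U"
begin

lemma diff_on_has_derivative:
  assumes "f differentiable_on U" "x \<in> U"
  shows "\<exists>f'. (f has_derivative f') (at x)"
  using assms U by (metis at_within_open differentiable_def differentiable_on_def)

lemma differentiable_onI:
  "(\<And>y. y \<in> U \<Longrightarrow> \<exists>f'. (f has_derivative f') (at y)) \<Longrightarrow> f differentiable_on U"
  unfolding differentiable_on_def differentiable_def using has_derivative_at_withinI by blast

lemma Ck_const: "Ck U m (\<lambda>x. c)"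
proof (induction m arbitrary: c)
  case (Suc m)
  have "partial_deriv i (\<lambda>x::real^'n. c) = (\<lambda>x. 0)" for i
    by (rule ext, subst partial_deriv_eqI[OF has_derivative_const]) simp
  then show ?case using Suc[of 0] by simp
qed simp

lemma Ck_add:
  assumes "Ck U m f" "Ck U m g" shows "Ck U m (\<lambda>x. f x + g x)"
  using assms
proof (induction m arbitrary: f g)
  case (Suc m)
  have "Ck U m (partial_deriv i (\<lambda>x. f x + g x))" for i
  proof (rule Ck_cong[OF U])
    show "Ck U m (\<lambda>x. partial_deriv i f x + partial_deriv i g x)" using Suc by auto
    fix y assume y: "y \<in> U"
    obtain f' g' where f': "(f has_derivative f') (at y)" and g': "(g has_derivative g') (at y)"
      using diff_on_has_derivative[OF _ y] Suc.prems by (meson Ck.simps(2))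
    show "partial_deriv i f y + partial_deriv i g y = partial_deriv i (\<lambda>x. f x + g x) y"
      by (simp add: partial_deriv_eqI[OF f'] partial_deriv_eqI[OF g'] partial_deriv_eqI[OF has_derivative_add[OF f' g']])
  qed
  then show ?case using Suc.prems by (simp add: differentiable_on_add)
qed simp

lemma Ck_linear:
  assumes h: "bounded_linear h" and "Ck U m f" shows "Ck U m (\<lambda>x. h (f x))"
  using assms(2)
proof (induction m arbitrary: f)
  case (Suc m)
  have d: "\<exists>f'. (f has_derivative f') (at y) \<and> ((\<lambda>x. h (f x)) has_derivative (\<lambda>v. h (f' v))) (at y)" if y: "y \<in> U" for y
  proof -
    obtain f' where f': "(f has_derivative f') (at y)"
      using diff_on_has_derivative[OF _ y, of f] Suc.prems by auto
    then show ?thesis using bounded_linear.has_derivative[OF h f'] by blast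
  qed
  have "Ck U m (partial_deriv i (\<lambda>x. h (f x)))" for i
  proof (rule Ck_cong[OF U])
    show "Ck U m (\<lambda>x. h (partial_deriv i f x))" using Suc by auto
    fix y assume y: "y \<in> U"
    obtain f' where f': "(f has_derivative f') (at y)" "((\<lambda>x. h (f x)) has_derivative (\<lambda>v. h (f' v))) (at y)"
      using d[OF y] by blast
    show "h (partial_deriv i f y) = partial_deriv i (\<lambda>x. h (f x)) y"
      by (simp add: partial_deriv_eqI[OF f'(1)] partial_deriv_eqI[OF f'(2)])
  qed
  moreover have "(\<lambda>x. h (f x)) differentiable_on U"
    by (rule differentiable_onI) (use d in blast)
  ultimately show ?case by simp
qed simp

lemma Ck_bilinear:
  assumes h: "bounded_bilinear h" and "Ck U m f" "Ck U m g" shows "Ck U m (\<lambda>x. h (f x) (g x))"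
  using assms(2,3)
proof (induction m arbitrary: f g)
  case (Suc m)
  have fg: "Ck U m f" "Ck U m g" using Suc.prems Ck_Suc by blast+
  have d: "\<exists>f' g'. (f has_derivative f') (at y) \<and> (g has_derivative g') (at y) \<and>
     ((\<lambda>x. h (f x) (g x)) has_derivative (\<lambda>v. h (f y) (g' v) + h (f' v) (g y))) (at y)" if y: "y \<in> U" for y
  proof -
    obtain f' where f': "(f has_derivative f') (at y)"
      using diff_on_has_derivative[OF _ y, of f] Suc.prems by auto
    obtain g' where g': "(g has_derivative g') (at y)"
      using diff_on_has_derivative[OF _ y, of g] Suc.prems by auto
    show ?thesis using bounded_bilinear.FDERIV[OF h f' g'] f' g' by blast
  qed
  have "Ck U m (partial_deriv i (\<lambda>x. h (f x) (g x)))" for i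
  proof (rule Ck_cong[OF U])
    show "Ck U m (\<lambda>x. h (f x) (partial_deriv i g x) + h (partial_deriv i f x) (g x))"
      using Suc fg by (intro Ck_add) auto
    fix y assume y: "y \<in> U"
    obtain f' g' where f': "(f has_derivative f') (at y)" "(g has_derivative g') (at y)"
      "((\<lambda>x. h (f x) (g x)) has_derivative (\<lambda>v. h (f y) (g' v) + h (f' v) (g y))) (at y)"
      using d[OF y] by blast
    show "h (f y) (partial_deriv i g y) + h (partial_deriv i f y) (g y) = partial_deriv i (\<lambda>x. h (f x) (g x)) y"
      by (simp add: partial_deriv_eqI[OF f'(1)] partial_deriv_eqI[OF f'(2)] partial_deriv_eqI[OF f'(3)])
  qed
  moreover have "(\<lambda>x. h (f x) (g x)) differentiable_on U"
    by (rule differentiable_onI) (use d in blast)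
  ultimately show ?case by simp
qed simp

text \<open>\<open>D\<close> is a whole sequence of successive derivatives. Stating the claim for
  all \<open>j\<close> closes the induction, because differentiating D j (q x) leads to D (j + 1) (q
  x); this takes the place of a higher-order chain rule.\<close>

lemma Ck_compose_real:
  fixes D :: "nat \<Rightarrow> real \<Rightarrow> real"
  assumes D: "\<And>j t. t \<in> T \<Longrightarrow> (D j has_real_derivative D (Suc j) t) (at t)"
    and q: "\<And>x. x \<in> U \<Longrightarrow> q x \<in> T" "Ck U m q"
  shows "Ck U m (\<lambda>x. D j (q x))"
  using q(2)
proof (induction m arbitrary: j)
  case (Suc m)
  have d: "\<exists>q'. (q has_derivative q') (at y) \<and> ((\<lambda>x. D j (q x)) has_derivative (\<lambda>v. D (Suc j) (q y) * q' v)) (at y)"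
    if y: "y \<in> U" for y
  proof -
    obtain q' where q': "(q has_derivative q') (at y)"
      using diff_on_has_derivative[OF _ y, of q] Suc.prems by auto
    have "(D j has_derivative (\<lambda>h. D (Suc j) (q y) * h)) (at (q y))"
      using D q(1)[OF y] by (auto simp: has_field_derivative_def)
    from has_derivative_compose[OF q' this] q' show ?thesis by auto
  qed
  have "Ck U m (partial_deriv i (\<lambda>x. D j (q x)))" for i
  proof (rule Ck_cong[OF U])
    show "Ck U m (\<lambda>x. D (Suc j) (q x) * partial_deriv i q x)"
      using Suc.prems by (intro Ck_bilinear[OF bounded_bilinear_mult Suc.IH[OF Ck_Suc[OF Suc.prems]]]) simp
    fix y assume y: "y \<in> U"
    obtain q' where q': "(q has_derivative q') (at y)" "((\<lambda>x. D j (q x)) has_derivative (\<lambda>v. D (Suc j) (q y) * q' v)) (at y)"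
      using d[OF y] by blast
    show "D (Suc j) (q y) * partial_deriv i q y = partial_deriv i (\<lambda>x. D j (q x)) y"
      by (simp add: partial_deriv_eqI[OF q'(1)] partial_deriv_eqI[OF q'(2)])
  qed
  moreover have "(\<lambda>x. D j (q x)) differentiable_on U"
    by (rule differentiable_onI) (use d in blast)
  ultimately show ?case by simp
qed simp

lemma smooth_on_const: "smooth_on U (\<lambda>x. c)"
  and smooth_on_add: "smooth_on U f \<Longrightarrow> smooth_on U g \<Longrightarrow> smooth_on U (\<lambda>x. f x + g x)"
  and smooth_on_linear: "bounded_linear h \<Longrightarrow> smooth_on U f \<Longrightarrow> smooth_on U (\<lambda>x. h (f x))"
  and smooth_on_bilinear: "bounded_bilinear h' \<Longrightarrow> smooth_on U f \<Longrightarrow> smooth_on U g' \<Longrightarrow>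
    smooth_on U (\<lambda>x. h' (f x) (g' x))"
  and smooth_on_compose_real: "(\<And>j t. t \<in> T \<Longrightarrow> (D j has_real_derivative D (Suc j) t) (at t)) \<Longrightarrow>
    (\<And>x. x \<in> U \<Longrightarrow> q x \<in> T) \<Longrightarrow> smooth_on U q \<Longrightarrow> smooth_on U (\<lambda>x. D j (q x))"
  unfolding smooth_on_def
  using Ck_const Ck_add Ck_linear Ck_bilinear Ck_compose_real[of T D q _ j] by blast+

lemma smooth_on_scaleR: "smooth_on U f \<Longrightarrow> smooth_on U g \<Longrightarrow> smooth_on U (\<lambda>x. f x *\<^sub>R g x)"
  and smooth_on_mult: "smooth_on U p \<Longrightarrow> smooth_on U q \<Longrightarrow> smooth_on U (\<lambda>x. p x * q x :: real)"
  by (rule smooth_on_bilinear[OF bounded_bilinear_scaleR] smooth_on_bilinear[OF bounded_bilinear_mult], assumption+)+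

lemma smooth_on_minus: "smooth_on U f \<Longrightarrow> smooth_on U (\<lambda>x. - f x)"
  by (rule smooth_on_linear[OF bounded_linear_minus[OF bounded_linear_ident]])

lemma smooth_on_diff: "smooth_on U f \<Longrightarrow> smooth_on U g \<Longrightarrow> smooth_on U (\<lambda>x. f x - g x)"
  using smooth_on_add[OF _ smooth_on_minus] by fastforce

lemma smooth_on_sum: "(\<And>i. i \<in> I \<Longrightarrow> smooth_on U (f i)) \<Longrightarrow> smooth_on U (\<lambda>x. \<Sum>i\<in>I. f i x)"
  by (induction I rule: infinite_finite_induct) (auto simp: smooth_on_const smooth_on_add)

lemma smooth_on_id: "smooth_on U (\<lambda>x. x)"
  unfolding smooth_on_def
proof
  fix m show "Ck U m (\<lambda>x. x)"
  proof (cases m)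
    case (Suc k)
    have "partial_deriv i (\<lambda>x::real^'n. x) = (\<lambda>x. axis i 1)" for i
      by (rule ext, subst partial_deriv_eqI[OF has_derivative_ident]) simp
    then show ?thesis using Suc by (simp add: Ck_const differentiable_on_id[unfolded id_def])
  qed simp
qed

lemma smooth_on_inner: "smooth_on U (\<lambda>x. a \<bullet> x)"
  by (rule smooth_on_linear[OF bounded_linear_inner_right smooth_on_id])

lemma smooth_on_nth: "smooth_on U (\<lambda>x. x $ i)"
  by (rule smooth_on_linear[OF bounded_linear_vec_nth smooth_on_id])

lemma smooth_on_inner_self: "smooth_on U (\<lambda>x. (x - a) \<bullet> (x - a))"
  by (intro smooth_on_bilinear[OF bounded_bilinear_inner] smooth_on_diff smooth_on_id smooth_on_const)

lemma smooth_on_power: "smooth_on U p \<Longrightarrow> smooth_on U (\<lambda>x. p x ^ m :: real)"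
  by (induction m) (auto intro: smooth_on_const smooth_on_mult)

lemma smooth_on_prod: "(\<And>i. i \<in> I \<Longrightarrow> smooth_on U (f i)) \<Longrightarrow> smooth_on U (\<lambda>x. \<Prod>i\<in>I. f i x :: real)"
  by (induction I rule: infinite_finite_induct) (auto simp: smooth_on_const smooth_on_mult)

lemma smooth_on_cos: "smooth_on U q \<Longrightarrow> smooth_on U (\<lambda>x. cos (q x :: real))"
  and smooth_on_sin: "smooth_on U q \<Longrightarrow> smooth_on U (\<lambda>x. sin (q x :: real))"
proof -
  \<comment> \<open>The \<open>j\<close>-th derivative of the cosine; index 3 is the sine.\<close>
  define D where "D j t = cos (t + real j * (pi/2))" for j t
  have D: "(D j has_real_derivative D (Suc j) t) (at t)" for j t
  proof -
    have "t + real (Suc j) * (pi/2) = (t + real j * (pi/2)) + pi/2" by (simp add: algebra_simps add_divide_distrib)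
    then have "D (Suc j) t = - sin (t + real j * (pi/2))" unfolding D_def by (simp only: cos_add) simp
    then show ?thesis unfolding D_def by (auto intro!: derivative_eq_intros)
  qed
  have "D 0 = cos" by (simp add: D_def fun_eq_iff)
  moreover have "D 3 = sin"
  proof
    fix t show "D 3 t = sin t"
      using cos_3over2_pi sin_3over2_pi by (simp add: D_def cos_add)
  qed
  ultimately show "smooth_on U q \<Longrightarrow> smooth_on U (\<lambda>x. cos (q x :: real))" "smooth_on U q \<Longrightarrow> smooth_on U (\<lambda>x. sin (q x :: real))"
    using smooth_on_compose_real[of UNIV D q 0] smooth_on_compose_real[of UNIV D q 3] D by auto
qed

lemma smooth_on_inverse: "smooth_on U q \<Longrightarrow> (\<And>x. x \<in> U \<Longrightarrow> q x \<noteq> 0) \<Longrightarrow> smooth_on U (\<lambda>x. inverse (q x :: real))"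
proof -
  \<comment> \<open>The \<open>j\<close>-th derivative of the reciprocal.\<close>
  define D where "D j t = (-1)^j * fact j * inverse t ^ Suc j" for j and t :: real
  have D: "(D j has_real_derivative D (Suc j) t) (at t)" if "t \<in> - {0}" for j t
    unfolding D_def using that
    by (auto intro!: derivative_eq_intros simp: field_simps) (cases j; simp)
  have "D 0 = inverse" by (auto simp: D_def)
  then show "smooth_on U q \<Longrightarrow> (\<And>x. x \<in> U \<Longrightarrow> q x \<noteq> 0) \<Longrightarrow> smooth_on U (\<lambda>x. inverse (q x :: real))"
    using smooth_on_compose_real[of "- {0}" D q 0] D by auto
qed

lemma partial_deriv_add:
  assumes "smooth_on U f" "smooth_on U g" "y \<in> U"
  shows "partial_deriv i (\<lambda>x. f x + g x) y = partial_deriv i f y + partial_deriv i g y"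
proof -
  obtain f' g' where f': "(f has_derivative f') (at y)" and g': "(g has_derivative g') (at y)"
    using diff_on_has_derivative[OF smooth_on_differentiable assms(3)] assms(1,2) by meson
  show ?thesis
    by (simp add: partial_deriv_eqI[OF f'] partial_deriv_eqI[OF g'] partial_deriv_eqI[OF has_derivative_add[OF f' g']])
qed

lemma partial_deriv_linear:
  assumes "bounded_linear h" "smooth_on U f" "y \<in> U"
  shows "partial_deriv i (\<lambda>x. h (f x)) y = h (partial_deriv i f y)"
proof -
  obtain f' where f': "(f has_derivative f') (at y)"
    using diff_on_has_derivative[OF smooth_on_differentiable assms(3)] assms(2) by meson
  show ?thesis
    by (simp add: partial_deriv_eqI[OF f'] partial_deriv_eqI[OF bounded_linear.has_derivative[OF assms(1) f']])
qed

lemma partial_deriv_bilinear: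
  assumes "bounded_bilinear h" "smooth_on U f" "smooth_on U g" "y \<in> U"
  shows "partial_deriv i (\<lambda>x. h (f x) (g x)) y = h (f y) (partial_deriv i g y) + h (partial_deriv i f y) (g y)"
proof -
  obtain f' g' where f': "(f has_derivative f') (at y)" and g': "(g has_derivative g') (at y)"
    using diff_on_has_derivative[OF smooth_on_differentiable assms(4)] assms(2,3) by meson
  show ?thesis
    by (simp add: partial_deriv_eqI[OF f'] partial_deriv_eqI[OF g']
        partial_deriv_eqI[OF bounded_bilinear.FDERIV[OF assms(1) f' g']])
qed

end

lemma partial_derivs_linear:
  assumes "bounded_linear h" "smooth_on UNIV f"
  shows "partial_derivs is (\<lambda>x. h (f x)) = (\<lambda>x. h (partial_derivs is f x))"
proof (induction "is")
  case (Cons i js)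
  show ?case
    unfolding partial_derivs_Cons Cons.IH
    by (rule ext, rule partial_deriv_linear[OF open_UNIV assms(1) smooth_on_partial_derivs[OF assms(2)] UNIV_I])
qed simp

lemma partial_derivs_add:
  assumes "smooth_on UNIV f" "smooth_on UNIV g"
  shows "partial_derivs is (\<lambda>x. f x + g x) = (\<lambda>x. partial_derivs is f x + partial_derivs is g x)"
proof (induction "is")
  case (Cons i js)
  show ?case
    unfolding partial_derivs_Cons Cons.IH
    by (rule ext, rule partial_deriv_add[OF open_UNIV _ _ UNIV_I]) (intro smooth_on_partial_derivs assms)+
qed simp

lemma partial_deriv_affine:
  fixes f :: "real^'n::finite \<Rightarrow> 'e::real_normed_vector"
  assumes "f differentiable_on UNIV"
  shows "partial_deriv i (\<lambda>x. f (a + c *\<^sub>R x)) x = c *\<^sub>R partial_deriv i f (a + c *\<^sub>R x)"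
proof -
  obtain f' where f': "(f has_derivative f') (at (a + c *\<^sub>R x))"
    using diff_on_has_derivative[OF open_UNIV assms UNIV_I] by blast
  have "((\<lambda>x. a + c *\<^sub>R x) has_derivative (\<lambda>x. c *\<^sub>R x)) (at x)"
    by (auto intro!: derivative_eq_intros)
  from partial_deriv_eqI[OF has_derivative_compose[OF this f']]
  show ?thesis by (simp add: partial_deriv_eqI[OF f'] linear_scale[OF has_derivative_linear[OF f']])
qed

lemma smooth_on_affine:
  fixes f :: "real^'n::finite \<Rightarrow> 'e::real_normed_vector"
  assumes "smooth_on UNIV f"
  shows "smooth_on UNIV (\<lambda>x. f (a + c *\<^sub>R x))"
  unfolding smooth_on_def
proof
  fix m show "Ck UNIV m (\<lambda>x. f (a + c *\<^sub>R x))"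
    using assms
  proof (induction m arbitrary: f)
    case (Suc m)
    have "partial_deriv i (\<lambda>x. f (a + c *\<^sub>R x)) = (\<lambda>x. c *\<^sub>R partial_deriv i f (a + c *\<^sub>R x))" for i
      using partial_deriv_affine[OF smooth_on_differentiable[OF Suc.prems]] by blast
    moreover have "Ck UNIV m (\<lambda>x. c *\<^sub>R partial_deriv i f (a + c *\<^sub>R x))" for i
      by (intro Ck_linear[OF open_UNIV bounded_linear_scaleR_right] Suc.IH smooth_on_partial Suc.prems)
    moreover have "(\<lambda>x. f (a + c *\<^sub>R x)) differentiable_on UNIV"
    proof -
      have "(\<lambda>x. a + c *\<^sub>R x) differentiable_on UNIV" by (auto intro!: derivative_intros differentiable_on_add)
      then show ?thesis
        using smooth_on_differentiable[OF Suc.prems] differentiable_on_compose differentiable_on_subset by blast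
    qed
    ultimately show ?case by simp
  qed simp
qed

section \<open>Bump functions and test functions\<close>

text \<open>Polynomials p_j for which the \<open>j\<close>-th derivative of exp (- 1 / t) is p_j (1
  / t) exp (- 1 / t). With s = 1 / t one has d/dt = - s^2 d/ds, whence the recursion s^2 (p_j -
  p_j').\<close>

primrec flat_poly :: "nat \<Rightarrow> real poly" where
  "flat_poly 0 = 1"
| "flat_poly (Suc j) = [:0, 0, 1:] * (flat_poly j - pderiv (flat_poly j))"

text \<open>The \<open>j\<close>-th derivative of \<open>exp (- 1 / t)\<close>, extended by \<open>0\<close> to \<open>t \<le> 0\<close>.\<close>

definition flat :: "nat \<Rightarrow> real \<Rightarrow> real" where
  "flat j t = (if t > 0 then poly (flat_poly j) (1 / t) * exp (- (1 / t)) else 0)"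

lemma poly_times_exp_tendsto_0: "((\<lambda>s. poly p s * exp (- s)) \<longlongrightarrow> (0::real)) at_top"
proof -
  have "((\<lambda>s. \<Sum>i\<le>degree p. coeff p i * (s ^ i / exp s)) \<longlongrightarrow> (\<Sum>i\<le>degree p. coeff p i * 0)) at_top"
    by (intro tendsto_sum tendsto_mult tendsto_const tendsto_power_div_exp_0)
  then show ?thesis by (simp add: poly_altdef sum_distrib_right exp_minus divide_inverse mult.assoc)
qed

lemma flat_deriv: "(flat j has_real_derivative flat (Suc j) t) (at t)"
proof -
  consider "t > 0" | "t < 0" | "t = 0" by linarith
  then show ?thesis
  proof cases
    case 1
    have "((\<lambda>t. poly (flat_poly j) (1 / t) * exp (- (1 / t))) has_real_derivative flat (Suc j) t) (at t)"
      using 1 by (auto intro!: derivative_eq_intros DERIV_chain2[OF poly_DERIV] simp: flat_def field_simps power2_eq_square)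
    then show ?thesis
      by (rule has_field_derivative_transform_within_open[of _ _ _ "{0<..}"]) (use 1 in \<open>auto simp: flat_def\<close>)
  next
    case 2
    have "((\<lambda>t. 0) has_real_derivative flat (Suc j) t) (at t)" using 2 by (simp add: flat_def)
    then show ?thesis
      by (rule has_field_derivative_transform_within_open[of _ _ _ "{..<0}"]) (use 2 in \<open>auto simp: flat_def\<close>)
  next
    case 3
    \<comment> \<open>Division by \<open>t\<close> raises the polynomial in 1 / t by only one
      degree, so the exponential still wins, and the limit is the one-sided derivative at 0.\<close>
    have "((\<lambda>t. flat j t / t) \<longlongrightarrow> 0) (at_right 0)"
    proof -
      have "((\<lambda>t. poly ([:0,1:] * flat_poly j) (inverse t) * exp (- inverse t)) \<longlongrightarrow> 0) (at_right 0)"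
        using filterlim_compose[OF poly_times_exp_tendsto_0 filterlim_inverse_at_top_right] .
      then show ?thesis
        by (rule Lim_transform_eventually)
           (auto simp: eventually_at_filter flat_def field_simps)
    qed
    moreover have "((\<lambda>t. flat j t / t) \<longlongrightarrow> 0) (at_left 0)"
      by (rule Lim_transform_eventually[OF tendsto_const]) (auto simp: eventually_at_filter flat_def)
    ultimately have "((\<lambda>t. flat j t / t) \<longlongrightarrow> 0) (at 0)"
      by (rule filterlim_split_at[rotated])
    then show ?thesis using 3 by (simp add: DERIV_def flat_def)
  qed
qed

lemma flat_pos: "flat 0 t > 0 \<longleftrightarrow> t > 0" and flat_nonneg: "flat 0 t \<ge> 0" and flat_zero: "t \<le> 0 \<Longrightarrow> flat 0 t = 0"
  by (auto simp: flat_def)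

text \<open>A radial cutoff, 1 on the unit ball and 0 outside the ball of radius 2. The transition
  is made in x . x, which is a polynomial; the denominator is positive because the two arguments of
  \<open>flat 0\<close> have sum 3, so one of them is positive.\<close>

definition plateau :: "real^'n::finite \<Rightarrow> real" where
  "plateau x = flat 0 (4 - x \<bullet> x) * inverse (flat 0 (4 - x \<bullet> x) + flat 0 (x \<bullet> x - 1))"

lemma plateau_smooth: "smooth_on UNIV (plateau :: real^'n::finite \<Rightarrow> real)"
proof -
  have q: "smooth_on UNIV (\<lambda>x::real^'n. x \<bullet> x)" using smooth_on_inner_self[OF open_UNIV, of 0] by simp
  have pos: "flat 0 (4 - x \<bullet> x) + flat 0 (x \<bullet> x - 1) \<noteq> 0" for x :: "real^'n"
  proof -
    have "flat 0 (4 - x \<bullet> x) > 0 \<or> flat 0 (x \<bullet> x - 1) > 0" unfolding flat_pos by arith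
    then show ?thesis using flat_nonneg[of "4 - x \<bullet> x"] flat_nonneg[of "x \<bullet> x - 1"] by linarith
  qed
  have f: "smooth_on UNIV (\<lambda>x::real^'n. flat 0 (g x))" if "smooth_on UNIV g" for g
    by (rule smooth_on_compose_real[of UNIV UNIV flat g 0, OF open_UNIV flat_deriv]) (use that in auto)
  show ?thesis
    unfolding plateau_def
    by (intro smooth_on_mult smooth_on_inverse smooth_on_add f smooth_on_diff smooth_on_const q open_UNIV pos)
qed

lemma plateau_eq_1: "norm x \<le> 1 \<Longrightarrow> plateau x = 1"
proof -
  assume "norm x \<le> 1"
  then have "x \<bullet> x \<le> 1" by (simp add: dot_square_norm power_le_one)
  then show ?thesis using flat_pos[of "4 - x \<bullet> x"] by (simp add: plateau_def flat_zero)
qed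

lemma plateau_eq_0: "norm x \<ge> 2 \<Longrightarrow> plateau x = 0"
proof -
  assume "norm x \<ge> 2"
  then have "2\<^sup>2 \<le> (norm x)\<^sup>2" by (intro power_mono) auto
  then show ?thesis by (simp add: plateau_def flat_zero dot_square_norm)
qed

lemma plateau_range: "0 \<le> plateau x" "plateau x \<le> 1"
  using flat_nonneg[of "4 - x \<bullet> x"] flat_nonneg[of "x \<bullet> x - 1"]
  by (auto simp: plateau_def divide_simps divide_inverse[symmetric])

lemma plateau_norm: "norm x = norm y \<Longrightarrow> plateau x = plateau y"
  by (simp add: plateau_def dot_square_norm)

section \<open>Test functions: boundedness, integrability and integrals of derivatives\<close>

lemma test_functions_iff:
  "u \<in> test_functions \<longleftrightarrow> smooth_on UNIV u \<and> (\<exists>R. \<forall>x. norm x > R \<longrightarrow> u x = 0)"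
proof -
  have "compact (closure {x. u x \<noteq> 0}) \<longleftrightarrow> (\<exists>R. \<forall>x. norm x > R \<longrightarrow> u x = 0)"
    by (simp add: compact_closure bounded_iff not_le[symmetric]) blast
  then show ?thesis by (simp add: test_functions_def smooth_on_iff)
qed

lemma partial_deriv_vanish:
  fixes f :: "real^'n::finite \<Rightarrow> 'e::real_normed_vector"
  assumes "open U" "\<And>y. y \<in> U \<Longrightarrow> f y = 0" "x \<in> U"
  shows "partial_deriv i f x = 0"
  using partial_deriv_cong[OF assms(1,3), of f "\<lambda>_. 0" i] assms(2)
  by (simp add: partial_deriv_eqI[OF has_derivative_const])

lemma test_function_partial: "u \<in> test_functions \<Longrightarrow> partial_deriv i u \<in> test_functions"
proof -
  assume "u \<in> test_functions"
  then obtain R where u: "smooth_on UNIV u" and R: "\<And>x. norm x > R \<Longrightarrow> u x = 0"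
    by (auto simp: test_functions_iff)
  have "open {x. norm x > R}" by (intro open_Collect_less continuous_intros)
  then have "partial_deriv i u x = 0" if "norm x > R" for x
    using that R partial_deriv_vanish[of "{x. norm x > R}" u x i] by simp
  then show ?thesis using smooth_on_partial[OF u] by (auto simp: test_functions_iff)
qed

lemma test_function_partial_derivs: "u \<in> test_functions \<Longrightarrow> partial_derivs is u \<in> test_functions"
  by (induction "is") (auto intro: test_function_partial)

lemma test_function_continuous: "u \<in> test_functions \<Longrightarrow> continuous_on UNIV u"
  by (simp add: test_functions_iff smooth_on_continuous)

lemma test_function_measurable: "u \<in> test_functions \<Longrightarrow> u \<in> borel_measurable borel"
  by (intro borel_measurable_continuous_onI test_function_continuous)

lemma test_function_bounded:
  assumes "u \<in> test_functions"
  shows "\<exists>C\<ge>0. \<forall>x. norm (u x) \<le> C"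
proof -
  obtain R where R: "\<And>x. norm x > R \<Longrightarrow> u x = 0" using assms by (auto simp: test_functions_iff)
  have "compact (u ` cball 0 R)"
    using test_function_continuous[OF assms] continuous_on_subset
    by (intro compact_continuous_image) (auto)
  then obtain C where C: "\<And>y. y \<in> u ` cball 0 R \<Longrightarrow> norm y \<le> C" using compact_imp_bounded bounded_iff by metis
  have "norm (u x) \<le> max C 0" for x
    using C[of "u x"] R[of x] by (cases "norm x \<le> R") (auto simp: le_max_iff_disj)
  then show ?thesis by (intro exI[of _ "max C 0"]) simp
qed

lemma test_function_integrable:
  fixes u :: "real^'n::finite \<Rightarrow> 'e::euclidean_space"
  assumes "u \<in> test_functions"
  shows "integrable lborel u"
proof -
  obtain R where R: "\<And>x. norm x > R \<Longrightarrow> u x = 0" using assms by (auto simp: test_functions_iff)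
  have "integrable lborel (\<lambda>x. indicator (cball 0 R) x *\<^sub>R u x)"
    using test_function_continuous[OF assms] continuous_on_subset
    by (intro borel_integrable_compact) auto
  moreover have "(\<lambda>x. indicator (cball 0 R) x *\<^sub>R u x) = u"
    using R by (auto simp: fun_eq_iff indicator_def not_le)
  ultimately show ?thesis by simp
qed

text \<open>Difference quotients have integral 0 by translation invariance, and they converge to the
  partial derivative. Dominated convergence passes to the limit, the bound being the Lipschitz
  estimate \<open>lip\<close>.\<close>

lemma integral_partial_deriv_test:
  fixes u :: "real^'n::finite \<Rightarrow> 'e::euclidean_space"
  assumes u: "u \<in> test_functions"
  shows "(LINT x|lborel. partial_deriv i u x) = 0"
proof -
  obtain R where R: "\<And>x. norm x > R \<Longrightarrow> u x = 0" using u by (auto simp: test_functions_iff)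
  obtain C where C: "C \<ge> 0" "\<And>x. norm (partial_deriv i u x) \<le> C"
    using test_function_bounded[OF test_function_partial[OF u]] by metis
  have diff: "u differentiable at x" for x
    using u smooth_on_differentiable by (auto simp: test_functions_iff differentiable_on_def)
  let ?t = "\<lambda>n::nat. 1 / real (Suc n)"
  let ?s = "\<lambda>n x. (1 / ?t n) *\<^sub>R (u (x + ?t n *\<^sub>R axis i 1) - u x)"
  have shift: "((\<lambda>t. u (x + t *\<^sub>R axis i 1)) has_vector_derivative partial_deriv i u (x + s *\<^sub>R axis i 1)) (at s)" for x s
  proof -
    have d: "((\<lambda>t. t - s) has_vector_derivative 1 - 0) (at s)"
      by (intro has_vector_derivative_diff has_vector_derivative_id has_vector_derivative_const)
    have "((\<lambda>t. u (x + s *\<^sub>R axis i 1 + (t - s) *\<^sub>R axis i 1)) has_vector_derivative partial_deriv i u (x + s *\<^sub>R axis i 1)) (at s)"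
      using vector_diff_chain_at[of "\<lambda>t. t - s" 1 s "\<lambda>t. u (x + s *\<^sub>R axis i 1 + t *\<^sub>R axis i 1)"]
        partial_deriv_works[OF diff, of "x + s *\<^sub>R axis i 1" i]
        d by (simp add: o_def)
    then show ?thesis by (simp add: algebra_simps)
  qed
  have lip: "norm (u (x + t *\<^sub>R axis i 1) - u x) \<le> C * t" if "t \<ge> 0" for x t
  proof -
    have "norm (u (x + t *\<^sub>R axis i 1) - u (x + 0 *\<^sub>R axis i 1)) \<le> C * norm (t - 0)"
    proof (rule differentiable_bound[of UNIV])
      fix s
      show "((\<lambda>t. u (x + t *\<^sub>R axis i 1)) has_derivative (\<lambda>h. h *\<^sub>R partial_deriv i u (x + s *\<^sub>R axis i 1))) (at s within UNIV)"
        using shift[of x s] by (simp add: has_vector_derivative_def)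
      show "onorm (\<lambda>h. h *\<^sub>R partial_deriv i u (x + s *\<^sub>R axis i 1)) \<le> C"
        using C by (auto intro!: onorm_bound simp: mult.commute[of C] mult_left_mono)
    qed auto
    then show ?thesis using that by simp
  qed
  have int: "integrable lborel (\<lambda>x. u (x + a))" "(LINT x|lborel. u (x + a)) = (LINT x|lborel. u x)" for a
  proof -
    have "(\<lambda>x. x + a) = (+) a" by (auto simp: add.commute)
    then have *: "lborel = distr lborel borel (\<lambda>x. x + a :: real^'n)"
      using lborel_distr_plus[of a] by simp
    show "integrable lborel (\<lambda>x. u (x + a))"
      using test_function_integrable[OF u] test_function_measurable[OF u]
      by (subst (asm) *) (simp add: integrable_distr_eq)
    show "(LINT x|lborel. u (x + a)) = (LINT x|lborel. u x)"
      using test_function_measurable[OF u] by (subst (2) *) (simp add: integral_distr)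
  qed
  have zero: "(LINT x|lborel. ?s n x) = 0" for n
    using int test_function_integrable[OF u] by (simp add: Bochner_Integration.integral_diff)
  have "(\<lambda>n. LINT x|lborel. ?s n x) \<longlonglongrightarrow> (LINT x|lborel. partial_deriv i u x)"
  proof (rule integral_dominated_convergence)
    show "partial_deriv i u \<in> borel_measurable lborel"
      using test_function_measurable[OF test_function_partial[OF u]] by simp
    show "?s n \<in> borel_measurable lborel" for n
      using test_function_measurable[OF u] by simp
    \<comment> \<open>The step lengths are at most 1, so all difference quotients vanish outside the
      ball of radius |R| + 1; inside it they are at most \<open>C\<close>.\<close>
    show "integrable lborel (\<lambda>x. indicator (cball 0 (\<bar>R\<bar> + 1)) x *\<^sub>R C)"
      by (intro borel_integrable_compact) auto
    show "AE x in lborel. (\<lambda>n. ?s n x) \<longlonglongrightarrow> partial_deriv i u x"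
    proof (rule AE_I2)
      fix x
      have "((\<lambda>t. norm (u (x + t *\<^sub>R axis i 1) - u x - t *\<^sub>R partial_deriv i u x) / \<bar>t\<bar>) \<longlongrightarrow> 0) (at 0)"
        using partial_deriv_works[OF diff, of x i]
        by (simp add: has_vector_derivative_def has_derivative_iff_norm)
      then have "((\<lambda>t. norm ((1/t) *\<^sub>R (u (x + t *\<^sub>R axis i 1) - u x) - partial_deriv i u x)) \<longlongrightarrow> 0) (at 0)"
      proof (rule Lim_transform_eventually)
        have "norm (a - t *\<^sub>R b) / \<bar>t\<bar> = norm ((1 / t) *\<^sub>R a - b)" if "t \<noteq> 0" for t :: real and a b :: 'e
        proof -
          have "norm ((1 / t) *\<^sub>R (a - t *\<^sub>R b)) = norm (a - t *\<^sub>R b) / \<bar>t\<bar>" by simp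
          then show ?thesis using that by (simp add: scaleR_diff_right)
        qed
        then show "\<forall>\<^sub>F t in at 0. norm (u (x + t *\<^sub>R axis i 1) - u x - t *\<^sub>R partial_deriv i u x) / \<bar>t\<bar> =
          norm ((1/t) *\<^sub>R (u (x + t *\<^sub>R axis i 1) - u x) - partial_deriv i u x)"
          by (auto simp: eventually_at_filter)
      qed
      then have "((\<lambda>t. (1/t) *\<^sub>R (u (x + t *\<^sub>R axis i 1) - u x)) \<longlongrightarrow> partial_deriv i u x) (at 0)"
        by (simp add: tendsto_norm_zero_iff LIM_zero_iff)
      then show "(\<lambda>n. ?s n x) \<longlonglongrightarrow> partial_deriv i u x"
        by (rule filterlim_compose[where f = "\<lambda>n. ?t n"])
           (use LIMSEQ_inverse_real_of_nat in \<open>simp add: filterlim_at inverse_eq_divide\<close>)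
    qed
    show "AE x in lborel. norm (?s n x) \<le> indicator (cball 0 (\<bar>R\<bar> + 1)) x *\<^sub>R C" for n
    proof (rule AE_I2)
      fix x
      show "norm (?s n x) \<le> indicator (cball 0 (\<bar>R\<bar> + 1)) x *\<^sub>R C"
      proof (cases "norm x \<le> \<bar>R\<bar> + 1")
        case True
        then show ?thesis using lip[of "?t n" x] by (simp add: divide_simps mult.commute)
      next
        case False
        have "norm (x + ?t n *\<^sub>R axis i 1) \<ge> norm x - norm (?t n *\<^sub>R axis i 1 :: real^'n)"
          by (metis add.commute norm_diff_ineq)
        moreover have "norm (?t n *\<^sub>R axis i 1 :: real^'n) \<le> 1" by simp
        ultimately have "norm (x + ?t n *\<^sub>R axis i 1) > R" using False by linarith
        then have "u (x + ?t n *\<^sub>R axis i 1) = 0" "u x = 0" using False by (auto intro!: R)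
        then show ?thesis using C(1) by simp
      qed
    qed
  qed
  then show ?thesis using zero by (simp add: LIMSEQ_const_iff)
qed

section \<open>Integration on Euclidean space\<close>

lemma prod_Basis_vec:
  "(\<Prod>b\<in>(Basis :: (real^'n::finite) set). g b) = (\<Prod>i\<in>UNIV. g (axis i 1))"
proof -
  have B: "(Basis :: (real^'n) set) = (\<lambda>i. axis i 1) ` UNIV"
    by (auto simp: Basis_vec_def)
  show ?thesis
    unfolding B by (subst prod.reindex) (auto intro: injI simp: axis_eq_axis)
qed

lemma nn_integral_vec_prod:
  fixes f :: "'n::finite \<Rightarrow> real \<Rightarrow> ennreal"
  assumes [measurable]: "\<And>i. f i \<in> borel_measurable borel"
  shows "(\<integral>\<^sup>+x. (\<Prod>i\<in>UNIV. f i ((x::real^'n) $ i)) \<partial>lborel) = (\<Prod>i\<in>UNIV. \<integral>\<^sup>+t. f i t \<partial>lborel)"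
proof -
  have "(\<integral>\<^sup>+x. (\<Prod>b\<in>Basis. f (axis_index b) ((x::real^'n) \<bullet> b)) \<partial>lborel) =
      (\<Prod>b\<in>(Basis::(real^'n) set). \<integral>\<^sup>+t. f (axis_index b) t \<partial>lborel)"
    by (rule nn_integral_lborel_prod) auto
  then show ?thesis by (simp add: prod_Basis_vec inner_axis)
qed

lemma integral_vec_prod:
  fixes f :: "'n::finite \<Rightarrow> real \<Rightarrow> complex"
  assumes f: "\<And>i. integrable lborel (f i)"
  shows "integrable lborel (\<lambda>x::real^'n. \<Prod>i\<in>UNIV. f i (x $ i))"
    and "(LINT x|lborel. (\<Prod>i\<in>UNIV. f i ((x::real^'n) $ i))) = (\<Prod>i\<in>UNIV. integral\<^sup>L lborel (f i))"
proof -
  interpret product_sigma_finite "\<lambda>b::real^'n. lborel :: real measure" ..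
  let ?T = "\<lambda>g::real^'n \<Rightarrow> real. \<Sum>b\<in>Basis. g b *\<^sub>R b"
  have T: "?T g \<bullet> b = g b" if "b \<in> Basis" for g b using that by (simp add: inner_sum_left_Basis)
  have [measurable]: "f i \<in> borel_measurable borel" for i
    using borel_measurable_integrable[OF f[of i]] by simp
  have [measurable]: "(\<lambda>x::real^'n. \<Prod>b\<in>Basis. f (axis_index b) (x \<bullet> b)) \<in> borel_measurable borel"
    by measurable
  have eq: "(\<Prod>b\<in>Basis. f (axis_index b) (?T g \<bullet> b)) = (\<Prod>b\<in>Basis. f (axis_index b) (g b))" for g
    by (intro prod.cong refl) (simp only: T)
  have m: "?T \<in> measurable (\<Pi>\<^sub>M b\<in>Basis. lborel) borel" by measurable
  have "integrable lborel (\<lambda>x::real^'n. \<Prod>b\<in>Basis. f (axis_index b) (x \<bullet> b))"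
    unfolding lborel_eq[where 'a = "real^'n"]
    by (subst integrable_distr_eq[OF m]) (simp_all only: eq, measurable, intro product_integrable_prod f finite_Basis)
  then show "integrable lborel (\<lambda>x::real^'n. \<Prod>i\<in>UNIV. f i (x $ i))"
    by (simp add: prod_Basis_vec inner_axis)
  have "(LINT x|lborel. (\<Prod>b\<in>Basis. f (axis_index b) ((x::real^'n) \<bullet> b))) = (\<Prod>b\<in>(Basis::(real^'n) set). integral\<^sup>L lborel (f (axis_index b)))"
    unfolding lborel_eq[where 'a = "real^'n"]
    by (subst integral_distr[OF m]) (simp_all only: eq, measurable, intro product_integral_prod f finite_Basis)
  then show "(LINT x|lborel. (\<Prod>i\<in>UNIV. f i ((x::real^'n) $ i))) = (\<Prod>i\<in>UNIV. integral\<^sup>L lborel (f i))"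
    by (simp add: prod_Basis_vec inner_axis)
qed

text \<open>A decay weight that factorises over the coordinates, so that its integrability reduces
  to that of 1 / (1 + t^2) on the line.\<close>

lemma integrable_prod_inverse_square:
  "integrable lborel (\<lambda>x::real^'n::finite. \<Prod>i\<in>UNIV. inverse (1 + (x $ i)\<^sup>2))"
proof (rule integrableI_nonneg)
  have 1: "integrable lborel (\<lambda>t::real. inverse (1 + t\<^sup>2))"
    using integrable_inverse_1_plus_square by (simp add: set_integrable_def einterval_def)
  have "(\<integral>\<^sup>+t. ennreal (inverse (1 + t\<^sup>2)) \<partial>lborel) < \<infinity>"
    using 1 by (simp add: integrable_iff_bounded)
  then have "(\<Prod>i\<in>(UNIV::'n set). \<integral>\<^sup>+t. ennreal (inverse (1 + t\<^sup>2)) \<partial>lborel) < \<infinity>"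
    by (simp add: power_less_top_ennreal)
  moreover have "(\<integral>\<^sup>+x. ennreal (\<Prod>i\<in>UNIV. inverse (1 + ((x::real^'n) $ i)\<^sup>2)) \<partial>lborel) =
    (\<Prod>i\<in>(UNIV::'n set). \<integral>\<^sup>+t. ennreal (inverse (1 + t\<^sup>2)) \<partial>lborel)"
    by (subst nn_integral_vec_prod[symmetric]) (auto simp: prod_ennreal)
  ultimately show "(\<integral>\<^sup>+x. ennreal (\<Prod>i\<in>UNIV. inverse (1 + ((x::real^'n) $ i)\<^sup>2)) \<partial>lborel) < \<infinity>" by simp
qed (auto intro!: prod_nonneg borel_measurable_prod)

text \<open>Christensen's comparison of measures that are uniformly distributed over balls: average the
  indicator of the open set over small balls, apply Fatou's lemma and exchange the integrals.\<close>

lemma emeasure_le_of_uniform_balls: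
  fixes \<mu> \<nu> :: "(real^'n::finite) measure"
  assumes [measurable_cong]: "sets \<mu> = sets borel" "sets \<nu> = sets borel"
    and sf: "sigma_finite_measure \<mu>" "sigma_finite_measure \<nu>"
    and S[measurable]: "S \<in> sets borel" and null: "emeasure \<nu> (- S) = 0"
    and r: "r \<longlonglongrightarrow> 0" "\<And>j. r j > 0"
    and G: "\<And>x j. x \<in> S \<Longrightarrow> emeasure \<mu> (ball x (r j)) \<le> G j"
    and H: "\<And>x j. x \<in> S \<Longrightarrow> emeasure \<nu> (ball x (r j)) = H j" "\<And>j. 0 < H j" "\<And>j. H j < \<infinity>"
    and L: "(\<lambda>j. G j / H j) \<longlonglongrightarrow> L"
    and U: "open U" and fin: "emeasure \<nu> U < \<infinity>"
  shows "emeasure \<mu> (U \<inter> S) \<le> L * emeasure \<nu> U"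
proof -
  interpret \<mu>: sigma_finite_measure \<mu> by fact
  interpret \<nu>: sigma_finite_measure \<nu> by fact
  interpret pair_sigma_finite \<mu> \<nu> ..
  note U[THEN borel_open, measurable]
  \<comment> \<open>The condition that \<open>x\<close> lies in the ball around \<open>y\<close> is
    symmetric. For \<open>x\<close> in \<open>U \<inter> S\<close> the integral in \<open>y\<close>
    against \<nu> is 1 as soon as the ball around \<open>x\<close> lies in \<open>U\<close>, while
    the integral in \<open>x\<close> against \<mu> is at most \<open>G j / H j\<close>.\<close>
  define k where "k j x y = indicator (U \<inter> S) x * indicator U y * indicator (ball y (r j)) x * (1 / H j)" for j x y
  have b: "{p :: (real^'n) \<times> (real^'n). fst p \<in> ball (snd p) (r j)} \<in> sets (borel \<Otimes>\<^sub>M borel)" for j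
  proof -
    have "open {p :: (real^'n) \<times> (real^'n). dist (snd p) (fst p) < r j}"
      by (intro open_Collect_less continuous_intros)
    moreover have "{p :: (real^'n) \<times> (real^'n). fst p \<in> ball (snd p) (r j)} = {p. dist (snd p) (fst p) < r j}" by simp
    ultimately show ?thesis unfolding borel_prod by (simp add: borel_open)
  qed
  have ind: "indicator (ball y (r j)) x = (indicator {p. fst p \<in> ball (snd p) (r j)} (x, y) :: ennreal)" for x y j
    by (simp add: indicator_def)
  have [measurable]: "(\<lambda>(x, y). indicator (ball y (r j)) x :: ennreal) \<in> borel_measurable (\<mu> \<Otimes>\<^sub>M \<nu>)" for j
    unfolding ind case_prod_beta prod.collapse using b[of j] by (intro borel_measurable_indicator) simp
  have k[measurable]: "(\<lambda>(x, y). k j x y) \<in> borel_measurable (\<mu> \<Otimes>\<^sub>M \<nu>)" for j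
    unfolding k_def by measurable
  have low: "indicator (U \<inter> S) x \<le> liminf (\<lambda>j. \<integral>\<^sup>+y. k j x y \<partial>\<nu>)" for x
  proof (cases "x \<in> U \<inter> S")
    case True
    then obtain e where e: "e > 0" "ball x e \<subseteq> U" using U openE by blast
    have "eventually (\<lambda>j. r j < e) sequentially" using r(1) e(1) by (rule order_tendstoD(2))
    then have "eventually (\<lambda>j. (\<integral>\<^sup>+y. k j x y \<partial>\<nu>) = 1) sequentially"
    proof eventually_elim
      fix j assume "r j < e"
      have "k j x y = indicator (ball x (r j)) y * (1 / H j)" for y
      proof -
        have "y \<in> ball x (r j) \<Longrightarrow> y \<in> U" using \<open>r j < e\<close> e(2) by auto
        then show ?thesis using True by (auto simp: k_def indicator_def dist_commute)
      qed
      then have "(\<integral>\<^sup>+y. k j x y \<partial>\<nu>) = (\<integral>\<^sup>+y. indicator (ball x (r j)) y * (1 / H j) \<partial>\<nu>)" by simp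
      also have "\<dots> = H j * (1 / H j)"
        using True H(1) by (subst nn_integral_multc) (auto intro!: borel_measurable_indicator simp: assms(2))
      also have "\<dots> = 1" using H(2,3)[of j] by (simp add: ennreal_times_divide ennreal_divide_self)
      finally show "(\<integral>\<^sup>+y. k j x y \<partial>\<nu>) = 1" .
    qed
    then have "liminf (\<lambda>j. \<integral>\<^sup>+y. k j x y \<partial>\<nu>) = liminf (\<lambda>j. 1)" by (rule Liminf_eq)
    then show ?thesis by (simp add: Liminf_const indicator_def)
  qed simp
  have up: "(\<integral>\<^sup>+x. \<integral>\<^sup>+y. k j x y \<partial>\<nu> \<partial>\<mu>) \<le> G j / H j * emeasure \<nu> U" for j
  proof -
    have "(\<integral>\<^sup>+x. \<integral>\<^sup>+y. k j x y \<partial>\<nu> \<partial>\<mu>) = (\<integral>\<^sup>+y. \<integral>\<^sup>+x. k j x y \<partial>\<mu> \<partial>\<nu>)"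
      by (rule Fubini'[symmetric]) measurable
    also have "\<dots> \<le> (\<integral>\<^sup>+y. G j / H j * indicator U y \<partial>\<nu>)"
    proof (rule nn_integral_mono_AE)
      have "AE y in \<nu>. y \<in> S" by (rule AE_I[of _ _ "- S"]) (use null in auto)
      then show "AE y in \<nu>. (\<integral>\<^sup>+x. k j x y \<partial>\<mu>) \<le> G j / H j * indicator U y"
      proof eventually_elim
        fix y assume "y \<in> S"
        have "(\<integral>\<^sup>+x. k j x y \<partial>\<mu>) \<le> (\<integral>\<^sup>+x. indicator (ball y (r j)) x * (indicator U y * (1 / H j)) \<partial>\<mu>)"
          by (intro nn_integral_mono) (auto simp: k_def indicator_def)
        also have "\<dots> = emeasure \<mu> (ball y (r j)) * (indicator U y * (1 / H j))"
          by (subst nn_integral_multc) (auto intro!: borel_measurable_indicator simp: assms(1))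
        also have "\<dots> \<le> G j * (indicator U y * (1 / H j))" using G[OF \<open>y \<in> S\<close>] by (rule mult_right_mono) simp
        also have "\<dots> = G j / H j * indicator U y" by (simp add: indicator_def ennreal_times_divide)
        finally show "(\<integral>\<^sup>+x. k j x y \<partial>\<mu>) \<le> G j / H j * indicator U y" .
      qed
    qed
    also have "\<dots> = G j / H j * emeasure \<nu> U" by (simp add: nn_integral_cmult)
    finally show ?thesis .
  qed
  have "emeasure \<mu> (U \<inter> S) = (\<integral>\<^sup>+x. indicator (U \<inter> S) x \<partial>\<mu>)" by simp
  also have "\<dots> \<le> (\<integral>\<^sup>+x. liminf (\<lambda>j. \<integral>\<^sup>+y. k j x y \<partial>\<nu>) \<partial>\<mu>)" by (intro nn_integral_mono low)
  also have "\<dots> \<le> liminf (\<lambda>j. \<integral>\<^sup>+x. \<integral>\<^sup>+y. k j x y \<partial>\<nu> \<partial>\<mu>)" by (intro nn_integral_liminf) measurable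
  also have "\<dots> \<le> liminf (\<lambda>j. G j / H j * emeasure \<nu> U)" by (intro Liminf_mono always_eventually allI up)
  also have "\<dots> = L * emeasure \<nu> U"
    using ennreal_tendsto_cmult[OF _ L, of "emeasure \<nu> U"] fin by (intro lim_imp_Liminf) (simp_all add: mult.commute)
  finally show ?thesis .
qed

text \<open>The preimage of a ball is a ball of the same radius, so the image measure and Lebesgue
  measure agree on balls. The comparison of uniformly distributed measures applies in both
  directions with ratio 1 and yields equality on boxes.\<close>

lemma lborel_distr_orthogonal:
  fixes T :: "real^'n::finite \<Rightarrow> real^'n"
  assumes T: "orthogonal_transformation T"
  shows "distr lborel borel T = lborel"
proof (rule lborel_eqI[symmetric])
  have [measurable]: "T \<in> borel_measurable borel"
    using T by (intro borel_measurable_continuous_onI linear_continuous_on)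
      (simp add: orthogonal_transformation_linear linear_conv_bounded_linear[symmetric])
  have inv: "orthogonal_transformation (inv T)" and bij: "bij T"
    using T by (auto intro: orthogonal_transformation_inv orthogonal_transformation_bij)
  let ?r = "\<lambda>j. 1 / real (Suc j)" and ?\<mu> = "distr lborel borel T"
  have r: "?r \<longlonglongrightarrow> 0" using LIMSEQ_inverse_real_of_nat by (simp add: inverse_eq_divide)
  let ?H = "\<lambda>j. ennreal (unit_ball_vol (real CARD('n)) * ?r j ^ CARD('n))"
  have H: "emeasure lborel (ball x (?r j)) = ?H j" for x :: "real^'n" and j
    by (subst emeasure_ball) auto
  have G: "emeasure ?\<mu> (ball x (?r j)) = ?H j" for x and j
  proof -
    have "T -` ball x (?r j) = ball (inv T x) (?r j)"
      using bij image_orthogonal_transformation_ball[OF inv, of x "?r j"] by (simp add: bij_vimage_eq_inv_image)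
    then show ?thesis using H[of "inv T x" j] by (simp add: emeasure_distr)
  qed
  have fin: "emeasure ?\<mu> (ball 0 (real j)) < \<infinity>" for j
  proof -
    have "T -` ball 0 (real j) = ball (inv T 0) (real j)"
      using bij image_orthogonal_transformation_ball[OF inv, of 0 "real j"] by (simp add: bij_vimage_eq_inv_image)
    then show ?thesis by (simp add: emeasure_distr emeasure_ball)
  qed
  have sf: "sigma_finite_measure ?\<mu>"
  proof
    note fin
    moreover have "(\<Union>j. ball (0::real^'n) (real j)) = UNIV" using reals_Archimedean2 by auto
    ultimately show "\<exists>A. countable A \<and> A \<subseteq> sets ?\<mu> \<and> \<Union>A = space ?\<mu> \<and> (\<forall>a\<in>A. emeasure ?\<mu> a \<noteq> \<infinity>)"
      by (intro exI[of _ "range (\<lambda>j::nat. ball (0::real^'n) (real j))"]) (auto simp: less_top)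
  qed
  have "0 < unit_ball_vol (real CARD('n)) * ?r j ^ CARD('n)" for j by (rule mult_pos_pos[OF unit_ball_vol_pos]) simp_all
  then have pos: "0 < ?H j" for j by (simp only: ennreal_less_zero_iff)
  have "?H j / ?H j = 1" for j by (rule ennreal_divide_self[OF pos[unfolded zero_less_iff_neq_zero]]) simp
  then have ratio: "(\<lambda>j. ?H j / ?H j) \<longlonglongrightarrow> 1" by simp
  fix l u :: "real^'n" assume lu: "\<And>b. b \<in> Basis \<Longrightarrow> l \<bullet> b \<le> u \<bullet> b"
  obtain j :: nat where j: "box l u \<subseteq> ball 0 (real j)"
  proof -
    obtain K where "\<And>x. x \<in> box l u \<Longrightarrow> norm x \<le> K" using bounded_box[of l u] bounded_iff by blast
    moreover obtain j :: nat where "K < real j" using reals_Archimedean2 by blast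
    ultimately show thesis by (intro that[of j]) force
  qed
  have fin': "emeasure ?\<mu> (box l u) < \<infinity>"
    using emeasure_mono[OF j, of ?\<mu>] fin[of j] by (simp add: le_less_trans)
  have fin'': "emeasure lborel (box l u) < \<infinity>" by (intro emeasure_bounded_finite) simp
  have "emeasure ?\<mu> (box l u \<inter> UNIV) \<le> 1 * emeasure lborel (box l u)"
    by (rule emeasure_le_of_uniform_balls[where r = ?r and G = ?H and H = ?H])
      (use sf r G H pos ratio fin'' in \<open>auto simp: open_box sigma_finite_lborel simp del: of_nat_Suc\<close>)
  moreover have "emeasure lborel (box l u \<inter> UNIV) \<le> 1 * emeasure ?\<mu> (box l u)"
    by (rule emeasure_le_of_uniform_balls[where r = ?r and G = ?H and H = ?H])
      (use sf r G H pos ratio fin' in \<open>auto simp: open_box sigma_finite_lborel simp del: of_nat_Suc\<close>)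
  ultimately show "emeasure ?\<mu> (box l u) = (\<Prod>b\<in>Basis. (u - l) \<bullet> b)"
    using lu by (simp add: emeasure_lborel_box)
qed simp

lemma nn_integral_lborel_scale:
  fixes f :: "'a::euclidean_space \<Rightarrow> ennreal"
  assumes [measurable]: "f \<in> borel_measurable borel" and "c > 0"
  shows "(\<integral>\<^sup>+x. f x \<partial>lborel) = ennreal (c ^ DIM('a)) * (\<integral>\<^sup>+x. f (c *\<^sub>R x) \<partial>lborel)"
  using assms(2) by (subst lborel_affine[of c 0]) (auto simp: nn_integral_density nn_integral_distr nn_integral_cmult)

section \<open>Dilates of a fixed annulus in place of polar coordinates\<close>

definition annulus :: "(real^'n::finite) set" where
  "annulus = {z. 1 \<le> norm z \<and> norm z \<le> 2}"

lemma annulus_measurable [measurable]: "annulus \<in> sets borel"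
  unfolding annulus_def by measurable

lemma compact_annulus: "compact (annulus :: (real^'n::finite) set)"
proof -
  have eq: "(annulus :: (real^'n) set) = cball 0 2 - ball 0 1" by (auto simp: annulus_def)
  show ?thesis unfolding eq by (intro compact_diff compact_cball open_ball)
qed

lemma emeasure_annulus_finite: "emeasure lborel (annulus :: (real^'n::finite) set) < \<infinity>"
  using emeasure_compact_finite[OF compact_annulus] by (simp add: less_top)

text \<open>After the substitution x = t z and an exchange of the integrals, a fixed x other than 0
  is reached exactly for t in [|x| / 2, |x|], with weight 1 / t. This accounts for the factor ln
  2.\<close>

lemma nn_integral_dilation:
  fixes h :: "real^'n::finite \<Rightarrow> ennreal"
  assumes [measurable]: "h \<in> borel_measurable borel"
  shows "(\<integral>\<^sup>+t. \<integral>\<^sup>+z. ennreal (indicator {0<..} t * t ^ (CARD('n) - 1)) * indicator annulus z * h (t *\<^sub>R z) \<partial>lborel \<partial>lborel)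
     = ennreal (ln 2) * (\<integral>\<^sup>+x. h x \<partial>lborel)"
proof -
  have "(\<integral>\<^sup>+z. ennreal (indicator {0<..} t * t ^ (CARD('n) - 1)) * indicator annulus z * h (t *\<^sub>R z) \<partial>lborel) =
    (\<integral>\<^sup>+x. ennreal (indicator {0<..} t * inverse t) * indicator annulus (inverse t *\<^sub>R x) * h x \<partial>lborel)" for t
  proof (cases "t > 0")
    case True
    have "(\<integral>\<^sup>+x. ennreal (indicator {0<..} t * inverse t) * indicator annulus (inverse t *\<^sub>R x) * h x \<partial>lborel)
      = ennreal (t ^ CARD('n)) * (\<integral>\<^sup>+x. ennreal (inverse t) * (indicator annulus x * h (t *\<^sub>R x)) \<partial>lborel)"
      using True by (subst nn_integral_lborel_scale[of _ t]) (auto simp: mult.assoc)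
    also have "\<dots> = (\<integral>\<^sup>+x. ennreal (t ^ CARD('n) * inverse t) * (indicator annulus x * h (t *\<^sub>R x)) \<partial>lborel)"
      using True by (simp add: nn_integral_cmult ennreal_mult mult.assoc)
    also have "t ^ CARD('n) * inverse t = t ^ (CARD('n) - 1)"
      using True by (simp add: power_diff divide_inverse)
    finally show ?thesis using True by (simp add: mult.assoc)
  qed simp
  then have "(\<integral>\<^sup>+t. \<integral>\<^sup>+z. ennreal (indicator {0<..} t * t ^ (CARD('n) - 1)) * indicator annulus z * h (t *\<^sub>R z) \<partial>lborel \<partial>lborel)
    = (\<integral>\<^sup>+t. \<integral>\<^sup>+x. ennreal (indicator {0<..} t * inverse t) * indicator annulus (inverse t *\<^sub>R x) * h x \<partial>lborel \<partial>lborel)"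
    by simp
  also have "\<dots> = (\<integral>\<^sup>+x. \<integral>\<^sup>+t. ennreal (indicator {0<..} t * inverse t) * indicator annulus (inverse t *\<^sub>R x) * h x \<partial>lborel \<partial>lborel)"
    by (rule lborel_pair.Fubini') measurable
  also have "\<dots> = (\<integral>\<^sup>+x. ennreal (ln 2) * h x \<partial>lborel)"
  proof (rule nn_integral_cong_AE)
    have "AE x in lborel. x \<noteq> (0::real^'n)" by (rule AE_lborel_singleton)
    then show "AE x in lborel. (\<integral>\<^sup>+t. ennreal (indicator {0<..} t * inverse t) * indicator annulus (inverse t *\<^sub>R x) * h x \<partial>lborel) = ennreal (ln 2) * h x"
    proof eventually_elim
      fix x :: "real^'n" assume x: "x \<noteq> 0"
      have "(\<integral>\<^sup>+t. ennreal (indicator {0<..} t * inverse t) * indicator annulus (inverse t *\<^sub>R x) * h x \<partial>lborel)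
        = (\<integral>\<^sup>+t. ennreal (inverse t) * indicator {norm x / 2..norm x} t \<partial>lborel) * h x"
      proof (subst nn_integral_multc[symmetric])
        show "(\<integral>\<^sup>+t. ennreal (indicator {0<..} t * inverse t) * indicator annulus (inverse t *\<^sub>R x) * h x \<partial>lborel)
          = (\<integral>\<^sup>+t. ennreal (inverse t) * indicator {norm x / 2..norm x} t * h x \<partial>lborel)"
        proof (rule nn_integral_cong)
          fix t
          have "0 < t \<and> inverse t *\<^sub>R x \<in> annulus \<longleftrightarrow> norm x / 2 \<le> t \<and> t \<le> norm x"
          proof (cases "t > 0")
            case True
            then show ?thesis by (auto simp: annulus_def field_simps)
          next
            case False
            moreover have "norm x / 2 > 0" using x by simp
            ultimately show ?thesis by linarith
          qed
          then show "ennreal (indicator {0<..} t * inverse t) * indicator annulus (inverse t *\<^sub>R x) * h x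
            = ennreal (inverse t) * indicator {norm x / 2..norm x} t * h x"
            by (auto simp: indicator_def)
        qed
      qed auto
      also have "(\<integral>\<^sup>+t. ennreal (inverse t) * indicator {norm x / 2..norm x} t \<partial>lborel) = ennreal (ln (norm x) - ln (norm x / 2))"
      proof (rule nn_integral_FTC_Icc)
        fix t assume t: "t \<in> {norm x / 2..norm x}"
        have "0 < norm x / 2" using x by simp
        moreover have "norm x / 2 \<le> t" using t by simp
        ultimately have "0 < t" by linarith
        then show "DERIV ln t :> inverse t" "0 \<le> inverse t" by (auto intro!: derivative_eq_intros simp: divide_inverse)
      qed (use x in auto)
      also have "ln (norm x) - ln (norm x / 2) = ln 2" using x by (simp add: ln_div)
      finally show "(\<integral>\<^sup>+t. ennreal (indicator {0<..} t * inverse t) * indicator annulus (inverse t *\<^sub>R x) * h x \<partial>lborel) = ennreal (ln 2) * h x" .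
    qed
  qed
  also have "\<dots> = ennreal (ln 2) * (\<integral>\<^sup>+x. h x \<partial>lborel)" by (simp add: nn_integral_cmult)
  finally show ?thesis .
qed

text \<open>The density that represents Lebesgue measure as a superposition of the dilates of the annulus;
  it takes the place of polar coordinates.\<close>

definition dil :: "real \<times> (real^'n::finite) \<Rightarrow> real" where
  "dil p = indicator {0<..} (fst p) * fst p ^ (CARD('n) - 1) * indicator annulus (snd p) / ln 2"

lemma dil_measurable [measurable]: "dil \<in> borel_measurable (borel \<Otimes>\<^sub>M borel)"
  unfolding dil_def by measurable

lemma dil_nonneg: "dil p \<ge> 0"
  by (auto simp: dil_def indicator_def)

lemma dilation_measure:
  "distr (density (lborel \<Otimes>\<^sub>M lborel) (\<lambda>p. ennreal (dil p))) borel (\<lambda>p. fst p *\<^sub>R snd p) = (lborel :: (real^'n::finite) measure)"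
proof (rule measure_eqI)
  fix A assume "A \<in> sets (distr (density (lborel \<Otimes>\<^sub>M lborel) (\<lambda>p. ennreal (dil p))) borel (\<lambda>p. fst p *\<^sub>R snd p :: real^'n))"
  then have [measurable]: "A \<in> sets borel" by simp
  have [measurable]: "(\<lambda>p::real \<times> (real^'n). fst p *\<^sub>R snd p) \<in> borel_measurable (borel \<Otimes>\<^sub>M borel)" by measurable
  have "emeasure (distr (density (lborel \<Otimes>\<^sub>M lborel) (\<lambda>p. ennreal (dil p))) borel (\<lambda>p. fst p *\<^sub>R snd p)) A =
    (\<integral>\<^sup>+x. indicator A x \<partial>distr (density (lborel \<Otimes>\<^sub>M lborel) (\<lambda>p. ennreal (dil p))) borel (\<lambda>p. fst p *\<^sub>R snd p))"
    by simp
  also have "\<dots> = (\<integral>\<^sup>+p. ennreal (dil p) * indicator A (fst p *\<^sub>R snd p) \<partial>(lborel \<Otimes>\<^sub>M lborel))"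
    by (subst nn_integral_distr, simp, simp, subst nn_integral_density) auto
  also have "\<dots> = (\<integral>\<^sup>+t. \<integral>\<^sup>+z. ennreal (dil (t, z)) * indicator A (t *\<^sub>R z) \<partial>lborel \<partial>lborel)"
    by (subst lborel.nn_integral_fst[symmetric]) auto
  also have "\<dots> = (\<integral>\<^sup>+t. \<integral>\<^sup>+z. ennreal (indicator {0<..} t * t ^ (CARD('n) - 1)) * indicator annulus z * (ennreal (1 / ln 2) * indicator A (t *\<^sub>R z)) \<partial>lborel \<partial>lborel)"
    by (intro nn_integral_cong) (auto simp: dil_def indicator_def ennreal_mult'[symmetric] ac_simps)
  also have "\<dots> = ennreal (ln 2) * (\<integral>\<^sup>+x. ennreal (1 / ln 2) * indicator A x \<partial>lborel)"
    by (rule nn_integral_dilation) simp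
  also have "\<dots> = emeasure lborel A"
    by (simp add: nn_integral_cmult mult.assoc[symmetric] ennreal_mult'[symmetric])
  finally show "emeasure (distr (density (lborel \<Otimes>\<^sub>M lborel) (\<lambda>p. ennreal (dil p))) borel (\<lambda>p. fst p *\<^sub>R snd p)) A = emeasure lborel A" .
qed simp

lemma integral_dilation:
  fixes h :: "real^'n::finite \<Rightarrow> 'e::euclidean_space"
  assumes h: "integrable lborel h"
  shows "integrable (lborel \<Otimes>\<^sub>M lborel) (\<lambda>p. dil p *\<^sub>R h (fst p *\<^sub>R snd p))"
    and "(LINT p|(lborel \<Otimes>\<^sub>M lborel). dil p *\<^sub>R h (fst p *\<^sub>R snd p)) = (LINT x|lborel. h x)"
proof -
  have [measurable]: "h \<in> borel_measurable borel" using h by auto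
  have [measurable]: "(\<lambda>p::real \<times> (real^'n). fst p *\<^sub>R snd p) \<in> borel_measurable (borel \<Otimes>\<^sub>M borel)" by measurable
  have h': "integrable (distr (density (lborel \<Otimes>\<^sub>M lborel) (\<lambda>p. ennreal (dil p))) borel (\<lambda>p. fst p *\<^sub>R snd p)) h"
    unfolding dilation_measure by (rule h)
  then have "integrable (density (lborel \<Otimes>\<^sub>M lborel) (\<lambda>p. ennreal (dil p))) (\<lambda>p. h (fst p *\<^sub>R snd p))"
    by (subst (asm) integrable_distr_eq) auto
  then show "integrable (lborel \<Otimes>\<^sub>M lborel) (\<lambda>p. dil p *\<^sub>R h (fst p *\<^sub>R snd p))"
    by (subst (asm) integrable_density) (auto simp: dil_nonneg)
  have "(LINT x|lborel. h x) = (LINT p|(density (lborel \<Otimes>\<^sub>M lborel) (\<lambda>p. ennreal (dil p))). h (fst p *\<^sub>R snd p))"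
    by (subst dilation_measure[symmetric], subst integral_distr) auto
  also have "\<dots> = (LINT p|(lborel \<Otimes>\<^sub>M lborel). dil p *\<^sub>R h (fst p *\<^sub>R snd p))"
    by (subst integral_density) (auto simp: dil_nonneg)
  finally show "(LINT p|(lborel \<Otimes>\<^sub>M lborel). dil p *\<^sub>R h (fst p *\<^sub>R snd p)) = (LINT x|lborel. h x)" by simp
qed

section \<open>The logarithm\<close>

text \<open>An antiderivative of - ln t is t - t ln t, with limit 0 at 0. The interval [-2, 2]
  contains the values of every coordinate on the annulus.\<close>

lemma nn_integral_abs_ln: "(\<integral>\<^sup>+t. ennreal \<bar>ln \<bar>t\<bar>\<bar> * indicator {-2..2} t \<partial>lborel) < \<infinity>"
proof -
  have I: "(\<integral>\<^sup>+t. ennreal \<bar>ln t\<bar> * indicator {0..2} t \<partial>lborel) < \<infinity>"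
  proof -
    have *: "set_integrable lborel (einterval 0 1) (\<lambda>t. - ln t)"
    proof (rule interval_integral_FTC_nonneg(1)[where F = "\<lambda>t. t - t * ln t" and A = 0 and B = 1])
      show "DERIV (\<lambda>t. t - t * ln t) x :> - ln x" if "0 < ereal x" "ereal x < 1" for x
        using that by (auto intro!: derivative_eq_intros)
      show "isCont (\<lambda>t. - ln t) x" if "0 < ereal x" "ereal x < 1" for x
        using that by (auto intro!: continuous_intros)
      show "AE x in lborel. 0 < ereal x \<longrightarrow> ereal x < 1 \<longrightarrow> 0 \<le> - ln x" by auto
      have "filterlim (\<lambda>t::real. - ln t) at_top (at_right 0)"
        using ln_at_0 by (simp add: filterlim_uminus_at_top)
      from filterlim_compose[OF tendsto_power_div_exp_0[of 1] this]
      have "((\<lambda>t::real. (- ln t) ^ 1 / exp (- ln t)) \<longlongrightarrow> 0) (at_right 0)" .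
      moreover have "eventually (\<lambda>t::real. (- ln t) ^ 1 / exp (- ln t) = - (t * ln t)) (at_right 0)"
        by (auto simp: eventually_at_filter exp_minus divide_inverse)
      ultimately have "((\<lambda>t::real. - (t * ln t)) \<longlongrightarrow> 0) (at_right 0)" by (rule Lim_transform_eventually)
      from tendsto_add[OF tendsto_ident_at this]
      have "((\<lambda>t::real. t - t * ln t) \<longlongrightarrow> 0) (at_right 0)" by simp
      then show "(((\<lambda>t. t - t * ln t) \<circ> real_of_ereal) \<longlongrightarrow> 0) (at_right 0)"
        by (simp add: zero_ereal_def ereal_tendsto_simps1)
      have "((\<lambda>t::real. t - t * ln t) \<longlongrightarrow> 1 - 1 * ln 1) (at_left 1)"
        by (intro tendsto_intros) auto
      then show "(((\<lambda>t. t - t * ln t) \<circ> real_of_ereal) \<longlongrightarrow> 1) (at_left 1)"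
        by (simp add: one_ereal_def ereal_tendsto_simps1)
    qed auto
    have "einterval 0 1 = {0<..<1::real}" by (auto simp: einterval_def)
    with * have "integrable lborel (\<lambda>t::real. indicator {0<..<1} t * (- ln t))" by (simp add: set_integrable_def)
    then have "(\<integral>\<^sup>+t. ennreal (norm (indicator {0<..<1} t * (- ln t) :: real)) \<partial>lborel) < \<infinity>"
      by (simp add: integrable_iff_bounded)
    moreover have "(\<integral>\<^sup>+t. ennreal (ln 2) * indicator {0..2::real} t \<partial>lborel) < \<infinity>"
      by (simp add: nn_integral_cmult_indicator ennreal_mult_less_top)
    ultimately have "(\<integral>\<^sup>+t. ennreal (norm (indicator {0<..<1} t * (- ln t) :: real)) + ennreal (ln 2) * indicator {0..2::real} t \<partial>lborel) < \<infinity>"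
      by (subst nn_integral_add) auto
    moreover have "(\<integral>\<^sup>+t. ennreal \<bar>ln t\<bar> * indicator {0..2} t \<partial>lborel) \<le>
      (\<integral>\<^sup>+t. ennreal (norm (indicator {0<..<1} t * (- ln t) :: real)) + ennreal (ln 2) * indicator {0..2::real} t \<partial>lborel)"
    proof (rule nn_integral_mono)
      fix t :: real
      have "\<bar>ln t\<bar> \<le> norm (indicator {0<..<1} t * (- ln t)) + ln 2" if "0 \<le> t" "t \<le> 2"
      proof -
        consider "t = 0" | "0 < t" "t < 1" | "1 \<le> t" using \<open>0 \<le> t\<close> by linarith
        then show ?thesis
        proof cases
          case 3
          then have "0 \<le> ln t" "ln t \<le> ln 2" using that by auto
          then show ?thesis by (simp add: indicator_def)
        qed auto
      qed
      then show "ennreal \<bar>ln t\<bar> * indicator {0..2} t \<le> ennreal (norm (indicator {0<..<1} t * (- ln t))) + ennreal (ln 2) * indicator {0..2} t"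
        by (auto simp: indicator_def ennreal_plus[symmetric] simp del: ennreal_plus split: if_splits)
    qed
    ultimately show ?thesis by (rule le_less_trans[rotated])
  qed
  have "(\<integral>\<^sup>+t. ennreal \<bar>ln \<bar>t\<bar>\<bar> * indicator {-2..0} t \<partial>lborel) = (\<integral>\<^sup>+t. ennreal \<bar>ln \<bar>t\<bar>\<bar> * indicator {0..2} t \<partial>lborel)"
    by (subst nn_integral_real_affine[where c = "-1" and t = 0]) (auto simp: indicator_def intro!: nn_integral_cong)
  also have "\<dots> = (\<integral>\<^sup>+t. ennreal \<bar>ln t\<bar> * indicator {0..2} t \<partial>lborel)"
    by (intro nn_integral_cong) (auto simp: indicator_def)
  finally have II: "(\<integral>\<^sup>+t. ennreal \<bar>ln \<bar>t\<bar>\<bar> * indicator {-2..0} t \<partial>lborel) < \<infinity>" using I by simp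
  have "(\<integral>\<^sup>+t. ennreal \<bar>ln \<bar>t\<bar>\<bar> * indicator {-2..2} t \<partial>lborel) \<le>
     (\<integral>\<^sup>+t. ennreal \<bar>ln \<bar>t\<bar>\<bar> * indicator {-2..0} t + ennreal \<bar>ln t\<bar> * indicator {0..2} t \<partial>lborel)"
    by (intro nn_integral_mono) (auto simp: indicator_def)
  also have "\<dots> < \<infinity>" using I II by (subst nn_integral_add) auto
  finally show ?thesis .
qed

text \<open>A rotation takes a coordinate axis to the direction of \<open>x\<close> and turns the
  integrand into |ln |z_i||; enlarging the annulus to the cube [-2, 2]^n leaves a product of
  one-dimensional integrals. The point is that the bound does not depend on
  \<open>x\<close>.\<close>

lemma annulus_log_bound:
  "\<exists>L\<ge>0. \<forall>x::real^'n::finite. x \<noteq> 0 \<longrightarrow>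
     (\<integral>\<^sup>+z. indicator annulus z * ennreal \<bar>ln (\<bar>x \<bullet> z\<bar> / norm x)\<bar> \<partial>lborel) \<le> ennreal L"
proof -
  obtain i :: 'n where True by simp
  define f where "f j t = (if j = i then ennreal \<bar>ln \<bar>t\<bar>\<bar> * indicator {-2..2} t else indicator {-2..2} t)" for j :: 'n and t
  have [measurable]: "f j \<in> borel_measurable borel" for j unfolding f_def by (cases "j = i") auto
  define I where "I = (\<integral>\<^sup>+z. (\<Prod>j\<in>UNIV. f j ((z::real^'n) $ j)) \<partial>lborel)"
  have "I = (\<Prod>j\<in>UNIV. \<integral>\<^sup>+t. f j t \<partial>lborel)" unfolding I_def by (rule nn_integral_vec_prod) simp
  also have "\<dots> < \<infinity>"
  proof -
    have "(\<integral>\<^sup>+t. f j t \<partial>lborel) < \<infinity>" for j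
      using nn_integral_abs_ln by (cases "j = i") (auto simp: f_def)
    then show ?thesis by (simp add: less_top[symmetric] ennreal_prod_eq_top)
  qed
  finally have "I < \<infinity>" .
  then obtain L where L: "L \<ge> 0" "I = ennreal L" by (cases I) auto
  have "(\<integral>\<^sup>+z. indicator annulus z * ennreal \<bar>ln (\<bar>x \<bullet> z\<bar> / norm x)\<bar> \<partial>lborel) \<le> ennreal L" if x: "x \<noteq> 0" for x :: "real^'n"
  proof -
    have "norm (axis i 1 :: real^'n) = norm (x /\<^sub>R norm x)" using x by simp
    then obtain T where T: "orthogonal_transformation T" "T (axis i 1 :: real^'n) = x /\<^sub>R norm x"
      by (rule orthogonal_transformation_exists)
    have [measurable]: "T \<in> borel_measurable borel"
      using T(1) by (intro borel_measurable_continuous_onI linear_continuous_on)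
        (simp add: orthogonal_transformation_linear linear_conv_bounded_linear[symmetric])
    have Tx: "\<bar>x \<bullet> T z\<bar> / norm x = \<bar>z $ i\<bar>" for z :: "real^'n"
    proof -
      have "T (axis i 1) \<bullet> T z = axis i 1 \<bullet> z" using T(1) by (simp add: orthogonal_transformation_def)
      then have "(x \<bullet> T z) / norm x = z $ i" by (simp add: T(2) inner_axis' divide_inverse mult.commute)
      then have "\<bar>(x \<bullet> T z) / norm x\<bar> = \<bar>z $ i\<bar>" by simp
      then show ?thesis by simp
    qed
    have Ta: "T z \<in> annulus \<longleftrightarrow> z \<in> annulus" for z
      using T(1) by (simp add: annulus_def orthogonal_transformation_norm)
    have "(\<integral>\<^sup>+z. indicator annulus z * ennreal \<bar>ln (\<bar>x \<bullet> z\<bar> / norm x)\<bar> \<partial>lborel) =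
      (\<integral>\<^sup>+z. indicator annulus (T z) * ennreal \<bar>ln (\<bar>x \<bullet> T z\<bar> / norm x)\<bar> \<partial>lborel)"
      by (subst lborel_distr_orthogonal[OF T(1), symmetric], subst nn_integral_distr) auto
    also have "\<dots> = (\<integral>\<^sup>+z. indicator annulus z * ennreal \<bar>ln \<bar>z $ i\<bar>\<bar> \<partial>lborel)"
      unfolding Tx by (simp add: Ta indicator_def)
    also have "\<dots> \<le> I"
      unfolding I_def
    proof (rule nn_integral_mono)
      fix z :: "real^'n"
      show "indicator annulus z * ennreal \<bar>ln \<bar>z $ i\<bar>\<bar> \<le> (\<Prod>j\<in>UNIV. f j (z $ j))"
      proof (cases "z \<in> annulus")
        case True
        then have "\<bar>z $ j\<bar> \<le> 2" for j using component_le_norm_cart[of z j] by (simp add: annulus_def)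
        then have "z $ j \<in> {-2..2}" for j by (simp add: abs_le_iff) (metis minus_le_iff)
        then have "(\<Prod>j\<in>UNIV. f j (z $ j)) = (\<Prod>j\<in>UNIV. if j = i then ennreal \<bar>ln \<bar>z $ i\<bar>\<bar> else 1)"
          by (intro prod.cong) (auto simp: f_def)
        then show ?thesis using True by (simp add: prod.delta)
      qed simp
    qed
    finally show ?thesis using L by simp
  qed
  then show ?thesis using L(1) by blast
qed

section \<open>Truncated oscillatory integrals\<close>

text \<open>The substitution u = t s turns the integral into a difference of two values of the sine
  integral \<open>Si\<close>, which is a bounded function.\<close>

lemma integral_sin_over_bound:
  "\<exists>B\<ge>0. \<forall>\<epsilon> R s :: real. 0 < \<epsilon> \<longrightarrow> \<epsilon> \<le> R \<longrightarrow> \<bar>LINT t|lborel. indicator {\<epsilon>..R} t * (sin (t * s) / t)\<bar> \<le> B"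
proof -
  obtain B where B: "\<And>T. \<bar>Si T\<bar> \<le> B" using bounded_Si by blast
  have "\<bar>LINT t|lborel. indicator {\<epsilon>..R} t * (sin (t * s) / t)\<bar> \<le> 2 * B" if e: "0 < \<epsilon>" "\<epsilon> \<le> R" for \<epsilon> R s :: real
  proof -
    have "(LINT t|lborel. indicator {\<epsilon>..R} t *\<^sub>R (sin (t * s) / t)) = Si (R * s) - Si (\<epsilon> * s)"
    proof (rule integral_FTC_Icc[OF e(2)])
      show "continuous_on {\<epsilon>..R} (\<lambda>t. sin (t * s) / t)" using e by (auto intro!: continuous_intros)
      fix t assume t: "\<epsilon> \<le> t" "t \<le> R"
      have "((\<lambda>t. Si (t * s)) has_real_derivative sinc (t * s) * s) (at t)"
        by (rule DERIV_chain2[OF DERIV_Si]) (auto intro!: derivative_eq_intros)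
      moreover have "sinc (t * s) * s = sin (t * s) / t" using t e by (cases "s = 0") auto
      ultimately show "((\<lambda>t. Si (t * s)) has_vector_derivative sin (t * s) / t) (at t within {\<epsilon>..R})"
        by (simp add: has_real_derivative_iff_has_vector_derivative has_vector_derivative_at_within)
    qed
    then show ?thesis using B[of "R * s"] B[of "\<epsilon> * s"] by simp
  qed
  moreover have "0 \<le> 2 * B" using B[of 0] by simp
  ultimately show ?thesis by (intro exI[of _ "2 * B"]) simp
qed

text \<open>With an antiderivative G of cos u / u, the two integrals are G (R |s|) - G (\<epsilon>
  |s|) and the same with s'. Their difference is regrouped into one pair at R and one at \<epsilon>;
  as |cos| \<le> 1, each pair costs at most |ln (|s| / |s'|)|, whatever the truncation.\<close>

lemma integral_cos_over_diff:
  fixes s s' \<epsilon> R :: real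
  assumes e: "0 < \<epsilon>" "\<epsilon> \<le> R" and s: "s \<noteq> 0" "s' \<noteq> 0"
  shows "\<bar>(LINT t|lborel. indicator {\<epsilon>..R} t * (cos (t * s) / t)) - (LINT t|lborel. indicator {\<epsilon>..R} t * (cos (t * s') / t))\<bar>
     \<le> 2 * \<bar>ln (\<bar>s\<bar> / \<bar>s'\<bar>)\<bar>"
proof -
  \<comment> \<open>The interval [m, M] contains t |s| and t |s'| for all t in [\<epsilon>, R] and
    avoids the pole of cos u / u at 0, so one antiderivative serves both integrals.\<close>
  define m where "m = \<epsilon> * min \<bar>s\<bar> \<bar>s'\<bar>"
  define M where "M = R * max \<bar>s\<bar> \<bar>s'\<bar>"
  have m: "m > 0" unfolding m_def using e s by (intro mult_pos_pos) auto
  have "continuous_on {m..M} (\<lambda>u::real. cos u / u)" using m by (auto intro!: continuous_intros)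
  then obtain G :: "real \<Rightarrow> real" where G: "\<And>u::real. u \<in> {m..M} \<Longrightarrow> (G has_vector_derivative cos u / u) (at u within {m..M})"
    using antiderivative_continuous by blast
  have FTC: "(LINT t|lborel. indicator {\<epsilon>..R} t * (cos (t * r) / t)) = G (R * \<bar>r\<bar>) - G (\<epsilon> * \<bar>r\<bar>)"
    and ineq: "\<epsilon> * \<bar>r\<bar> \<in> {m..M}" "R * \<bar>r\<bar> \<in> {m..M}" if "r = s \<or> r = s'" for r
  proof -
    have r: "\<bar>r\<bar> > 0" "min \<bar>s\<bar> \<bar>s'\<bar> \<le> \<bar>r\<bar>" "\<bar>r\<bar> \<le> max \<bar>s\<bar> \<bar>s'\<bar>" using that s by auto
    have img: "t * \<bar>r\<bar> \<in> {m..M}" if "t \<in> {\<epsilon>..R}" for t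
    proof -
      have "\<epsilon> * min \<bar>s\<bar> \<bar>s'\<bar> \<le> t * \<bar>r\<bar>" using that e r(2) by (intro mult_mono) simp_all
      moreover have "t * \<bar>r\<bar> \<le> R * max \<bar>s\<bar> \<bar>s'\<bar>" using that e r(3) by (intro mult_mono) simp_all
      ultimately show ?thesis by (simp add: m_def M_def)
    qed
    then show "\<epsilon> * \<bar>r\<bar> \<in> {m..M}" "R * \<bar>r\<bar> \<in> {m..M}" using e by auto
    have "(LINT t|lborel. indicator {\<epsilon>..R} t *\<^sub>R (cos (t * r) / t)) = G (R * \<bar>r\<bar>) - G (\<epsilon> * \<bar>r\<bar>)"
    proof (rule integral_FTC_Icc[OF e(2)])
      show "continuous_on {\<epsilon>..R} (\<lambda>t. cos (t * r) / t)" using e by (auto intro!: continuous_intros)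
      fix t assume t: "\<epsilon> \<le> t" "t \<le> R"
      have d: "((\<lambda>t. t * \<bar>r\<bar>) has_vector_derivative \<bar>r\<bar>) (at t within {\<epsilon>..R})"
        by (auto intro!: derivative_eq_intros simp: has_real_derivative_iff_has_vector_derivative[symmetric])
      have "(G has_vector_derivative cos (t * \<bar>r\<bar>) / (t * \<bar>r\<bar>)) (at (t * \<bar>r\<bar>) within (\<lambda>t. t * \<bar>r\<bar>) ` {\<epsilon>..R})"
        using img t by (intro has_vector_derivative_within_subset[OF G]) auto
      from vector_diff_chain_within[OF d this]
      have "((\<lambda>t. G (t * \<bar>r\<bar>)) has_vector_derivative \<bar>r\<bar> *\<^sub>R (cos (t * \<bar>r\<bar>) / (t * \<bar>r\<bar>))) (at t within {\<epsilon>..R})"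
        by (simp add: o_def)
      moreover have "\<bar>r\<bar> *\<^sub>R (cos (t * \<bar>r\<bar>) / (t * \<bar>r\<bar>)) = cos (t * r) / t"
        using r by (cases "r \<ge> 0") auto
      ultimately show "((\<lambda>t. G (t * \<bar>r\<bar>)) has_vector_derivative cos (t * r) / t) (at t within {\<epsilon>..R})" by simp
    qed
    then show "(LINT t|lborel. indicator {\<epsilon>..R} t * (cos (t * r) / t)) = G (R * \<bar>r\<bar>) - G (\<epsilon> * \<bar>r\<bar>)" by simp
  qed
  have mono: "\<bar>G b - G a\<bar> \<le> \<bar>ln (b / a)\<bar>" if ab: "a \<in> {m..M}" "b \<in> {m..M}" for a b
  proof -
    have *: "\<bar>G b - G a\<bar> \<le> ln b - ln a" if ab: "a \<in> {m..M}" "b \<in> {m..M}" "a \<le> b" for a b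
    proof -
      have G': "(G has_vector_derivative cos u / u) (at u within {a..b})" if "u \<in> {a..b}" for u
        using that ab by (intro has_vector_derivative_within_subset[OF G]) auto
      have c: "continuous_on {a..b} (\<lambda>u. cos u / u)" "continuous_on {a..b} (\<lambda>u. 1 / u)"
        using m ab by (auto intro!: continuous_intros)
      have 1: "(LINT u|lborel. indicator {a..b} u *\<^sub>R (cos u / u)) = G b - G a"
        using G' c ab by (intro integral_FTC_Icc) auto
      have 2: "(LINT u|lborel. indicator {a..b} u *\<^sub>R (1 / u)) = ln b - ln a"
        using c ab m by (intro integral_FTC_Icc)
          (auto intro!: derivative_eq_intros simp: has_real_derivative_iff_has_vector_derivative[symmetric])
      have "norm (LINT u|lborel. indicator {a..b} u *\<^sub>R (cos u / u)) \<le> (LINT u|lborel. indicator {a..b} u *\<^sub>R (1 / u))"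
      proof (rule order_trans[OF integral_norm_bound integral_mono])
        have i: "integrable lborel (\<lambda>u. indicator {a..b} u *\<^sub>R (cos u / u))" "integrable lborel (\<lambda>u. indicator {a..b} u *\<^sub>R (1 / u))"
          by (intro borel_integrable_compact c compact_Icc)+
        show "integrable lborel (\<lambda>u. norm (indicator {a..b} u *\<^sub>R (cos u / u)))" "integrable lborel (\<lambda>u. indicator {a..b} u *\<^sub>R (1 / u))"
          by (rule integrable_norm[OF i(1)], rule i(2))
        show "norm (indicator {a..b} u *\<^sub>R (cos u / u)) \<le> indicator {a..b} u *\<^sub>R (1 / u)" for u
          using ab m by (auto simp: indicator_def divide_simps abs_mult)
      qed
      then show ?thesis by (simp only: 1 2 real_norm_def)
    qed
    have pos: "a > 0" "b > 0" using ab m by auto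
    then have "ln (b / a) = ln b - ln a" by (simp add: ln_div)
    then show ?thesis using *[of a b] *[of b a] ab by (cases "a \<le> b") auto
  qed
  have "\<bar>(G (R * \<bar>s\<bar>) - G (\<epsilon> * \<bar>s\<bar>)) - (G (R * \<bar>s'\<bar>) - G (\<epsilon> * \<bar>s'\<bar>))\<bar> \<le> \<bar>G (R * \<bar>s\<bar>) - G (R * \<bar>s'\<bar>)\<bar> + \<bar>G (\<epsilon> * \<bar>s\<bar>) - G (\<epsilon> * \<bar>s'\<bar>)\<bar>"
    by linarith
  also have "\<dots> \<le> \<bar>ln (R * \<bar>s\<bar> / (R * \<bar>s'\<bar>))\<bar> + \<bar>ln (\<epsilon> * \<bar>s\<bar> / (\<epsilon> * \<bar>s'\<bar>))\<bar>"
    by (intro add_mono mono ineq) auto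
  also have "\<dots> = 2 * \<bar>ln (\<bar>s\<bar> / \<bar>s'\<bar>)\<bar>" using e by simp
  finally show ?thesis unfolding FTC[OF disjI1[OF refl]] FTC[OF disjI2[OF refl]] .
qed

section \<open>Hausdorff measure\<close>

text \<open>The size restriction is moved into the set function by letting oversized sets cost
  infinity. In this form \<open>hausdorff_pre\<close> is an instance of the general outer measure
  construction.\<close>

definition small_content :: "nat \<Rightarrow> real \<Rightarrow> 'a::metric_space set \<Rightarrow> ennreal" where
  "small_content m \<delta> C = (if bounded C \<and> diameter C \<le> \<delta> then hausdorff_content m C else \<infinity>)"

lemma hausdorff_content_mono:
  assumes "C \<subseteq> D" "bounded D" shows "hausdorff_content m C \<le> hausdorff_content m D"
proof (cases "C = {}")
  case False
  then have "D \<noteq> {}" using assms by auto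
  have "diameter C \<le> diameter D" "0 \<le> diameter C"
    using assms bounded_subset diameter_subset diameter_ge_0 by blast+
  then show ?thesis using False \<open>D \<noteq> {}\<close>
    by (auto simp: hausdorff_content_def intro!: ennreal_leI mult_left_mono power_mono)
qed (simp add: hausdorff_content_def)

lemma small_content_increasing: "increasing (Pow UNIV) (small_content m \<delta>)"
  unfolding increasing_def
proof (intro ballI impI)
  fix C D :: "'a set" assume "C \<subseteq> D"
  show "small_content m \<delta> C \<le> small_content m \<delta> D"
  proof (cases "bounded D \<and> diameter D \<le> \<delta>")
    case True
    then have "bounded C" using \<open>C \<subseteq> D\<close> bounded_subset by blast
    moreover have "diameter C \<le> \<delta>" using diameter_subset[OF \<open>C \<subseteq> D\<close>] True by linarith
    ultimately show ?thesis using True hausdorff_content_mono[OF \<open>C \<subseteq> D\<close>] by (simp add: small_content_def)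
  next
    case False
    then have "small_content m \<delta> D = \<infinity>" unfolding small_content_def by (rule if_not_P)
    then show ?thesis by simp
  qed
qed

lemma small_content_positive: "\<delta> \<ge> 0 \<Longrightarrow> positive (Pow UNIV) (small_content m \<delta>)"
  by (simp add: positive_def small_content_def hausdorff_content_def)

lemma ring_of_sets_Pow: "ring_of_sets S (Pow S)"
  by (simp add: ring_of_sets_iff) blast

text \<open>The general construction takes the infimum over disjoint covers,
  \<open>hausdorff_pre\<close> over arbitrary ones. In one direction a cover with an oversized set
  costs infinity and any other is admissible; in the other, \<open>outer_measure_le\<close> makes a
  cover disjoint with the help of monotonicity.\<close>

lemma hausdorff_pre_eq_outer_measure:
  fixes A :: "'a::metric_space set"
  assumes "\<delta> \<ge> 0"
  shows "hausdorff_pre m \<delta> A = outer_measure (Pow UNIV) (small_content m \<delta>) A"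
proof (rule antisym)
  show "hausdorff_pre m \<delta> A \<le> outer_measure (Pow UNIV) (small_content m \<delta>) A"
    unfolding outer_measure_def
  proof (rule INF_greatest)
    fix C :: "nat \<Rightarrow> 'a set" assume "C \<in> {C. range C \<subseteq> Pow UNIV \<and> disjoint_family C \<and> A \<subseteq> \<Union> (range C)}"
    then have A: "A \<subseteq> \<Union> (range C)" by auto
    show "hausdorff_pre m \<delta> A \<le> (\<Sum>i. small_content m \<delta> (C i))"
    proof (cases "\<forall>i. bounded (C i) \<and> diameter (C i) \<le> \<delta>")
      case True
      then have "(\<Sum>i. small_content m \<delta> (C i)) = (\<Sum>i. hausdorff_content m (C i))"
        by (simp add: small_content_def)
      then show ?thesis unfolding hausdorff_pre_def using A True by (auto intro!: INF_lower2[of C])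
    next
      case False
      then obtain i where "\<not> (bounded (C i) \<and> diameter (C i) \<le> \<delta>)" by blast
      then have "small_content m \<delta> (C i) = top" by (auto simp: small_content_def)
      then have "\<not> (\<Sum>i. small_content m \<delta> (C i)) < top"
        using ennreal_suminf_lessD[of "\<lambda>i. small_content m \<delta> (C i)" top i] by auto
      then have "(\<Sum>i. small_content m \<delta> (C i)) = \<infinity>" by (simp add: less_top[symmetric])
      then show ?thesis by simp
    qed
  qed
  show "outer_measure (Pow UNIV) (small_content m \<delta>) A \<le> hausdorff_pre m \<delta> A"
    unfolding hausdorff_pre_def
  proof (rule INF_greatest)
    fix C :: "nat \<Rightarrow> 'a set" assume C: "C \<in> {C. A \<subseteq> (\<Union>i. C i) \<and> (\<forall>i. bounded (C i) \<and> diameter (C i) \<le> \<delta>)}"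
    interpret ring_of_sets UNIV "Pow UNIV :: 'a set set" by (rule ring_of_sets_Pow)
    have "outer_measure (Pow UNIV) (small_content m \<delta>) A \<le> (\<Sum>i. small_content m \<delta> (C i))"
      by (rule outer_measure_le[OF small_content_positive[OF assms] small_content_increasing]) (use C in auto)
    also have "\<dots> = (\<Sum>i. hausdorff_content m (C i))" using C by (simp add: small_content_def)
    finally show "outer_measure (Pow UNIV) (small_content m \<delta>) A \<le> (\<Sum>i. hausdorff_content m (C i))" .
  qed
qed

lemma hausdorff_pre_space:
  "\<delta> \<ge> 0 \<Longrightarrow> outer_measure_space (Pow UNIV) (hausdorff_pre m \<delta> :: 'a::metric_space set \<Rightarrow> ennreal)"
proof -
  assume d: "\<delta> \<ge> 0"
  interpret ring_of_sets UNIV "Pow UNIV :: 'a set set" by (rule ring_of_sets_Pow)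
  have "outer_measure_space (Pow UNIV) (outer_measure (Pow UNIV) (small_content m \<delta>) :: 'a set \<Rightarrow> ennreal)"
    by (rule outer_measure_space_outer_measure[OF small_content_positive[OF d] small_content_increasing])
  moreover have "hausdorff_pre m \<delta> = (outer_measure (Pow UNIV) (small_content m \<delta>) :: 'a set \<Rightarrow> ennreal)"
    using hausdorff_pre_eq_outer_measure[OF d] by blast
  ultimately show ?thesis by simp
qed

lemma hausdorff_pre_le_outer: "\<delta> > 0 \<Longrightarrow> hausdorff_pre m \<delta> A \<le> hausdorff_outer m A"
  unfolding hausdorff_outer_def by (rule SUP_upper) simp

lemma hausdorff_pre_mono: "\<delta> \<ge> 0 \<Longrightarrow> A \<subseteq> B \<Longrightarrow> hausdorff_pre m \<delta> A \<le> hausdorff_pre m \<delta> B"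
  using hausdorff_pre_space[of \<delta> m] by (auto simp: outer_measure_space_def increasing_def)

lemma hausdorff_outer_mono: "A \<subseteq> B \<Longrightarrow> hausdorff_outer m A \<le> hausdorff_outer m B"
  unfolding hausdorff_outer_def
proof (rule SUP_mono)
  fix \<delta> :: real assume "A \<subseteq> B" "\<delta> \<in> {0<..}"
  then show "\<exists>\<epsilon>\<in>{0<..}. hausdorff_pre m \<delta> A \<le> hausdorff_pre m \<epsilon> B"
    by (intro bexI[of _ \<delta>] hausdorff_pre_mono) auto
qed

lemma hausdorff_outer_empty: "hausdorff_outer m {} = 0"
proof -
  have "hausdorff_pre m \<delta> {} = 0" if "\<delta> > 0" for \<delta>
    using hausdorff_pre_space[of \<delta> m] that by (auto simp: outer_measure_space_def positive_def)
  then have "hausdorff_outer m {} \<le> (0 :: ennreal)" unfolding hausdorff_outer_def by (intro SUP_least) simp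
  then show ?thesis by simp
qed

lemma hausdorff_outer_UN_le:
  fixes A :: "nat \<Rightarrow> 'a::metric_space set"
  shows "hausdorff_outer m (\<Union>i. A i) \<le> (\<Sum>i. hausdorff_outer m (A i))"
  unfolding hausdorff_outer_def[of m "\<Union>i. A i"]
proof (rule SUP_least)
  fix \<delta> :: real assume "\<delta> \<in> {0<..}"
  then have d: "\<delta> > 0" by simp
  \<comment> \<open>\<open>countably_subadditive\<close> speaks of disjoint families, so the sets
    are first made disjoint; monotonicity returns to the family \<open>A\<close>.\<close>
  have "hausdorff_pre m \<delta> (\<Union>i. disjointed A i) \<le> (\<Sum>i. hausdorff_pre m \<delta> (disjointed A i))"
  proof -
    have "countably_subadditive (Pow UNIV) (hausdorff_pre m \<delta> :: 'a set \<Rightarrow> ennreal)"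
      using hausdorff_pre_space[of \<delta> m, where 'a = 'a] d by (simp add: outer_measure_space_def)
    then show ?thesis
      unfolding countably_subadditive_def using disjoint_family_disjointed[of A] by blast
  qed
  also have "\<dots> \<le> (\<Sum>i. hausdorff_pre m \<delta> (A i))"
    using d by (intro suminf_le hausdorff_pre_mono disjointed_subset) auto
  finally have "hausdorff_pre m \<delta> (\<Union>i. A i) \<le> (\<Sum>i. hausdorff_pre m \<delta> (A i))"
    by (simp add: UN_disjointed_eq)
  also have "\<dots> \<le> (\<Sum>i. hausdorff_outer m (A i))"
    by (intro suminf_le hausdorff_pre_le_outer d) auto
  finally show "hausdorff_pre m \<delta> (\<Union>i. A i) \<le> (\<Sum>i. hausdorff_outer m (A i))" .
qed

lemma hausdorff_outer_space: "outer_measure_space (Pow UNIV) (hausdorff_outer m)"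
  unfolding outer_measure_space_def positive_def increasing_def countably_subadditive_def
  by (auto simp: hausdorff_outer_empty hausdorff_outer_mono hausdorff_outer_UN_le)

lemma hausdorff_outer_Un_le: "hausdorff_outer m (A \<union> B) \<le> hausdorff_outer m A + hausdorff_outer m B"
proof -
  have "hausdorff_outer m (\<Union>i. if i = 0 then A else if i = Suc 0 then B else {}) \<le>
    (\<Sum>i. hausdorff_outer m (if i = 0 then A else if i = Suc 0 then B else {}))"
    by (rule hausdorff_outer_UN_le)
  also have "\<dots> = (\<Sum>i\<in>{0, Suc 0}. hausdorff_outer m (if i = 0 then A else if i = Suc 0 then B else {}))"
    by (rule suminf_finite) (auto simp: hausdorff_outer_empty)
  also have "\<dots> = hausdorff_outer m A + hausdorff_outer m B" by simp
  also have "(\<Union>i. if i = 0 then A else if i = Suc 0 then B else {}) = A \<union> B"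
    by (auto split: if_splits)
  finally show ?thesis .
qed

section \<open>Additivity on separated sets and measurability of Borel sets\<close>

lemma hausdorff_pre_antimono: "\<delta> \<le> \<epsilon> \<Longrightarrow> hausdorff_pre m \<epsilon> A \<le> hausdorff_pre m \<delta> A"
  unfolding hausdorff_pre_def by (rule INF_superset_mono) (auto intro: order_trans)

text \<open>A set of diameter less than \<open>d\<close> cannot meet both \<open>A\<close> and
  \<open>B\<close>, so a cover of the union splits into covers of \<open>A\<close> and of
  \<open>B\<close>. Discarded sets are replaced by {}, whose content is 0 also for m = 0.\<close>

lemma hausdorff_pre_separated:
  assumes d: "0 < \<delta>" "\<delta> < d" and sep: "\<And>x y. x \<in> A \<Longrightarrow> y \<in> B \<Longrightarrow> dist x y \<ge> d"
  shows "hausdorff_pre m \<delta> A + hausdorff_pre m \<delta> B \<le> hausdorff_pre m \<delta> (A \<union> B)"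
  unfolding hausdorff_pre_def[of m \<delta> "A \<union> B"]
proof (rule INF_greatest)
  fix C :: "nat \<Rightarrow> 'a set" assume "C \<in> {C. A \<union> B \<subseteq> (\<Union>i. C i) \<and> (\<forall>i. bounded (C i) \<and> diameter (C i) \<le> \<delta>)}"
  then have C: "A \<union> B \<subseteq> (\<Union>i. C i)" "\<And>i. bounded (C i)" "\<And>i. diameter (C i) \<le> \<delta>" by auto
  let ?p = "\<lambda>i. C i \<inter> A \<noteq> {}"
  let ?CA = "\<lambda>i. if ?p i then C i else {}" and ?CB = "\<lambda>i. if ?p i then {} else C i"
  have "x \<in> (\<Union>i. ?CB i)" if x: "x \<in> B" for x
  proof -
    obtain i where i: "x \<in> C i" using C(1) x by blast
    have "\<not> ?p i"
    proof
      assume "?p i"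
      then obtain y where y: "y \<in> C i" "y \<in> A" by auto
      have "dist y x \<le> diameter (C i)" by (rule diameter_bounded_bound[OF C(2) y(1) i])
      then show False using sep[OF y(2) x] C(3)[of i] d by linarith
    qed
    then show ?thesis using i by (auto intro!: UN_I[of i])
  qed
  then have "hausdorff_pre m \<delta> B \<le> (\<Sum>i. hausdorff_content m (?CB i))"
    unfolding hausdorff_pre_def using C d by (intro INF_lower) auto
  moreover have "x \<in> (\<Union>i. ?CA i)" if x: "x \<in> A" for x
  proof -
    obtain i where i: "x \<in> C i" using C(1) x by blast
    then show ?thesis using x by (auto intro!: UN_I[of i])
  qed
  then have "hausdorff_pre m \<delta> A \<le> (\<Sum>i. hausdorff_content m (?CA i))"
    unfolding hausdorff_pre_def using C d by (intro INF_lower) auto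
  ultimately have "hausdorff_pre m \<delta> A + hausdorff_pre m \<delta> B \<le>
    (\<Sum>i. hausdorff_content m (?CA i)) + (\<Sum>i. hausdorff_content m (?CB i))" by (rule add_mono[rotated])
  also have "\<dots> = (\<Sum>i. hausdorff_content m (?CA i) + hausdorff_content m (?CB i))"
    by (rule suminf_add) auto
  also have "\<dots> = (\<Sum>i. hausdorff_content m (C i))"
    by (intro suminf_cong) (auto simp: hausdorff_content_def)
  finally show "hausdorff_pre m \<delta> A + hausdorff_pre m \<delta> B \<le> (\<Sum>i. hausdorff_content m (C i))" .
qed

text \<open>Caratheodory's metric criterion. The two pre-measures are brought to a common scale
  below the separation \<open>d\<close>, which can only increase them.\<close>

lemma hausdorff_outer_separated:
  assumes d: "0 < d" and sep: "\<And>x y. x \<in> A \<Longrightarrow> y \<in> B \<Longrightarrow> dist x y \<ge> d"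
  shows "hausdorff_outer m (A \<union> B) = hausdorff_outer m A + hausdorff_outer m B"
proof (rule antisym)
  have "hausdorff_pre m \<delta>1 A + hausdorff_pre m \<delta>2 B \<le> hausdorff_outer m (A \<union> B)"
    if "\<delta>1 > 0" "\<delta>2 > 0" for \<delta>1 \<delta>2
  proof -
    define \<delta> where "\<delta> = min (d / 2) (min \<delta>1 \<delta>2)"
    have \<delta>: "0 < \<delta>" "\<delta> < d" "\<delta> \<le> \<delta>1" "\<delta> \<le> \<delta>2" using d that by (auto simp: \<delta>_def)
    have "hausdorff_pre m \<delta>1 A + hausdorff_pre m \<delta>2 B \<le> hausdorff_pre m \<delta> A + hausdorff_pre m \<delta> B"
      by (intro add_mono hausdorff_pre_antimono \<delta>)
    also have "\<dots> \<le> hausdorff_pre m \<delta> (A \<union> B)" by (rule hausdorff_pre_separated[OF \<delta>(1,2) sep])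
    also have "\<dots> \<le> hausdorff_outer m (A \<union> B)" by (rule hausdorff_pre_le_outer[OF \<delta>(1)])
    finally show ?thesis .
  qed
  then have "(SUP \<delta>1\<in>{0<..}. hausdorff_pre m \<delta>1 A) + hausdorff_pre m \<delta>2 B \<le> hausdorff_outer m (A \<union> B)"
    if "\<delta>2 > 0" for \<delta>2
    using that by (subst ennreal_SUP_add_left[symmetric]) (auto intro!: SUP_least)
  then have "(SUP \<delta>2\<in>{0<..}. (SUP \<delta>1\<in>{0<..}. hausdorff_pre m \<delta>1 A) + hausdorff_pre m \<delta>2 B) \<le> hausdorff_outer m (A \<union> B)"
    by (intro SUP_least) simp
  then show "hausdorff_outer m A + hausdorff_outer m B \<le> hausdorff_outer m (A \<union> B)"
    unfolding hausdorff_outer_def[of m A] hausdorff_outer_def[of m B]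
    by (subst ennreal_SUP_add_right) auto
qed (rule hausdorff_outer_Un_le)

text \<open>The sets \<open>R j\<close> decompose the part of \<open>T\<close> near the closed set \<open>F\<close> into shells; shells whose
  indices differ by two are separated, so their measures are summable.\<close>

lemma hausdorff_outer_closed_split:
  fixes F T :: "'a::metric_space set"
  assumes F: "closed F"
  shows "hausdorff_outer m (F \<inter> T) + hausdorff_outer m (T - F) \<le> hausdorff_outer m T"
proof (cases "hausdorff_outer m T = \<infinity> \<or> F = {}")
  case True
  then show ?thesis by (auto simp: hausdorff_outer_empty)
next
  case False
  let ?H = "hausdorff_outer m"
  have fin: "?H T < \<infinity>" using False by (simp add: less_top)
  have "F \<noteq> {}" using False by simp
  define T' where "T' j = {x \<in> T - F. infdist x F \<ge> 1 / real (Suc j)}" for j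
  define R where "R j = T' (Suc j) - T' j" for j
  have T'_mono: "T' i \<subseteq> T' j" if "i \<le> j" for i j
    unfolding T'_def using that frac_le[of 1 1 "real (Suc i)" "real (Suc j)"] by fastforce
  have R_T: "R j \<subseteq> T" for j by (auto simp: R_def T'_def)
  have T'_sub: "T' j \<subseteq> T" for j by (auto simp: T'_def)
  have cover: "T - F = T' N \<union> (\<Union>j. R (j + N))" for N
  proof
    show "T - F \<subseteq> T' N \<union> (\<Union>j. R (j + N))"
    proof
      fix x assume x: "x \<in> T - F"
      then have "infdist x F > 0"
        using in_closed_iff_infdist_zero[OF F \<open>F \<noteq> {}\<close>] infdist_nonneg[of x F] by (auto simp: less_le)
      then obtain j0 where "1 / real (Suc j0) < infdist x F"
        using nat_approx_posE by blast
      then have ex: "\<exists>j. x \<in> T' j" using x by (auto simp: T'_def intro!: exI[of _ j0])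
      define j where "j = (LEAST j. x \<in> T' j)"
      have j: "x \<in> T' j" "\<And>i. x \<in> T' i \<Longrightarrow> j \<le> i" unfolding j_def using ex by (auto intro: LeastI_ex Least_le)
      show "x \<in> T' N \<union> (\<Union>j. R (j + N))"
      proof (cases "j \<le> N")
        case True
        then show ?thesis using j T'_mono by blast
      next
        case False
        then have "x \<in> R (j - 1)" using j(1) j(2)[of "j - 1"] by (auto simp: R_def)
        moreover have "j - 1 = (j - 1 - N) + N" using False by simp
        ultimately show ?thesis by (metis UnI2 UN_I UNIV_I)
      qed
    qed
  qed (auto simp: T'_def R_def)
  have sep: "dist x y \<ge> 1 / real (Suc (Suc i)) - 1 / real (Suc (Suc (Suc i)))"
    if "x \<in> T' (Suc i)" "y \<in> R j" "i + 2 \<le> j" for x y i j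
  proof -
    have x: "infdist x F \<ge> 1 / real (Suc (Suc i))" using that by (simp add: T'_def)
    have "y \<notin> T' (Suc (Suc i))" using that T'_mono[of "Suc (Suc i)" j] by (auto simp: R_def)
    then have y: "infdist y F < 1 / real (Suc (Suc (Suc i)))" using that by (auto simp: T'_def R_def)
    have "infdist x F \<le> infdist y F + dist x y" by (rule infdist_triangle)
    then show ?thesis using x y by linarith
  qed
  have pos: "0 < 1 / real (Suc (Suc i)) - 1 / real (Suc (Suc (Suc i)))" for i
    using frac_less2[of 1 1 "real (Suc (Suc i))" "real (Suc (Suc (Suc i)))"] by simp
  \<comment> \<open>The offset \<open>e\<close> selects the parity. The shells before the last one
    all lie in \<open>T' (Suc (2 * k + e))\<close> and are thus separated from the last by the gap
    in \<open>pos\<close>, so the measures add.\<close>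
  have partial: "(\<Sum>i<n. ?H (R (2 * i + e))) \<le> ?H (\<Union>i<n. R (2 * i + e))" for n e
  proof (induction n)
    case (Suc n)
    show ?case
    proof (cases n)
      case (Suc k)
      have "?H ((\<Union>i<n. R (2 * i + e)) \<union> R (2 * n + e)) = ?H (\<Union>i<n. R (2 * i + e)) + ?H (R (2 * n + e))"
      proof (rule hausdorff_outer_separated[OF pos[of "2 * k + e"]])
        fix x y assume x: "x \<in> (\<Union>i<n. R (2 * i + e))" and y: "y \<in> R (2 * n + e)"
        then obtain i where i: "i < n" "x \<in> R (2 * i + e)" by auto
        have "Suc (2 * i + e) \<le> Suc (2 * k + e)" using i Suc by simp
        then have "x \<in> T' (Suc (2 * k + e))" using i T'_mono[of "Suc (2 * i + e)" "Suc (2 * k + e)"] by (auto simp: R_def)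
        then show "dist x y \<ge> 1 / real (Suc (Suc (2 * k + e))) - 1 / real (Suc (Suc (Suc (2 * k + e))))"
          by (rule sep[OF _ y]) (use Suc in simp)
      qed
      moreover have "(\<Union>i<Suc n. R (2 * i + e)) = (\<Union>i<n. R (2 * i + e)) \<union> R (2 * n + e)"
        by (auto simp: lessThan_Suc)
      ultimately show ?thesis using Suc.IH by (simp add: add_right_mono)
    qed (simp add: lessThan_Suc)
  qed simp
  have summ: "(\<Sum>i. ?H (R (2 * i + e))) < \<infinity>" for e
  proof -
    have "(\<Sum>i. ?H (R (2 * i + e))) \<le> ?H T"
    proof (rule suminf_le_const)
      show "(\<Sum>i<n. ?H (R (2 * i + e))) \<le> ?H T" for n
        by (rule order_trans[OF partial hausdorff_outer_mono]) (use R_T in auto)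
    qed simp
    then show ?thesis using fin by (rule le_less_trans)
  qed
  have tail: "(\<lambda>N. \<Sum>i. f (i + N)) \<longlonglongrightarrow> 0" if "(\<Sum>i. f i) < \<infinity>" for f :: "nat \<Rightarrow> ennreal"
  proof -
    have fi: "f i < top" for i using ennreal_suminf_lessD[of f top i] that by simp
    define g where "g i = enn2real (f i)" for i
    have fg: "f i = ennreal (g i)" for i using fi[of i] by (simp add: g_def)
    have g0: "0 \<le> g i" for i by (simp add: g_def)
    have sg: "summable g" using that g0 by (intro summable_suminf_not_top) (auto simp: fg)
    have "(\<Sum>i. f (i + N)) = ennreal (\<Sum>i. g (i + N))" for N
      unfolding fg by (rule suminf_ennreal2) (use g0 sg in auto)
    moreover have "(\<lambda>N. \<Sum>i. g (i + N)) \<longlonglongrightarrow> 0" using suminf_exist_split2[OF sg] .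
    ultimately show ?thesis using tendsto_ennrealI[of "\<lambda>N. \<Sum>i. g (i + N)" 0 sequentially] by simp
  qed
  have bound: "?H (F \<inter> T) + ?H (T - F) \<le> ?H T + ((\<Sum>i. ?H (R (2 * (i + N)))) + (\<Sum>i. ?H (R (2 * (i + N) + 1))))" for N
  proof -
    have "?H (F \<inter> T) + ?H (T' (2 * N)) = ?H ((F \<inter> T) \<union> T' (2 * N))"
    proof (rule hausdorff_outer_separated[symmetric, of "1 / real (Suc (2 * N))"])
      fix x y assume "x \<in> F \<inter> T" "y \<in> T' (2 * N)"
      then have "1 / real (Suc (2 * N)) \<le> infdist y F" "infdist y F \<le> dist y x"
        by (auto simp: T'_def intro: infdist_le)
      then show "1 / real (Suc (2 * N)) \<le> dist x y" by (simp add: dist_commute)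
    qed simp
    also have "\<dots> \<le> ?H T" by (rule hausdorff_outer_mono) (use T'_sub in auto)
    finally have 1: "?H (F \<inter> T) + ?H (T' (2 * N)) \<le> ?H T" .
    \<comment> \<open>Starting at an even index and splitting by parity matches the two series whose
      finiteness is given by \<open>summ\<close>.\<close>
    have "(\<Union>j. R (j + 2 * N)) = (\<Union>i. R (2 * (i + N))) \<union> (\<Union>i. R (2 * (i + N) + 1))"
    proof (intro equalityI subsetI)
      fix x assume "x \<in> (\<Union>j. R (j + 2 * N))"
      then obtain j where j: "x \<in> R (j + 2 * N)" by auto
      show "x \<in> (\<Union>i. R (2 * (i + N))) \<union> (\<Union>i. R (2 * (i + N) + 1))"
      proof (cases "even j")
        case True
        then obtain i where "j = 2 * i" by (elim evenE)
        then have "j + 2 * N = 2 * (i + N)" by simp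
        then show ?thesis using j by auto
      next
        case False
        then obtain i where "j = 2 * i + 1" by (elim oddE)
        then have "j + 2 * N = 2 * (i + N) + 1" by simp
        then show ?thesis using j by auto
      qed
    next
      fix x assume "x \<in> (\<Union>i. R (2 * (i + N))) \<union> (\<Union>i. R (2 * (i + N) + 1))"
      then obtain i where "x \<in> R (2 * i + 2 * N) \<or> x \<in> R ((2 * i + 1) + 2 * N)" by (auto simp: algebra_simps)
      then show "x \<in> (\<Union>j. R (j + 2 * N))" by blast
    qed
    then have "T - F = T' (2 * N) \<union> ((\<Union>i. R (2 * (i + N))) \<union> (\<Union>i. R (2 * (i + N) + 1)))" using cover[of "2 * N"] by simp
    then have "?H (T - F) \<le> ?H (T' (2 * N)) + ?H ((\<Union>i. R (2 * (i + N))) \<union> (\<Union>i. R (2 * (i + N) + 1)))"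
      using hausdorff_outer_Un_le[of m "T' (2 * N)"] by simp
    also have "?H ((\<Union>i. R (2 * (i + N))) \<union> (\<Union>i. R (2 * (i + N) + 1))) \<le> ?H (\<Union>i. R (2 * (i + N))) + ?H (\<Union>i. R (2 * (i + N) + 1))"
      by (rule hausdorff_outer_Un_le)
    also have "\<dots> \<le> (\<Sum>i. ?H (R (2 * (i + N)))) + (\<Sum>i. ?H (R (2 * (i + N) + 1)))"
      by (intro add_mono hausdorff_outer_UN_le)
    finally have 2: "?H (T - F) \<le> ?H (T' (2 * N)) + ((\<Sum>i. ?H (R (2 * (i + N)))) + (\<Sum>i. ?H (R (2 * (i + N) + 1))))"
      by (simp add: add_left_mono)
    have "?H (F \<inter> T) + ?H (T - F) \<le> ?H (F \<inter> T) + (?H (T' (2 * N)) + ((\<Sum>i. ?H (R (2 * (i + N)))) + (\<Sum>i. ?H (R (2 * (i + N) + 1)))))"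
      by (intro add_left_mono 2)
    also have "\<dots> = (?H (F \<inter> T) + ?H (T' (2 * N))) + ((\<Sum>i. ?H (R (2 * (i + N)))) + (\<Sum>i. ?H (R (2 * (i + N) + 1))))"
      by (simp add: add.assoc)
    also have "\<dots> \<le> ?H T + ((\<Sum>i. ?H (R (2 * (i + N)))) + (\<Sum>i. ?H (R (2 * (i + N) + 1))))"
      by (intro add_right_mono 1)
    finally show ?thesis .
  qed
  have "(\<lambda>N. ?H T + ((\<Sum>i. ?H (R (2 * (i + N)))) + (\<Sum>i. ?H (R (2 * (i + N) + 1))))) \<longlonglongrightarrow> ?H T + (0 + 0)"
    using tail[OF summ[of 0]] tail[OF summ[of 1]] by (intro tendsto_add tendsto_const) simp_all
  then show ?thesis
    by (intro tendsto_lowerbound[of _ "?H T" sequentially]) (use bound in \<open>auto intro!: always_eventually\<close>)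
qed

text \<open>Closed sets are Caratheodory measurable by the splitting inequality, and they generate
  the Borel sets. This matters because \<open>measure_of\<close> returns the zero measure unless the
  given set function is a measure; the cancellation condition would then be empty.\<close>

lemma measure_space_hausdorff: "measure_space UNIV (sets borel) (hausdorff_outer m :: 'a::metric_space set \<Rightarrow> ennreal)"
proof -
  interpret sigma_algebra UNIV "Pow UNIV :: 'a set set" by (rule sigma_algebra_Pow)
  let ?L = "lambda_system UNIV (Pow UNIV) (hausdorff_outer m :: 'a set \<Rightarrow> ennreal)"
  have ms: "measure_space UNIV ?L (hausdorff_outer m)"
    by (rule caratheodory_lemma[OF hausdorff_outer_space])
  then have sa: "sigma_algebra UNIV ?L" by (simp add: measure_space_def)
  have "F \<in> ?L" if "closed F" for F
    unfolding lambda_system_def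
  proof (intro CollectI conjI ballI)
    fix T :: "'a set"
    have "hausdorff_outer m T \<le> hausdorff_outer m (F \<inter> T) + hausdorff_outer m (T - F)"
    proof -
      have "T = (F \<inter> T) \<union> (T - F)" by auto
      then show ?thesis using hausdorff_outer_Un_le[of m "F \<inter> T" "T - F"] by simp
    qed
    moreover have "(UNIV - F) \<inter> T = T - F" by auto
    ultimately show "hausdorff_outer m (F \<inter> T) + hausdorff_outer m ((UNIV - F) \<inter> T) = hausdorff_outer m T"
      using hausdorff_outer_closed_split[OF that, of m T] by (auto intro: antisym)
  qed simp
  then have "sigma_sets UNIV (Collect closed) \<subseteq> ?L"
    by (intro sigma_algebra.sigma_sets_subset[OF sa]) auto
  moreover have "sets (borel :: 'a measure) = sigma_sets UNIV (Collect closed)"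
    by (simp add: borel_eq_closed)
  moreover have "sigma_algebra UNIV (sets (borel :: 'a measure))"
    using sets.sigma_algebra_axioms[of "borel :: 'a measure"] by simp
  ultimately show ?thesis by (intro measure_down[OF ms]) auto
qed

lemma emeasure_hausdorff_measure:
  assumes "A \<in> sets borel"
  shows "emeasure (hausdorff_measure m) A = hausdorff_outer m A"
  unfolding hausdorff_measure_def
  using measure_space_hausdorff[of m] assms
  by (subst emeasure_measure_of_sigma) (auto simp: measure_space_def sets.sigma_sets_eq[of borel, simplified])

lemma sets_hausdorff_measure [simp, measurable_cong]: "sets (hausdorff_measure m) = sets borel"
  and space_hausdorff_measure [simp]: "space (hausdorff_measure m) = UNIV"
  by (simp_all add: hausdorff_measure_def sets.sigma_sets_eq[of borel, simplified])

section \<open>Surface measure on the sphere\<close>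

lemma orthogonal_transformation_dist:
  fixes T :: "'a::euclidean_space \<Rightarrow> 'a"
  assumes "orthogonal_transformation T" shows "dist (T x) (T y) = dist x y"
  using assms by (metis dist_norm linear_diff orthogonal_transformation)

lemma hausdorff_outer_orthogonal_image_le:
  fixes T :: "'a::euclidean_space \<Rightarrow> 'a"
  assumes T: "orthogonal_transformation T"
  shows "hausdorff_outer m (T ` A) \<le> hausdorff_outer m A"
  unfolding hausdorff_outer_def
proof (rule SUP_mono)
  fix \<delta> :: real assume \<delta>: "\<delta> \<in> {0<..}"
  have iso: "dist (T x) (T y) = dist x y" for x y by (rule orthogonal_transformation_dist[OF T])
  have img: "bounded (T ` C)" "diameter (T ` C) \<le> diameter C" if "bounded C" for C
  proof -
    have "linear T" using T by (rule orthogonal_transformation_linear)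
    then show "bounded (T ` C)" using that by (simp add: bounded_linear_image linear_conv_bounded_linear)
    show "diameter (T ` C) \<le> diameter C"
    proof (rule diameter_le)
      show "T ` C \<noteq> {} \<or> 0 \<le> diameter C" using diameter_ge_0[OF that] by simp
      fix x y assume "x \<in> T ` C" "y \<in> T ` C"
      then obtain x' y' where "x' \<in> C" "y' \<in> C" "x = T x'" "y = T y'" by auto
      then show "norm (x - y) \<le> diameter C"
        using diameter_bounded_bound[OF that, of x' y'] iso[of x' y'] by (simp add: dist_norm)
    qed
  qed
  have "hausdorff_pre m \<delta> (T ` A) \<le> hausdorff_pre m \<delta> A"
    unfolding hausdorff_pre_def[of m \<delta> A]
  proof (rule INF_greatest)
    fix C :: "nat \<Rightarrow> 'a set" assume C: "C \<in> {C. A \<subseteq> (\<Union>i. C i) \<and> (\<forall>i. bounded (C i) \<and> diameter (C i) \<le> \<delta>)}"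
    have "T ` A \<subseteq> (\<Union>i. T ` C i)" using C by blast
    moreover have "bounded (T ` C i) \<and> diameter (T ` C i) \<le> \<delta>" for i
      using img[of "C i"] C order_trans by blast
    ultimately have "hausdorff_pre m \<delta> (T ` A) \<le> (\<Sum>i. hausdorff_content m (T ` C i))"
      unfolding hausdorff_pre_def by (intro INF_lower) auto
    also have "\<dots> \<le> (\<Sum>i. hausdorff_content m (C i))"
    proof (intro suminf_le)
      fix i
      have "diameter (T ` C i) \<le> diameter (C i)" "0 \<le> diameter (T ` C i)"
        using img[of "C i"] C diameter_ge_0 by blast+
      then show "hausdorff_content m (T ` C i) \<le> hausdorff_content m (C i)"
        by (auto simp: hausdorff_content_def intro!: ennreal_leI mult_left_mono power_mono)
    qed auto
    finally show "hausdorff_pre m \<delta> (T ` A) \<le> (\<Sum>i. hausdorff_content m (C i))" .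
  qed
  then show "\<exists>\<epsilon>\<in>{0<..}. hausdorff_pre m \<delta> (T ` A) \<le> hausdorff_pre m \<epsilon> A" using \<delta> by blast
qed

lemma hausdorff_outer_orthogonal_image:
  fixes T :: "'a::euclidean_space \<Rightarrow> 'a"
  assumes T: "orthogonal_transformation T"
  shows "hausdorff_outer m (T ` A) = hausdorff_outer m A"
proof (rule antisym)
  have "inv T ` T ` A = A" using orthogonal_transformation_inj[OF T] by (simp add: image_inv_f_f)
  then show "hausdorff_outer m A \<le> hausdorff_outer m (T ` A)"
    using hausdorff_outer_orthogonal_image_le[OF orthogonal_transformation_inv[OF T], of m "T ` A"] by simp
qed (rule hausdorff_outer_orthogonal_image_le[OF T])

section \<open>Finiteness, positivity and uniqueness of the rotation-invariant measure on the
  sphere\<close>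

lemma real_nat_floor:
  assumes "0 \<le> (y::real)"
  shows "real (nat \<lfloor>y\<rfloor>) \<le> y" "y < real (nat \<lfloor>y\<rfloor>) + 1"
proof -
  have "real (nat \<lfloor>y\<rfloor>) = of_int \<lfloor>y\<rfloor>" using assms by simp
  then show "real (nat \<lfloor>y\<rfloor>) \<le> y" "y < real (nat \<lfloor>y\<rfloor>) + 1" by linarith+
qed

lemma power_diff_le:
  fixes a b :: real
  assumes "0 \<le> a" "a \<le> b"
  shows "b ^ n - a ^ n \<le> real n * (b - a) * b ^ (n - 1)"
proof (induction n)
  case (Suc n)
  have "b ^ Suc n - a ^ Suc n = b * (b ^ n - a ^ n) + (b - a) * a ^ n" by (simp add: algebra_simps)
  also have "\<dots> \<le> b * (real n * (b - a) * b ^ (n - 1)) + (b - a) * b ^ n"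
    using assms Suc.IH by (intro add_mono mult_left_mono power_mono) auto
  also have "\<dots> = real (Suc n) * (b - a) * b ^ n" by (cases n) (auto simp: algebra_simps)
  finally show ?case by simp
qed simp

text \<open>Packing bound: the balls of radius \<open>\<delta> / 2\<close> around a separated set lie in a thin shell.\<close>

lemma separated_card_bound:
  fixes F :: "(real^'n::finite) set"
  assumes F: "finite F" "F \<subseteq> sphere 0 1" and \<delta>: "0 < \<delta>" "\<delta> \<le> 1"
    and sep: "\<And>x y. x \<in> F \<Longrightarrow> y \<in> F \<Longrightarrow> x \<noteq> y \<Longrightarrow> \<delta> \<le> dist x y"
  shows "real (card F) * \<delta> ^ (CARD('n) - 1) \<le> real CARD('n) * 4 ^ CARD('n)"
proof -
  let ?n = "CARD('n)" and ?V = "unit_ball_vol (real CARD('n))"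
  have V: "?V > 0" by (rule unit_ball_vol_pos) simp
  let ?B = "\<lambda>x. ball x (\<delta> / 2) :: (real^'n) set"
  let ?S = "ball 0 (1 + \<delta> / 2) - ball 0 (1 - \<delta> / 2) :: (real^'n) set"
  have disj: "disjoint_family_on ?B F"
    unfolding disjoint_family_on_def
  proof (intro ballI impI)
    fix x y assume xy: "x \<in> F" "y \<in> F" "x \<noteq> y"
    show "?B x \<inter> ?B y = {}"
    proof (rule ccontr)
      assume "?B x \<inter> ?B y \<noteq> {}"
      then obtain z where "dist x z < \<delta> / 2" "dist y z < \<delta> / 2" by auto
      then have "dist x y < \<delta>" using dist_triangle2[of x y z] by linarith
      then show False using sep[OF xy] by simp
    qed
  qed
  have fb: "emeasure lborel (ball x r) < \<infinity>" for x :: "real^'n" and r by (intro emeasure_bounded_finite) simp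
  have "measure lborel (\<Union>x\<in>F. ?B x) = (\<Sum>x\<in>F. measure lborel (?B x))"
    by (rule measure_finite_Union[OF F(1)]) (use disj fb in \<open>auto simp: less_top\<close>)
  also have "\<dots> = real (card F) * (?V * (\<delta> / 2) ^ ?n)" using \<delta> by (simp add: content_ball)
  finally have 1: "measure lborel (\<Union>x\<in>F. ?B x) = real (card F) * (?V * (\<delta> / 2) ^ ?n)" .
  have sub: "(\<Union>x\<in>F. ?B x) \<subseteq> ?S"
  proof safe
    fix x z assume x: "x \<in> F" and z: "z \<in> ?B x"
    have "norm x = 1" using x F by auto
    moreover have "norm (x - z) < \<delta> / 2" using z by (simp add: dist_norm)
    ultimately show "z \<in> ball 0 (1 + \<delta> / 2)"
      using norm_triangle_ineq4[of x "x - z"] by simp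
    assume "z \<in> ball 0 (1 - \<delta> / 2)"
    then show False using \<open>norm x = 1\<close> \<open>norm (x - z) < \<delta> / 2\<close> norm_triangle_ineq[of z "x - z"] by simp
  qed
  have "measure lborel (\<Union>x\<in>F. ?B x) \<le> measure lborel ?S"
  proof (rule measure_mono_fmeasurable[OF sub])
    show "?S \<in> fmeasurable lborel" by (intro fmeasurable.Diff) (auto intro!: fmeasurableI fb)
  qed (use F(1) in auto)
  also have "\<dots> = measure lborel (ball 0 (1 + \<delta> / 2) :: (real^'n) set) - measure lborel (ball 0 (1 - \<delta> / 2) :: (real^'n) set)"
    using \<delta> fb by (intro measure_Diff) (auto simp: less_top intro!: subset_ball)
  also have "\<dots> = ?V * ((1 + \<delta> / 2) ^ ?n - (1 - \<delta> / 2) ^ ?n)"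
    using \<delta> by (simp add: content_ball algebra_simps)
  also have "\<dots> \<le> ?V * (real ?n * \<delta> * 2 ^ (?n - 1))"
  proof -
    have "(1 + \<delta> / 2) ^ ?n - (1 - \<delta> / 2) ^ ?n \<le> real ?n * \<delta> * (1 + \<delta> / 2) ^ (?n - 1)"
      using power_diff_le[of "1 - \<delta> / 2" "1 + \<delta> / 2" ?n] \<delta> by simp
    also have "\<dots> \<le> real ?n * \<delta> * 2 ^ (?n - 1)" using \<delta> by (intro mult_left_mono power_mono) auto
    finally show ?thesis using V by simp
  qed
  finally have "real (card F) * (?V * (\<delta> / 2) ^ ?n) \<le> ?V * (real ?n * \<delta> * 2 ^ (?n - 1))" unfolding 1 .
  then have "?V * (real (card F) * (\<delta> / 2) ^ ?n) \<le> ?V * (real ?n * \<delta> * 2 ^ (?n - 1))" by (simp add: ac_simps)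
  then have "real (card F) * (\<delta> / 2) ^ ?n \<le> real ?n * \<delta> * 2 ^ (?n - 1)"
    using V by (simp only: mult_le_cancel_left_pos)
  moreover have "\<delta> ^ ?n = \<delta> * \<delta> ^ (?n - 1)" by (metis One_nat_def Suc_pred power_Suc zero_less_card_finite)
  ultimately have "\<delta> * (real (card F) * \<delta> ^ (?n - 1)) \<le> \<delta> * (real ?n * 2 ^ (?n - 1) * 2 ^ ?n)"
    by (simp add: power_divide field_simps)
  then have "real (card F) * \<delta> ^ (?n - 1) \<le> real ?n * 2 ^ (?n - 1) * 2 ^ ?n"
    using \<delta> by (simp only: mult_le_cancel_left_pos)
  also have "\<dots> \<le> real ?n * 2 ^ ?n * 2 ^ ?n" by (intro mult_right_mono mult_left_mono power_increasing) auto
  also have "\<dots> = real ?n * 4 ^ ?n" by (simp add: power_mult_distrib[symmetric])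
  finally show ?thesis .
qed

text \<open>A \<delta>-separated subset of the sphere of maximal cardinality exists by the packing
  bound, and maximality makes it a \<delta>-net. The balls of radius \<delta> around its points form
  a cover of total content at most \<open>K\<close>, independently of \<delta>.\<close>

lemma hausdorff_outer_sphere_finite: "hausdorff_outer (CARD('n) - 1) (sphere 0 1 :: (real^'n::finite) set) < \<infinity>"
proof -
  define m where "m = CARD('n) - 1"
  let ?n = "CARD('n)" and ?S = "sphere 0 1 :: (real^'n) set"
  define K where "K = unit_ball_vol (real m) * (real ?n * 4 ^ ?n)"
  have small: "hausdorff_pre m (2 * \<delta>) ?S \<le> ennreal K" if \<delta>: "0 < \<delta>" "\<delta> \<le> 1" for \<delta>
  proof -
    define P where "P F \<longleftrightarrow> finite F \<and> F \<subseteq> ?S \<and> (\<forall>x\<in>F. \<forall>y\<in>F. x \<noteq> y \<longrightarrow> \<delta> \<le> dist x y)" for F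
    have bd: "real (card F) * \<delta> ^ m \<le> real ?n * 4 ^ ?n" if "P F" for F
      using that \<delta> by (unfold m_def, intro separated_card_bound) (auto simp: P_def)
    have "card F < nat \<lceil>real ?n * 4 ^ ?n / \<delta> ^ m\<rceil> + 1" if "P F" for F
    proof -
      have "real (card F) \<le> real ?n * 4 ^ ?n / \<delta> ^ m" using bd[OF that] \<delta> by (simp add: field_simps)
      then show ?thesis by linarith
    qed
    moreover have "P {}" by (simp add: P_def)
    ultimately obtain F where F: "P F" "\<And>F'. P F' \<Longrightarrow> card F' \<le> card F"
      using ex_has_greatest_nat[of P "{}" card] by (metis less_imp_le_nat)
    have net: "\<exists>y\<in>F. dist y x < \<delta>" if "x \<in> ?S" for x
    proof (rule ccontr)
      assume "\<not> ?thesis"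
      then have far: "\<And>y. y \<in> F \<Longrightarrow> \<delta> \<le> dist y x" by (simp add: not_less)
      then have "P (insert x F)" using F(1) that by (auto simp: P_def dist_commute)
      moreover have "x \<notin> F" using far \<delta> by fastforce
      ultimately show False using F(2)[of "insert x F"] F(1) by (simp add: P_def)
    qed
    obtain e where e: "bij_betw e {..<card F} F"
      using F(1) ex_bij_betw_nat_finite[of F] by (auto simp: P_def atLeast0LessThan)
    define C where "C i = (if i < card F then ball (e i) \<delta> else {})" for i
    have "?S \<subseteq> (\<Union>i. C i)"
    proof
      fix x assume "x \<in> ?S"
      then obtain y where y: "y \<in> F" "dist y x < \<delta>" using net by blast
      then obtain i where "i < card F" "y = e i" using e by (auto simp: bij_betw_def)
      then show "x \<in> (\<Union>i. C i)" using y by (auto simp: C_def intro!: UN_I[of i])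
    qed
    moreover have "bounded (C i) \<and> diameter (C i) \<le> 2 * \<delta>" for i using \<delta> by (simp add: C_def)
    ultimately have "hausdorff_pre m (2 * \<delta>) ?S \<le> (\<Sum>i. hausdorff_content m (C i))"
      unfolding hausdorff_pre_def by (intro INF_lower) auto
    also have "\<dots> = (\<Sum>i<card F. hausdorff_content m (C i))"
      by (rule suminf_finite) (auto simp: C_def hausdorff_content_def)
    also have "\<dots> = (\<Sum>i<card F. ennreal (unit_ball_vol (real m) * \<delta> ^ m))"
      using \<delta> by (intro sum.cong) (auto simp: C_def hausdorff_content_def)
    also have "\<dots> = ennreal (\<Sum>i<card F. unit_ball_vol (real m) * \<delta> ^ m)"
      using \<delta> by (intro sum_ennreal) simp
    also have "\<dots> \<le> ennreal K"
    proof -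
      have "unit_ball_vol (real m) * (real (card F) * \<delta> ^ m) \<le> K"
        unfolding K_def by (intro mult_left_mono bd F) simp
      then show ?thesis by (intro ennreal_leI) (simp add: ac_simps)
    qed
    finally show ?thesis .
  qed
  have "hausdorff_pre m \<delta> ?S \<le> ennreal K" if "\<delta> > 0" for \<delta>
  proof -
    \<comment> \<open>The packing bound is available for radii up to 1, and balls of radius r have
      diameter up to 2 r; antitonicity in the scale reduces every \<delta> to this case.\<close>
    have "hausdorff_pre m \<delta> ?S \<le> hausdorff_pre m (2 * min 1 (\<delta> / 2)) ?S"
      by (rule hausdorff_pre_antimono) auto
    also have "\<dots> \<le> ennreal K" using that by (intro small) auto
    finally show ?thesis .
  qed
  then have "hausdorff_outer m ?S \<le> ennreal K"
    unfolding hausdorff_outer_def by (intro SUP_least) simp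
  then show ?thesis by (simp add: le_less_trans m_def)
qed

text \<open>The cone over a set of diameter at most \<open>t\<close> is covered by about \<open>1 / t\<close> balls of radius \<open>3 * t\<close>.\<close>

lemma cone_cover:
  fixes C :: "(real^'n::finite) set"
  assumes t: "0 < t" "t \<le> 1" and C: "\<And>x y. x \<in> C \<Longrightarrow> y \<in> C \<Longrightarrow> dist x y \<le> t" and m: "CARD('n) = Suc m"
  shows "\<exists>E\<in>sets borel. (\<forall>z\<in>annulus. sgn z \<in> C \<longrightarrow> z \<in> E) \<and>
     emeasure lborel E \<le> ennreal (2 * unit_ball_vol (real CARD('n)) * 3 ^ CARD('n) * t ^ m)"
proof (cases "C \<inter> sphere 0 1 = {}")
  case True
  have "sgn z \<in> sphere 0 1" if "z \<in> annulus" for z :: "real^'n"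
    using that by (auto simp: annulus_def norm_sgn)
  then show ?thesis using True t by (intro bexI[of _ "{}"]) auto
next
  case False
  then obtain c where c: "c \<in> C" "norm c = 1" by auto
  define N where "N = nat \<lfloor>1 / t\<rfloor>"
  have N: "real N \<le> 1 / t" "1 / t < real N + 1" unfolding N_def using t by (auto intro!: real_nat_floor)
  \<comment> \<open>The centres lie on the ray through \<open>c\<close> at spacing \<open>t\<close>.
    Of the radius 3 t, the part 2 t pays for the error of the direction, which is at most t and gets
    scaled by at most 2, and t pays for rounding the norm down to the grid.\<close>
  define E where "E = (\<Union>j\<le>N. cball ((1 + real j * t) *\<^sub>R c) (3 * t))"
  have "z \<in> E" if z: "z \<in> annulus" "sgn z \<in> C" for z
  proof -
    define s where "s = norm z"
    have s: "1 \<le> s" "s \<le> 2" using z by (auto simp: annulus_def s_def)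
    have "norm z \<noteq> 0" using s by (auto simp: s_def)
    then have zs: "z = s *\<^sub>R sgn z" by (simp add: s_def sgn_div_norm)
    define j where "j = nat \<lfloor>(s - 1) / t\<rfloor>"
    have j: "real j \<le> (s - 1) / t" "(s - 1) / t < real j + 1"
      unfolding j_def using t s by (auto intro!: real_nat_floor)
    have j': "real j * t \<le> s - 1" "s - 1 < real j * t + t" using j t by (auto simp: field_simps)
    have "(s - 1) / t \<le> 1 / t" using s t by (intro divide_right_mono) auto
    then have "j \<le> N" using j N by linarith
    have "norm ((1 + real j * t) *\<^sub>R c - z) \<le> norm ((1 + real j * t) *\<^sub>R (c - sgn z)) + norm ((1 + real j * t - s) *\<^sub>R sgn z)"
    proof -
      have "(1 + real j * t) *\<^sub>R c - z = (1 + real j * t) *\<^sub>R (c - sgn z) + (1 + real j * t - s) *\<^sub>R sgn z"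
        by (subst zs) (simp add: algebra_simps)
      then show ?thesis by (simp only: norm_triangle_ineq)
    qed
    also have "norm ((1 + real j * t) *\<^sub>R (c - sgn z)) \<le> 2 * t"
    proof -
      have "\<bar>1 + real j * t\<bar> \<le> 2" using j' s t by (simp add: abs_le_iff) 
      moreover have "norm (c - sgn z) \<le> t" using C[OF c(1) z(2)] by (simp add: dist_norm)
      ultimately show ?thesis by (auto intro!: mult_mono)
    qed
    also have "norm ((1 + real j * t - s) *\<^sub>R sgn z) \<le> t"
      using j' s by (auto simp: norm_sgn)
    finally have "norm ((1 + real j * t) *\<^sub>R c - z) \<le> 3 * t" by simp
    then show ?thesis using \<open>j \<le> N\<close> by (auto simp: E_def dist_norm)
  qed
  moreover have "E \<in> sets borel" unfolding E_def by (intro sets.finite_UN) auto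
  moreover have "emeasure lborel E \<le> ennreal (2 * unit_ball_vol (real CARD('n)) * 3 ^ CARD('n) * t ^ m)"
  proof -
    let ?V = "unit_ball_vol (real CARD('n))"
    have "emeasure lborel E \<le> (\<Sum>j\<le>N. emeasure lborel (cball ((1 + real j * t) *\<^sub>R c) (3 * t)))"
      unfolding E_def by (rule emeasure_subadditive_finite) auto
    also have "\<dots> = (\<Sum>j\<le>N. ennreal (?V * (3 * t) ^ CARD('n)))"
      using t by (intro sum.cong) (auto simp: emeasure_cball)
    also have "\<dots> = ennreal (\<Sum>j\<le>N. ?V * (3 * t) ^ CARD('n))"
      using t by (intro sum_ennreal) simp
    also have "\<dots> \<le> ennreal (2 * ?V * 3 ^ CARD('n) * t ^ m)"
    proof (rule ennreal_leI)
      have "(real N + 1) * t \<le> 2" using N t by (simp add: field_simps)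
      then have "(real N + 1) * t * (?V * 3 ^ CARD('n) * t ^ m) \<le> 2 * (?V * 3 ^ CARD('n) * t ^ m)"
        using t by (intro mult_right_mono) auto
      then show "(\<Sum>j\<le>N. ?V * (3 * t) ^ CARD('n)) \<le> 2 * ?V * 3 ^ CARD('n) * t ^ m"
        by (simp add: m power_mult_distrib ac_simps)
    qed
    finally show ?thesis .
  qed
  ultimately show ?thesis by blast
qed

lemma emeasure_annulus_pos: "0 < emeasure lborel (annulus :: (real^'n::finite) set)"
proof -
  obtain i :: 'n where True by simp
  let ?c = "(3/2) *\<^sub>R axis i 1 :: real^'n"
  have "ball ?c (1/2) \<subseteq> annulus"
  proof
    fix x assume "x \<in> ball ?c (1/2)"
    then have "norm (?c - x) < 1/2" by (simp add: dist_norm)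
    moreover have "norm ?c = 3/2" by simp
    ultimately show "x \<in> annulus"
      using norm_triangle_ineq4[of ?c "?c - x"] norm_triangle_ineq[of x "?c - x"] by (simp add: annulus_def)
  qed
  then have "emeasure lborel (ball ?c (1/2)) \<le> emeasure lborel (annulus :: (real^'n) set)"
    by (intro emeasure_mono) auto
  moreover have "0 < emeasure lborel (ball ?c (1/2))"
  proof -
    have "0 < unit_ball_vol (real CARD('n)) * (1/2) ^ CARD('n)"
      by (rule mult_pos_pos[OF unit_ball_vol_pos]) simp_all
    then show ?thesis by (simp only: emeasure_ball ennreal_less_zero_iff DIM_cart DIM_real mult_1_right)
  qed
  ultimately show ?thesis by (rule less_le_trans[rotated])
qed

text \<open>Volume is the witness. The cones over a cover of the sphere by small sets cover the
  annulus, and \<open>cone_cover\<close> bounds their volumes by a fixed multiple of the contents;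
  so the total content of a cover is bounded below by a multiple of the volume of the
  annulus.\<close>

lemma hausdorff_outer_sphere_pos: "0 < hausdorff_outer (CARD('n) - 1) (sphere 0 1 :: (real^'n::finite) set)"
proof -
  define m where "m = CARD('n) - 1"
  define v where "v = unit_ball_vol (real m)"
  have v: "v > 0" unfolding v_def by (rule unit_ball_vol_pos) simp
  let ?S = "sphere 0 1 :: (real^'n) set"
  define K where "K = 2 * unit_ball_vol (real CARD('n)) * 3 ^ CARD('n)"
  define K1 where "K1 = K * (2 ^ m / v)"
  have K: "K > 0" unfolding K_def by (intro mult_pos_pos unit_ball_vol_pos) auto
  have m: "CARD('n) = Suc m" by (simp add: m_def)
  have K1: "K1 > 0" using K v by (simp add: K1_def)
    have *: "emeasure lborel (annulus :: (real^'n) set) \<le> ennreal K1 * (\<Sum>i. hausdorff_content m (C i))"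
      if C: "?S \<subseteq> (\<Union>i. C i)" "\<And>i. bounded (C i)" "\<And>i. diameter (C i) \<le> 1" for C :: "nat \<Rightarrow> (real^'n) set"
    proof (rule ennreal_le_epsilon)
      fix e :: real assume e: "0 < e"
      \<comment> \<open>A cover may contain sets of diameter 0, whereas \<open>cone_cover\<close>
        needs a positive size. Each diameter is therefore raised to at least
        \<open>\<eta> i\<close>; the total cost, K times the sum of the \<open>\<eta> i\<close>, is
        at most \<open>e\<close>.\<close>
      define \<eta> where "\<eta> i = min 1 (e / K) * (1/2) ^ Suc i" for i
      have \<eta>: "0 < \<eta> i" "\<eta> i \<le> 1" for i
      proof -
        have a: "0 < min 1 (e / K)" "min 1 (e / K) \<le> 1" using e K by auto
        have b: "(1/2 :: real) ^ Suc i \<le> 1" by (rule power_le_one) auto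
        show "0 < \<eta> i" unfolding \<eta>_def by (rule mult_pos_pos[OF a(1)]) simp
        show "\<eta> i \<le> 1" unfolding \<eta>_def by (rule mult_le_one[OF a(2) _ b]) simp
      qed
      define t where "t i = max (diameter (C i)) (\<eta> i)" for i
      have t: "0 < t i" "t i \<le> 1" for i using \<eta>[of i] C(3)[of i] by (auto simp: t_def)
      have tm: "t i ^ m \<le> diameter (C i) ^ m + \<eta> i" for i
      proof (cases "m = 0")
        case False
        then have "\<eta> i ^ m \<le> \<eta> i" using \<eta>[of i] power_decreasing[of 1 m "\<eta> i"] by simp
        moreover have "0 \<le> diameter (C i) ^ m" using diameter_ge_0[OF C(2), of i] by simp
        ultimately show ?thesis using \<eta>[of i] by (auto simp: t_def max_def)
      qed (use \<eta>[of i] in simp)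
      have "\<exists>E\<in>sets borel. (\<forall>z\<in>annulus. sgn z \<in> C i \<longrightarrow> z \<in> E) \<and>
         emeasure lborel E \<le> ennreal K1 * hausdorff_content m (C i) + ennreal (K * \<eta> i)" for i
      proof (cases "C i = {}")
        case True
        then show ?thesis by (intro bexI[of _ "{}"]) auto
      next
        case False
        have "dist x y \<le> t i" if "x \<in> C i" "y \<in> C i" for x y
          using diameter_bounded_bound[OF C(2) that] by (simp add: t_def)
        from cone_cover[OF t this m] obtain E where E: "E \<in> sets borel"
          "\<forall>z\<in>annulus. sgn z \<in> C i \<longrightarrow> z \<in> E" "emeasure lborel E \<le> ennreal (K * t i ^ m)"
          unfolding K_def by blast
        have "K * t i ^ m \<le> K * diameter (C i) ^ m + K * \<eta> i"
          using K tm[of i] by (simp add: distrib_left[symmetric])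
        then have "ennreal (K * t i ^ m) \<le> ennreal (K * diameter (C i) ^ m + K * \<eta> i)" by (rule ennreal_leI)
        also have "\<dots> = ennreal (K * diameter (C i) ^ m) + ennreal (K * \<eta> i)"
          using K \<eta>[of i] diameter_ge_0[OF C(2), of i] by (intro ennreal_plus) auto
        also have "ennreal (K * diameter (C i) ^ m) = ennreal K1 * hausdorff_content m (C i)"
        proof -
          have "hausdorff_content m (C i) = ennreal (v * (diameter (C i) / 2) ^ m)"
            using False by (simp add: hausdorff_content_def v_def)
          moreover have "K1 * (v * (diameter (C i) / 2) ^ m) = K * diameter (C i) ^ m"
            using v by (simp add: K1_def power_divide)
          ultimately show ?thesis using K1 by (simp add: ennreal_mult'[symmetric])
        qed
        finally show ?thesis using E by (intro bexI[of _ E]) auto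
      qed
      then obtain E where E: "\<And>i. E i \<in> sets borel" "\<And>i z. z \<in> annulus \<Longrightarrow> sgn z \<in> C i \<Longrightarrow> z \<in> E i"
        "\<And>i. emeasure lborel (E i) \<le> ennreal K1 * hausdorff_content m (C i) + ennreal (K * \<eta> i)" by metis
      have "annulus \<subseteq> (\<Union>i. E i)"
      proof
        fix z :: "real^'n" assume z: "z \<in> annulus"
        then have "sgn z \<in> ?S" by (auto simp: annulus_def norm_sgn)
        then obtain i where "sgn z \<in> C i" using C(1) by blast
        then show "z \<in> (\<Union>i. E i)" using E(2)[OF z] by blast
      qed
      then have "emeasure lborel (annulus :: (real^'n) set) \<le> emeasure lborel (\<Union>i. E i)"
        using E(1) by (intro emeasure_mono) auto
      also have "\<dots> \<le> (\<Sum>i. emeasure lborel (E i))" using E(1) by (intro emeasure_subadditive_countably) auto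
      also have "\<dots> \<le> (\<Sum>i. ennreal K1 * hausdorff_content m (C i) + ennreal (K * \<eta> i))"
        by (intro suminf_le E) auto
      also have "\<dots> = (\<Sum>i. ennreal K1 * hausdorff_content m (C i)) + (\<Sum>i. ennreal (K * \<eta> i))"
        by (rule suminf_add[symmetric]) auto
      also have "(\<Sum>i. ennreal K1 * hausdorff_content m (C i)) = ennreal K1 * (\<Sum>i. hausdorff_content m (C i))"
        by (rule ennreal_suminf_cmult)
      also have "(\<Sum>i. ennreal (K * \<eta> i)) \<le> ennreal e"
      proof -
        have "(\<lambda>i. (K * min 1 (e / K)) * (1/2) ^ Suc i) sums ((K * min 1 (e / K)) * 1)"
          by (intro sums_mult power_half_series)
        then have "(\<lambda>i. K * \<eta> i) sums (K * min 1 (e / K))" by (simp add: \<eta>_def mult.assoc)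
        then have "(\<Sum>i. ennreal (K * \<eta> i)) = ennreal (K * min 1 (e / K))"
          using K \<eta> by (intro suminf_ennreal_eq) (simp_all add: less_imp_le)
        also have "\<dots> \<le> ennreal e"
        proof (rule ennreal_leI)
          have "K * min 1 (e / K) \<le> K * (e / K)" using K by (intro mult_left_mono) auto
          then show "K * min 1 (e / K) \<le> e" using K by simp
        qed
        finally show ?thesis .
      qed
      finally show "emeasure lborel (annulus :: (real^'n) set) \<le> ennreal K1 * (\<Sum>i. hausdorff_content m (C i)) + ennreal e"
        by (simp add: add_left_mono)
    qed
  have inv: "ennreal (1 / K1) * (ennreal K1 * x) = x" for x
    using K1 by (simp add: mult.assoc[symmetric] ennreal_mult'[symmetric])
  have "ennreal (1 / K1) * emeasure lborel (annulus :: (real^'n) set) \<le> hausdorff_pre m 1 ?S"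
    unfolding hausdorff_pre_def
  proof (rule INF_greatest)
    fix C :: "nat \<Rightarrow> (real^'n) set" assume "C \<in> {C. ?S \<subseteq> (\<Union>i. C i) \<and> (\<forall>i. bounded (C i) \<and> diameter (C i) \<le> 1)}"
    then have "emeasure lborel (annulus :: (real^'n) set) \<le> ennreal K1 * (\<Sum>i. hausdorff_content m (C i))"
      by (intro *) auto
    then have "ennreal (1 / K1) * emeasure lborel (annulus :: (real^'n) set) \<le> ennreal (1 / K1) * (ennreal K1 * (\<Sum>i. hausdorff_content m (C i)))"
      by (rule mult_left_mono) simp
    then show "ennreal (1 / K1) * emeasure lborel (annulus :: (real^'n) set) \<le> (\<Sum>i. hausdorff_content m (C i))"
      by (simp only: inv)
  qed
  moreover have "0 < ennreal (1 / K1) * emeasure lborel (annulus :: (real^'n) set)"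
    using K1 emeasure_annulus_pos[where 'n = 'n] by (simp add: ennreal_zero_less_mult_iff)
  ultimately have "0 < hausdorff_pre m 1 ?S" by (rule less_le_trans[rotated])
  also have "\<dots> \<le> hausdorff_outer m ?S" by (rule hausdorff_pre_le_outer) simp
  finally show ?thesis by (simp add: m_def)
qed

text \<open>Christensen's uniqueness argument: the comparison of the two measures in both
  directions, along the same radii, gives \<mu> \<le> L \<nu> and \<nu> \<le> \<mu> / L on open
  sets. This is equality there, and the open sets generate the Borel sets.\<close>

lemma uniform_sphere_measures_proportional:
  fixes \<mu> \<nu> :: "(real^'n::finite) measure"
  defines "S \<equiv> sphere 0 1"
  assumes s[measurable_cong, simp]: "sets \<mu> = sets borel" "sets \<nu> = sets borel"
    and fin: "emeasure \<mu> UNIV < \<infinity>" "emeasure \<nu> UNIV < \<infinity>"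
    and null: "emeasure \<mu> (- S) = 0" "emeasure \<nu> (- S) = 0"
    and pos: "0 < emeasure \<mu> UNIV" "0 < emeasure \<nu> UNIV"
    and unif: "\<And>x y r. x \<in> S \<Longrightarrow> y \<in> S \<Longrightarrow> emeasure \<mu> (ball x r) = emeasure \<mu> (ball y r)"
      "\<And>x y r. x \<in> S \<Longrightarrow> y \<in> S \<Longrightarrow> emeasure \<nu> (ball x r) = emeasure \<nu> (ball y r)"
  shows "\<exists>c>0. \<mu> = density \<nu> (\<lambda>_. ennreal c)"
proof -
  have sp: "space \<mu> = UNIV" "space \<nu> = UNIV" using sets_eq_imp_space_eq[OF s(1)] sets_eq_imp_space_eq[OF s(2)] by auto
  have sf: "sigma_finite_measure \<mu>" "sigma_finite_measure \<nu>"
    using fin by (auto intro!: finite_measure.axioms finite_measureI simp: sp less_top)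
  have S[measurable]: "S \<in> sets borel" unfolding S_def by simp
  obtain i :: 'n where True by simp
  define x0 :: "real^'n" where "x0 = axis i 1"
  have x0: "x0 \<in> S" by (simp add: x0_def S_def)
  define r where "r j = 1 / real (Suc j)" for j
  have r: "r \<longlonglongrightarrow> 0" "\<And>j. r j > 0"
    using LIMSEQ_inverse_real_of_nat by (simp_all add: r_def[abs_def] inverse_eq_divide)
  \<comment> \<open>If balls of one radius around points of the sphere were null, finitely many of
    them would cover the compact sphere, and the measure would vanish.\<close>
  have ball_pos: "0 < emeasure M (ball x0 d)"
    if M: "sets M = sets borel" "emeasure M (- S) = 0" "0 < emeasure M UNIV"
      "\<And>x y r. x \<in> S \<Longrightarrow> y \<in> S \<Longrightarrow> emeasure M (ball x r) = emeasure M (ball y r)" and "d > 0"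
    for M :: "(real^'n) measure" and d
  proof (rule ccontr)
    assume "\<not> ?thesis"
    then have z: "emeasure M (ball x d) = 0" if "x \<in> S" for x using M(4)[OF that x0] by (simp add: not_less)
    have "compact S" unfolding S_def by simp
    then obtain F where F: "finite F" "F \<subseteq> S" "S \<subseteq> (\<Union>x\<in>F. ball x d)"
      using compactE_image[of S S "\<lambda>x. ball x d"] \<open>d > 0\<close> by (metis UN_I centre_in_ball open_ball subsetI)
    have "emeasure M S \<le> emeasure M (\<Union>x\<in>F. ball x d)" using F M by (intro emeasure_mono) auto
    also have "\<dots> \<le> (\<Sum>x\<in>F. emeasure M (ball x d))" using F M by (intro emeasure_subadditive_finite) auto
    also have "\<dots> = 0" using z F by (intro sum.neutral) auto
    finally have "emeasure M S = 0" by simp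
    have "emeasure M UNIV = emeasure M (S \<union> - S)" by simp
    also have "\<dots> \<le> emeasure M S + emeasure M (- S)" using M by (intro emeasure_subadditive) auto
    finally show False using M(2,3) \<open>emeasure M S = 0\<close> by simp
  qed
  define G where "G j = emeasure \<mu> (ball x0 (r j))" for j
  define H where "H j = emeasure \<nu> (ball x0 (r j))" for j
  have G: "0 < G j" "G j < \<infinity>" and H: "0 < H j" "H j < \<infinity>" for j
  proof -
    show "0 < G j" unfolding G_def by (rule ball_pos[OF s(1) null(1) pos(1) unif(1) r(2)])
    show "0 < H j" unfolding H_def by (rule ball_pos[OF s(2) null(2) pos(2) unif(2) r(2)])
    show "G j < \<infinity>" "H j < \<infinity>" unfolding G_def H_def
      using fin emeasure_mono[of "ball x0 (r j)" UNIV \<mu>] emeasure_mono[of "ball x0 (r j)" UNIV \<nu>]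
      by (auto simp: le_less_trans)
  qed
  \<comment> \<open>Convergence of the ratios of ball measures is not known beforehand. Compactness
    of the extended half-line supplies a subsequence, along which the inverse ratios converge as
    well.\<close>
  obtain L \<sigma> where \<sigma>: "strict_mono \<sigma>" and L: "((\<lambda>j. G j / H j) \<circ> \<sigma>) \<longlonglongrightarrow> L"
    using compact_complete_linorder[of "\<lambda>j. G j / H j"] by blast
  have L1: "(\<lambda>j. G (\<sigma> j) / H (\<sigma> j)) \<longlonglongrightarrow> L" using L by (simp add: o_def)
  have L2: "(\<lambda>j. H (\<sigma> j) / G (\<sigma> j)) \<longlonglongrightarrow> inverse L"
  proof -
    have "(\<lambda>j. inverse (G (\<sigma> j) / H (\<sigma> j))) \<longlonglongrightarrow> inverse L"
      using continuous_on_tendsto_compose[OF continuous_on_inverse_ennreal[OF continuous_on_id] L1 UNIV_I] by simp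
    moreover have "inverse (G j / H j) = H j / G j" for j
      using G[of j] H[of j] by (cases "G j"; cases "H j") (auto simp: divide_ennreal inverse_ennreal)
    ultimately show ?thesis by simp
  qed
  have r': "(\<lambda>j. r (\<sigma> j)) \<longlonglongrightarrow> 0" using LIMSEQ_subseq_LIMSEQ[OF r(1) \<sigma>] by (simp add: o_def)
  have fU: "emeasure M U < \<infinity>" if "emeasure M UNIV < \<infinity>" "sets M = sets borel" for U and M :: "(real^'n) measure"
    using emeasure_mono[of U UNIV M] that by (auto simp: le_less_trans)
  have full: "emeasure M (U \<inter> S) = emeasure M U" if "emeasure M (- S) = 0" "sets M = sets borel" "open U"
    for U and M :: "(real^'n) measure"
    using that by (intro emeasure_eq_AE AE_I[of _ _ "- S"]) auto
  have le1: "emeasure \<mu> U \<le> L * emeasure \<nu> U" if U: "open U" for U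
  proof -
    have "emeasure \<mu> (U \<inter> S) \<le> L * emeasure \<nu> U"
      by (rule emeasure_le_of_uniform_balls[OF s sf S null(2) r' r(2) _ _ H L1 U fU[OF fin(2) s(2)]])
        (auto simp: G_def H_def intro: eq_refl unif x0)
    then show ?thesis using full[OF null(1) s(1) U] by simp
  qed
  have le2: "emeasure \<nu> U \<le> inverse L * emeasure \<mu> U" if U: "open U" for U
  proof -
    have "emeasure \<nu> (U \<inter> S) \<le> inverse L * emeasure \<mu> U"
      by (rule emeasure_le_of_uniform_balls[OF s(2,1) sf(2,1) S null(1) r' r(2) _ _ G L2 U fU[OF fin(1) s(1)]])
        (auto simp: G_def H_def intro: eq_refl unif x0)
    then show ?thesis using full[OF null(2) s(2) U] by simp
  qed
  have "L \<noteq> 0" using le1[OF open_UNIV] pos by auto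
  moreover have "L \<noteq> \<infinity>" using le2[OF open_UNIV] pos by auto
  ultimately obtain c where c: "c > 0" "L = ennreal c" by (cases L) (auto simp: less_le)
  have eq: "emeasure \<mu> U = L * emeasure \<nu> U" if "open U" for U
  proof (rule antisym[OF le1[OF that]])
    have "L * emeasure \<nu> U \<le> L * (inverse L * emeasure \<mu> U)" by (intro mult_left_mono le2 that) simp
    also have "\<dots> = emeasure \<mu> U"
      using c by (simp add: mult.assoc[symmetric] inverse_ennreal ennreal_mult'[symmetric])
    finally show "L * emeasure \<nu> U \<le> emeasure \<mu> U" .
  qed
  have "\<mu> = density \<nu> (\<lambda>_. ennreal c)"
  proof (rule measure_eqI_generator_eq[of "Collect open" UNIV _ _ "\<lambda>_. UNIV"])
    show "emeasure \<mu> X = emeasure (density \<nu> (\<lambda>_. ennreal c)) X" if "X \<in> Collect open" for X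
      using that eq[of X] c by (simp add: emeasure_density_const)
    show "sets \<mu> = sigma_sets UNIV (Collect open)" by (simp add: borel_def)
    show "sets (density \<nu> (\<lambda>_. ennreal c)) = sigma_sets UNIV (Collect open)" by (simp add: borel_def)
    show "Int_stable (Collect open :: (real^'n) set set)" by (auto simp: Int_stable_def)
  qed (use fin in \<open>auto simp: less_top\<close>)
  then show ?thesis using c by blast
qed

text \<open>The weight |z|^(-n) is matched to kernels of degree -n: integrating the restriction of
  such a kernel to the sphere against this measure is the same as integrating the kernel over the
  annulus.\<close>

definition sphere_cone_measure :: "(real^'n::finite) measure" where
  "sphere_cone_measure = distr (density lborel (\<lambda>z. ennreal (indicator annulus z / norm z ^ CARD('n)))) borel sgn"

lemma sgn_measurable [measurable]: "(sgn :: real^'n::finite \<Rightarrow> real^'n) \<in> borel_measurable borel"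
  unfolding sgn_div_norm[abs_def] by measurable

lemma emeasure_sphere_cone:
  assumes [measurable]: "A \<in> sets borel"
  shows "emeasure sphere_cone_measure A =
     (\<integral>\<^sup>+z. ennreal (indicator annulus z / norm z ^ CARD('n)) * indicator A (sgn z) \<partial>(lborel :: (real^'n::finite) measure))"
proof -
  have "sgn -` A \<in> sets (borel :: (real^'n) measure)" using measurable_sets[OF sgn_measurable assms] by simp
  then show ?thesis
    unfolding sphere_cone_measure_def
    by (subst emeasure_distr) (auto simp: emeasure_density indicator_vimage[symmetric] intro!: nn_integral_cong simp: indicator_def)
qed

lemma orthogonal_transformation_sgn: "orthogonal_transformation T \<Longrightarrow> sgn (T z) = T (sgn z)"
  by (simp add: sgn_div_norm orthogonal_transformation_norm linear_scale orthogonal_transformation_linear)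

text \<open>Both measures are finite, nonzero, concentrated on the sphere and rotation invariant.
  Positivity of \<open>c\<close> is all that is asked of the factor, because the cancellation
  condition only concerns the vanishing of integrals.\<close>

lemma hausdorff_sphere_eq_cone:
  "\<exists>c>0. density (hausdorff_measure (CARD('n) - 1)) (indicator (sphere 0 1)) =
     density (sphere_cone_measure :: (real^'n::finite) measure) (\<lambda>_. ennreal c)"
  unfolding One_nat_def
proof (rule uniform_sphere_measures_proportional)
  let ?H = "hausdorff_measure (CARD('n) - Suc 0) :: (real^'n) measure" and ?S = "sphere 0 1 :: (real^'n) set"
  have eH: "emeasure (density ?H (indicator ?S)) A = hausdorff_outer (CARD('n) - Suc 0) (?S \<inter> A)" if "A \<in> sets borel" for A
  proof -
    have [measurable]: "?S \<in> sets ?H" "A \<in> sets ?H" using that by simp_all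
    have "emeasure (density ?H (indicator ?S)) A = (\<integral>\<^sup>+x. indicator ?S x * indicator A x \<partial>?H)"
      by (rule emeasure_density) (simp_all add: that)
    also have "\<dots> = (\<integral>\<^sup>+x. indicator (?S \<inter> A) x \<partial>?H)"
      by (intro nn_integral_cong) (simp add: indicator_inter_arith)
    also have "\<dots> = emeasure ?H (?S \<inter> A)" by (rule nn_integral_indicator) simp
    finally show ?thesis using that by (simp add: emeasure_hausdorff_measure)
  qed
  have T: "\<exists>T. orthogonal_transformation T \<and> T x = y" if "x \<in> ?S" "y \<in> ?S" for x y
    using orthogonal_transformation_exists[of x y] that by auto
  show "sets (density ?H (indicator ?S)) = sets borel" "sets sphere_cone_measure = sets (borel :: (real^'n) measure)"
    by (simp_all add: sphere_cone_measure_def)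
  show "emeasure (density ?H (indicator ?S)) UNIV < \<infinity>" "0 < emeasure (density ?H (indicator ?S)) UNIV"
    using hausdorff_outer_sphere_finite[where 'n = 'n] hausdorff_outer_sphere_pos[where 'n = 'n] by (simp_all add: eH)
  show "emeasure (density ?H (indicator ?S)) (- ?S) = 0" by (simp add: eH hausdorff_outer_empty)
  show "emeasure (density ?H (indicator ?S)) (ball x r) = emeasure (density ?H (indicator ?S)) (ball y r)"
    if xy: "x \<in> ?S" "y \<in> ?S" for x y r
  proof -
    obtain T where T: "orthogonal_transformation T" "T x = y" using T[OF xy] by blast
    have "T ` (?S \<inter> ball x r) = ?S \<inter> ball y r"
    proof -
      have "T ` ?S = ?S"
      proof -
        have "T ` sphere 0 1 \<subseteq> sphere 0 1" if "orthogonal_transformation T" for T :: "real^'n \<Rightarrow> real^'n"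
          using that by (auto simp: orthogonal_transformation_norm)
        from this[OF T(1)] this[OF orthogonal_transformation_inv[OF T(1)]]
        show ?thesis using orthogonal_transformation_bij[OF T(1)]
          by (metis bij_is_surj image_inv_f_f bij_is_inj image_f_inv_f image_mono subset_antisym)
      qed
      moreover have "T ` ball x r = ball y r" using image_orthogonal_transformation_ball[OF T(1)] T(2) by simp
      moreover have "inj T" using T(1) by (rule orthogonal_transformation_inj)
      ultimately show ?thesis by (simp add: image_Int)
    qed
    then show ?thesis using hausdorff_outer_orthogonal_image[OF T(1), of "CARD('n) - Suc 0" "?S \<inter> ball x r"] by (simp add: eH)
  qed
  have dens: "ennreal (indicator annulus z / norm z ^ CARD('n)) \<le> indicator annulus z" for z :: "real^'n"
    using one_le_power[of "norm z" "CARD('n)"] by (auto simp: indicator_def annulus_def divide_le_eq)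
  show "emeasure (sphere_cone_measure :: (real^'n) measure) UNIV < \<infinity>"
  proof -
    have "emeasure (sphere_cone_measure :: (real^'n) measure) UNIV \<le> (\<integral>\<^sup>+z. indicator annulus z \<partial>(lborel :: (real^'n) measure))"
      by (subst emeasure_sphere_cone, simp, intro nn_integral_mono) (simp add: dens)
    then show ?thesis using emeasure_annulus_finite[where 'n = 'n] by (simp add: le_less_trans)
  qed
  show "emeasure (sphere_cone_measure :: (real^'n) measure) (- ?S) = 0"
  proof -
    have "emeasure (sphere_cone_measure :: (real^'n) measure) (- ?S) = (\<integral>\<^sup>+z. 0 \<partial>(lborel :: (real^'n) measure))"
      by (subst emeasure_sphere_cone, simp, intro nn_integral_cong) (auto simp: indicator_def annulus_def norm_sgn)
    then show ?thesis by simp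
  qed
  show "0 < emeasure (sphere_cone_measure :: (real^'n) measure) UNIV"
  proof -
    have "ennreal (1 / 2 ^ CARD('n)) * emeasure lborel (annulus :: (real^'n) set) =
      (\<integral>\<^sup>+z. ennreal (1 / 2 ^ CARD('n)) * indicator annulus z \<partial>(lborel :: (real^'n) measure))"
      by (simp add: nn_integral_cmult_indicator)
    also have "\<dots> \<le> emeasure (sphere_cone_measure :: (real^'n) measure) UNIV"
      by (subst emeasure_sphere_cone, simp, intro nn_integral_mono)
        (auto simp: indicator_def annulus_def intro!: ennreal_leI divide_left_mono power_mono mult_pos_pos zero_less_power)
    finally have "ennreal (1 / 2 ^ CARD('n)) * emeasure lborel (annulus :: (real^'n) set) \<le> emeasure (sphere_cone_measure :: (real^'n) measure) UNIV" .
    moreover have "0 < ennreal (1 / 2 ^ CARD('n)) * emeasure lborel (annulus :: (real^'n) set)"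
      using emeasure_annulus_pos[where 'n = 'n] by (simp add: ennreal_zero_less_mult_iff)
    ultimately show ?thesis by (rule less_le_trans[rotated])
  qed
  show "emeasure (sphere_cone_measure :: (real^'n) measure) (ball x r) = emeasure sphere_cone_measure (ball y r)"
    if xy: "x \<in> ?S" "y \<in> ?S" for x y r
  proof -
    obtain T where T: "orthogonal_transformation T" "T x = y" using T[OF xy] by blast
    have [measurable]: "T \<in> borel_measurable borel"
      using T(1) by (intro borel_measurable_continuous_onI linear_continuous_on)
        (simp add: orthogonal_transformation_linear linear_conv_bounded_linear[symmetric])
    have [measurable]: "(\<lambda>z::real^'n. indicator (ball y r) (sgn z) :: ennreal) \<in> borel_measurable borel"
      by (rule measurable_compose[OF sgn_measurable borel_measurable_indicator]) simp
    have "dist y (T z) = dist x z" for z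
      using orthogonal_transformation_dist[OF T(1), of x z] T(2) by simp
    then have b: "T (sgn z) \<in> ball y r \<longleftrightarrow> sgn z \<in> ball x r" for z by simp
    have "emeasure sphere_cone_measure (ball y r) =
      (\<integral>\<^sup>+z. ennreal (indicator annulus (T z) / norm (T z) ^ CARD('n)) * indicator (ball y r) (sgn (T z)) \<partial>lborel)"
      by (subst emeasure_sphere_cone, simp, subst lborel_distr_orthogonal[OF T(1), symmetric], subst nn_integral_distr) auto
    also have "\<dots> = emeasure sphere_cone_measure (ball x r)"
      using b T(1) by (subst emeasure_sphere_cone, simp, intro nn_integral_cong)
        (simp add: orthogonal_transformation_sgn orthogonal_transformation_norm annulus_def indicator_def)
    finally show ?thesis by simp
  qed
qed

lemma sphere_integral_eq_0_iff:
  fixes g :: "real^'n::finite \<Rightarrow> 'e::euclidean_space"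
  assumes [measurable]: "g \<in> borel_measurable borel"
  shows "(LINT \<xi>:sphere 0 1|hausdorff_measure (CARD('n) - 1). g \<xi>) = 0 \<longleftrightarrow>
    (LINT z|lborel. (indicator annulus z / norm z ^ CARD('n)) *\<^sub>R g (sgn z)) = 0"
proof -
  let ?H = "hausdorff_measure (CARD('n) - 1) :: (real^'n) measure"
  obtain c where c: "c > 0" "density ?H (indicator (sphere 0 1)) = density sphere_cone_measure (\<lambda>_. ennreal c)"
    using hausdorff_sphere_eq_cone by blast
  have [measurable]: "sphere 0 1 \<in> sets ?H" by simp
  have [measurable]: "g \<in> borel_measurable ?H" "g \<in> borel_measurable sphere_cone_measure"
    by (simp_all add: sphere_cone_measure_def measurable_cong_sets[OF sets_hausdorff_measure refl])
  have "(LINT \<xi>:sphere 0 1|?H. g \<xi>) = (LINT \<xi>|density ?H (\<lambda>x. ennreal (indicator (sphere 0 1) x)). g \<xi>)"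
    unfolding set_lebesgue_integral_def by (subst integral_density) auto
  also have "(\<lambda>x. ennreal (indicator (sphere 0 1) x)) = indicator (sphere 0 1 :: (real^'n) set)"
    by (auto simp: indicator_def)
  also have "(LINT \<xi>|density ?H (indicator (sphere 0 1)). g \<xi>) = c *\<^sub>R (LINT \<xi>|sphere_cone_measure. g \<xi>)"
    using c(1) unfolding c(2) by (subst integral_density) auto
  also have "(LINT \<xi>|sphere_cone_measure. g \<xi>) = (LINT z|lborel. (indicator annulus z / norm z ^ CARD('n)) *\<^sub>R g (sgn z))"
    unfolding sphere_cone_measure_def by (subst integral_distr, simp, simp, subst integral_density) auto
  finally show ?thesis using c(1) by simp
qed

section \<open>The Fourier transform\<close>

text \<open>Multiplication by exp (i \<theta>), with \<open>J\<close> in the role of i.\<close>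

definition rot :: "('e::euclidean_space \<Rightarrow> 'e) \<Rightarrow> real \<Rightarrow> 'e \<Rightarrow> 'e" where
  "rot J \<theta> v = cos \<theta> *\<^sub>R v + sin \<theta> *\<^sub>R J v"

text \<open>\<open>osc J s\<close> is the Fourier transform for \<open>s = -1\<close> and, up to a factor, its inverse for \<open>s = 1\<close>.\<close>

definition osc :: "('e::euclidean_space \<Rightarrow> 'e) \<Rightarrow> real \<Rightarrow> (real^'n::finite \<Rightarrow> 'e) \<Rightarrow> real^'n \<Rightarrow> 'e" where
  "osc J s u y = (LINT x|lborel. rot J (s * (x \<bullet> y)) (u x))"

text \<open>Decay without smoothness. Finite moments suffice to differentiate a transform, and they
  survive multiplication by bounded measurable multipliers such as P S, which is in general
  discontinuous at 0.\<close>

definition rapid :: "(real^'n::finite \<Rightarrow> 'e::euclidean_space) \<Rightarrow> bool" where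
  "rapid u \<longleftrightarrow> u \<in> borel_measurable borel \<and> (\<forall>m. integrable lborel (\<lambda>x. norm x ^ m * norm (u x)))"

lemma cscale_exp: "cscale J (exp (\<i> * complex_of_real t)) v = rot J t v"
  and cscale_exp_minus: "cscale J (exp (- \<i> * complex_of_real t)) v = rot J (- t) v"
proof -
  show *: "cscale J (exp (\<i> * complex_of_real t)) v = rot J t v" for t
    by (simp add: cscale_def rot_def cis_conv_exp[symmetric])
  show "cscale J (exp (- \<i> * complex_of_real t)) v = rot J (- t) v"
    using *[of "- t"] by simp
qed

lemma fourier_eq_osc: "fourier J u \<xi> = osc J (-1) u \<xi>"
  unfolding fourier_def osc_def cscale_exp_minus by (simp add: inner_commute)

lemma inverse_fourier_eq_osc:
  "inverse_fourier J g x = (1 / (2 * pi) ^ CARD('n)) *\<^sub>R osc J 1 g (x :: real^'n::finite)"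
  unfolding inverse_fourier_def osc_def cscale_exp by (simp add: inner_commute)

lemma rapid_integrable: "rapid u \<Longrightarrow> integrable lborel u"
proof (rule integrable_norm_cancel)
  assume u: "rapid u"
  then show "u \<in> borel_measurable lborel" by (simp add: rapid_def)
  have "integrable lborel (\<lambda>x. norm x ^ 0 * norm (u x))" using u unfolding rapid_def by blast
  then show "integrable lborel (\<lambda>x. norm (u x))" by simp
qed

lemma rapid_moment: "rapid u \<Longrightarrow> integrable lborel (\<lambda>x. norm x ^ m * norm (u x))"
  unfolding rapid_def by blast

lemma rapid_measurable: "rapid u \<Longrightarrow> u \<in> borel_measurable borel"
  unfolding rapid_def by blast

lemma rapid_dominated:
  assumes u: "rapid u" and [measurable]: "v \<in> borel_measurable borel" and le: "\<And>x. norm (v x) \<le> C * norm x ^ j * norm (u x)"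
  shows "rapid v"
  unfolding rapid_def
proof (intro conjI allI)
  fix m
  have "integrable lborel (\<lambda>x. C * (norm x ^ (m + j) * norm (u x)))"
    by (intro integrable_mult_right rapid_moment u)
  then show "integrable lborel (\<lambda>x. norm x ^ m * norm (v x))"
  proof (rule Bochner_Integration.integrable_bound)
    show "AE x in lborel. norm (norm x ^ m * norm (v x)) \<le> norm (C * (norm x ^ (m + j) * norm (u x)))"
    proof (rule AE_I2)
      fix x
      have "norm (norm x ^ m * norm (v x)) = norm x ^ m * norm (v x)" by simp
      also have "\<dots> \<le> norm x ^ m * (C * norm x ^ j * norm (u x))" by (intro mult_left_mono le) simp
      also have "\<dots> = C * (norm x ^ (m + j) * norm (u x))" by (simp add: power_add)
      finally show "norm (norm x ^ m * norm (v x)) \<le> norm (C * (norm x ^ (m + j) * norm (u x)))" by simp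
    qed
  qed simp
qed (rule assms)

text \<open>\<open>B h\<close> says that \<open>h\<close> stays bounded above after multiplication
  by the absolute value of any monomial. The class is stable under sums and multiplication by |y_i|,
  hence, for nonnegative \<open>h\<close>, by |y|, and by the product of the 1 + y_i^2; dividing by
  that product leaves an integrable majorant.\<close>

lemma rapid_if_bounded:
  fixes w :: "real^'n::finite \<Rightarrow> 'e::euclidean_space"
  assumes [measurable]: "w \<in> borel_measurable borel"
    and bd: "\<And>is. \<exists>C. \<forall>y. \<bar>prod_list (map (\<lambda>i. y $ i) is)\<bar> * norm (w y) \<le> C"
  shows "rapid w"
proof -
  define B where "B h \<longleftrightarrow> (\<forall>is. \<exists>C. \<forall>y::real^'n. \<bar>prod_list (map (\<lambda>i. y $ i) is)\<bar> * h y \<le> C)" for h :: "real^'n \<Rightarrow> real"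
  have coord: "B (\<lambda>y. \<bar>y $ i\<bar> * h y)" if "B h" for h i
    unfolding B_def
  proof
    fix "is"
    obtain C where "\<And>y. \<bar>prod_list (map (\<lambda>i. y $ i) (i # is))\<bar> * h y \<le> C" using \<open>B h\<close> unfolding B_def by blast
    then show "\<exists>C. \<forall>y. \<bar>prod_list (map (\<lambda>i. y $ i) is)\<bar> * (\<bar>y $ i\<bar> * h y) \<le> C"
      by (intro exI[of _ C]) (simp add: abs_mult ac_simps)
  qed
  have add: "B (\<lambda>y. h y + k y)" if "B h" "B k" for h k
    unfolding B_def
  proof
    fix "is"
    obtain C where C: "\<And>y. \<bar>prod_list (map (\<lambda>i. y $ i) is)\<bar> * h y \<le> C" using \<open>B h\<close> unfolding B_def by blast
    obtain D where D: "\<And>y. \<bar>prod_list (map (\<lambda>i. y $ i) is)\<bar> * k y \<le> D" using \<open>B k\<close> unfolding B_def by blast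
    show "\<exists>C. \<forall>y. \<bar>prod_list (map (\<lambda>i. y $ i) is)\<bar> * (h y + k y) \<le> C"
      by (intro exI[of _ "C + D"] allI) (simp add: distrib_left add_mono C D)
  qed
  have sum: "B (\<lambda>y. \<Sum>i\<in>I. h i y)" if "\<And>i. i \<in> I \<Longrightarrow> B (h i)" "finite I" for h and I :: "'n set"
    using that(2,1)
  proof (induction I)
    case empty
    show ?case by (auto simp: B_def)
  qed (auto intro: add)
  have mono: "B k" if "B h" "\<And>y. k y \<le> h y" for h k
    unfolding B_def
  proof
    fix "is"
    obtain C where C: "\<And>y. \<bar>prod_list (map (\<lambda>i. y $ i) is)\<bar> * h y \<le> C" using \<open>B h\<close> unfolding B_def by blast
    then show "\<exists>C. \<forall>y. \<bar>prod_list (map (\<lambda>i. y $ i) is)\<bar> * k y \<le> C"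
      by (intro exI[of _ C]) (meson abs_ge_zero mult_left_mono order_trans that(2))
  qed
  have norm1: "B (\<lambda>y. norm y * h y)" if "B h" "\<And>y. h y \<ge> 0" for h
  proof (rule mono)
    show "B (\<lambda>y. \<Sum>i\<in>UNIV. \<bar>y $ i\<bar> * h y)" by (intro sum coord that) auto
    show "norm y * h y \<le> (\<Sum>i\<in>UNIV. \<bar>y $ i\<bar> * h y)" for y
      using mult_right_mono[OF norm_le_l1_cart[of y] that(2)[of y]] by (simp add: sum_distrib_right)
  qed
  have normm: "B (\<lambda>y. norm y ^ m * norm (w y))" for m
  proof (induction m)
    case 0
    then show ?case using bd by (simp add: B_def)
  next
    case (Suc m)
    from norm1[OF this] show ?case by (simp add: mult.assoc)
  qed
  have prodB: "B (\<lambda>y. (\<Prod>i\<in>I. 1 + (y $ i)\<^sup>2) * (norm y ^ m * norm (w y)))" if "finite I" for m and I :: "'n set"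
    using that
  proof (induction I)
    case empty
    show ?case using normm by simp
  next
    case (insert i I)
    have "B (\<lambda>y. (\<Prod>i\<in>I. 1 + (y $ i)\<^sup>2) * (norm y ^ m * norm (w y)) + \<bar>y $ i\<bar> * (\<bar>y $ i\<bar> * ((\<Prod>i\<in>I. 1 + (y $ i)\<^sup>2) * (norm y ^ m * norm (w y)))))"
      by (intro add coord insert)
    also have "(\<lambda>y. (\<Prod>i\<in>I. 1 + (y $ i)\<^sup>2) * (norm y ^ m * norm (w y)) + \<bar>y $ i\<bar> * (\<bar>y $ i\<bar> * ((\<Prod>i\<in>I. 1 + (y $ i)\<^sup>2) * (norm y ^ m * norm (w y)))))
      = (\<lambda>y. (\<Prod>i\<in>insert i I. 1 + (y $ i)\<^sup>2) * (norm y ^ m * norm (w y)))"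
      using insert.hyps by (auto simp: fun_eq_iff distrib_right mult.assoc[symmetric] power2_eq_square)
    finally show ?case .
  qed
  show ?thesis
    unfolding rapid_def
  proof (intro conjI allI)
    fix m
    obtain C where C: "\<And>y::real^'n. (\<Prod>i\<in>UNIV. 1 + (y $ i)\<^sup>2) * (norm y ^ m * norm (w y)) \<le> C"
    proof -
      have "\<exists>C. \<forall>y::real^'n. \<bar>prod_list (map (\<lambda>i. y $ i) [])\<bar> * ((\<Prod>i\<in>UNIV. 1 + (y $ i)\<^sup>2) * (norm y ^ m * norm (w y))) \<le> C"
        using prodB[OF finite_class.finite_UNIV, of m] unfolding B_def by blast
      then show thesis using that by auto
    qed
    have "integrable lborel (\<lambda>x::real^'n. C * (\<Prod>i\<in>UNIV. inverse (1 + (x $ i)\<^sup>2)))"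
      by (intro integrable_mult_right integrable_prod_inverse_square)
    then show "integrable lborel (\<lambda>x. norm x ^ m * norm (w x))"
    proof (rule Bochner_Integration.integrable_bound)
      show "AE x in lborel. norm (norm x ^ m * norm (w x)) \<le> norm (C * (\<Prod>i\<in>UNIV. inverse (1 + (x $ i)\<^sup>2)))"
      proof (rule AE_I2)
        fix x :: "real^'n"
        have p: "(\<Prod>i\<in>UNIV. 1 + (x $ i)\<^sup>2) > 0" by (intro prod_pos) (auto intro: add_pos_nonneg)
        have "norm x ^ m * norm (w x) \<le> C / (\<Prod>i\<in>UNIV. 1 + (x $ i)\<^sup>2)"
          using C[of x] p by (simp add: pos_le_divide_eq mult.commute)
        also have "\<dots> = C * (\<Prod>i\<in>UNIV. inverse (1 + (x $ i)\<^sup>2))" by (simp add: divide_inverse prod_inversef[unfolded o_def])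
        finally show "norm (norm x ^ m * norm (w x)) \<le> norm (C * (\<Prod>i\<in>UNIV. inverse (1 + (x $ i)\<^sup>2)))" by simp
      qed
    qed simp
  qed (rule assms)
qed

section \<open>Calculus rules for the transform\<close>

context
  fixes J :: "'e::euclidean_space \<Rightarrow> 'e"
  assumes J: "complex_structure J"
begin

lemma J_linear: "linear J" and J_norm [simp]: "norm (J v) = norm v" and J_J [simp]: "J (J v) = - v"
  using J by (auto simp: complex_structure_def orthogonal_transformation)

lemma J_bounded_linear: "bounded_linear J"
  using J_linear by (simp add: linear_conv_bounded_linear)

lemma J_add: "J (a + b) = J a + J b" and J_scale: "J (c *\<^sub>R a) = c *\<^sub>R J a" and J_minus: "J (- a) = - J a"
  using J_linear by (auto simp: linear_add linear_scale linear_neg)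

lemma J_inner: "v \<bullet> J v = 0"
proof -
  have "J v \<bullet> J (J v) = v \<bullet> J v" using J unfolding complex_structure_def orthogonal_transformation_def by blast
  then show ?thesis using inner_commute[of "J v" v] by simp
qed

lemma J_measurable [measurable]: "J \<in> borel_measurable borel"
  by (intro borel_measurable_continuous_onI linear_continuous_on J_bounded_linear)

lemma norm_cscale: "norm (cscale J z v) = cmod z * norm v"
proof -
  have "(norm (cscale J z v))\<^sup>2 = (Re z)\<^sup>2 * (norm v)\<^sup>2 + (Im z)\<^sup>2 * (norm (J v))\<^sup>2"
    unfolding cscale_def power2_norm_eq_inner using J_inner[of v] inner_commute[of "J v" v]
    by (simp add: inner_add_left inner_add_right power2_eq_square)
  also have "\<dots> = (cmod z * norm v)\<^sup>2" by (simp add: cmod_power2 power_mult_distrib distrib_right)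
  finally show ?thesis by (metis norm_ge_zero power2_eq_imp_eq mult_nonneg_nonneg)
qed

lemma rot_cscale: "rot J \<theta> v = cscale J (cis \<theta>) v"
  by (simp add: rot_def cscale_def)

lemma norm_rot [simp]: "norm (rot J \<theta> v) = norm v"
  by (simp add: rot_cscale norm_cscale)

lemma rot_bounded_linear: "bounded_linear (rot J \<theta>)"
  unfolding rot_def
  by (intro bounded_linear_add bounded_linear_scaleR_const bounded_linear_ident
      bounded_linear_compose[OF bounded_linear_scaleR_right J_bounded_linear] bounded_linear_scaleR_right)

lemma rot_add: "rot J (a + b) v = rot J a (rot J b v)"
  by (simp add: rot_def cos_add sin_add J_add J_scale algebra_simps)

lemma rot_J: "rot J \<theta> (J v) = J (rot J \<theta> v)"
  by (simp add: rot_def J_add J_scale)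

lemma rot_scaleR: "rot J \<theta> (c *\<^sub>R v) = c *\<^sub>R rot J \<theta> v"
  using rot_bounded_linear by (simp add: linear_scale bounded_linear.linear)

lemma rot_vadd: "rot J \<theta> (v + w) = rot J \<theta> v + rot J \<theta> w"
  using rot_bounded_linear by (simp add: linear_add bounded_linear.linear)

lemma rot_diff: "rot J \<theta> (v - w) = rot J \<theta> v - rot J \<theta> w"
  using rot_bounded_linear by (simp add: linear_diff bounded_linear.linear)

lemma rot_taylor: "norm (rot J a v - v - a *\<^sub>R J v) \<le> a\<^sup>2 * norm v"
proof -
  have "rot J a v - v - a *\<^sub>R J v = cscale J (cis a - 1 - \<i> * complex_of_real a) v"
    by (simp add: rot_def cscale_def algebra_simps)
  moreover have "cmod (cis a - 1 - \<i> * complex_of_real a) \<le> a\<^sup>2 / 2"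
    using iexp_approx1[of a 1] by (simp add: cis_conv_exp numeral_2_eq_2 atMost_Suc diff_diff_eq add.commute)
  moreover have "a\<^sup>2 / 2 \<le> a\<^sup>2" by simp
  ultimately show ?thesis
    by (simp only: norm_cscale) (intro mult_right_mono, linarith, simp)
qed

lemma rot_measurable [measurable]:
  assumes [measurable]: "\<theta> \<in> borel_measurable M" "u \<in> borel_measurable M"
  shows "(\<lambda>x. rot J (\<theta> x) (u x)) \<in> borel_measurable M"
  unfolding rot_def by measurable

lemma rot_integrable:
  assumes "integrable M u" and [measurable]: "\<theta> \<in> borel_measurable M"
  shows "integrable M (\<lambda>x. rot J (\<theta> x) (u x))"
proof (rule Bochner_Integration.integrable_bound[OF assms(1)])
  have [measurable]: "u \<in> borel_measurable M" using assms(1) by auto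
  show "(\<lambda>x. rot J (\<theta> x) (u x)) \<in> borel_measurable M" by measurable
qed simp

lemma osc_integrable: "integrable lborel u \<Longrightarrow> integrable lborel (\<lambda>x. rot J (s * (x \<bullet> y)) (u x))"
  by (rule rot_integrable) auto

lemma norm_osc_le: "norm (osc J s u y) \<le> (LINT x|lborel. norm (u x))"
  unfolding osc_def using integral_norm_bound[of lborel "\<lambda>x. rot J (s * (x \<bullet> y)) (u x)"] by simp

lemma osc_measurable [measurable]:
  fixes u :: "real^'n::finite \<Rightarrow> 'e"
  assumes [measurable]: "u \<in> borel_measurable borel"
  shows "osc J s u \<in> borel_measurable borel"
proof -
  have "(\<lambda>y. LINT x|lborel. rot J (s * (x \<bullet> y)) (u x)) \<in> borel_measurable lborel"
    by (rule lborel.borel_measurable_lebesgue_integral) measurable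
  then show ?thesis unfolding osc_def[abs_def] by simp
qed

lemma osc_linear:
  assumes "integrable lborel u" "bounded_linear L" "\<And>\<theta> v. rot J' \<theta> (L v) = L (rot J \<theta> v)"
  shows "osc J' s (\<lambda>x. L (u x)) y = L (osc J s u y)"
  unfolding osc_def assms(3) by (rule integral_bounded_linear[OF assms(2) osc_integrable[OF assms(1)]])

lemma osc_add:
  assumes "integrable lborel u" "integrable lborel v"
  shows "osc J s (\<lambda>x. u x + v x) y = osc J s u y + osc J s v y"
  unfolding osc_def rot_vadd by (rule Bochner_Integration.integral_add[OF osc_integrable[OF assms(1)] osc_integrable[OF assms(2)]])

lemma osc_diff:
  assumes "integrable lborel u" "integrable lborel v"
  shows "osc J s (\<lambda>x. u x - v x) y = osc J s u y - osc J s v y"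
  unfolding osc_def rot_diff by (rule Bochner_Integration.integral_diff[OF osc_integrable[OF assms(1)] osc_integrable[OF assms(2)]])

lemma osc_scaleR: "osc J s (\<lambda>x. c *\<^sub>R u x) y = c *\<^sub>R osc J s u y"
  unfolding osc_def rot_scaleR by simp

lemma osc_J: "integrable lborel u \<Longrightarrow> osc J s (\<lambda>x. J (u x)) y = J (osc J s u y)"
  by (rule osc_linear[OF _ J_bounded_linear]) (auto simp: rot_J)

lemma rapid_coord_J: "rapid u \<Longrightarrow> rapid (\<lambda>x. (c * (x \<bullet> h)) *\<^sub>R J (u x))"
proof (rule rapid_dominated[of u _ "\<bar>c\<bar> * norm h" 1])
  assume "rapid u"
  note rapid_measurable[OF this, measurable]
  show "(\<lambda>x. (c * (x \<bullet> h)) *\<^sub>R J (u x)) \<in> borel_measurable borel" by measurable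
  show "norm ((c * (x \<bullet> h)) *\<^sub>R J (u x)) \<le> \<bar>c\<bar> * norm h * norm x ^ 1 * norm (u x)" for x
    using mult_right_mono[OF mult_left_mono[OF Cauchy_Schwarz_ineq2[of x h], of "\<bar>c\<bar>"], of "norm (u x)"]
    by (simp add: abs_mult ac_simps)
qed

text \<open>A quadratic remainder estimate takes the place of differentiation under the integral: by
  \<open>rot_taylor\<close> the first-order error of the phase is at most (s (x . h))^2, which the
  second moment of \<open>u\<close> makes integrable.\<close>

lemma osc_has_derivative:
  fixes u :: "real^'n::finite \<Rightarrow> 'e"
  assumes u: "rapid u"
  shows "(osc J s u has_derivative (\<lambda>h. osc J s (\<lambda>x. (s * (x \<bullet> h)) *\<^sub>R J (u x)) y)) (at y)"
proof -
  note [measurable] = rapid_measurable[OF u]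
  define K where "K = (LINT x|lborel. norm x ^ 2 * norm (u x))"
  have i2: "integrable lborel (\<lambda>x. norm x ^ 2 * norm (u x))" by (rule rapid_moment[OF u])
  have ih: "integrable lborel (\<lambda>x. (s * (x \<bullet> h)) *\<^sub>R J (u x))" for h
    by (rule rapid_integrable[OF rapid_coord_J[OF u]])
  let ?D = "\<lambda>h. osc J s (\<lambda>x. (s * (x \<bullet> h)) *\<^sub>R J (u x)) y"
  have lin: "linear ?D"
  proof
    fix a b :: "real^'n" and c :: real
    show "?D (a + b) = ?D a + ?D b"
      using osc_add[OF ih[of a] ih[of b]] by (simp add: inner_add_right distrib_left scaleR_add_left)
    show "?D (c *\<^sub>R a) = c *\<^sub>R ?D a"
      using osc_scaleR[of s c "\<lambda>x. (s * (x \<bullet> a)) *\<^sub>R J (u x)" y] by (simp add: ac_simps)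
  qed
  have est: "norm (osc J s u (y + h) - osc J s u y - ?D h) \<le> s\<^sup>2 * K * (norm h)\<^sup>2" for h
  proof -
    have "osc J s u (y + h) - osc J s u y - ?D h =
      (LINT x|lborel. rot J (s * (x \<bullet> y)) (rot J (s * (x \<bullet> h)) (u x) - u x - (s * (x \<bullet> h)) *\<^sub>R J (u x)))"
    proof -
      have eq: "rot J (s * (x \<bullet> y)) (rot J (s * (x \<bullet> h)) (u x) - u x - (s * (x \<bullet> h)) *\<^sub>R J (u x)) =
        rot J (s * (x \<bullet> (y + h))) (u x) - rot J (s * (x \<bullet> y)) (u x) - rot J (s * (x \<bullet> y)) ((s * (x \<bullet> h)) *\<^sub>R J (u x))" for x
        by (simp add: inner_add_right distrib_left rot_add rot_diff)
      have i1: "integrable lborel (\<lambda>x. rot J (s * (x \<bullet> z)) (u x))" for z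
        by (rule osc_integrable[OF rapid_integrable[OF u]])
      have i2: "integrable lborel (\<lambda>x. rot J (s * (x \<bullet> y)) ((s * (x \<bullet> h)) *\<^sub>R J (u x)))"
        by (rule osc_integrable[OF ih])
      show ?thesis
        unfolding osc_def eq
        by (simp only: Bochner_Integration.integral_diff[OF Bochner_Integration.integrable_diff[OF i1 i1] i2] Bochner_Integration.integral_diff[OF i1 i1])
    qed
    also have "norm \<dots> \<le> (LINT x|lborel. (s\<^sup>2 * (norm h)\<^sup>2) * (norm x ^ 2 * norm (u x)))"
    proof (rule order_trans[OF integral_norm_bound integral_mono'])
      show "integrable lborel (\<lambda>x. (s\<^sup>2 * (norm h)\<^sup>2) * (norm x ^ 2 * norm (u x)))" using i2 by simp
      fix x
      have "norm (rot J (s * (x \<bullet> h)) (u x) - u x - (s * (x \<bullet> h)) *\<^sub>R J (u x)) \<le> (s * (x \<bullet> h))\<^sup>2 * norm (u x)"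
        by (rule rot_taylor)
      also have "\<dots> \<le> (s\<^sup>2 * (norm h)\<^sup>2) * (norm x ^ 2 * norm (u x))"
      proof -
        have "(x \<bullet> h)\<^sup>2 \<le> (norm x * norm h)\<^sup>2"
          using Cauchy_Schwarz_ineq2[of x h] power_mono[of "\<bar>x \<bullet> h\<bar>" "norm x * norm h" 2] by simp
        then have "s\<^sup>2 * (x \<bullet> h)\<^sup>2 * norm (u x) \<le> s\<^sup>2 * (norm x * norm h)\<^sup>2 * norm (u x)"
          by (intro mult_right_mono mult_left_mono) auto
        then show ?thesis by (simp add: power_mult_distrib ac_simps)
      qed
      finally show "norm (rot J (s * (x \<bullet> y)) (rot J (s * (x \<bullet> h)) (u x) - u x - (s * (x \<bullet> h)) *\<^sub>R J (u x)))
        \<le> (s\<^sup>2 * (norm h)\<^sup>2) * (norm x ^ 2 * norm (u x))" by simp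
    qed auto
    also have "\<dots> = s\<^sup>2 * K * (norm h)\<^sup>2" by (simp add: K_def)
    finally show ?thesis .
  qed
  show ?thesis
    unfolding has_derivative_at
  proof
    show "bounded_linear ?D" using lin by (simp add: linear_conv_bounded_linear)
    show "(\<lambda>h. norm (osc J s u (y + h) - osc J s u y - ?D h) / norm h) \<midarrow>0\<rightarrow> 0"
    proof (rule tendsto_sandwich[of "\<lambda>_. 0" _ _ "\<lambda>h. s\<^sup>2 * K * norm h"])
      show "\<forall>\<^sub>F h in at 0. norm (osc J s u (y + h) - osc J s u y - ?D h) / norm h \<le> s\<^sup>2 * K * norm h"
      proof (rule eventually_at_filter[THEN iffD2], rule always_eventually, intro allI impI)
        fix h :: "real^'n" assume "h \<noteq> 0"
        then show "norm (osc J s u (y + h) - osc J s u y - ?D h) / norm h \<le> s\<^sup>2 * K * norm h"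
          using est[of h] by (simp add: pos_divide_le_eq power2_eq_square mult.assoc)
      qed
      show "((\<lambda>h::real^'n. s\<^sup>2 * K * norm h) \<longlongrightarrow> 0) (at 0)"
        by (auto intro!: tendsto_eq_intros)
    qed auto
  qed
qed

lemma osc_partial_deriv:
  "rapid u \<Longrightarrow> partial_deriv i (osc J s u) = osc J s (\<lambda>x. (s * x $ i) *\<^sub>R J (u x))"
  by (rule ext, subst partial_deriv_eqI[OF osc_has_derivative]) (auto simp: inner_axis)

lemma rapid_coord: "rapid u \<Longrightarrow> rapid (\<lambda>x. (s * x $ i) *\<^sub>R J (u x))"
  using rapid_coord_J[of u s "axis i 1"] by (simp add: inner_axis)

lemma osc_smooth:
  assumes "rapid u" shows "smooth_on UNIV (osc J s u)"
  unfolding smooth_on_def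
proof
  fix m show "Ck UNIV m (osc J s u)"
    using assms
  proof (induction m arbitrary: u)
    case (Suc m)
    have "osc J s u differentiable_on UNIV"
      by (intro differentiable_onI) (auto intro: osc_has_derivative[OF Suc.prems])
    then show ?case using Suc.IH[OF rapid_coord[OF Suc.prems]] by (simp add: osc_partial_deriv[OF Suc.prems])
  qed simp
qed

text \<open>The multiplier of an iterated derivative: the product of the factors s i x_j over the
  list, the powers of i being iterates of \<open>J\<close>.\<close>

definition mono_J :: "real \<Rightarrow> 'n list \<Rightarrow> real^'n::finite \<Rightarrow> 'e \<Rightarrow> 'e" where
  "mono_J s is x v = prod_list (map (\<lambda>i. s * x $ i) is) *\<^sub>R (J ^^ length is) v"

lemma mono_J_Cons: "mono_J s (i # is) x v = (s * x $ i) *\<^sub>R J (mono_J s is x v)"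
  by (simp add: mono_J_def J_scale mult.commute)

lemma norm_mono_J: "norm (mono_J s is x v) = \<bar>prod_list (map (\<lambda>i. s * x $ i) is)\<bar> * norm v"
proof -
  have "norm ((J ^^ m) v) = norm v" for m by (induction m) auto
  then show ?thesis by (simp add: mono_J_def)
qed

lemma rapid_mono_J: "rapid u \<Longrightarrow> rapid (\<lambda>x. mono_J s is x (u x))"
proof (induction "is")
  case Nil
  then show ?case by (simp add: mono_J_def)
next
  case (Cons i js)
  then show ?case unfolding mono_J_Cons by (intro rapid_coord) auto
qed

lemma osc_partial_derivs:
  assumes "rapid u" shows "partial_derivs is (osc J s u) = osc J s (\<lambda>x. mono_J s is x (u x))"
proof (induction "is")
  case Nil
  then show ?case by (simp add: mono_J_def)
next
  case (Cons i js)
  show ?case unfolding partial_derivs_Cons Cons mono_J_Cons by (rule osc_partial_deriv[OF rapid_mono_J[OF assms]])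
qed

text \<open>Integration by parts: the product of the phase and \<open>u\<close> is again a test
  function, so its partial derivative has integral 0. The phase is differentiated through its cosine
  and sine parts.\<close>

lemma osc_of_partial_deriv:
  fixes u :: "real^'n::finite \<Rightarrow> 'e"
  assumes u: "u \<in> test_functions"
  shows "osc J s (partial_deriv i u) y = (- s * y $ i) *\<^sub>R J (osc J s u y)"
proof -
  have us: "smooth_on UNIV u" using u by (simp add: test_functions_iff)
  let ?c = "\<lambda>x. cos (s * (x \<bullet> y))" and ?s = "\<lambda>x. sin (s * (x \<bullet> y))"
  have q: "smooth_on UNIV (\<lambda>x::real^'n. s * (x \<bullet> y))"
    using smooth_on_inner[OF open_UNIV, of "s *\<^sub>R y"] by (simp add: inner_commute)
  have Js: "smooth_on UNIV (\<lambda>x. J (u x))" by (rule smooth_on_linear[OF open_UNIV J_bounded_linear us])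
  have c: "smooth_on UNIV ?c" and sn: "smooth_on UNIV ?s"
    using smooth_on_cos[OF open_UNIV q] smooth_on_sin[OF open_UNIV q] .
  have cu: "smooth_on UNIV (\<lambda>x. ?c x *\<^sub>R u x)" and su: "smooth_on UNIV (\<lambda>x. ?s x *\<^sub>R J (u x))"
    by (rule smooth_on_scaleR[OF open_UNIV c us] smooth_on_scaleR[OF open_UNIV sn Js])+
  obtain R where R: "\<And>x. norm x > R \<Longrightarrow> u x = 0" using u by (auto simp: test_functions_iff)
  have test: "(\<lambda>x. rot J (s * (x \<bullet> y)) (u x)) \<in> test_functions"
    unfolding test_functions_iff rot_def
    using smooth_on_add[OF open_UNIV cu su] R J_linear by (auto simp: linear_0 intro!: exI[of _ R])
  have pc: "partial_deriv i ?c x = - (s * y $ i) * ?s x" and ps: "partial_deriv i ?s x = (s * y $ i) * ?c x" for x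
  proof -
    have "(?c has_derivative (\<lambda>h. - ((s * (h \<bullet> y)) * ?s x))) (at x)" by (auto intro!: derivative_eq_intros)
    from partial_deriv_eqI[OF this, of i] show "partial_deriv i ?c x = - (s * y $ i) * ?s x" by (simp add: inner_axis')
    have "(?s has_derivative (\<lambda>h. (s * (h \<bullet> y)) * ?c x)) (at x)" by (auto intro!: derivative_eq_intros)
    from partial_deriv_eqI[OF this, of i] show "partial_deriv i ?s x = (s * y $ i) * ?c x" by (simp add: inner_axis')
  qed
  have pd: "partial_deriv i (\<lambda>x. rot J (s * (x \<bullet> y)) (u x)) x =
      rot J (s * (x \<bullet> y)) (partial_deriv i u x) + (s * y $ i) *\<^sub>R J (rot J (s * (x \<bullet> y)) (u x))" for x
  proof -
    have "partial_deriv i (\<lambda>x. rot J (s * (x \<bullet> y)) (u x)) x =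
      (?c x *\<^sub>R partial_deriv i u x + partial_deriv i ?c x *\<^sub>R u x) +
      (?s x *\<^sub>R J (partial_deriv i u x) + partial_deriv i ?s x *\<^sub>R J (u x))"
      unfolding rot_def
      by (simp only: partial_deriv_add[OF open_UNIV cu su UNIV_I]
          partial_deriv_bilinear[OF open_UNIV bounded_bilinear_scaleR c us UNIV_I]
          partial_deriv_bilinear[OF open_UNIV bounded_bilinear_scaleR sn Js UNIV_I]
          partial_deriv_linear[OF open_UNIV J_bounded_linear us UNIV_I])
    then show ?thesis by (simp add: pc ps rot_def J_add J_scale algebra_simps)
  qed
  have int: "integrable lborel u" "integrable lborel (partial_deriv i u)"
    using u test_function_partial test_function_integrable by blast+
  have "0 = (LINT x|lborel. rot J (s * (x \<bullet> y)) (partial_deriv i u x) + (s * y $ i) *\<^sub>R J (rot J (s * (x \<bullet> y)) (u x)))"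
    using integral_partial_deriv_test[OF test, of i] by (simp only: pd)
  also have "\<dots> = osc J s (partial_deriv i u) y + (s * y $ i) *\<^sub>R J (osc J s u y)"
    unfolding osc_def
    by (subst Bochner_Integration.integral_add)
      (auto intro!: osc_integrable int integrable_bounded_linear[OF J_bounded_linear] simp: integral_bounded_linear[OF J_bounded_linear osc_integrable[OF int(1)]])
  finally show ?thesis by (simp add: eq_neg_iff_add_eq_0)
qed

lemma osc_of_partial_derivs:
  assumes u: "u \<in> test_functions"
  shows "osc J s (partial_derivs is u) y = mono_J (- s) is y (osc J s u y)"
proof (induction "is")
  case Nil
  show ?case by (simp add: mono_J_def)
next
  case (Cons i js)
  show ?case
    unfolding partial_derivs_Cons mono_J_Cons
    by (simp add: osc_of_partial_deriv[OF test_function_partial_derivs[OF u]] Cons)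
qed

text \<open>A monomial times the transform has the norm of the transform of a derivative of
  \<open>u\<close>, which is bounded by an L1 norm; |s| = 1 keeps the monomials unscaled.\<close>

lemma osc_test_rapid:
  fixes u :: "real^'n::finite \<Rightarrow> 'e"
  assumes u: "u \<in> test_functions" and s: "\<bar>s\<bar> = 1"
  shows "rapid (osc J s u)"
proof (rule rapid_if_bounded)
  show "osc J s u \<in> borel_measurable borel" using test_function_measurable[OF u] by (rule osc_measurable)
  fix "is" :: "'n list"
  have "\<bar>prod_list (map (\<lambda>i. y $ i) is)\<bar> * norm (osc J s u y) \<le> (LINT x|lborel. norm (partial_derivs is u x))" for y
  proof -
    have "\<bar>prod_list (map (\<lambda>i. - s * y $ i) is)\<bar> = \<bar>prod_list (map (\<lambda>i. y $ i) is)\<bar>"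
      by (induction "is") (auto simp: abs_mult s)
    then have "\<bar>prod_list (map (\<lambda>i. y $ i) is)\<bar> * norm (osc J s u y) = norm (osc J s (partial_derivs is u) y)"
      by (simp add: osc_of_partial_derivs[OF u] norm_mono_J)
    then show ?thesis using norm_osc_le[of s "partial_derivs is u" y] by simp
  qed
  then show "\<exists>C. \<forall>y. \<bar>prod_list (map (\<lambda>i. y $ i) is)\<bar> * norm (osc J s u y) \<le> C" by blast
qed

end

section \<open>Gaussians and Fourier inversion\<close>

lemma gaussian_prod:
  "exp (- (e\<^sup>2 * (norm (x::real^'n::finite))\<^sup>2 / 2)) = (\<Prod>i\<in>UNIV. exp (- (e * x $ i)\<^sup>2 / 2))"
proof -
  have "(norm x)\<^sup>2 = (\<Sum>i\<in>UNIV. (x $ i)\<^sup>2)" by (simp add: norm_vec_def L2_set_def sum_nonneg)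
  then have "- (e\<^sup>2 * (norm x)\<^sup>2 / 2) = (\<Sum>i\<in>UNIV. - (e * x $ i)\<^sup>2 / 2)"
    by (simp add: sum_distrib_left sum_negf sum_divide_distrib power_mult_distrib)
  then show ?thesis by (simp add: exp_sum)
qed

text \<open>The characteristic function of the standard normal distribution after the substitution x
  = e t.\<close>

lemma gaussian_transform_real:
  assumes e: "e > 0"
  shows "has_bochner_integral lborel (\<lambda>t::real. iexp (a * t) * complex_of_real (exp (- (e * t)\<^sup>2 / 2)))
     (complex_of_real (sqrt (2 * pi) / e * exp (- (a / e)\<^sup>2 / 2)))"
proof -
  let ?f = "\<lambda>x. std_normal_density x *\<^sub>R iexp (a / e * x)"
  have i: "integrable lborel ?f"
    by (rule Bochner_Integration.integrable_bound[OF integrable_normal_density[where \<mu> = 0 and \<sigma> = 1]]) auto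
  have "(LINT x|lborel. ?f x) = (LINT x|std_normal_distribution. iexp (a / e * x))"
    by (subst integral_density) auto
  also have "\<dots> = complex_of_real (exp (- ((a / e)\<^sup>2) / 2))"
    using fun_cong[OF char_std_normal_distribution, of "a / e"] by (simp add: char_def)
  finally have "has_bochner_integral lborel ?f (complex_of_real (exp (- (a / e)\<^sup>2 / 2)))"
    using i by (simp add: has_bochner_integral_iff)
  then have "has_bochner_integral lborel (\<lambda>t. ?f (0 + e * t)) (complex_of_real (exp (- (a / e)\<^sup>2 / 2)) /\<^sub>R \<bar>e\<bar>)"
    using e by (subst lborel_has_bochner_integral_real_affine_iff[symmetric]) auto
  then have "has_bochner_integral lborel (\<lambda>t. sqrt (2 * pi) *\<^sub>R ?f (0 + e * t)) (sqrt (2 * pi) *\<^sub>R (complex_of_real (exp (- (a / e)\<^sup>2 / 2)) /\<^sub>R \<bar>e\<bar>))"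
    by (intro has_bochner_integral_scaleR_right)
  moreover have "sqrt (2 * pi) *\<^sub>R ?f (0 + e * t) = iexp (a * t) * complex_of_real (exp (- (e * t)\<^sup>2 / 2))" for t
  proof -
    have eq: "0 + e * t = e * t" "a / e * (e * t) = a * t" using e by simp_all
    have key: "c *\<^sub>R ((1 / c * E) *\<^sub>R Z) = Z * complex_of_real E" if "c \<noteq> 0" for c E Z
      using that by (simp add: scaleR_conv_of_real)
    show ?thesis unfolding eq std_normal_density_def by (rule key) simp
  qed
  moreover have "sqrt (2 * pi) *\<^sub>R (complex_of_real (exp (- (a / e)\<^sup>2 / 2)) /\<^sub>R \<bar>e\<bar>) = complex_of_real (sqrt (2 * pi) / e * exp (- (a / e)\<^sup>2 / 2))"
  proof -
    have "c *\<^sub>R (complex_of_real X /\<^sub>R \<bar>e\<bar>) = complex_of_real (c / e * X)" for c X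
      using e by (simp add: scaleR_conv_of_real field_simps)
    then show ?thesis .
  qed
  ultimately show ?thesis by (simp only:)
qed

definition gauss :: "real \<Rightarrow> real^'n::finite \<Rightarrow> real" where
  "gauss e x = exp (- (e\<^sup>2 * (norm x)\<^sup>2 / 2))"

lemma gauss_measurable [measurable]: "gauss e \<in> borel_measurable borel"
  unfolding gauss_def by measurable

lemma gauss_bounds: "0 < gauss e x" "gauss e x \<le> 1"
  by (auto simp: gauss_def)

lemma gaussian_transform_complex:
  fixes \<xi> :: "real^'n::finite"
  assumes e: "e > 0"
  shows "has_bochner_integral lborel (\<lambda>x. complex_of_real (gauss e x) * cis (x \<bullet> \<xi>))
    (complex_of_real ((sqrt (2 * pi) / e) ^ CARD('n) * gauss (1 / e) \<xi>))"
proof -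
  let ?f = "\<lambda>i t. iexp (\<xi> $ i * t) * complex_of_real (exp (- (e * t)\<^sup>2 / 2))"
  have f: "integrable lborel (?f i)" for i using gaussian_transform_real[OF e, of "\<xi> $ i"] by (simp add: has_bochner_integral_iff)
  have eq: "(\<Prod>i\<in>UNIV. ?f i (x $ i)) = complex_of_real (gauss e x) * cis (x \<bullet> \<xi>)" for x
  proof -
    have "x \<bullet> \<xi> = (\<Sum>i\<in>UNIV. \<xi> $ i * x $ i)" by (simp add: inner_vec_def mult.commute)
    then have "cis (x \<bullet> \<xi>) = (\<Prod>i\<in>UNIV. iexp (\<xi> $ i * x $ i))"
      by (simp add: cis_conv_exp exp_sum[symmetric] sum_distrib_left)
    moreover have "complex_of_real (gauss e x) = (\<Prod>i\<in>UNIV. complex_of_real (exp (- (e * x $ i)\<^sup>2 / 2)))"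
      unfolding gauss_def gaussian_prod by simp
    ultimately show ?thesis by (simp add: prod.distrib mult.commute)
  qed
  have "(LINT x|lborel. (\<Prod>i\<in>UNIV. ?f i ((x::real^'n) $ i))) = (\<Prod>i\<in>UNIV. complex_of_real (sqrt (2 * pi) / e * exp (- (\<xi> $ i / e)\<^sup>2 / 2)))"
    unfolding integral_vec_prod(2)[of ?f, OF f] using gaussian_transform_real[OF e] by (simp add: has_bochner_integral_iff)
  also have "\<dots> = complex_of_real ((sqrt (2 * pi) / e) ^ CARD('n) * gauss (1 / e) \<xi>)"
  proof -
    have "(\<Prod>i\<in>UNIV. complex_of_real (c * g i)) = complex_of_real (c ^ CARD('n) * (\<Prod>i\<in>UNIV. g i))" for c and g :: "'n \<Rightarrow> real"
      by (simp add: prod.distrib)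
    moreover have "gauss (1 / e) \<xi> = (\<Prod>i\<in>UNIV. exp (- (\<xi> $ i / e)\<^sup>2 / 2))"
      unfolding gauss_def gaussian_prod by simp
    ultimately show ?thesis by (simp only:)
  qed
  finally show ?thesis
    using integral_vec_prod(1)[of ?f, OF f] unfolding eq by (simp add: has_bochner_integral_iff)
qed

lemma gauss_integral:
  assumes "e > 0"
  shows "integrable lborel (gauss e :: real^'n::finite \<Rightarrow> real)" and "(LINT x|lborel. gauss e (x::real^'n)) = (sqrt (2 * pi) / e) ^ CARD('n)"
proof -
  have "has_bochner_integral lborel (\<lambda>x::real^'n. Re (complex_of_real (gauss e x) * cis (x \<bullet> 0)))
    (Re (complex_of_real ((sqrt (2 * pi) / e) ^ CARD('n) * gauss (1 / e) (0 :: real^'n))))"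
    by (rule has_bochner_integral_Re[OF gaussian_transform_complex[OF assms]])
  moreover have "gauss (1 / e) (0 :: real^'n) = 1" by (simp add: gauss_def)
  ultimately have "has_bochner_integral lborel (gauss e :: real^'n \<Rightarrow> real) ((sqrt (2 * pi) / e) ^ CARD('n))"
    by simp
  then show "integrable lborel (gauss e :: real^'n \<Rightarrow> real)" "(LINT x|lborel. gauss e (x::real^'n)) = (sqrt (2 * pi) / e) ^ CARD('n)"
    by (simp_all add: has_bochner_integral_iff)
qed

lemma integral_lborel_scale:
  fixes f :: "'a::euclidean_space \<Rightarrow> 'b::{banach, second_countable_topology}"
  assumes [measurable]: "f \<in> borel_measurable borel" and c: "c > 0"
  shows "(LINT x|lborel. f x) = c ^ DIM('a) *\<^sub>R (LINT x|lborel. f (c *\<^sub>R x))"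
proof -
  have "(LINT x|lborel. f x) = (LINT x|density (distr lborel borel (\<lambda>x. 0 + c *\<^sub>R x)) (\<lambda>_. \<bar>c\<bar> ^ DIM('a)). f x)"
    using lborel_affine[of c "0::'a"] c by simp
  also have "\<dots> = c ^ DIM('a) *\<^sub>R (LINT x|lborel. f (c *\<^sub>R x))"
    using c by (subst integral_density) (auto simp: integral_distr)
  finally show ?thesis .
qed

lemma integral_lborel_shift:
  fixes f :: "'a::euclidean_space \<Rightarrow> 'b::{banach, second_countable_topology}"
  assumes [measurable]: "f \<in> borel_measurable borel"
  shows "(LINT x|lborel. f (x + a)) = (LINT x|lborel. f x)"
proof -
  have "(\<lambda>x. x + a) = (+) a" by (auto simp: add.commute)
  then have *: "lborel = distr lborel borel (\<lambda>x. x + a)" using lborel_distr_plus[of a] by simp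
  show ?thesis by (subst (2) *) (simp add: integral_distr)
qed

context
  fixes J :: "'e::euclidean_space \<Rightarrow> 'e"
  assumes J: "complex_structure J"
begin

lemma gauss_rot_integral:
  fixes \<xi> :: "real^'n::finite"
  assumes e: "e > 0"
  shows "(LINT x|lborel. gauss e x *\<^sub>R rot J (x \<bullet> \<xi>) v) = ((sqrt (2 * pi) / e) ^ CARD('n) * gauss (1 / e) \<xi>) *\<^sub>R v"
proof -
  have "bounded_linear (\<lambda>z. cscale J z v)"
    unfolding cscale_def
    by (intro bounded_linear_add bounded_linear_scaleR_const bounded_linear_Re bounded_linear_Im)
  from has_bochner_integral_bounded_linear[OF this gaussian_transform_complex[OF e, of \<xi>]]
  have "(LINT x|lborel. cscale J (complex_of_real (gauss e x) * cis (x \<bullet> \<xi>)) v) =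
    cscale J (complex_of_real ((sqrt (2 * pi) / e) ^ CARD('n) * gauss (1 / e) \<xi>)) v"
    by (rule has_bochner_integral_integral_eq)
  moreover have "cscale J (complex_of_real (gauss e x) * cis (x \<bullet> \<xi>)) v = gauss e x *\<^sub>R rot J (x \<bullet> \<xi>) v" for x
    by (simp add: cscale_def rot_def scaleR_add_right)
  ultimately show ?thesis by (simp add: cscale_def)
qed

text \<open>Fubini's theorem moves the transform from \<open>h\<close> to the Gaussian, whose
  transform is explicit. This serves Fourier inversion and, later, the averaging of the estimate
  over translates.\<close>

lemma gauss_osc:
  fixes h :: "real^'n::finite \<Rightarrow> 'e"
  assumes h: "integrable lborel h" and e: "e > 0" and s: "\<bar>s\<bar> = 1"
  shows "(LINT y|lborel. gauss e y *\<^sub>R osc J s h y) = (LINT x|lborel. ((sqrt (2 * pi) / e) ^ CARD('n) * gauss (1 / e) x) *\<^sub>R h x)"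
proof -
  have [measurable]: "h \<in> borel_measurable borel" using h by auto
  note rot_measurable[OF J, measurable]
  let ?F = "\<lambda>x y. gauss e y *\<^sub>R rot J (s * (x \<bullet> y)) (h x)"
  have m: "case_prod ?F \<in> borel_measurable (lborel \<Otimes>\<^sub>M lborel)" by measurable
  have i: "integrable (lborel \<Otimes>\<^sub>M lborel) (case_prod ?F)"
  proof (rule lborel_pair.Fubini_integrable[OF m])
    show "integrable lborel (\<lambda>x. LINT y|lborel. norm (case_prod ?F (x, y)))"
      using h by (simp add: norm_rot[OF J] abs_of_pos[OF gauss_bounds(1)])
    have "integrable lborel (\<lambda>y. case_prod ?F (x, y))" for x
    proof -
      have "integrable lborel (\<lambda>y::real^'n. gauss e y *\<^sub>R norm (h x))"
        by (intro integrable_scaleR_left gauss_integral e)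
      then show "integrable lborel (\<lambda>y. case_prod ?F (x, y))"
        by (rule Bochner_Integration.integrable_bound) (auto simp: norm_rot[OF J])
    qed
    then show "AE x in lborel. integrable lborel (\<lambda>y. case_prod ?F (x, y))" by simp
  qed
  have "(LINT y|lborel. gauss e y *\<^sub>R osc J s h y) = (LINT y|lborel. LINT x|lborel. ?F x y)"
    unfolding osc_def by simp
  also have "\<dots> = (LINT x|lborel. LINT y|lborel. ?F x y)" by (rule lborel_pair.Fubini_integral[OF i])
  also have "(\<lambda>x. LINT y|lborel. ?F x y) = (\<lambda>x. ((sqrt (2 * pi) / e) ^ CARD('n) * gauss (1 / e) x) *\<^sub>R h x)"
  proof
    fix x :: "real^'n"
    have "s * s = 1" using s by (metis abs_mult_self_eq mult_1)
    then have "gauss (1 / e) (s *\<^sub>R x) = gauss (1 / e) x" using s by (simp add: gauss_def)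
    then show "(LINT y|lborel. ?F x y) = ((sqrt (2 * pi) / e) ^ CARD('n) * gauss (1 / e) x) *\<^sub>R h x"
      using gauss_rot_integral[OF e, of "s *\<^sub>R x" "h x"] by (simp add: inner_commute)
  qed
  finally show ?thesis .
qed

text \<open>Gauss summability: as the Gaussian factor on the frequency side flattens, its transform
  concentrates at \<open>x\<close>. Of the constant (2 pi)^n one square root stems from the
  transform of the Gaussian and the other from the total mass of \<open>gauss 1\<close>.\<close>

theorem osc_inversion:
  fixes u :: "real^'n::finite \<Rightarrow> 'e"
  assumes u: "u \<in> test_functions" and s: "\<bar>s\<bar> = 1"
  shows "osc J (- s) (osc J s u) x = (2 * pi) ^ CARD('n) *\<^sub>R u x"
proof -
  note rot_measurable[OF J, measurable] test_function_measurable[OF u, measurable]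
  have om[measurable]: "osc J s u \<in> borel_measurable borel" by (rule osc_measurable[OF J]) simp
  have oi: "integrable lborel (osc J s u)" by (rule rapid_integrable[OF osc_test_rapid[OF J u s]])
  let ?e = "\<lambda>m::nat. 1 / real (Suc m)"
  have e0: "?e \<longlonglongrightarrow> 0" using LIMSEQ_inverse_real_of_nat by (simp add: inverse_eq_divide)
  have gl: "(\<lambda>m. gauss (?e m) y) \<longlonglongrightarrow> 1" for y :: "real^'n"
  proof -
    have "(\<lambda>m. exp (- ((?e m)\<^sup>2 * (norm y)\<^sup>2 / 2))) \<longlonglongrightarrow> exp (- (0\<^sup>2 * (norm y)\<^sup>2 / 2))"
      by (intro tendsto_intros e0) auto
    then show ?thesis by (simp add: gauss_def)
  qed
  let ?v = "\<lambda>z. u (z + x)"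
  have vi: "integrable lborel ?v"
  proof -
    have "?v \<in> test_functions"
      using u smooth_on_affine[of u x 1] unfolding test_functions_iff
    proof (safe, goal_cases)
      case (1 R)
      then show ?case by (simp add: add.commute)
    next
      case (2 R)
      have "norm z > R + norm x \<Longrightarrow> norm (z + x) > R" for z using norm_diff_ineq[of z x] by linarith
      then show ?case using 2 by blast
    qed
    then show ?thesis by (rule test_function_integrable)
  qed
  \<comment> \<open>The phase is absorbed into a translation of \<open>u\<close>, which turns
    evaluation at \<open>x\<close> into evaluation at 0.\<close>
  have shift: "rot J (- s * (y \<bullet> x)) (osc J s u y) = osc J s ?v y" for y
  proof -
    have "osc J s ?v y = (LINT z|lborel. rot J (s * (((z + x) - x) \<bullet> y)) (u (z + x)))" by (simp add: osc_def)
    also have "\<dots> = (LINT z|lborel. rot J (s * ((z - x) \<bullet> y)) (u z))"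
      by (rule integral_lborel_shift[of "\<lambda>z. rot J (s * ((z - x) \<bullet> y)) (u z)"]) measurable
    also have "\<dots> = (LINT z|lborel. rot J (- s * (y \<bullet> x)) (rot J (s * (z \<bullet> y)) (u z)))"
      unfolding rot_add[OF J, symmetric] by (simp add: inner_diff_left inner_commute algebra_simps)
    also have "\<dots> = rot J (- s * (y \<bullet> x)) (osc J s u y)"
      unfolding osc_def by (rule integral_bounded_linear[OF rot_bounded_linear[OF J] osc_integrable[OF J test_function_integrable[OF u]]])
    finally show ?thesis by simp
  qed
  have "(\<lambda>m. LINT y|lborel. gauss (?e m) y *\<^sub>R rot J (- s * (y \<bullet> x)) (osc J s u y)) \<longlonglongrightarrow>
    (LINT y|lborel. rot J (- s * (y \<bullet> x)) (osc J s u y))"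
  proof (rule integral_dominated_convergence[where w = "\<lambda>y. norm (osc J s u y)"])
    show "AE y in lborel. (\<lambda>m. gauss (?e m) y *\<^sub>R rot J (- s * (y \<bullet> x)) (osc J s u y)) \<longlonglongrightarrow> rot J (- s * (y \<bullet> x)) (osc J s u y)"
      using tendsto_scaleR[OF gl tendsto_const] by (intro AE_I2) fastforce
    show "AE y in lborel. norm (gauss (?e m) y *\<^sub>R rot J (- s * (y \<bullet> x)) (osc J s u y)) \<le> norm (osc J s u y)" for m
      by (intro AE_I2) (simp add: norm_rot[OF J] abs_of_pos[OF gauss_bounds(1)] mult_left_le_one_le gauss_bounds less_imp_le)
  qed (use oi in auto)
  then have L: "(\<lambda>m. LINT y|lborel. gauss (?e m) y *\<^sub>R rot J (- s * (y \<bullet> x)) (osc J s u y)) \<longlonglongrightarrow> osc J (- s) (osc J s u) x"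
    by (simp add: osc_def[of J "- s"])
  \<comment> \<open>The substitution z = E w replaces the concentrating Gaussian by a fixed one, so
    that dominated convergence applies with the bound of \<open>u\<close>.\<close>
  have R1: "(LINT y|lborel. gauss E y *\<^sub>R rot J (- s * (y \<bullet> x)) (osc J s u y)) =
     sqrt (2 * pi) ^ CARD('n) *\<^sub>R (LINT w|lborel. gauss 1 w *\<^sub>R u (E *\<^sub>R w + x))" if pos: "E > 0" for E
  proof -
    have g: "gauss (1 / E) (E *\<^sub>R w) = gauss 1 w" for w :: "real^'n"
      using pos by (simp add: gauss_def power_mult_distrib power_divide)
    have "(LINT y|lborel. gauss E y *\<^sub>R rot J (- s * (y \<bullet> x)) (osc J s u y)) =
      (LINT z|lborel. ((sqrt (2 * pi) / E) ^ CARD('n) * gauss (1 / E) z) *\<^sub>R u (z + x))"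
      unfolding shift by (rule gauss_osc[OF vi pos s])
    also have "\<dots> = E ^ CARD('n) *\<^sub>R (LINT w|lborel. ((sqrt (2 * pi) / E) ^ CARD('n) * gauss 1 w) *\<^sub>R u (E *\<^sub>R w + x))"
      by (subst integral_lborel_scale[OF _ pos]) (auto simp: g)
    also have "\<dots> = E ^ CARD('n) *\<^sub>R (LINT w|lborel. (sqrt (2 * pi) / E) ^ CARD('n) *\<^sub>R (gauss 1 w *\<^sub>R u (E *\<^sub>R w + x)))"
      by simp
    also have "\<dots> = (E ^ CARD('n) * (sqrt (2 * pi) / E) ^ CARD('n)) *\<^sub>R (LINT w|lborel. gauss 1 w *\<^sub>R u (E *\<^sub>R w + x))"
      by (simp only: integral_scaleR_right) (simp only: scaleR_scaleR)
    also have "E ^ CARD('n) * (sqrt (2 * pi) / E) ^ CARD('n) = sqrt (2 * pi) ^ CARD('n)"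
      using pos by (simp add: power_divide)
    finally show ?thesis .
  qed
  have R1': "(LINT y|lborel. gauss (?e m) y *\<^sub>R rot J (- s * (y \<bullet> x)) (osc J s u y)) =
     sqrt (2 * pi) ^ CARD('n) *\<^sub>R (LINT w|lborel. gauss 1 w *\<^sub>R u (?e m *\<^sub>R w + x))" for m
    by (rule R1) simp
  obtain C where C: "C \<ge> 0" "\<And>z. norm (u z) \<le> C" using test_function_bounded[OF u] by metis
  have "(\<lambda>m. LINT w|lborel. gauss 1 w *\<^sub>R u (?e m *\<^sub>R w + x)) \<longlonglongrightarrow> (LINT w|lborel. gauss 1 (w::real^'n) *\<^sub>R u x)"
  proof (rule integral_dominated_convergence[where w = "\<lambda>w::real^'n. gauss 1 w * C"])
    show "integrable lborel (\<lambda>w::real^'n. gauss 1 w * C)" by (intro integrable_mult_left gauss_integral) simp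
    show "AE w in lborel. (\<lambda>m. gauss 1 w *\<^sub>R u (?e m *\<^sub>R w + x)) \<longlonglongrightarrow> gauss 1 w *\<^sub>R u x"
    proof (intro AE_I2 tendsto_scaleR tendsto_const)
      fix w
      have "(\<lambda>m. ?e m *\<^sub>R w + x) \<longlonglongrightarrow> 0 *\<^sub>R w + x" by (intro tendsto_intros e0)
      then have "(\<lambda>m. ?e m *\<^sub>R w + x) \<longlonglongrightarrow> x" by simp
      then show "(\<lambda>m. u (?e m *\<^sub>R w + x)) \<longlonglongrightarrow> u x"
        by (rule continuous_on_tendsto_compose[OF test_function_continuous[OF u]]) auto
    qed
    show "AE w in lborel. norm (gauss 1 w *\<^sub>R u (?e m *\<^sub>R w + x)) \<le> gauss 1 w * C" for m
      by (intro AE_I2) (simp add: abs_of_pos[OF gauss_bounds(1)] mult_left_mono C gauss_bounds less_imp_le)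
  qed auto
  moreover have "(LINT w|lborel. gauss 1 (w::real^'n) *\<^sub>R u x) = sqrt (2 * pi) ^ CARD('n) *\<^sub>R u x"
    using gauss_integral[of 1, where 'n = 'n] by simp
  ultimately have "(\<lambda>m. LINT y|lborel. gauss (?e m) y *\<^sub>R rot J (- s * (y \<bullet> x)) (osc J s u y)) \<longlonglongrightarrow>
    sqrt (2 * pi) ^ CARD('n) *\<^sub>R (sqrt (2 * pi) ^ CARD('n) *\<^sub>R u x)"
    unfolding R1' by (intro tendsto_scaleR tendsto_const) simp
  moreover have "sqrt (2 * pi) ^ CARD('n) *\<^sub>R (sqrt (2 * pi) ^ CARD('n) *\<^sub>R u x) = (2 * pi) ^ CARD('n) *\<^sub>R u x"
  proof -
    have "sqrt (2 * pi) ^ CARD('n) * sqrt (2 * pi) ^ CARD('n) = (2 * pi) ^ CARD('n)"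
      by (subst power_mult_distrib[symmetric]) simp
    then show ?thesis by (simp only: scaleR_scaleR)
  qed
  ultimately show ?thesis using LIMSEQ_unique[OF L] by simp
qed

lemma osc_scale:
  fixes u :: "real^'n::finite \<Rightarrow> 'e"
  assumes [measurable]: "u \<in> borel_measurable borel" and c: "c > 0"
  shows "osc J s (\<lambda>x. u ((1 / c) *\<^sub>R x)) y = c ^ CARD('n) *\<^sub>R osc J s u (c *\<^sub>R y)"
proof -
  note rot_measurable[OF J, measurable]
  show ?thesis
    unfolding osc_def using c by (subst integral_lborel_scale[OF _ c]) auto
qed

text \<open>The factor c^n from scaling the transform is cancelled by the Jacobian. Hence the
  dilated bumps in the necessity proof have transforms of one and the same L1 norm.\<close>

lemma osc_scale_L1:
  fixes u :: "real^'n::finite \<Rightarrow> 'e"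
  assumes [measurable]: "u \<in> borel_measurable borel" and c: "c > 0"
  shows "(LINT y|lborel. norm (osc J s (\<lambda>x. u ((1 / c) *\<^sub>R x)) y)) = (LINT y|lborel. norm (osc J s u y))"
proof -
  note osc_measurable[OF J, measurable]
  show ?thesis
    unfolding osc_scale[OF assms] using c by (subst (2) integral_lborel_scale[OF _ c]) auto
qed

end

section \<open>Regularity of the pseudoinverse of the symbol\<close>

definition adjb :: "('v::euclidean_space \<Rightarrow>\<^sub>L 'w::euclidean_space) \<Rightarrow> 'w \<Rightarrow>\<^sub>L 'v" where
  "adjb A = Blinfun (adjoint (blinfun_apply A))"

lemma adjb_apply: "blinfun_apply (adjb A) = adjoint (blinfun_apply A)"
  unfolding adjb_def
  by (rule bounded_linear_Blinfun_apply, unfold linear_conv_bounded_linear[symmetric],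
      rule adjoint_linear[OF bounded_linear.linear[OF blinfun.bounded_linear_right]])

lemma adjb_inner: "v \<bullet> adjb A w = A v \<bullet> w"
  by (simp add: adjb_apply adjoint_works blinfun.bounded_linear_right bounded_linear.linear)

lemma norm_adjb_le: "norm (adjb A) \<le> norm A"
proof (rule norm_blinfun_bound)
  fix w
  have "norm (adjb A w) * norm (adjb A w) = A (adjb A w) \<bullet> w"
    using adjb_inner[of "adjb A w" A w] by (simp add: dot_square_norm power2_eq_square)
  also have "\<dots> \<le> norm (A (adjb A w)) * norm w" by (rule norm_cauchy_schwarz)
  also have "\<dots> \<le> norm A * norm (adjb A w) * norm w" by (intro mult_right_mono norm_blinfun) simp
  finally have "norm (adjb A w) * norm (adjb A w) \<le> norm (adjb A w) * (norm A * norm w)" by (simp add: ac_simps)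
  then show "norm (adjb A w) \<le> norm A * norm w"
    by (cases "adjb A w = 0") auto
qed simp

lemma bounded_linear_adjb: "bounded_linear adjb"
proof (rule bounded_linear_intro[where K = 1])
  show "adjb (A + C) = adjb A + adjb C" for A C :: "('v::euclidean_space) \<Rightarrow>\<^sub>L ('w::euclidean_space)"
    by (rule blinfun_eqI, rule vector_eq_ldot[THEN iffD1])
      (simp add: inner_add_right adjb_inner blinfun.add_left inner_add_left)
  show "adjb (r *\<^sub>R A) = r *\<^sub>R adjb A" for r and A :: "('v::euclidean_space) \<Rightarrow>\<^sub>L ('w::euclidean_space)"
    by (rule blinfun_eqI, rule vector_eq_ldot[THEN iffD1])
      (simp add: adjb_inner blinfun.scaleR_left)
qed (simp add: norm_adjb_le)

text \<open>A product rule at a zero of \<open>E\<close>: continuity of \<open>C\<close> is enough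
  there, since its variation is multiplied by an increment of first order. In Wedin's identity the
  pseudoinverse whose derivative is sought stands in the place of \<open>C\<close>.\<close>

lemma has_derivative_bilinear_vanishing:
  fixes C :: "'a::real_normed_vector \<Rightarrow> 'b::real_normed_vector" and E :: "'a \<Rightarrow> 'c::real_normed_vector"
  assumes h: "bounded_bilinear h" and C: "isCont C x" and E: "(E has_derivative E') (at x)" and 0: "E x = 0"
  shows "((\<lambda>y. h (C y) (E y)) has_derivative (\<lambda>d. h (C x) (E' d))) (at x)"
proof -
  interpret h: bounded_bilinear h by fact
  obtain K where K: "K > 0" "\<And>a b. norm (h a b) \<le> norm a * norm b * K" using h.pos_bounded by blast
  have bE: "bounded_linear E'" using E by (rule has_derivative_bounded_linear)
  then obtain M where M: "M \<ge> 0" "\<And>d. norm (E' d) \<le> norm d * M" using bounded_linear.nonneg_bounded by blast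
  have lim: "((\<lambda>d. norm (E (x + d) - E x - E' d) / norm d) \<longlongrightarrow> 0) (at 0)"
    using E by (simp add: has_derivative_at)
  have Cl: "((\<lambda>d. norm (C (x + d) - C x)) \<longlongrightarrow> 0) (at 0)"
  proof -
    have "((\<lambda>d. C (x + d)) \<longlongrightarrow> C x) (at 0)" using C by (simp add: isCont_iff)
    then show ?thesis using LIM_zero tendsto_norm_zero by blast
  qed
  show ?thesis
    unfolding has_derivative_at
  proof
    show "bounded_linear (\<lambda>d. h (C x) (E' d))"
      by (rule bounded_linear_compose[OF h.bounded_linear_right bE])
    have "((\<lambda>d. (norm (C (x + d) - C x) + norm (C x)) * (norm (E (x + d) - E x - E' d) / norm d) * K + norm (C (x + d) - C x) * M * K) \<longlongrightarrow>
      (0 + norm (C x)) * 0 * K + 0 * M * K) (at 0)"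
      by (intro tendsto_intros lim Cl)
    then have up: "((\<lambda>d. (norm (C (x + d) - C x) + norm (C x)) * (norm (E (x + d) - E x - E' d) / norm d) * K + norm (C (x + d) - C x) * M * K) \<longlongrightarrow> 0) (at 0)"
      by simp
    show "(\<lambda>d. norm (h (C (x + d)) (E (x + d)) - h (C x) (E x) - h (C x) (E' d)) / norm d) \<midarrow>0\<rightarrow> 0"
    proof (rule tendsto_sandwich[OF _ _ tendsto_const up])
      show "\<forall>\<^sub>F d in at 0. norm (h (C (x + d)) (E (x + d)) - h (C x) (E x) - h (C x) (E' d)) / norm d \<le>
        (norm (C (x + d) - C x) + norm (C x)) * (norm (E (x + d) - E x - E' d) / norm d) * K + norm (C (x + d) - C x) * M * K"
      proof (rule eventually_at_filter[THEN iffD2], rule always_eventually, intro allI impI)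
        fix d :: 'a assume d: "d \<noteq> 0"
        have "h (C (x + d)) (E (x + d)) - h (C x) (E x) - h (C x) (E' d) =
          h (C (x + d)) (E (x + d) - E x - E' d) + h (C (x + d) - C x) (E' d)"
          by (simp add: 0 h.zero_right h.diff_left h.diff_right)
        also have "norm \<dots> \<le> norm (C (x + d)) * norm (E (x + d) - E x - E' d) * K + norm (C (x + d) - C x) * norm (E' d) * K"
          by (intro norm_triangle_le add_mono K)
        also have "\<dots> \<le> (norm (C (x + d) - C x) + norm (C x)) * norm (E (x + d) - E x - E' d) * K + norm (C (x + d) - C x) * (norm d * M) * K"
          using K(1) M(2)[of d] norm_triangle_sub[of "C (x + d)" "C x"]
          by (intro add_mono mult_right_mono mult_left_mono) auto
        finally show "norm (h (C (x + d)) (E (x + d)) - h (C x) (E x) - h (C x) (E' d)) / norm d \<le>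
        (norm (C (x + d) - C x) + norm (C x)) * (norm (E (x + d) - E x - E' d) / norm d) * K + norm (C (x + d) - C x) * M * K"
          using d by (simp add: divide_simps) (simp add: algebra_simps)
      qed
    qed auto
  qed
qed

section \<open>The pseudoinverse of the symbol: continuity and smoothness off the origin\<close>

locale const_rank_operator =
  fixes B :: "'n::finite multi_index \<Rightarrow> 'v::euclidean_space \<Rightarrow> 'w::euclidean_space" and k :: nat
  assumes B_linear: "\<And>\<alpha>. \<alpha> \<in> multi_indices k \<Longrightarrow> linear (B \<alpha>)"
    and const_rank: "constant_rank k B"
begin

abbreviation "S \<equiv> symbol k B"
abbreviation "P \<xi> \<equiv> moore_penrose (symbol k B \<xi>)"

lemma S_linear: "linear (S \<xi>)"
  unfolding symbol_def
  by (intro linear_compose_sum ballI linear_compose_scale_right B_linear)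

lemma monomial_scale: "\<alpha> \<in> multi_indices k \<Longrightarrow> monomial \<alpha> (t *\<^sub>R \<xi>) = t ^ k * monomial \<alpha> \<xi>"
  by (auto simp: monomial_def multi_indices_def power_mult_distrib prod.distrib power_sum)

lemma S_scale: "S (t *\<^sub>R \<xi>) v = t ^ k *\<^sub>R S \<xi> v"
  unfolding symbol_def scaleR_sum_right by (intro sum.cong) (simp_all add: monomial_scale)

lemma P_linear: "linear (P \<xi>)"
  by (rule linear_moore_penrose[OF S_linear])

lemma P_scale:
  assumes "t \<noteq> 0" shows "P (t *\<^sub>R \<xi>) w = (1 / t ^ k) *\<^sub>R P \<xi> w"
proof -
  have "S (t *\<^sub>R \<xi>) = (\<lambda>v. t ^ k *\<^sub>R S \<xi> v)" using S_scale by blast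
  then show ?thesis using moore_penrose_scaleR[OF S_linear, of "t ^ k" \<xi>] assms by simp
qed

definition Sb :: "real^'n \<Rightarrow> 'v \<Rightarrow>\<^sub>L 'w" where "Sb \<xi> = Blinfun (S \<xi>)"
definition Pb :: "real^'n \<Rightarrow> 'w \<Rightarrow>\<^sub>L 'v" where "Pb \<xi> = Blinfun (P \<xi>)"

lemma Sb_apply: "blinfun_apply (Sb \<xi>) = S \<xi>"
  unfolding Sb_def using S_linear by (simp add: bounded_linear_Blinfun_apply linear_conv_bounded_linear)

lemma Pb_apply: "blinfun_apply (Pb \<xi>) = P \<xi>"
  unfolding Pb_def using P_linear by (simp add: bounded_linear_Blinfun_apply linear_conv_bounded_linear)

lemma monomial_smooth: "smooth_on UNIV (monomial \<alpha> :: real^'n \<Rightarrow> real)"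
  unfolding monomial_def by (intro smooth_on_prod smooth_on_power smooth_on_nth open_UNIV)

lemma Sb_smooth: "smooth_on UNIV Sb"
proof -
  have bl: "bounded_linear (B \<alpha>)" if "\<alpha> \<in> multi_indices k" for \<alpha>
    using B_linear[OF that] by (simp add: linear_conv_bounded_linear)
  have "Sb \<xi> = (\<Sum>\<alpha>\<in>multi_indices k. monomial \<alpha> \<xi> *\<^sub>R Blinfun (B \<alpha>))" for \<xi>
    by (rule blinfun_eqI)
      (auto simp: Sb_apply symbol_def blinfun.sum_left blinfun.scaleR_left bounded_linear_Blinfun_apply bl intro!: sum.cong)
  then have "Sb = (\<lambda>\<xi>. \<Sum>\<alpha>\<in>multi_indices k. monomial \<alpha> \<xi> *\<^sub>R Blinfun (B \<alpha>))" by blast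
  then show ?thesis
    by (simp only:) (intro smooth_on_sum smooth_on_scaleR smooth_on_const monomial_smooth open_UNIV)
qed

lemma Pb_diff:
  "Pb \<xi> - Pb \<eta> = - (Pb \<xi> o\<^sub>L ((Sb \<xi> - Sb \<eta>) o\<^sub>L Pb \<eta>))
     + ((Pb \<xi> o\<^sub>L adjb (Pb \<xi>)) o\<^sub>L (adjb (Sb \<xi> - Sb \<eta>) o\<^sub>L (id_blinfun - (Sb \<eta> o\<^sub>L Pb \<eta>))))
     + ((id_blinfun - (Pb \<xi> o\<^sub>L Sb \<xi>)) o\<^sub>L (adjb (Sb \<xi> - Sb \<eta>) o\<^sub>L (adjb (Pb \<eta>) o\<^sub>L Pb \<eta>)))"
proof (rule blinfun_eqI)
  fix w
  have "adjb (Sb \<xi> - Sb \<eta>) = adjb (Sb \<xi>) - adjb (Sb \<eta>)"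
    by (rule linear_diff[OF bounded_linear.linear[OF bounded_linear_adjb]])
  then show "blinfun_apply (Pb \<xi> - Pb \<eta>) w = blinfun_apply (- (Pb \<xi> o\<^sub>L ((Sb \<xi> - Sb \<eta>) o\<^sub>L Pb \<eta>))
     + ((Pb \<xi> o\<^sub>L adjb (Pb \<xi>)) o\<^sub>L (adjb (Sb \<xi> - Sb \<eta>) o\<^sub>L (id_blinfun - (Sb \<eta> o\<^sub>L Pb \<eta>))))
     + ((id_blinfun - (Pb \<xi> o\<^sub>L Sb \<xi>)) o\<^sub>L (adjb (Sb \<xi> - Sb \<eta>) o\<^sub>L (adjb (Pb \<eta>) o\<^sub>L Pb \<eta>)))) w"
    using moore_penrose_diff[OF S_linear[of \<eta>] S_linear[of \<xi>], of w]
    by (simp add: blinfun.diff_left blinfun.add_left blinfun.minus_left adjb_apply Sb_apply Pb_apply)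
qed

lemma norm_projections:
  "norm (id_blinfun - (Sb \<eta> o\<^sub>L Pb \<eta>)) \<le> 2" "norm (id_blinfun - (Pb \<eta> o\<^sub>L Sb \<eta>)) \<le> 2"
proof -
  have "norm (w - S \<eta> (P \<eta> w)) \<le> 2 * norm w" for w
    using norm_triangle_ineq4[of w "S \<eta> (P \<eta> w)"] norm_moore_penrose_MX[OF S_linear, of \<eta> w] by linarith
  then show "norm (id_blinfun - (Sb \<eta> o\<^sub>L Pb \<eta>)) \<le> 2"
    by (intro norm_blinfun_bound) (auto simp: blinfun.diff_left Sb_apply Pb_apply)
  have "norm (v - P \<eta> (S \<eta> v)) \<le> 2 * norm v" for v
    using norm_triangle_ineq4[of v "P \<eta> (S \<eta> v)"] norm_moore_penrose_XM[OF S_linear, of \<eta> v] by linarith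
  then show "norm (id_blinfun - (Pb \<eta> o\<^sub>L Sb \<eta>)) \<le> 2"
    by (intro norm_blinfun_bound) (auto simp: blinfun.diff_left Sb_apply Pb_apply)
qed

lemma rank_eq: "\<xi> \<noteq> 0 \<Longrightarrow> \<eta> \<noteq> 0 \<Longrightarrow> dim (range (S \<xi>)) = dim (range (S \<eta>))"
  using const_rank unfolding constant_rank_def by metis

lemma Sb_isCont: "isCont Sb \<eta>"
  using smooth_on_continuous[OF Sb_smooth] by (simp add: continuous_on_eq_continuous_at)

text \<open>Constant rank enters the analysis here. Near a point other than 0 the symbol is close to
  its value at that point and the ranks agree, so the perturbation bound holds with twice the
  constant.\<close>

lemma Pb_locally_bounded:
  assumes "\<eta> \<noteq> 0"
  shows "\<exists>K>0. \<forall>\<^sub>F \<xi> in at \<eta>. norm (Pb \<xi>) \<le> K"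
proof -
  define K where "K = norm (Pb \<eta>) + 1"
  have K: "K > 0" by (simp add: K_def add_nonneg_pos)
  have PK: "norm (P \<eta> w) \<le> K * norm w" for w
    using norm_blinfun[of "Pb \<eta>" w] by (simp add: Pb_apply K_def distrib_right add_increasing2)
  have "((\<lambda>\<xi>. norm (Sb \<xi> - Sb \<eta>)) \<longlongrightarrow> 0) (at \<eta>)"
    using Sb_isCont[of \<eta>] LIM_zero tendsto_norm_zero unfolding isCont_def by blast
  then have "\<forall>\<^sub>F \<xi> in at \<eta>. norm (Sb \<xi> - Sb \<eta>) < 1 / (2 * K)" using K by (intro order_tendstoD(2)) auto
  moreover have "\<forall>\<^sub>F \<xi> in at \<eta>. \<xi> \<noteq> 0" by (rule tendsto_imp_eventually_ne[OF tendsto_ident_at assms])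
  ultimately have "\<forall>\<^sub>F \<xi> in at \<eta>. norm (Pb \<xi>) \<le> 2 * K"
  proof eventually_elim
    case (elim \<xi>)
    have "norm (S \<xi> v - S \<eta> v) \<le> norm v / (2 * K)" for v
    proof -
      have "norm (S \<xi> v - S \<eta> v) = norm ((Sb \<xi> - Sb \<eta>) v)" by (simp add: blinfun.diff_left Sb_apply)
      also have "\<dots> \<le> norm (Sb \<xi> - Sb \<eta>) * norm v" by (rule norm_blinfun)
      also have "\<dots> \<le> (1 / (2 * K)) * norm v" using elim by (intro mult_right_mono) auto
      finally show ?thesis by simp
    qed
    then have "norm (P \<xi> w) \<le> 2 * K * norm w" for w
      using moore_penrose_local_bound[OF S_linear S_linear rank_eq[OF assms elim(2)] K PK] by blast
    then show ?case using K by (intro norm_blinfun_bound) (auto simp: Pb_apply)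
  qed
  then show ?thesis using K by (intro exI[of _ "2 * K"]) auto
qed

lemma Pb_isCont:
  assumes "\<eta> \<noteq> 0" shows "isCont Pb \<eta>"
proof -
  obtain K0 where K0: "K0 > 0" "\<forall>\<^sub>F \<xi> in at \<eta>. norm (Pb \<xi>) \<le> K0" using Pb_locally_bounded[OF assms] by blast
  define K where "K = max K0 (norm (Pb \<eta>))"
  have K: "K > 0" "norm (Pb \<eta>) \<le> K" using K0 by (auto simp: K_def)
  \<comment> \<open>The three terms of Wedin's identity contribute 1, 2 and 2 times K^2, the factors
    2 coming from the complementary projections.\<close>
  have ev: "\<forall>\<^sub>F \<xi> in at \<eta>. norm (Pb \<xi> - Pb \<eta>) \<le> 5 * K\<^sup>2 * norm (Sb \<xi> - Sb \<eta>)"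
    using K0(2)
  proof eventually_elim
    case (elim \<xi>)
    then have x: "norm (Pb \<xi>) \<le> K" by (simp add: K_def)
    let ?E = "Sb \<xi> - Sb \<eta>"
    have comp: "norm (f o\<^sub>L g) \<le> a * b" if "norm f \<le> a" "norm g \<le> b"
      for f :: "'b::real_normed_vector \<Rightarrow>\<^sub>L 'c::real_normed_vector" and g :: "'a::real_normed_vector \<Rightarrow>\<^sub>L 'b" and a b
    proof -
      have "0 \<le> a" using that(1) norm_ge_zero order_trans by blast
      then show ?thesis using norm_blinfun_compose[of f g] mult_mono[OF that] by (simp add: order_trans)
    qed
    have E: "norm ?E \<le> norm ?E" "norm (adjb ?E) \<le> norm ?E" by (simp_all add: norm_adjb_le)
    have aP: "norm (adjb (Pb \<xi>)) \<le> K" "norm (adjb (Pb \<eta>)) \<le> K"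
      using norm_adjb_le[of "Pb \<xi>"] norm_adjb_le[of "Pb \<eta>"] x K by linarith+
    have "norm (Pb \<xi> - Pb \<eta>) \<le> K * (norm ?E * K) + (K * K) * (norm ?E * 2) + 2 * (norm ?E * (K * K))"
      unfolding Pb_diff[of \<xi> \<eta>]
      by (intro norm_triangle_le add_mono)
        (simp_all only: norm_minus_cancel, (intro comp x K E aP norm_projections)+)
    also have "\<dots> = 5 * K\<^sup>2 * norm ?E" by (simp add: power2_eq_square algebra_simps)
    finally show ?case .
  qed
  have "((\<lambda>\<xi>. 5 * K\<^sup>2 * norm (Sb \<xi> - Sb \<eta>)) \<longlongrightarrow> 5 * K\<^sup>2 * 0) (at \<eta>)"
  proof (intro tendsto_intros)
    show "((\<lambda>\<xi>. norm (Sb \<xi> - Sb \<eta>)) \<longlongrightarrow> 0) (at \<eta>)"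
      using Sb_isCont[of \<eta>] LIM_zero tendsto_norm_zero unfolding isCont_def by blast
  qed
  then have "((\<lambda>\<xi>. norm (Pb \<xi> - Pb \<eta>)) \<longlongrightarrow> 0) (at \<eta>)"
    by (intro tendsto_sandwich[OF _ ev tendsto_const]) auto
  then show ?thesis unfolding isCont_def by (simp add: tendsto_norm_zero_iff LIM_zero_iff)
qed

text \<open>Wedin's identity is exact, so its right-hand side may be differentiated at \<eta>. Each
  summand pairs a factor that is merely continuous in \<xi> with a difference of symbols that
  vanishes at \<eta>; continuity of \<open>Pb\<close> thus already yields differentiability.\<close>

lemma Pb_has_derivative:
  assumes \<eta>: "\<eta> \<noteq> 0" and S': "(Sb has_derivative S') (at \<eta>)"
  shows "(Pb has_derivative (\<lambda>d. - (Pb \<eta> o\<^sub>L (S' d o\<^sub>L Pb \<eta>))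
     + ((Pb \<eta> o\<^sub>L adjb (Pb \<eta>)) o\<^sub>L (adjb (S' d) o\<^sub>L (id_blinfun - (Sb \<eta> o\<^sub>L Pb \<eta>))))
     + ((id_blinfun - (Pb \<eta> o\<^sub>L Sb \<eta>)) o\<^sub>L (adjb (S' d) o\<^sub>L (adjb (Pb \<eta>) o\<^sub>L Pb \<eta>))))) (at \<eta>)"
proof -
  have o: "bounded_bilinear (o\<^sub>L)" by (rule bounded_bilinear_blinfun_compose)
  have c: "isCont Pb \<eta>" "isCont Sb \<eta>" using Pb_isCont[OF \<eta>] Sb_isCont .
  have ca: "isCont (\<lambda>\<xi>. adjb (Pb \<xi>)) \<eta>"
    using bounded_linear.isCont[OF bounded_linear_adjb c(1)] .
  have E: "((\<lambda>\<xi>. Sb \<xi> - Sb \<eta>) has_derivative S') (at \<eta>)"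
    using has_derivative_diff[OF S' has_derivative_const[of "Sb \<eta>"]] by simp
  have aE: "((\<lambda>\<xi>. adjb (Sb \<xi> - Sb \<eta>)) has_derivative (\<lambda>d. adjb (S' d))) (at \<eta>)"
    by (rule bounded_linear.has_derivative[OF bounded_linear_adjb E])
  have r: "((\<lambda>\<xi>. F \<xi> o\<^sub>L A) has_derivative (\<lambda>d. F' d o\<^sub>L A)) (at \<eta>)" if "(F has_derivative F') (at \<eta>)"
    for F :: "real^'n \<Rightarrow> ('b::real_normed_vector \<Rightarrow>\<^sub>L 'c::real_normed_vector)" and F' and A :: "'a::real_normed_vector \<Rightarrow>\<^sub>L 'b"
    by (rule bounded_linear.has_derivative[OF bounded_bilinear.bounded_linear_left[OF bounded_bilinear_blinfun_compose] that])
  have z: "adjb (Sb \<eta> - Sb \<eta>) = 0" by (simp add: linear_0[OF bounded_linear.linear[OF bounded_linear_adjb]])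
  note cc = bounded_bilinear.isCont[OF bounded_bilinear_blinfun_compose]
  have "((\<lambda>\<xi>. - (Pb \<xi> o\<^sub>L ((Sb \<xi> - Sb \<eta>) o\<^sub>L Pb \<eta>))
     + ((Pb \<xi> o\<^sub>L adjb (Pb \<xi>)) o\<^sub>L (adjb (Sb \<xi> - Sb \<eta>) o\<^sub>L (id_blinfun - (Sb \<eta> o\<^sub>L Pb \<eta>))))
     + ((id_blinfun - (Pb \<xi> o\<^sub>L Sb \<xi>)) o\<^sub>L (adjb (Sb \<xi> - Sb \<eta>) o\<^sub>L (adjb (Pb \<eta>) o\<^sub>L Pb \<eta>)))) has_derivative
    (\<lambda>d. - (Pb \<eta> o\<^sub>L (S' d o\<^sub>L Pb \<eta>))
     + ((Pb \<eta> o\<^sub>L adjb (Pb \<eta>)) o\<^sub>L (adjb (S' d) o\<^sub>L (id_blinfun - (Sb \<eta> o\<^sub>L Pb \<eta>))))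
     + ((id_blinfun - (Pb \<eta> o\<^sub>L Sb \<eta>)) o\<^sub>L (adjb (S' d) o\<^sub>L (adjb (Pb \<eta>) o\<^sub>L Pb \<eta>))))) (at \<eta>)"
  proof (intro has_derivative_add has_derivative_minus)
    show "((\<lambda>\<xi>. Pb \<xi> o\<^sub>L ((Sb \<xi> - Sb \<eta>) o\<^sub>L Pb \<eta>)) has_derivative (\<lambda>d. Pb \<eta> o\<^sub>L (S' d o\<^sub>L Pb \<eta>))) (at \<eta>)"
      by (rule has_derivative_bilinear_vanishing[OF bounded_bilinear_blinfun_compose c(1) r[OF E]])
        (simp add: bounded_bilinear.zero_left[OF bounded_bilinear_blinfun_compose])
    show "((\<lambda>\<xi>. (Pb \<xi> o\<^sub>L adjb (Pb \<xi>)) o\<^sub>L (adjb (Sb \<xi> - Sb \<eta>) o\<^sub>L (id_blinfun - (Sb \<eta> o\<^sub>L Pb \<eta>)))) has_derivative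
      (\<lambda>d. (Pb \<eta> o\<^sub>L adjb (Pb \<eta>)) o\<^sub>L (adjb (S' d) o\<^sub>L (id_blinfun - (Sb \<eta> o\<^sub>L Pb \<eta>))))) (at \<eta>)"
      by (rule has_derivative_bilinear_vanishing[OF bounded_bilinear_blinfun_compose cc[OF c(1) ca] r[OF aE]])
        (simp only: z bounded_bilinear.zero_left[OF bounded_bilinear_blinfun_compose])
    show "((\<lambda>\<xi>. (id_blinfun - (Pb \<xi> o\<^sub>L Sb \<xi>)) o\<^sub>L (adjb (Sb \<xi> - Sb \<eta>) o\<^sub>L (adjb (Pb \<eta>) o\<^sub>L Pb \<eta>))) has_derivative
      (\<lambda>d. (id_blinfun - (Pb \<eta> o\<^sub>L Sb \<eta>)) o\<^sub>L (adjb (S' d) o\<^sub>L (adjb (Pb \<eta>) o\<^sub>L Pb \<eta>)))) (at \<eta>)"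
      by (rule has_derivative_bilinear_vanishing[OF bounded_bilinear_blinfun_compose isCont_diff[OF continuous_const cc[OF c]] r[OF aE]])
        (simp only: z bounded_bilinear.zero_left[OF bounded_bilinear_blinfun_compose])
  qed
  then have "((\<lambda>\<xi>. Pb \<xi> - Pb \<eta>) has_derivative (\<lambda>d. - (Pb \<eta> o\<^sub>L (S' d o\<^sub>L Pb \<eta>))
     + ((Pb \<eta> o\<^sub>L adjb (Pb \<eta>)) o\<^sub>L (adjb (S' d) o\<^sub>L (id_blinfun - (Sb \<eta> o\<^sub>L Pb \<eta>))))
     + ((id_blinfun - (Pb \<eta> o\<^sub>L Sb \<eta>)) o\<^sub>L (adjb (S' d) o\<^sub>L (adjb (Pb \<eta>) o\<^sub>L Pb \<eta>))))) (at \<eta>)"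
    unfolding Pb_diff[symmetric] .
  from has_derivative_add[OF this has_derivative_const[of "Pb \<eta>"]] show ?thesis by simp
qed

text \<open>Bootstrapping: the derivative formula writes \<open>partial_deriv i Pb\<close> as a
  polynomial in \<open>Pb\<close>, \<open>Sb\<close>, the derivative of \<open>Sb\<close> and their
  adjoints, so order \<open>m\<close> for \<open>Pb\<close> gives order \<open>m\<close> for its
  partial derivatives.\<close>

lemma Pb_smooth: "smooth_on (- {0}) Pb"
  unfolding smooth_on_def
proof
  have U: "open (- {0::real^'n})" by (rule open_Compl) simp
  note comp = Ck_bilinear[OF U bounded_bilinear_blinfun_compose]
  note adj = Ck_linear[OF U bounded_linear_adjb]
  fix m show "Ck (- {0}) m Pb"
  proof (induction m)
    case (Suc m)
    have Sm: "Ck (- {0}) j Sb" "Ck (- {0}) j (partial_deriv i Sb)" for i j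
      using smooth_on_subset[OF subset_UNIV Sb_smooth] smooth_on_subset[OF subset_UNIV smooth_on_partial[OF Sb_smooth]]
      unfolding smooth_on_def by blast+
    have Sd: "\<exists>S'. (Sb has_derivative S') (at \<eta>)" for \<eta>
      using diff_on_has_derivative[OF open_UNIV smooth_on_differentiable[OF Sb_smooth] UNIV_I] .
    have "Pb differentiable_on (- {0})"
    proof (rule differentiable_onI[OF U])
      fix \<eta> :: "real^'n" assume "\<eta> \<in> - {0}"
      moreover obtain S' where "(Sb has_derivative S') (at \<eta>)" using Sd by blast
      ultimately show "\<exists>f'. (Pb has_derivative f') (at \<eta>)" using Pb_has_derivative by blast
    qed
    moreover have "Ck (- {0}) m (partial_deriv i Pb)" for i
    proof (rule Ck_cong[OF U])
      let ?D = "\<lambda>\<eta>. - (Pb \<eta> o\<^sub>L (partial_deriv i Sb \<eta> o\<^sub>L Pb \<eta>))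
     + ((Pb \<eta> o\<^sub>L adjb (Pb \<eta>)) o\<^sub>L (adjb (partial_deriv i Sb \<eta>) o\<^sub>L (id_blinfun + - (Sb \<eta> o\<^sub>L Pb \<eta>))))
     + ((id_blinfun + - (Pb \<eta> o\<^sub>L Sb \<eta>)) o\<^sub>L (adjb (partial_deriv i Sb \<eta>) o\<^sub>L (adjb (Pb \<eta>) o\<^sub>L Pb \<eta>)))"
      note neg = Ck_linear[OF U bounded_linear_minus[OF bounded_linear_ident]]
      show "Ck (- {0}) m ?D"
        by (intro Ck_add[OF U] neg comp adj Ck_const[OF U] Suc.IH Sm)
      fix \<eta> :: "real^'n" assume \<eta>: "\<eta> \<in> - {0}"
      obtain S' where S': "(Sb has_derivative S') (at \<eta>)" using Sd by blast
      show "?D \<eta> = partial_deriv i Pb \<eta>"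
        using partial_deriv_eqI[OF Pb_has_derivative[OF _ S'], of i] partial_deriv_eqI[OF S', of i] \<eta> by simp
    qed
    ultimately show ?case by simp
  qed simp
qed

end

section \<open>Boundedness of the kernel\<close>

lemma integrable_pair_mult:
  fixes a :: "'a::euclidean_space \<Rightarrow> real" and b :: "'b::euclidean_space \<Rightarrow> real"
  assumes a: "integrable lborel a" and b: "integrable lborel b"
  shows "integrable (lborel \<Otimes>\<^sub>M lborel) (\<lambda>(x, y). a x * b y)"
proof (rule lborel_pair.Fubini_integrable)
  have [measurable]: "a \<in> borel_measurable borel" "b \<in> borel_measurable borel" using a b by auto
  show "(\<lambda>(x, y). a x * b y) \<in> borel_measurable (lborel \<Otimes>\<^sub>M lborel)" by measurable
  show "integrable lborel (\<lambda>x. LINT y|lborel. norm (case (x, y) of (x, y) \<Rightarrow> a x * b y))"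
    using a by (simp add: abs_mult)
  show "AE x in lborel. integrable lborel (\<lambda>y. case (x, y) of (x, y) \<Rightarrow> a x * b y)" using b by simp
qed

lemma measurable_linear_apply:
  fixes L :: "'a \<Rightarrow> 'w::euclidean_space \<Rightarrow> 'v::euclidean_space"
  assumes lin: "\<And>x. linear (L x)" and [measurable]: "\<And>y. (\<lambda>x. L x y) \<in> borel_measurable M" "g \<in> borel_measurable M"
  shows "(\<lambda>x. L x (g x)) \<in> borel_measurable M"
proof -
  have "L x (g x) = (\<Sum>b\<in>Basis. (g x \<bullet> b) *\<^sub>R L x b)" for x
    by (subst euclidean_representation[symmetric, of "g x"]) (simp only: linear_sum[OF lin] linear_scale[OF lin])
  then have "(\<lambda>x. L x (g x)) = (\<lambda>x. \<Sum>b\<in>Basis. (g x \<bullet> b) *\<^sub>R L x b)" by blast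
  then show ?thesis by (simp only:) measurable
qed

lemma AE_inner_neq_0:
  fixes x :: "'a::euclidean_space"
  assumes "x \<noteq> 0" shows "AE z in lborel. x \<bullet> z \<noteq> 0"
proof -
  have "negligible {z. x \<bullet> z = 0}" using assms by (rule negligible_hyperplane[OF disjI1])
  moreover have "{z. x \<bullet> z = 0} \<in> sets borel" by (intro borel_closed closed_hyperplane)
  ultimately have "{z. x \<bullet> z = 0} \<in> null_sets lborel"
    by (auto simp: negligible_iff_null_sets null_sets_completion_iff)
  then show ?thesis by (rule AE_I'[where N = "{z. x \<bullet> z = 0}"]) auto
qed

text \<open>Integrability of the full integrand is assumed but only qualitatively; it gives no
  constant. The bound is therefore proved for the radially truncated dilation integral, for a single
  point x at a time (\<open>inner\<close>), then integrated against \<open>f\<close>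
  (\<open>main\<close>), and finally freed from the truncation.\<close>

lemma bounded_kernel:
  fixes Om :: "real^'n::finite \<Rightarrow> 'w::euclidean_space \<Rightarrow> 'v::euclidean_space"
  assumes J: "complex_structure J"
    and lin: "\<And>z. linear (Om z)" and meas: "\<And>y. (\<lambda>z. Om z y) \<in> borel_measurable borel"
    and bd: "K \<ge> 0" "\<And>z y. z \<in> annulus \<Longrightarrow> norm (Om z y) \<le> K * norm y"
    and hom: "\<And>t z y. t > 0 \<Longrightarrow> Om (t *\<^sub>R z) y = (1 / t ^ CARD('n)) *\<^sub>R Om z y"
    and cancel: "\<And>y. (LINT z|lborel. indicator annulus z *\<^sub>R Om z y) = 0"
  shows "\<exists>C\<ge>0. \<forall>f. integrable lborel f \<longrightarrow> integrable lborel (\<lambda>\<xi>. Om \<xi> (osc J (-1) f \<xi>)) \<longrightarrow>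
     norm (LINT \<xi>|lborel. Om \<xi> (osc J (-1) f \<xi>)) \<le> C * (LINT x|lborel. norm (f x))"
proof -
  note meas[measurable] rot_measurable[OF J, measurable]
  obtain B :: real where B0: "B \<ge> 0 \<and> (\<forall>\<epsilon> R s. 0 < \<epsilon> \<longrightarrow> \<epsilon> \<le> R \<longrightarrow> \<bar>LINT t|lborel. indicator {\<epsilon>..R} t * (sin (t * s) / t)\<bar> \<le> B)"
    using integral_sin_over_bound by (rule exE)
  have B: "B \<ge> 0" "\<And>\<epsilon> R s. 0 < \<epsilon> \<Longrightarrow> \<epsilon> \<le> R \<Longrightarrow> \<bar>LINT t|lborel. indicator {\<epsilon>..R} t * (sin (t * s) / t)\<bar> \<le> B"
    by (simp_all only: B0[THEN conjunct1] B0[THEN conjunct2, rule_format])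
  obtain L :: real where L0: "L \<ge> 0 \<and> (\<forall>x::real^'n. x \<noteq> 0 \<longrightarrow> (\<integral>\<^sup>+z. indicator annulus z * ennreal \<bar>ln (\<bar>x \<bullet> z\<bar> / norm x)\<bar> \<partial>lborel) \<le> ennreal L)"
    using annulus_log_bound by (rule exE)
  have L: "L \<ge> 0" "\<And>x::real^'n. x \<noteq> 0 \<Longrightarrow> (\<integral>\<^sup>+z. indicator annulus z * ennreal \<bar>ln (\<bar>x \<bullet> z\<bar> / norm x)\<bar> \<partial>lborel) \<le> ennreal L"
    by (rule L0[THEN conjunct1], rule L0[THEN conjunct2, rule_format])
  define A where "A = measure lborel (annulus :: (real^'n) set)"
  have A: "emeasure lborel (annulus :: (real^'n) set) = ennreal A" "A \<ge> 0"
    using emeasure_annulus_finite[where 'n = 'n] by (auto simp: A_def emeasure_eq_ennreal_measure less_top[symmetric])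
  \<comment> \<open>\<open>K\<close> bounds the kernel on the annulus, 2 L stems from the cosine
    parts, 2 B A from the sine parts, and ln 2 is the normalisation of \<open>dil\<close>.\<close>
  define C where "C = K * (2 * L + 2 * B * A) / ln 2"
  have C: "C \<ge> 0" using bd(1) L(1) B(1) A(2) by (auto simp: C_def)
  have ann_int: "integrable lborel (indicator annulus :: real^'n \<Rightarrow> real)"
    using emeasure_annulus_finite[where 'n = 'n] by (intro integrable_real_indicator) auto
  have Om_scale: "Om z (c *\<^sub>R y) = c *\<^sub>R Om z y" for z c y by (rule linear_scale[OF lin])

  have inner: "norm (LINT p|(lborel \<Otimes>\<^sub>M lborel). (indicator {\<epsilon>..R} (fst p) * indicator annulus (snd p) / fst p) *\<^sub>R
        Om (snd p) (rot J (- (fst p * (x \<bullet> snd p))) y)) \<le> K * (2 * L + 2 * B * A) * norm y"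
    if e: "0 < \<epsilon>" "\<epsilon> \<le> R" and x: "x \<noteq> 0" for \<epsilon> R :: real and x :: "real^'n" and y
  proof -
    let ?W = "\<lambda>t z. indicator {\<epsilon>..R} t * indicator annulus z / t"
    have iW: "integrable (lborel \<Otimes>\<^sub>M lborel) (\<lambda>(t, z). (indicator {\<epsilon>..R} t * (1 / t)) * indicator annulus (z::real^'n))"
    proof (rule integrable_pair_mult[OF _ ann_int])
      have "continuous_on {\<epsilon>..R} (\<lambda>t. 1 / t)" using e by (auto intro!: continuous_intros)
      from borel_integrable_compact[OF compact_Icc this]
      show "integrable lborel (\<lambda>t. indicator {\<epsilon>..R} t * (1 / t))" by simp
    qed
    have iF: "integrable (lborel \<Otimes>\<^sub>M lborel) (\<lambda>(t, z). ?W t z *\<^sub>R Om z (rot J (\<theta> t z) y))"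
      if [measurable]: "(\<lambda>p. \<theta> (fst p) (snd p)) \<in> borel_measurable (borel \<Otimes>\<^sub>M borel)" for \<theta> :: "real \<Rightarrow> real^'n \<Rightarrow> real"
    proof (rule Bochner_Integration.integrable_bound)
      show "integrable (lborel \<Otimes>\<^sub>M lborel) (\<lambda>p. K * norm y * (case p of (t, z) \<Rightarrow> (indicator {\<epsilon>..R} t * (1 / t)) * indicator annulus (z::real^'n)))"
        by (intro integrable_mult_right iW)
      have "(\<lambda>p. Om (snd p) (rot J (\<theta> (fst p) (snd p)) y)) \<in> borel_measurable (borel \<Otimes>\<^sub>M borel)"
        by (rule measurable_linear_apply) (use lin in auto)
      then show "(\<lambda>(t, z). ?W t z *\<^sub>R Om z (rot J (\<theta> t z) y)) \<in> borel_measurable (lborel \<Otimes>\<^sub>M lborel)"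
        unfolding case_prod_beta by measurable
      show "AE p in lborel \<Otimes>\<^sub>M lborel. norm (case p of (t, z) \<Rightarrow> ?W t z *\<^sub>R Om z (rot J (\<theta> t z) y)) \<le>
        norm (K * norm y * (case p of (t, z) \<Rightarrow> (indicator {\<epsilon>..R} t * (1 / t)) * indicator annulus z))"
      proof (rule AE_I2)
        fix p :: "real \<times> (real^'n)"
        obtain t z where p: "p = (t, z)" by (cases p)
        show "norm (case p of (t, z) \<Rightarrow> ?W t z *\<^sub>R Om z (rot J (\<theta> t z) y)) \<le>
          norm (K * norm y * (case p of (t, z) \<Rightarrow> (indicator {\<epsilon>..R} t * (1 / t)) * indicator annulus z))"
        proof (cases "t \<in> {\<epsilon>..R} \<and> z \<in> annulus")
          case True
          then have t: "t > 0" using e by auto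
          have "norm (Om z (rot J (\<theta> t z) y)) \<le> K * norm y" using bd(2)[of z "rot J (\<theta> t z) y"] True by (simp add: norm_rot[OF J])
          then show ?thesis using True t bd(1) by (simp add: p divide_right_mono)
        qed (auto simp: p indicator_def)
      qed
    qed
    have m1: "(\<lambda>p::real \<times> (real^'n). - (fst p * (x \<bullet> snd p))) \<in> borel_measurable (borel \<Otimes>\<^sub>M borel)"
      and m2: "(\<lambda>p::real \<times> (real^'n). - (fst p * norm x)) \<in> borel_measurable (borel \<Otimes>\<^sub>M borel)" by measurable
    note i1 = iF[OF m1] and i2 = iF[OF m2]
    have Omi: "integrable lborel (\<lambda>z. indicator annulus z *\<^sub>R Om z v)" for v
    proof (rule Bochner_Integration.integrable_bound)
      show "integrable lborel (\<lambda>z::real^'n. K * norm v * indicator annulus z)" by (intro integrable_mult_right ann_int)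
      show "AE z in lborel. norm (indicator annulus z *\<^sub>R Om z v) \<le> norm (K * norm v * indicator annulus z)"
        using bd by (intro AE_I2) (auto simp: indicator_def)
    qed (use meas in \<open>auto intro!: borel_measurable_scaleR borel_measurable_indicator\<close>)
    \<comment> \<open>The use of \<open>cancel\<close>: with the reference phase t |x| the rotated
      vector does not depend on z, so the z-integral is a mean of the kernel.\<close>
    have zero: "(LINT p|(lborel \<Otimes>\<^sub>M lborel). (case p of (t, z) \<Rightarrow> ?W t z *\<^sub>R Om z (rot J (- (t * norm x)) y))) = 0"
    proof -
      have "(LINT p|(lborel \<Otimes>\<^sub>M lborel). (case p of (t, z) \<Rightarrow> ?W t z *\<^sub>R Om z (rot J (- (t * norm x)) y))) =
        (LINT t|lborel. LINT z|lborel. ?W t z *\<^sub>R Om z (rot J (- (t * norm x)) y))"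
        by (rule lborel_pair.integral_fst[symmetric, OF i2])
      also have "\<dots> = (LINT t|lborel. (indicator {\<epsilon>..R} t / t) *\<^sub>R (LINT z|lborel. indicator annulus z *\<^sub>R Om z (rot J (- (t * norm x)) y)))"
        by (intro Bochner_Integration.integral_cong refl)
          (simp only: integral_scaleR_right[symmetric] scaleR_scaleR times_divide_eq_left)
      also have "\<dots> = 0" by (simp add: cancel)
      finally show ?thesis .
    qed
    let ?V = "\<lambda>z. LINT t|lborel. (indicator {\<epsilon>..R} t / t) *\<^sub>R (rot J (- (t * (x \<bullet> z))) y - rot J (- (t * norm x)) y)"
    have it: "integrable lborel (\<lambda>t. (indicator {\<epsilon>..R} t / t) *\<^sub>R rot J (- (t * s)) y)" for s
    proof -
      have "continuous_on {\<epsilon>..R} (\<lambda>t. (1 / t) *\<^sub>R rot J (- (t * s)) y)"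
        unfolding rot_def using e by (auto intro!: continuous_intros)
      from borel_integrable_compact[OF compact_Icc this] show ?thesis by simp
    qed
    \<comment> \<open>The cosine integrals are compared with each other, since each of them alone
      grows logarithmically as \<epsilon> tends to 0; the sine integrals are bounded
      separately.\<close>
    have V: "norm (?V z) \<le> (2 * \<bar>ln (\<bar>x \<bullet> z\<bar> / norm x)\<bar> + 2 * B) * norm y" if z: "x \<bullet> z \<noteq> 0" for z
    proof -
      let ?s = "x \<bullet> z" and ?s' = "norm x"
      let ?c = "\<lambda>s. LINT t|lborel. indicator {\<epsilon>..R} t * (cos (t * s) / t)"
      let ?n = "\<lambda>s. LINT t|lborel. indicator {\<epsilon>..R} t * (sin (t * s) / t)"
      have ic: "integrable lborel (\<lambda>t. indicator {\<epsilon>..R} t * (cos (t * s) / t))" for s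
      proof -
        have "continuous_on {\<epsilon>..R} (\<lambda>t. cos (t * s) / t)" using e by (auto intro!: continuous_intros)
        from borel_integrable_compact[OF compact_Icc this] show ?thesis by simp
      qed
      have is': "integrable lborel (\<lambda>t. indicator {\<epsilon>..R} t * (sin (t * s) / t))" for s
      proof -
        have "continuous_on {\<epsilon>..R} (\<lambda>t. sin (t * s) / t)" using e by (auto intro!: continuous_intros)
        from borel_integrable_compact[OF compact_Icc this] show ?thesis by simp
      qed
      have rots: "(LINT t|lborel. (indicator {\<epsilon>..R} t / t) *\<^sub>R rot J (- (t * s)) y) = ?c s *\<^sub>R y - ?n s *\<^sub>R J y" for s
      proof -
        have "(indicator {\<epsilon>..R} t / t) *\<^sub>R rot J (- (t * s)) y =
          (indicator {\<epsilon>..R} t * (cos (t * s) / t)) *\<^sub>R y - (indicator {\<epsilon>..R} t * (sin (t * s) / t)) *\<^sub>R J y" for t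
          by (simp add: rot_def scaleR_diff_right)
        then show ?thesis
          by (simp only: Bochner_Integration.integral_diff[OF integrable_scaleR_left[OF ic] integrable_scaleR_left[OF is']]
              integral_scaleR_left[OF ic] integral_scaleR_left[OF is'])
      qed
      define c1 c2 n1 n2 where "c1 = ?c ?s" and "c2 = ?c ?s'" and "n1 = ?n ?s" and "n2 = ?n ?s'"
      have "?V z = (c1 *\<^sub>R y - n1 *\<^sub>R J y) - (c2 *\<^sub>R y - n2 *\<^sub>R J y)"
        unfolding c1_def c2_def n1_def n2_def
        by (simp only: scaleR_diff_right Bochner_Integration.integral_diff[OF it it] rots)
      also have "\<dots> = (c1 - c2) *\<^sub>R y - (n1 - n2) *\<^sub>R J y" by (simp add: algebra_simps)
      also have "norm \<dots> \<le> norm ((c1 - c2) *\<^sub>R y) + norm ((n1 - n2) *\<^sub>R J y)" by (rule norm_triangle_ineq4)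
      also have "\<dots> = \<bar>c1 - c2\<bar> * norm y + \<bar>n1 - n2\<bar> * norm y" by (simp add: J_norm[OF J])
      also have "\<dots> \<le> (2 * \<bar>ln (\<bar>?s\<bar> / \<bar>?s'\<bar>)\<bar>) * norm y + (2 * B) * norm y"
      proof (intro add_mono mult_right_mono norm_ge_zero)
        show "\<bar>c1 - c2\<bar> \<le> 2 * \<bar>ln (\<bar>?s\<bar> / \<bar>?s'\<bar>)\<bar>"
          unfolding c1_def c2_def by (rule integral_cos_over_diff[OF e z]) (use x in simp)
        have "\<bar>n1\<bar> \<le> B" "\<bar>n2\<bar> \<le> B" unfolding n1_def n2_def by (rule B(2)[OF e])+
        then show "\<bar>n1 - n2\<bar> \<le> 2 * B" by linarith
      qed
      finally show ?thesis by (simp add: distrib_right)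
    qed
    let ?D = "\<lambda>t z. ?W t z *\<^sub>R Om z (rot J (- (t * (x \<bullet> z))) y - rot J (- (t * norm x)) y)"
    have eqD: "(\<lambda>(t, z). ?D t z) = (\<lambda>p. (case p of (t, z) \<Rightarrow> ?W t z *\<^sub>R Om z (rot J (- (t * (x \<bullet> z))) y)) -
        (case p of (t, z) \<Rightarrow> ?W t z *\<^sub>R Om z (rot J (- (t * norm x)) y)))"
      by (rule ext) (simp add: case_prod_beta linear_diff[OF lin] scaleR_diff_right)
    have iD: "integrable (lborel \<Otimes>\<^sub>M lborel) (\<lambda>(t, z). ?D t z)"
      unfolding eqD by (rule Bochner_Integration.integrable_diff[OF i1 i2])
    have fiber: "(LINT t|lborel. ?D t z) = indicator annulus z *\<^sub>R Om z (?V z)" for z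
    proof -
      have ii: "integrable lborel (\<lambda>t. (indicator {\<epsilon>..R} t / t) *\<^sub>R (rot J (- (t * (x \<bullet> z))) y - rot J (- (t * norm x)) y))"
        unfolding scaleR_diff_right by (intro Bochner_Integration.integrable_diff it)
      have bl: "bounded_linear (\<lambda>v. indicator annulus z *\<^sub>R Om z v)"
        using lin[of z] by (intro bounded_linear_compose[OF bounded_linear_scaleR_right]) (simp add: linear_conv_bounded_linear)
      have "?D t z = indicator annulus z *\<^sub>R Om z ((indicator {\<epsilon>..R} t / t) *\<^sub>R (rot J (- (t * (x \<bullet> z))) y - rot J (- (t * norm x)) y))" for t
        by (simp add: Om_scale mult.commute)
      then show ?thesis using integral_bounded_linear[OF bl ii] by simp
    qed
    have "(LINT p|(lborel \<Otimes>\<^sub>M lborel). (case p of (t, z) \<Rightarrow> ?W t z *\<^sub>R Om z (rot J (- (t * (x \<bullet> z))) y))) =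
       (LINT p|(lborel \<Otimes>\<^sub>M lborel). (case p of (t, z) \<Rightarrow> ?D t z))"
      unfolding eqD Bochner_Integration.integral_diff[OF i1 i2] zero by simp
    also have "\<dots> = (LINT z|lborel. LINT t|lborel. ?D t z)"
      by (rule lborel_pair.integral_snd[symmetric, OF iD])
    also have "\<dots> = (LINT z|lborel. indicator annulus z *\<^sub>R Om z (?V z))" by (simp only: fiber)
    finally have eq: "(LINT p|(lborel \<Otimes>\<^sub>M lborel). (case p of (t, z) \<Rightarrow> ?W t z *\<^sub>R Om z (rot J (- (t * (x \<bullet> z))) y))) =
      (LINT z|lborel. indicator annulus z *\<^sub>R Om z (?V z))" .
    have iz: "integrable lborel (\<lambda>z. indicator annulus z *\<^sub>R Om z (?V z))"
      using lborel_pair.integrable_snd[OF iD] by (simp only: fiber)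
    have "ennreal (norm (LINT z|lborel. indicator annulus z *\<^sub>R Om z (?V z))) \<le>
      (\<integral>\<^sup>+z. ennreal (norm (indicator annulus z *\<^sub>R Om z (?V z))) \<partial>lborel)"
      by (rule integral_norm_bound_ennreal[OF iz])
    also have "\<dots> \<le> (\<integral>\<^sup>+z. ennreal (2 * K * norm y) * (indicator annulus z * ennreal \<bar>ln (\<bar>x \<bullet> z\<bar> / norm x)\<bar>) + ennreal (2 * K * B * norm y) * indicator annulus z \<partial>lborel)"
    proof (rule nn_integral_mono_AE)
      show "AE z in lborel. ennreal (norm (indicator annulus z *\<^sub>R Om z (?V z))) \<le>
        ennreal (2 * K * norm y) * (indicator annulus z * ennreal \<bar>ln (\<bar>x \<bullet> z\<bar> / norm x)\<bar>) + ennreal (2 * K * B * norm y) * indicator annulus z"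
        using AE_inner_neq_0[OF x]
      proof eventually_elim
        case (elim z)
        show ?case
        proof (cases "z \<in> annulus")
          case True
          have "norm (Om z (?V z)) \<le> K * norm (?V z)" by (rule bd(2)[OF True])
          also have "\<dots> \<le> K * ((2 * \<bar>ln (\<bar>x \<bullet> z\<bar> / norm x)\<bar> + 2 * B) * norm y)"
            by (rule mult_left_mono[OF V[OF elim] bd(1)])
          also have "\<dots> = (2 * K * norm y) * \<bar>ln (\<bar>x \<bullet> z\<bar> / norm x)\<bar> + 2 * K * B * norm y" by (simp add: algebra_simps)
          finally have "ennreal (norm (Om z (?V z))) \<le> ennreal ((2 * K * norm y) * \<bar>ln (\<bar>x \<bullet> z\<bar> / norm x)\<bar> + 2 * K * B * norm y)"
            by (rule ennreal_leI)
          also have "\<dots> = ennreal (2 * K * norm y) * ennreal \<bar>ln (\<bar>x \<bullet> z\<bar> / norm x)\<bar> + ennreal (2 * K * B * norm y)"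
            using bd(1) B(1) by (simp add: ennreal_mult)
          finally show ?thesis using True by simp
        qed simp
      qed
    qed
    also have "\<dots> = ennreal (2 * K * norm y) * (\<integral>\<^sup>+z. indicator annulus z * ennreal \<bar>ln (\<bar>x \<bullet> z\<bar> / norm x)\<bar> \<partial>lborel) + ennreal (2 * K * B * norm y) * ennreal A"
      by (subst nn_integral_add) (auto simp: nn_integral_cmult A(1))
    also have "\<dots> \<le> ennreal (2 * K * norm y) * ennreal L + ennreal (2 * K * B * norm y) * ennreal A"
      by (intro add_mono mult_left_mono L x) auto
    also have "\<dots> = ennreal (K * (2 * L + 2 * B * A) * norm y)"
      using bd(1) L(1) B(1) A(2) by (simp add: ennreal_mult[symmetric] ennreal_plus[symmetric] del: ennreal_plus) (simp add: algebra_simps)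
    finally have "norm (LINT z|lborel. indicator annulus z *\<^sub>R Om z (?V z)) \<le> K * (2 * L + 2 * B * A) * norm y"
      using bd(1) L(1) B(1) A(2) by (subst (asm) ennreal_le_iff) auto
    then show ?thesis unfolding eq[symmetric] case_prod_beta' .
  qed

  have main: "norm (LINT p|(lborel \<Otimes>\<^sub>M lborel). indicator {\<epsilon>..R} (fst p) *\<^sub>R (dil p *\<^sub>R Om (fst p *\<^sub>R snd p) (osc J (-1) f (fst p *\<^sub>R snd p))))
      \<le> C * (LINT x|lborel. norm (f x))"
    if e: "0 < \<epsilon>" "\<epsilon> \<le> R" and f: "integrable lborel f" for \<epsilon> R :: real and f :: "real^'n \<Rightarrow> 'w"
  proof -
    have [measurable]: "f \<in> borel_measurable borel" using f by auto
    define W :: "real \<times> (real^'n) \<Rightarrow> real" where "W p = indicator {\<epsilon>..R} (fst p) * indicator annulus (snd p) / fst p" for p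
    let ?F = "\<lambda>p x. W p *\<^sub>R Om (snd p) (rot J (- (fst p * (x \<bullet> snd p))) (f x))"
    have W_eq: "W p = (case p of (t, z) \<Rightarrow> (indicator {\<epsilon>..R} t * (1 / t)) * indicator annulus z)" for p
      by (simp add: W_def case_prod_beta)
    have iW: "integrable lborel W"
      unfolding W_eq[abs_def] lborel_prod[symmetric]
    proof (rule integrable_pair_mult[OF _ ann_int])
      have "continuous_on {\<epsilon>..R} (\<lambda>t. 1 / t)" using e by (auto intro!: continuous_intros)
      from borel_integrable_compact[OF compact_Icc this]
      show "integrable lborel (\<lambda>t. indicator {\<epsilon>..R} t * (1 / t))" by simp
    qed
    have [measurable]: "W \<in> borel_measurable borel" using iW by auto
    have W0: "W p \<ge> 0" for p using e by (auto simp: W_def indicator_def)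
    have WK: "norm (W p *\<^sub>R Om (snd p) v) \<le> K * (W p * norm v)" for p v
    proof (cases "snd p \<in> annulus")
      case True
      then show ?thesis using mult_left_mono[OF bd(2)[OF True, of v] W0[of p]] W0[of p] by (simp add: ac_simps)
    qed (simp add: W_def)
    have ip: "integrable (lborel \<Otimes>\<^sub>M lborel) (\<lambda>(p, x). ?F p x)"
    proof (rule Bochner_Integration.integrable_bound)
      show "integrable (lborel \<Otimes>\<^sub>M lborel) (\<lambda>q. K * (case q of (p, x) \<Rightarrow> W p * norm (f x)))"
        by (intro integrable_mult_right integrable_pair_mult iW integrable_norm f)
      have "(\<lambda>q. Om (snd (fst q)) (rot J (- (fst (fst q) * (snd q \<bullet> snd (fst q)))) (f (snd q)))) \<in> borel_measurable (lborel \<Otimes>\<^sub>M lborel)"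
      proof (rule measurable_linear_apply[OF lin])
        have [measurable]: "(\<lambda>q::(real \<times> (real^'n)) \<times> (real^'n). fst (fst q)) \<in> borel_measurable (lborel \<Otimes>\<^sub>M lborel)"
          "(\<lambda>q::(real \<times> (real^'n)) \<times> (real^'n). snd (fst q)) \<in> borel_measurable (lborel \<Otimes>\<^sub>M lborel)"
          unfolding lborel_prod by (auto intro!: borel_measurable_continuous_onI continuous_intros)
        show "(\<lambda>q::(real \<times> (real^'n)) \<times> (real^'n). Om (snd (fst q)) y) \<in> borel_measurable (lborel \<Otimes>\<^sub>M lborel)" for y
          by (rule measurable_compose[OF _ meas]) measurable
        show "(\<lambda>q::(real \<times> (real^'n)) \<times> (real^'n). rot J (- (fst (fst q) * (snd q \<bullet> snd (fst q)))) (f (snd q))) \<in> borel_measurable (lborel \<Otimes>\<^sub>M lborel)"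
          by measurable
      qed
      then show "(\<lambda>(p, x). ?F p x) \<in> borel_measurable (lborel \<Otimes>\<^sub>M lborel)" unfolding case_prod_beta by measurable
      show "AE q in lborel \<Otimes>\<^sub>M lborel. norm (case q of (p, x) \<Rightarrow> ?F p x) \<le> norm (K * (case q of (p, x) \<Rightarrow> W p * norm (f x)))"
      proof (rule AE_I2)
        fix q :: "(real \<times> (real^'n)) \<times> (real^'n)"
        obtain p x where q: "q = (p, x)" by (cases q)
        have "norm (K * (W p * norm (f x))) = K * (W p * norm (f x))" using bd(1) W0[of p] by simp
        then show "norm (case q of (p, x) \<Rightarrow> ?F p x) \<le> norm (K * (case q of (p, x) \<Rightarrow> W p * norm (f x)))"
          using WK[of p "rot J (- (fst p * (x \<bullet> snd p))) (f x)"] by (simp only: q prod.case norm_rot[OF J])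
      qed
    qed
    have point: "indicator {\<epsilon>..R} (fst p) *\<^sub>R (dil p *\<^sub>R Om (fst p *\<^sub>R snd p) (osc J (-1) f (fst p *\<^sub>R snd p))) = (1 / ln 2) *\<^sub>R (LINT x|lborel. ?F p x)" for p
    proof (cases "fst p \<in> {\<epsilon>..R}")
      case True
      then have t: "fst p > 0" using e by auto
      have bl: "bounded_linear (\<lambda>v. W p *\<^sub>R Om (snd p) v)"
        using lin[of "snd p"] by (intro bounded_linear_compose[OF bounded_linear_scaleR_right]) (simp add: linear_conv_bounded_linear)
      have "(LINT x|lborel. ?F p x) = W p *\<^sub>R Om (snd p) (LINT x|lborel. rot J (- (fst p * (x \<bullet> snd p))) (f x))"
        by (rule integral_bounded_linear[OF bl]) (rule rot_integrable[OF J f], simp)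
      also have "(LINT x|lborel. rot J (- (fst p * (x \<bullet> snd p))) (f x)) = osc J (-1) f (fst p *\<^sub>R snd p)"
        by (simp add: osc_def)
      finally have F: "(LINT x|lborel. ?F p x) = W p *\<^sub>R Om (snd p) (osc J (-1) f (fst p *\<^sub>R snd p))" .
      \<comment> \<open>The density t^(n-1) and the homogeneity factor t^(-n) leave the
        scale-invariant weight 1 / t of the oscillatory integrals.\<close>
      have "dil p * (1 / fst p ^ CARD('n)) = W p / ln 2"
      proof -
        have "fst p ^ CARD('n) = fst p * fst p ^ (CARD('n) - 1)" by (simp add: power_eq_if)
        then show ?thesis using t True by (simp add: dil_def W_def)
      qed
      then have "(dil p * (1 / fst p ^ CARD('n))) *\<^sub>R Om (snd p) (osc J (-1) f (fst p *\<^sub>R snd p)) =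
          (1 / ln 2) *\<^sub>R (LINT x|lborel. ?F p x)"
        by (simp only: F) simp
      then show ?thesis using True by (simp add: hom[OF t])
    qed (simp add: W_def)
    have "(LINT p|(lborel \<Otimes>\<^sub>M lborel). indicator {\<epsilon>..R} (fst p) *\<^sub>R (dil p *\<^sub>R Om (fst p *\<^sub>R snd p) (osc J (-1) f (fst p *\<^sub>R snd p))))
      = (1 / ln 2) *\<^sub>R (LINT p|lborel. LINT x|lborel. ?F p x)"
      unfolding point lborel_prod by (rule integral_scaleR_right)
    also have "(LINT p|lborel. LINT x|lborel. ?F p x) = (LINT x|lborel. LINT p|lborel. ?F p x)"
      by (rule lborel_pair.Fubini_integral[symmetric, OF ip])
    also have "norm ((1 / ln 2) *\<^sub>R (LINT x|lborel. LINT p|lborel. ?F p x)) \<le> (1 / ln 2) * (LINT x|lborel. K * (2 * L + 2 * B * A) * norm (f x))"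
    proof -
      have "norm (LINT x|lborel. LINT p|lborel. ?F p x) \<le> (LINT x|lborel. norm (LINT p|lborel. ?F p x))"
        by (rule integral_norm_bound)
      also have "\<dots> \<le> (LINT x|lborel. K * (2 * L + 2 * B * A) * norm (f x))"
      proof (rule integral_mono_AE)
        show "integrable lborel (\<lambda>x. norm (LINT p|lborel. ?F p x))"
          by (rule integrable_norm[OF lborel_pair.integrable_snd[OF ip]])
        show "integrable lborel (\<lambda>x. K * (2 * L + 2 * B * A) * norm (f x))" by (intro integrable_mult_right integrable_norm f)
        have "AE x in lborel. x \<noteq> (0::real^'n)" by (rule AE_lborel_singleton)
        then show "AE x in lborel. norm (LINT p|lborel. ?F p x) \<le> K * (2 * L + 2 * B * A) * norm (f x)"
        proof eventually_elim
          case (elim x)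
          show ?case using inner[OF e elim, of "f x"] unfolding lborel_prod W_def .
        qed
      qed
      finally show ?thesis by (simp add: divide_right_mono)
    qed
    also have "\<dots> = C * (LINT x|lborel. norm (f x))" by (simp add: C_def)
    finally show ?thesis .
  qed

  have "norm (LINT \<xi>|lborel. Om \<xi> (osc J (-1) f \<xi>)) \<le> C * (LINT x|lborel. norm (f x))"
    if f: "integrable lborel f" and i: "integrable lborel (\<lambda>\<xi>. Om \<xi> (osc J (-1) f \<xi>))" for f
  proof -
    let ?g = "\<lambda>p::real \<times> (real^'n). dil p *\<^sub>R Om (fst p *\<^sub>R snd p) (osc J (-1) f (fst p *\<^sub>R snd p))"
    note g = integral_dilation[OF i]
    have gm[measurable]: "?g \<in> borel_measurable (lborel \<Otimes>\<^sub>M lborel)" using g(1) by auto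
    let ?I = "\<lambda>m p. indicator {1 / real (Suc m)..real (Suc m)} (fst p) *\<^sub>R ?g p"
    \<comment> \<open>The bound \<open>main\<close> is uniform in the truncation to
      [1 / (m + 1), m + 1], and the untruncated integrand is integrable by assumption, so dominated
      convergence removes the truncation.\<close>
    have "(\<lambda>m. LINT p|(lborel \<Otimes>\<^sub>M lborel). ?I m p) \<longlonglongrightarrow> (LINT p|(lborel \<Otimes>\<^sub>M lborel). ?g p)"
    proof (rule integral_dominated_convergence[where w = "\<lambda>p. norm (?g p)"])
      show "integrable (lborel \<Otimes>\<^sub>M lborel) (\<lambda>p. norm (?g p))" using g(1) by (rule integrable_norm)
      show "?I m \<in> borel_measurable (lborel \<Otimes>\<^sub>M lborel)" for m by measurable
      show "AE p in lborel \<Otimes>\<^sub>M lborel. norm (?I m p) \<le> norm (?g p)" for m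
        by (intro AE_I2) (auto simp: indicator_def)
      show "AE p in lborel \<Otimes>\<^sub>M lborel. (\<lambda>m. ?I m p) \<longlonglongrightarrow> ?g p"
      proof (rule AE_I2)
        fix p :: "real \<times> (real^'n)"
        show "(\<lambda>m. ?I m p) \<longlonglongrightarrow> ?g p"
        proof (cases "fst p > 0")
          case True
          obtain m1 :: nat where m1: "1 / real (Suc m1) < fst p" using nat_approx_posE[OF True] by blast
          obtain m2 :: nat where m2: "fst p < real m2" using reals_Archimedean2 by blast
          have "?I m p = ?g p" if "m \<ge> max m1 m2" for m
          proof -
            have "1 / real (Suc m) \<le> 1 / real (Suc m1)" using that by (intro divide_left_mono) auto
            then have "fst p \<in> {1 / real (Suc m)..real (Suc m)}" using that m1 m2 by auto
            then show ?thesis by simp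
          qed
          then have "\<forall>\<^sub>F m in sequentially. ?g p = ?I m p"
            unfolding eventually_sequentially by (intro exI[of _ "max m1 m2"]) (auto simp del: of_nat_Suc)
          then show ?thesis by (rule Lim_transform_eventually[OF tendsto_const])
        qed (simp add: dil_def)
      qed
    qed measurable
    then have "(\<lambda>m. norm (LINT p|(lborel \<Otimes>\<^sub>M lborel). ?I m p)) \<longlonglongrightarrow> norm (LINT \<xi>|lborel. Om \<xi> (osc J (-1) f \<xi>))"
      unfolding g(2) by (rule tendsto_norm)
    then show ?thesis
    proof (rule LIMSEQ_le_const2)
      have "1 / real (Suc m) \<le> real (Suc m)" for m by (rule order_trans[of _ 1]) simp_all
      then show "\<exists>N. \<forall>m\<ge>N. norm (LINT p|(lborel \<Otimes>\<^sub>M lborel). ?I m p) \<le> C * (LINT x|lborel. norm (f x))"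
        by (intro exI[of _ 0] allI impI main f) simp_all
    qed
  qed
  then show ?thesis using C by blast
qed

text \<open>With \<open>J\<close> a pattern variable, \<open>J_measurable\<close> would match every measurability goal.\<close>

declare J_measurable [measurable del] rot_measurable [measurable del] osc_measurable [measurable del]

section \<open>The operator on the Fourier side\<close>

lemma prod_list_count:
  fixes f :: "'n::finite \<Rightarrow> real"
  shows "prod_list (map f xs) = (\<Prod>i\<in>UNIV. f i ^ count_list xs i)"
proof (induction xs)
  case (Cons a xs)
  have "(\<Prod>i\<in>UNIV. f i ^ count_list (a # xs) i) = (\<Prod>i\<in>UNIV. (if i = a then f a else 1) * f i ^ count_list xs i)"
    by (intro prod.cong) auto
  also have "\<dots> = f a * (\<Prod>i\<in>UNIV. f i ^ count_list xs i)" by (simp add: prod.distrib prod.delta)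
  finally show ?case using Cons by simp
qed simp

lemma length_count: "length xs = (\<Sum>i\<in>(UNIV::'n::finite set). count_list xs i)"
proof (induction xs)
  case (Cons a xs)
  have "(\<Sum>i\<in>UNIV. count_list (a # xs) i) = (\<Sum>i\<in>UNIV. (if i = a then 1 else 0) + count_list xs i)"
    by (intro sum.cong) auto
  also have "\<dots> = 1 + (\<Sum>i\<in>UNIV. count_list xs i)" by (simp add: sum.distrib sum.delta)
  finally show ?case using Cons by simp
qed simp

lemma ex_count_list: "\<exists>xs. \<forall>i. count_list xs i = \<alpha> (i::'n::finite)"
proof -
  have "\<exists>xs. \<forall>i. count_list xs i = (if i \<in> I then \<alpha> i else 0)" if "finite I" for I
    using that
  proof (induction I)
    case (insert a I)
    then obtain xs where xs: "\<forall>i. count_list xs i = (if i \<in> I then \<alpha> i else 0)" by blast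
    have "count_list (replicate m a) i = (if i = a then m else 0)" for m i by (induction m) auto
    then show ?case using insert.hyps xs by (intro exI[of _ "replicate (\<alpha> a) a @ xs"]) auto
  qed (auto intro: exI[of _ "[]"])
  from this[of UNIV] show ?thesis by simp
qed

text \<open>One list serves all functions \<open>u\<close>, because the choice in
  \<open>multi_deriv\<close> depends on \<alpha> only.\<close>

lemma multi_deriv_list:
  fixes \<alpha> :: "'n::finite multi_index"
  shows "\<exists>xs. (\<forall>u :: real^'n \<Rightarrow> 'e::real_normed_vector. multi_deriv \<alpha> u = partial_derivs xs u) \<and> (\<forall>i. count_list xs i = \<alpha> i)"
proof (intro exI conjI allI)
  let ?xs = "SOME is. \<forall>i. count_list is i = \<alpha> i"
  show "multi_deriv \<alpha> u = partial_derivs ?xs u" for u :: "real^'n \<Rightarrow> 'e" by (simp add: multi_deriv_def)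
  show "count_list ?xs i = \<alpha> i" for i using someI_ex[OF ex_count_list[of \<alpha>]] by blast
qed

text \<open>The identity i^4 = 1. It makes the iterate of order 3 k the inverse of the factor i^k
  that an operator of order k produces on the Fourier side.\<close>

lemma J_power4: "complex_structure J \<Longrightarrow> (J ^^ (4 * m)) v = v"
proof (induction m)
  case (Suc m)
  have "4 * Suc m = 4 + 4 * m" by simp
  then have "(J ^^ (4 * Suc m)) v = (J ^^ 4) ((J ^^ (4 * m)) v)" by (simp only: funpow_add o_apply)
  then show ?case using Suc by (simp add: numeral_eq_Suc J_J J_minus)
qed simp

lemma J_funpow_linear: "complex_structure J \<Longrightarrow> bounded_linear (J ^^ m)"
  by (induction m) (auto simp: id_def[symmetric] bounded_linear_ident[unfolded id_def[symmetric]] o_def intro: bounded_linear_compose[OF J_bounded_linear])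

lemma norm_J_funpow: "complex_structure J \<Longrightarrow> norm ((J ^^ m) v) = norm v"
  by (induction m) (auto simp: J_norm)

lemma rot_J_funpow: "complex_structure J \<Longrightarrow> rot J \<theta> ((J ^^ m) v) = (J ^^ m) (rot J \<theta> v)"
  by (induction m) (auto simp: rot_J)

lemma borel_measurable_off_0:
  fixes f :: "'a::euclidean_space \<Rightarrow> 'b::euclidean_space"
  assumes "continuous_on (- {0}) f" shows "f \<in> borel_measurable borel"
proof -
  have "(\<lambda>x. indicator (- {0}) x *\<^sub>R f x) \<in> borel_measurable borel"
    by (rule borel_measurable_continuous_on_indicator[OF _ assms]) simp
  then have "(\<lambda>x. indicator (- {0}) x *\<^sub>R f x + indicator {0} x *\<^sub>R f 0) \<in> borel_measurable borel"
    by measurable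
  also have "(\<lambda>x. indicator (- {0}) x *\<^sub>R f x + indicator {0} x *\<^sub>R f 0) = f"
    by (auto simp: indicator_def)
  finally show ?thesis .
qed

lemma partial_derivs_shift:
  fixes u :: "real^'n::finite \<Rightarrow> 'e::real_normed_vector"
  assumes "smooth_on UNIV u"
  shows "partial_derivs is (\<lambda>x. u (a + x)) = (\<lambda>x. partial_derivs is u (a + x))"
proof (induction "is")
  case (Cons i js)
  have "partial_deriv i (\<lambda>x. partial_derivs js u (a + 1 *\<^sub>R x)) x = 1 *\<^sub>R partial_deriv i (partial_derivs js u) (a + 1 *\<^sub>R x)" for x
    by (rule partial_deriv_affine[OF smooth_on_differentiable[OF smooth_on_partial_derivs[OF assms]]])
  then show ?case by (simp add: Cons)
qed simp

lemma test_function_shift: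
  assumes "u \<in> test_functions" shows "(\<lambda>x. u (a + x)) \<in> test_functions"
proof -
  obtain R where us: "smooth_on UNIV u" and R: "\<And>x. norm x > R \<Longrightarrow> u x = 0" using assms by (auto simp: test_functions_iff)
  have "norm z > R + norm a \<Longrightarrow> norm (a + z) > R" for z using norm_diff_ineq[of z a] by (simp add: add.commute)
  then show ?thesis using smooth_on_affine[OF us, of a 1] R unfolding test_functions_iff by auto
qed

lemma integral_shift':
  fixes f :: "'a::euclidean_space \<Rightarrow> 'b::{banach, second_countable_topology}"
  assumes "f \<in> borel_measurable borel"
  shows "(LINT x|lborel. f (a + x)) = (LINT x|lborel. f x)"
  using integral_lborel_shift[OF assms, of a] by (simp add: add.commute)

lemma osc_sum:
  assumes J: "complex_structure J" and f: "\<And>i. i \<in> I \<Longrightarrow> integrable lborel (f i)"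
  shows "osc J s (\<lambda>x. \<Sum>i\<in>I. f i x) y = (\<Sum>i\<in>I. osc J s (f i) y)"
proof -
  have "osc J s (\<lambda>x. \<Sum>i\<in>I. f i x) y = (LINT x|lborel. (\<Sum>i\<in>I. rot J (s * (x \<bullet> y)) (f i x)))"
    unfolding osc_def by (simp add: linear_sum[OF bounded_linear.linear[OF rot_bounded_linear[OF J]]])
  also have "\<dots> = (\<Sum>i\<in>I. osc J s (f i) y)"
    unfolding osc_def by (intro Bochner_Integration.integral_sum osc_integrable[OF J] f)
  finally show ?thesis .
qed

lemmas continuous_on_blinfun_apply = bounded_bilinear.continuous_on[OF bounded_bilinear_blinfun_apply]

section \<open>Averages of the kernel over the annulus\<close>

context const_rank_operator
begin

lemma S_continuous: "continuous_on UNIV (\<lambda>\<xi>. S \<xi> v)"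
  using continuous_on_blinfun_apply[OF smooth_on_continuous[OF Sb_smooth] continuous_on_const[of UNIV v]] by (simp add: Sb_apply)

lemma Pb_continuous: "continuous_on (- {0}) Pb"
  by (intro continuous_at_imp_continuous_on ballI Pb_isCont) simp

lemma P_continuous: "continuous_on (- {0}) g \<Longrightarrow> continuous_on (- {0}) (\<lambda>\<xi>. P \<xi> (g \<xi>))"
  using continuous_on_blinfun_apply[OF Pb_continuous] by (simp add: Pb_apply)

lemma P_measurable [measurable]: "(\<lambda>\<xi>. P \<xi> w) \<in> borel_measurable borel"
  by (intro borel_measurable_off_0 P_continuous continuous_on_const)

lemma S_measurable [measurable]: "(\<lambda>\<xi>. S \<xi> v) \<in> borel_measurable borel"
  by (intro borel_measurable_continuous_onI S_continuous)

lemma PS_measurable [measurable]: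
  "g \<in> borel_measurable borel \<Longrightarrow> (\<lambda>\<xi>. P \<xi> (S \<xi> (g \<xi>))) \<in> borel_measurable borel"
  by (rule measurable_linear_apply[OF P_linear P_measurable measurable_linear_apply[OF S_linear S_measurable]])

definition tens :: "'n list \<Rightarrow> real^'n \<Rightarrow> real" where
  "tens is \<xi> = prod_list (map (\<lambda>i. \<xi> $ i) is)"

lemma tens_measurable [measurable]: "tens is \<in> borel_measurable borel"
proof -
  have "(\<lambda>\<xi>. tens is \<xi>) \<in> borel_measurable borel"
    unfolding tens_def by (induction "is") auto
  then show ?thesis by simp
qed

lemma tens_scale: "tens is (t *\<^sub>R \<xi>) = t ^ length is * tens is \<xi>"
  by (induction "is") (auto simp: tens_def)

lemma tens_bound: "\<bar>tens is \<xi>\<bar> \<le> norm \<xi> ^ length is"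
proof (induction "is")
  case (Cons i js)
  have "\<bar>\<xi> $ i\<bar> * \<bar>tens js \<xi>\<bar> \<le> norm \<xi> * norm \<xi> ^ length js"
    by (intro mult_mono Cons component_le_norm_cart) auto
  then show ?case by (simp add: tens_def abs_mult)
qed (simp add: tens_def)

definition N :: "'w set" where "N = (\<Inter>\<xi>\<in>sphere 0 1. range (S \<xi>))"

text \<open>Homogeneity of the symbol carries the condition from the unit sphere to all \<xi> other
  than 0, and the range projection S P turns membership into an equation, which is accessible to
  continuity arguments.\<close>

lemma N_iff: "w \<in> N \<longleftrightarrow> (\<forall>\<xi>. \<xi> \<noteq> 0 \<longrightarrow> S \<xi> (P \<xi> w) = w)"
proof
  assume w: "w \<in> N"
  show "\<forall>\<xi>. \<xi> \<noteq> 0 \<longrightarrow> S \<xi> (P \<xi> w) = w"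
  proof (intro allI impI)
    fix \<xi> :: "real^'n" assume \<xi>: "\<xi> \<noteq> 0"
    have "sgn \<xi> \<in> sphere 0 1" using \<xi> by (simp add: norm_sgn)
    then have "w \<in> range (S (sgn \<xi>))" using w by (auto simp: N_def)
    then obtain v where v: "w = S (sgn \<xi>) v" by auto
    have "S \<xi> ((1 / norm \<xi> ^ k) *\<^sub>R v) = w"
    proof -
      have "\<xi> = norm \<xi> *\<^sub>R sgn \<xi>" using \<xi> by (simp add: sgn_div_norm)
      then have "S \<xi> v = norm \<xi> ^ k *\<^sub>R S (sgn \<xi>) v" using S_scale[of "norm \<xi>" "sgn \<xi>" v] by simp
      then show ?thesis using \<xi> by (simp add: linear_scale[OF S_linear] v)
    qed
    then show "S \<xi> (P \<xi> w) = w" using moore_penrose_range_iff[OF S_linear] by (metis rangeI)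
  qed
next
  assume *: "\<forall>\<xi>. \<xi> \<noteq> 0 \<longrightarrow> S \<xi> (P \<xi> w) = w"
  have "w \<in> range (S \<xi>)" if "\<xi> \<in> sphere 0 1" for \<xi>
  proof -
    have "\<xi> \<noteq> 0" using that by auto
    then show ?thesis using * by (metis rangeI)
  qed
  then show "w \<in> N" by (simp add: N_def)
qed

text \<open>The average of the kernel over the annulus, the analogue of the spherical integral in the
  cancellation condition.\<close>

definition avg :: "'n list \<Rightarrow> 'w \<Rightarrow> 'v" where
  "avg is w = (LINT z|lborel. indicator annulus z *\<^sub>R (tens is z *\<^sub>R P z w))"

lemma P_bound_annulus: "\<exists>K\<ge>0. \<forall>z\<in>annulus. \<forall>w. norm (P z w) \<le> K * norm w"
proof -
  have "continuous_on annulus Pb" using Pb_continuous by (rule continuous_on_subset) (auto simp: annulus_def)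
  then have "compact (Pb ` annulus)" by (rule compact_continuous_image[OF _ compact_annulus])
  then have "bounded (Pb ` annulus)" by (rule compact_imp_bounded)
  then obtain K where K: "\<And>z. z \<in> annulus \<Longrightarrow> norm (Pb z) \<le> K" unfolding bounded_iff by auto
  have "norm (P z w) \<le> max K 0 * norm w" if "z \<in> annulus" for z w
  proof -
    have "norm (P z w) \<le> norm (Pb z) * norm w" using norm_blinfun[of "Pb z" w] by (simp add: Pb_apply)
    also have "\<dots> \<le> max K 0 * norm w" using K[OF that] by (intro mult_right_mono) auto
    finally show ?thesis .
  qed
  then show ?thesis by (intro exI[of _ "max K 0"]) auto
qed

lemma annulus_integrable:
  fixes f :: "real^'n \<Rightarrow> 'e::euclidean_space"
  assumes [measurable]: "f \<in> borel_measurable borel" and bd: "\<And>z. z \<in> annulus \<Longrightarrow> norm (f z) \<le> C"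
  shows "integrable lborel (\<lambda>z. indicator annulus z *\<^sub>R f z)"
proof (rule Bochner_Integration.integrable_bound)
  show "integrable lborel (\<lambda>z::real^'n. C * indicator annulus z)"
    using emeasure_annulus_finite[where 'n = 'n] by (intro integrable_mult_right integrable_real_indicator) auto
  show "AE z in lborel. norm (indicator annulus z *\<^sub>R f z) \<le> norm (C * indicator annulus z)"
    using bd by (intro AE_I2) (force simp: indicator_def)
  show "(\<lambda>z. indicator annulus z *\<^sub>R f z) \<in> borel_measurable lborel"
    using borel_compact[OF compact_annulus] assms(1) by (intro borel_measurable_scaleR borel_measurable_indicator) auto
qed

lemma avg_integrable: "integrable lborel (\<lambda>z. indicator annulus z *\<^sub>R (tens is z *\<^sub>R P z w))"
proof -
  obtain K where K: "K \<ge> 0" "\<And>z w. z \<in> annulus \<Longrightarrow> norm (P z w) \<le> K * norm w" using P_bound_annulus by blast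
  show ?thesis
  proof (rule annulus_integrable[where C = "2 ^ length is * (K * norm w)"])
    show "(\<lambda>z. tens is z *\<^sub>R P z w) \<in> borel_measurable borel" by measurable
    fix z :: "real^'n" assume z: "z \<in> annulus"
    have "\<bar>tens is z\<bar> \<le> 2 ^ length is"
      using tens_bound[of "is" z] power_mono[of "norm z" 2 "length is"] z by (simp add: annulus_def)
    then show "norm (tens is z *\<^sub>R P z w) \<le> 2 ^ length is * (K * norm w)"
      using K(2)[OF z, of w] K(1) by (simp add: mult_mono)
  qed
qed

lemma avg_linear: "linear (avg is)"
proof
  fix a b :: 'w and c :: real
  show "avg is (a + b) = avg is a + avg is b"
    unfolding avg_def linear_add[OF P_linear] scaleR_add_right
    by (rule Bochner_Integration.integral_add[OF avg_integrable avg_integrable])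
  have "indicator annulus z *\<^sub>R tens is z *\<^sub>R P z (c *\<^sub>R a) = c *\<^sub>R (indicator annulus z *\<^sub>R tens is z *\<^sub>R P z a)" for z
    by (simp add: linear_scale[OF P_linear])
  then show "avg is (c *\<^sub>R a) = c *\<^sub>R avg is a"
    unfolding avg_def by (simp only: integral_scaleR_right)
qed

text \<open>With \<open>tens is\<close> of degree k - n and P of degree -k the kernel has degree -n,
  so on the annulus |z|^(-n) times the kernel at sgn z is the kernel at z.\<close>

lemma cancellation_iff_avg:
  assumes nk: "CARD('n) \<le> k"
  shows "cancellation_condition k B \<longleftrightarrow> (\<forall>w\<in>N. \<forall>is. length is = k - CARD('n) \<longrightarrow> avg is w = 0)"
proof -
  have "(LINT \<xi>:sphere 0 1|hausdorff_measure (CARD('n) - 1). tensor_power (P \<xi> w) \<xi> is) = 0 \<longleftrightarrow> avg is w = 0"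
    if l: "length is = k - CARD('n)" for w "is"
  proof -
    have "(\<lambda>\<xi>. tens is \<xi> *\<^sub>R P \<xi> w) \<in> borel_measurable borel" by measurable
    note sph = sphere_integral_eq_0_iff[OF this]
    have "(indicator annulus z / norm z ^ CARD('n)) *\<^sub>R (tens is (sgn z) *\<^sub>R P (sgn z) w) = indicator annulus z *\<^sub>R (tens is z *\<^sub>R P z w)" for z
    proof (cases "z \<in> annulus")
      case True
      then have z: "norm z > 0" by (auto simp: annulus_def)
      have s: "sgn z = (1 / norm z) *\<^sub>R z" by (simp add: sgn_div_norm divide_inverse)
      \<comment> \<open>By n \<le> k the natural subtraction in the length of the list is
        exact.\<close>
      have "norm z ^ k = norm z ^ CARD('n) * norm z ^ length is"
        using nk l by (simp add: power_add[symmetric])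
      then have "1 / norm z ^ CARD('n) * ((1 / norm z) ^ length is * (1 / (1 / norm z) ^ k)) = 1"
        using z by (simp add: power_divide field_simps)
      then have "(1 / norm z ^ CARD('n) * ((1 / norm z) ^ length is * (1 / (1 / norm z) ^ k))) *\<^sub>R (tens is z *\<^sub>R P z w) = tens is z *\<^sub>R P z w"
        by (simp only: scaleR_one)
      then show ?thesis using True z unfolding s tens_scale P_scale[of "1 / norm z", OF less_imp_neq[OF divide_pos_pos[OF zero_less_one z], symmetric]]
        by (simp add: ac_simps)
    qed simp
    then show ?thesis unfolding avg_def using sph by (simp add: tensor_power_def tens_def)
  qed
  then show ?thesis unfolding cancellation_condition_def N_def by simp
qed

text \<open>Subtracting a multiple of the projection onto the orthogonal complement of the range does not
  change the action on \<open>S \<xi> v\<close>, but makes the average vanish identically.\<close>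

lemma corrected_kernel_exists:
  assumes nk: "CARD('n) \<le> k" and l: "length is = k - CARD('n)" and cancel: "\<And>w. w \<in> N \<Longrightarrow> avg is w = 0"
  shows "\<exists>T. linear T \<and> (\<forall>w. (LINT z|lborel. indicator annulus z *\<^sub>R
     (tens is z *\<^sub>R P z w - (1 / norm z ^ CARD('n)) *\<^sub>R T (w - S z (P z w)))) = 0)"
proof -
  let ?\<rho> = "\<lambda>z::real^'n. indicator annulus z *\<^sub>R (1 / norm z ^ CARD('n))"
  define G where "G w = (LINT z|lborel. indicator annulus z *\<^sub>R ((1 / norm z ^ CARD('n)) *\<^sub>R (w - S z (P z w))))" for w
  have pm[measurable]: "(\<lambda>z. w - S z (P z w)) \<in> borel_measurable borel" for w
    by (intro borel_measurable_diff measurable_linear_apply[OF S_linear S_measurable P_measurable]) auto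
  have proj: "norm (w - S z (P z w)) \<le> 2 * norm w" for z w
    using norm_triangle_ineq4[of w "S z (P z w)"] norm_moore_penrose_MX[OF S_linear, of z w] by linarith
  have \<rho>1: "1 / norm z ^ CARD('n) \<le> 1" "0 \<le> 1 / norm z ^ CARD('n)" if "z \<in> annulus" for z :: "real^'n"
    using that one_le_power[of "norm z" "CARD('n)"] by (auto simp: annulus_def divide_le_eq)
  have Gi: "integrable lborel (\<lambda>z. indicator annulus z *\<^sub>R ((1 / norm z ^ CARD('n)) *\<^sub>R (w - S z (P z w))))" for w
  proof (rule annulus_integrable[where C = "1 * (2 * norm w)"])
    fix z :: "real^'n" assume "z \<in> annulus"
    show "norm ((1 / norm z ^ CARD('n)) *\<^sub>R (w - S z (P z w))) \<le> 1 * (2 * norm w)"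
      unfolding norm_scaleR using \<rho>1[OF \<open>z \<in> annulus\<close>] by (intro mult_mono proj) auto
  qed measurable
  have G: "linear G"
  proof
    fix a b :: 'w and c :: real
    have "a + b - S z (P z (a + b)) = (a - S z (P z a)) + (b - S z (P z b))" for z
      by (simp add: linear_add[OF P_linear] linear_add[OF S_linear])
    then show "G (a + b) = G a + G b"
      unfolding G_def by (simp only: scaleR_add_right Bochner_Integration.integral_add[OF Gi Gi])
    have "indicator annulus z *\<^sub>R ((1 / norm z ^ CARD('n)) *\<^sub>R (c *\<^sub>R a - S z (P z (c *\<^sub>R a)))) =
      c *\<^sub>R (indicator annulus z *\<^sub>R ((1 / norm z ^ CARD('n)) *\<^sub>R (a - S z (P z a))))" for z
      by (simp add: linear_scale[OF P_linear] linear_scale[OF S_linear] scaleR_diff_right ac_simps)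
    then show "G (c *\<^sub>R a) = c *\<^sub>R G a" unfolding G_def by (simp only: integral_scaleR_right)
  qed
  \<comment> \<open>The inner product of G w with w is the weighted integral of the squared distance
    of w from the ranges, so G w = 0 makes this distance vanish almost everywhere. Continuity
    removes the exceptional set inside the open shell, and homogeneity reaches all \<xi> other than
    0.\<close>
  have ker: "w \<in> N" if "G w = 0" for w
  proof -
    let ?q = "\<lambda>z. indicator annulus z * ((1 / norm z ^ CARD('n)) * (norm (w - S z (P z w)))\<^sup>2)"
    have sq: "(w - S z (P z w)) \<bullet> w = (norm (w - S z (P z w)))\<^sup>2" for z
    proof -
      have "S z (P z w) \<bullet> (w - S z (P z w)) = 0"
        using moore_penrose_MX_sym[OF S_linear, of z w "w - S z (P z w)"]
        by (simp add: linear_diff[OF P_linear] linear_diff[OF S_linear] moore_penrose_XMX[OF S_linear] linear_0[OF S_linear])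
      then show ?thesis by (simp add: power2_norm_eq_inner inner_diff_right inner_commute)
    qed
    have q: "(indicator annulus z *\<^sub>R ((1 / norm z ^ CARD('n)) *\<^sub>R (w - S z (P z w)))) \<bullet> w = ?q z" for z
      by (simp add: sq)
    have qi: "integrable lborel ?q" using integrable_inner_left[of w lborel, OF Gi[of w]] by (simp only: q)
    have "(LINT z|lborel. ?q z) = G w \<bullet> w" unfolding G_def q[symmetric] by (rule integral_inner_left) (rule Gi)
    then have "(LINT z|lborel. ?q z) = 0" using that by simp
    then have AE0: "AE z in lborel. ?q z = 0"
      using integral_nonneg_eq_0_iff_AE[OF qi] by (auto simp: indicator_def)
    define O1 where "O1 = {z::real^'n. 1 < norm z \<and> norm z < 2 \<and> S z (P z w) \<noteq> w}"
    have "open O1"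
    proof -
      have c: "continuous_on (- {0}) (\<lambda>z. S z (P z w))"
        using continuous_on_blinfun_apply[OF continuous_on_subset[OF smooth_on_continuous[OF Sb_smooth] subset_UNIV] P_continuous[OF continuous_on_const]]
        by (simp add: Sb_apply)
      have "open (- {0::real^'n})" by (rule open_Compl) simp
      then have "open ((\<lambda>z. S z (P z w)) -` (- {w}) \<inter> - {0})"
        using c by (subst (asm) continuous_on_open_vimage) auto
      moreover have "open {z::real^'n. 1 < norm z \<and> norm z < 2}" by (intro open_Collect_conj open_Collect_less continuous_intros)
      ultimately have "open ({z::real^'n. 1 < norm z \<and> norm z < 2} \<inter> ((\<lambda>z. S z (P z w)) -` (- {w}) \<inter> - {0}))" by (rule open_Int[rotated])
      also have "{z::real^'n. 1 < norm z \<and> norm z < 2} \<inter> ((\<lambda>z. S z (P z w)) -` (- {w}) \<inter> - {0}) = O1" by (auto simp: O1_def)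
      finally show ?thesis .
    qed
    moreover have "AE z in lborel. z \<notin> O1"
      using AE0
    proof eventually_elim
      case (elim z)
      show ?case
      proof
        assume z: "z \<in> O1"
        then have "z \<in> annulus" "norm z > 0" "norm (w - S z (P z w)) > 0" by (auto simp: O1_def annulus_def)
        then show False using elim by auto
      qed
    qed
    ultimately have "O1 = {}"
    proof -
      assume O: "open O1" "AE z in lborel. z \<notin> O1"
      have "O1 \<in> null_sets lborel"
        using O by (subst AE_iff_null_sets) (auto simp: borel_open)
      then show "O1 = {}"
        using O(1) open_not_negligible[of O1] by (auto simp: negligible_iff_null_sets null_sets_completion_iff2 null_sets_completionI)
    qed
    then have *: "S z (P z w) = w" if "1 < norm z" "norm z < 2" for z using that by (auto simp: O1_def)
    show ?thesis
      unfolding N_iff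
    proof (intro allI impI)
      fix \<xi> :: "real^'n" assume \<xi>: "\<xi> \<noteq> 0"
      \<comment> \<open>The factor 3 / 2 places the rescaled point inside the open shell 1 < |z| <
        2.\<close>
      define t where "t = 3 / 2 / norm \<xi>"
      have t: "t > 0" using \<xi> by (simp add: t_def)
      have "S (t *\<^sub>R \<xi>) (P (t *\<^sub>R \<xi>) w) = w" using \<xi> by (intro *) (simp_all add: t_def)
      moreover have "S (t *\<^sub>R \<xi>) (P (t *\<^sub>R \<xi>) w) = S \<xi> (P \<xi> w)"
        using t by (simp add: S_scale P_scale linear_scale[OF S_linear])
      ultimately show "S \<xi> (P \<xi> w) = w" by simp
    qed
  qed
  \<comment> \<open>\<open>avg is\<close> vanishes on \<open>N\<close>, hence on the kernel of
    \<open>G\<close>, and therefore factors through \<open>G\<close>; the pseudoinverse of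
    \<open>G\<close> provides a linear factorisation.\<close>
  define T where "T = avg is \<circ> moore_penrose G"
  have T: "linear T" unfolding T_def by (intro linear_compose linear_moore_penrose[OF G] avg_linear)
  have TG: "T (G w) = avg is w" for w
  proof -
    have "G (w - moore_penrose G (G w)) = 0" by (simp add: linear_diff[OF G] moore_penrose_MXM[OF G])
    then have "avg is (w - moore_penrose G (G w)) = 0" using ker cancel by blast
    then show ?thesis by (simp add: T_def linear_diff[OF avg_linear])
  qed
  have Tb: "bounded_linear T" using T by (simp add: linear_conv_bounded_linear)
  have "(LINT z|lborel. indicator annulus z *\<^sub>R (tens is z *\<^sub>R P z w - (1 / norm z ^ CARD('n)) *\<^sub>R T (w - S z (P z w)))) = 0" for w
  proof -
    have "indicator annulus z *\<^sub>R (tens is z *\<^sub>R P z w - (1 / norm z ^ CARD('n)) *\<^sub>R T (w - S z (P z w))) =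
      indicator annulus z *\<^sub>R (tens is z *\<^sub>R P z w) - T (indicator annulus z *\<^sub>R ((1 / norm z ^ CARD('n)) *\<^sub>R (w - S z (P z w))))" for z
      by (simp add: linear_scale[OF T] linear_diff[OF T] scaleR_diff_right)
    then have "(LINT z|lborel. indicator annulus z *\<^sub>R (tens is z *\<^sub>R P z w - (1 / norm z ^ CARD('n)) *\<^sub>R T (w - S z (P z w)))) =
      avg is w - T (G w)"
      unfolding avg_def G_def
      by (simp only: Bochner_Integration.integral_diff[OF avg_integrable integrable_bounded_linear[OF Tb Gi]] integral_bounded_linear[OF Tb Gi])
    then show ?thesis by (simp add: TG)
  qed
  then show ?thesis using T by blast
qed

end

section \<open>Complex-linear operators and the reduction to an estimate at the origin\<close>

locale complex_operator = const_rank_operator B k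
  for B :: "'n::finite multi_index \<Rightarrow> 'v::euclidean_space \<Rightarrow> 'w::euclidean_space" and k +
  fixes JV :: "'v \<Rightarrow> 'v" and JW :: "'w \<Rightarrow> 'w"
  assumes nk: "CARD('n) \<le> k" and JV: "complex_structure JV" and JW: "complex_structure JW"
    and commute: "\<And>\<alpha> v. \<alpha> \<in> multi_indices k \<Longrightarrow> B \<alpha> (JV v) = JW (B \<alpha> v)"
begin

lemma S_J: "S \<xi> (JV v) = JW (S \<xi> v)"
proof -
  have "JW (S \<xi> v) = (\<Sum>\<alpha>\<in>multi_indices k. JW (monomial \<alpha> \<xi> *\<^sub>R B \<alpha> v))"
    unfolding symbol_def by (rule linear_sum[OF J_linear[OF JW]])
  also have "\<dots> = S \<xi> (JV v)" unfolding symbol_def by (intro sum.cong) (simp_all add: J_scale[OF JW] commute)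
  finally show ?thesis by simp
qed

lemma S_J_funpow: "S \<xi> ((JV ^^ m) v) = (JW ^^ m) (S \<xi> v)"
  by (induction m) (auto simp: S_J)

lemma J_skew:
  assumes "complex_structure J" shows "J a \<bullet> b = - (a \<bullet> J b)"
proof -
  have "J a \<bullet> J (J b) = a \<bullet> J b" using assms unfolding complex_structure_def orthogonal_transformation_def by blast
  then show ?thesis by (simp add: J_J[OF assms])
qed

text \<open>The inverse of J is -J and J is skew, so - JV P JW satisfies the Penrose equations for
  the symbol, and uniqueness applies. The pseudoinverse formed with the real inner products is thus
  complex-linear.\<close>

lemma P_J: "P \<xi> (JW w) = JV (P \<xi> w)"
proof -
  let ?X = "\<lambda>w. - JV (P \<xi> (JW w))"
  have "P \<xi> = ?X"
  proof (rule moore_penrose_eqI[OF S_linear])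
    have lin: "linear ?X"
      using linear_compose[OF linear_compose[OF J_linear[OF JW] P_linear[of \<xi>]] J_linear[OF JV]]
      by (simp add: o_def linear_compose_neg)
    have SX: "S \<xi> (?X w) = - JW (S \<xi> (P \<xi> (JW w)))" for w by (simp add: linear_neg[OF S_linear] S_J)
    have XS: "?X (S \<xi> v) = - JV (P \<xi> (S \<xi> (JV v)))" for v by (simp add: S_J)
    show "penrose (S \<xi>) ?X"
      unfolding penrose_def
    proof (intro conjI allI lin)
      show "S \<xi> (?X (S \<xi> v)) = S \<xi> v" for v
      proof -
        have "S \<xi> (?X (S \<xi> v)) = - JW (S \<xi> (P \<xi> (S \<xi> (JV v))))" by (simp only: SX) (simp only: S_J)
        also have "\<dots> = - JW (S \<xi> (JV v))" by (simp only: moore_penrose_MXM[OF S_linear])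
        finally show ?thesis by (simp only: S_J J_J[OF JW] minus_minus)
      qed
      show "?X (S \<xi> (?X w)) = ?X w" for w
        by (simp add: SX J_minus[OF JW] J_J[OF JW] moore_penrose_XMX[OF S_linear])
      show "S \<xi> (?X w) \<bullet> z = w \<bullet> S \<xi> (?X z)" for w z
        by (simp only: SX inner_minus_left inner_minus_right J_skew[OF JW])
          (simp add: moore_penrose_MX_sym[OF S_linear] J_skew[OF JW])
      show "?X (S \<xi> v) \<bullet> u = v \<bullet> ?X (S \<xi> u)" for v u
        by (simp only: XS inner_minus_left inner_minus_right J_skew[OF JV])
          (simp add: moore_penrose_XM_sym[OF S_linear] J_skew[OF JV])
    qed
  qed
  then have "P \<xi> (JW w) = - JV (P \<xi> (JW (JW w)))" by (rule fun_cong)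
  then show ?thesis by (simp add: J_J[OF JW] linear_neg[OF P_linear] J_minus[OF JV])
qed

lemma rot_PS: "rot JV \<theta> (P \<xi> (S \<xi> v)) = P \<xi> (S \<xi> (rot JV \<theta> v))"
  by (simp add: rot_def linear_add[OF S_linear] linear_add[OF P_linear] linear_scale[OF S_linear] linear_scale[OF P_linear] S_J P_J)

lemma B_bounded_linear: "\<alpha> \<in> multi_indices k \<Longrightarrow> bounded_linear (B \<alpha>)"
  using B_linear by (simp add: linear_conv_bounded_linear)

lemma B_rot: "\<alpha> \<in> multi_indices k \<Longrightarrow> rot JW \<theta> (B \<alpha> v) = B \<alpha> (rot JV \<theta> v)"
  by (simp add: rot_def commute linear_add[OF B_linear] linear_scale[OF B_linear])

lemma diff_operator_integrable:
  assumes "u \<in> test_functions" shows "integrable lborel (diff_operator k B u)"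
proof -
  have "integrable lborel (\<lambda>x. B \<alpha> (multi_deriv \<alpha> u x))" if \<alpha>: "\<alpha> \<in> multi_indices k" for \<alpha>
  proof -
    obtain xs where "multi_deriv \<alpha> u = partial_derivs xs u" using multi_deriv_list[of \<alpha>, where 'e = 'v] by blast
    then show ?thesis
      using test_function_integrable[OF test_function_partial_derivs[OF assms]]
      by (intro integrable_bounded_linear[OF B_bounded_linear[OF \<alpha>]]) simp
  qed
  then show ?thesis unfolding diff_operator_def[abs_def] by (intro Bochner_Integration.integrable_sum)
qed

lemma multi_deriv_symbol:
  assumes \<alpha>: "\<alpha> \<in> multi_indices k"
  shows "\<exists>xs. (\<forall>u :: real^'n \<Rightarrow> 'v. multi_deriv \<alpha> u = partial_derivs xs u) \<and> (\<forall>\<xi> v. mono_J JV 1 xs \<xi> v = monomial \<alpha> \<xi> *\<^sub>R (JV ^^ k) v)"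
proof -
  obtain xs where xs: "\<And>u :: real^'n \<Rightarrow> 'v. multi_deriv \<alpha> u = partial_derivs xs u" "\<And>i. count_list xs i = \<alpha> i"
    using multi_deriv_list[of \<alpha>, where 'e = 'v] by blast
  have "length xs = k" using \<alpha> by (simp add: length_count xs(2) multi_indices_def)
  moreover have "prod_list (map (\<lambda>i. 1 * \<xi> $ i) xs) = monomial \<alpha> \<xi>" for \<xi> by (simp add: prod_list_count monomial_def xs(2))
  ultimately have "mono_J JV 1 xs \<xi> v = monomial \<alpha> \<xi> *\<^sub>R (JV ^^ k) v" for \<xi> v by (simp add: mono_J_def[OF JV])
  then show ?thesis using xs(1) by blast
qed

text \<open>Every derivative of order k contributes its monomial together with the same factor i^k,
  which can be pulled out of the sum.\<close>

lemma osc_diff_operator: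
  assumes u: "u \<in> test_functions"
  shows "osc JW (-1) (diff_operator k B u) \<xi> = (JW ^^ k) (S \<xi> (osc JV (-1) u \<xi>))"
proof -
  have *: "integrable lborel (\<lambda>x. B \<alpha> (multi_deriv \<alpha> u x)) \<and>
      osc JW (-1) (\<lambda>x. B \<alpha> (multi_deriv \<alpha> u x)) \<xi> = monomial \<alpha> \<xi> *\<^sub>R B \<alpha> ((JV ^^ k) (osc JV (-1) u \<xi>))"
    if \<alpha>: "\<alpha> \<in> multi_indices k" for \<alpha>
  proof -
    obtain xs where xs: "multi_deriv \<alpha> u = partial_derivs xs u" "\<And>\<xi> v. mono_J JV 1 xs \<xi> v = monomial \<alpha> \<xi> *\<^sub>R (JV ^^ k) v"
      using multi_deriv_symbol[OF \<alpha>] by blast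
    have i: "integrable lborel (multi_deriv \<alpha> u)"
      unfolding xs(1) by (rule test_function_integrable[OF test_function_partial_derivs[OF u]])
    have "osc JW (-1) (\<lambda>x. B \<alpha> (multi_deriv \<alpha> u x)) \<xi> = B \<alpha> (osc JV (-1) (multi_deriv \<alpha> u) \<xi>)"
      by (rule osc_linear[OF JV i B_bounded_linear[OF \<alpha>] B_rot[OF \<alpha>]])
    also have "osc JV (-1) (multi_deriv \<alpha> u) \<xi> = monomial \<alpha> \<xi> *\<^sub>R (JV ^^ k) (osc JV (-1) u \<xi>)"
      unfolding xs(1) using osc_of_partial_derivs[OF JV u, of "-1" xs \<xi>] by (simp add: xs(2))
    finally show ?thesis
      using integrable_bounded_linear[OF B_bounded_linear[OF \<alpha>] i] by (simp add: linear_scale[OF B_linear[OF \<alpha>]])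
  qed
  have "osc JW (-1) (diff_operator k B u) \<xi> = (\<Sum>\<alpha>\<in>multi_indices k. osc JW (-1) (\<lambda>x. B \<alpha> (multi_deriv \<alpha> u x)) \<xi>)"
    unfolding diff_operator_def[abs_def] using * by (intro osc_sum[OF JW]) blast
  also have "\<dots> = S \<xi> ((JV ^^ k) (osc JV (-1) u \<xi>))"
    unfolding symbol_def using * by (intro sum.cong) auto
  finally show ?thesis by (simp add: S_J_funpow)
qed

text \<open>\<open>PSF u\<close> is the Fourier transform of \<open>u - \<pi> u\<close>; \<open>Tfun is u\<close> is, up to a constant and powers of \<open>JV\<close>,
  its derivative of order \<open>is\<close> at \<open>0\<close>.\<close>

definition PSF :: "(real^'n \<Rightarrow> 'v) \<Rightarrow> real^'n \<Rightarrow> 'v" where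
  "PSF u \<xi> = P \<xi> (S \<xi> (osc JV (-1) u \<xi>))"

definition Tfun :: "'n list \<Rightarrow> (real^'n \<Rightarrow> 'v) \<Rightarrow> 'v" where
  "Tfun is u = (LINT \<xi>|lborel. tens is \<xi> *\<^sub>R PSF u \<xi>)"

lemma PSF_measurable: "u \<in> test_functions \<Longrightarrow> PSF u \<in> borel_measurable borel"
  unfolding PSF_def[abs_def] by (intro PS_measurable osc_measurable[OF JV] test_function_measurable)

lemma PSF_rapid:
  assumes u: "u \<in> test_functions" shows "rapid (PSF u)"
proof (rule rapid_dominated[where C = 1 and j = 0])
  show "rapid (osc JV (-1) u)" by (rule osc_test_rapid[OF JV u]) simp
  show "norm (PSF u x) \<le> 1 * norm x ^ 0 * norm (osc JV (-1) u x)" for x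
    using norm_moore_penrose_XM[OF S_linear] by (simp add: PSF_def)
qed (rule PSF_measurable[OF u])

lemma tens_PSF_rapid:
  assumes u: "u \<in> test_functions" shows "rapid (\<lambda>\<xi>. tens is \<xi> *\<^sub>R PSF u \<xi>)"
proof (rule rapid_dominated[OF PSF_rapid[OF u], where C = 1 and j = "length is"])
  note PSF_measurable[OF u, measurable]
  show "(\<lambda>\<xi>. tens is \<xi> *\<^sub>R PSF u \<xi>) \<in> borel_measurable borel" by measurable
  show "norm (tens is x *\<^sub>R PSF u x) \<le> 1 * norm x ^ length is * norm (PSF u x)" for x
    using tens_bound[of "is" x] by (simp add: mult_right_mono)
qed

lemma complement_projection:
  assumes u: "u \<in> test_functions"
  shows "u x - complex_projection JV k B u x = (1 / (2 * pi) ^ CARD('n)) *\<^sub>R osc JV 1 (PSF u) x"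
proof -
  have F: "fourier JV u = osc JV (-1) u" using fourier_eq_osc by blast
  have ir: "integrable lborel (osc JV (-1) u)" by (rule rapid_integrable[OF osc_test_rapid[OF JV u]]) simp
  have ip: "integrable lborel (PSF u)" by (rule rapid_integrable[OF PSF_rapid[OF u]])
  have "complex_projection JV k B u x = (1 / (2 * pi) ^ CARD('n)) *\<^sub>R osc JV 1 (\<lambda>\<xi>. osc JV (-1) u \<xi> - PSF u \<xi>) x"
    unfolding complex_projection_def fourier_multiplier_def inverse_fourier_eq_osc F
    by (simp add: kernel_symbol_def PSF_def)
  also have "\<dots> = (1 / (2 * pi) ^ CARD('n)) *\<^sub>R (osc JV 1 (osc JV (-1) u) x - osc JV 1 (PSF u) x)"
    by (simp only: osc_diff[OF JV ir ip])
  also have "osc JV 1 (osc JV (-1) u) x = (2 * pi) ^ CARD('n) *\<^sub>R u x"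
    using osc_inversion[OF JV u, of "-1" x] by simp
  finally show ?thesis by (simp add: scaleR_diff_right)
qed

lemma complement_deriv:
  assumes u: "u \<in> test_functions"
  shows "partial_derivs is (\<lambda>x. u x - complex_projection JV k B u x) x =
    (1 / (2 * pi) ^ CARD('n)) *\<^sub>R (JV ^^ length is) (osc JV 1 (\<lambda>\<xi>. tens is \<xi> *\<^sub>R PSF u \<xi>) x)"
proof -
  let ?c = "1 / (2 * pi) ^ CARD('n)"
  have "(\<lambda>x. u x - complex_projection JV k B u x) = (\<lambda>x. ?c *\<^sub>R osc JV 1 (PSF u) x)"
    using complement_projection[OF u] by blast
  then have "partial_derivs is (\<lambda>x. u x - complex_projection JV k B u x) x = ?c *\<^sub>R partial_derivs is (osc JV 1 (PSF u)) x"
    using partial_derivs_linear[OF bounded_linear_scaleR_right osc_smooth[OF JV PSF_rapid[OF u]], of "is" ?c] by simp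
  also have "partial_derivs is (osc JV 1 (PSF u)) = osc JV 1 (\<lambda>x. mono_J JV 1 is x (PSF u x))"
    by (rule osc_partial_derivs[OF JV PSF_rapid[OF u]])
  also have "(\<lambda>x. mono_J JV 1 is x (PSF u x)) = (\<lambda>x. (JV ^^ length is) (tens is x *\<^sub>R PSF u x))"
    by (simp add: mono_J_def[OF JV] tens_def linear_scale[OF bounded_linear.linear[OF J_funpow_linear[OF JV]]])
  also have "osc JV 1 (\<lambda>x. (JV ^^ length is) (tens is x *\<^sub>R PSF u x)) x = (JV ^^ length is) (osc JV 1 (\<lambda>x. tens is x *\<^sub>R PSF u x) x)"
    by (rule osc_linear[OF JV rapid_integrable[OF tens_PSF_rapid[OF u]] J_funpow_linear[OF JV] rot_J_funpow[OF JV]])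
  finally show ?thesis .
qed

text \<open>Translation multiplies the transform by a phase, and phases commute with the
  complex-linear multiplier P S. An estimate at the origin for all translates of u is therefore an
  estimate of the derivative at every point.\<close>

lemma Tfun_shift:
  assumes u: "u \<in> test_functions"
  shows "Tfun is (\<lambda>x. u (a + x)) = osc JV 1 (\<lambda>\<xi>. tens is \<xi> *\<^sub>R PSF u \<xi>) a"
proof -
  note [measurable] = test_function_measurable[OF u] rot_measurable[OF JV]
  have F: "osc JV (-1) (\<lambda>x. u (a + x)) \<xi> = rot JV (\<xi> \<bullet> a) (osc JV (-1) u \<xi>)" for \<xi>
  proof -
    have "osc JV (-1) (\<lambda>x. u (a + x)) \<xi> = (LINT x|lborel. rot JV ((-1) * (((a + x) - a) \<bullet> \<xi>)) (u (a + x)))" by (simp add: osc_def)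
    also have "\<dots> = (LINT x|lborel. rot JV ((-1) * ((x - a) \<bullet> \<xi>)) (u x))"
      by (rule integral_shift'[of "\<lambda>x. rot JV ((-1) * ((x - a) \<bullet> \<xi>)) (u x)"]) measurable
    also have "\<dots> = (LINT x|lborel. rot JV (\<xi> \<bullet> a) (rot JV ((-1) * (x \<bullet> \<xi>)) (u x)))"
      unfolding rot_add[OF JV, symmetric] by (simp add: inner_diff_left inner_commute algebra_simps)
    also have "\<dots> = rot JV (\<xi> \<bullet> a) (osc JV (-1) u \<xi>)"
      unfolding osc_def by (rule integral_bounded_linear[OF rot_bounded_linear[OF JV] osc_integrable[OF JV test_function_integrable[OF u]]])
    finally show ?thesis .
  qed
  show ?thesis
    unfolding Tfun_def osc_def[of JV 1] PSF_def F
    by (intro Bochner_Integration.integral_cong refl) (simp add: rot_scaleR[OF JV] rot_PS)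
qed

lemma diff_operator_shift:
  assumes u: "u \<in> test_functions"
  shows "diff_operator k B (\<lambda>x. u (a + x)) = (\<lambda>x. diff_operator k B u (a + x))"
proof
  fix x
  have us: "smooth_on UNIV u" using u by (simp add: test_functions_iff)
  have "multi_deriv \<alpha> (\<lambda>x. u (a + x)) x = multi_deriv \<alpha> u (a + x)" for \<alpha>
    by (simp add: multi_deriv_def partial_derivs_shift[OF us])
  then show "diff_operator k B (\<lambda>x. u (a + x)) x = diff_operator k B u (a + x)" by (simp add: diff_operator_def)
qed

lemma L1_norm_shift:
  assumes u: "u \<in> test_functions"
  shows "L1_norm (diff_operator k B (\<lambda>x. u (a + x))) = L1_norm (diff_operator k B u)"
proof -
  have [measurable]: "diff_operator k B u \<in> borel_measurable borel" using diff_operator_integrable[OF u] by auto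
  show ?thesis unfolding L1_norm_def diff_operator_shift[OF u] by (rule integral_shift') measurable
qed

text \<open>The class \<open>U\<close> is kept general because the real case poses the estimate for
  the functions (u, 0) only; closure under translations passes from the origin to all points.
  Conversely the essential supremum is a pointwise bound: the tensor norm is continuous, so the set
  where it exceeds the bound is open and null, hence empty.\<close>

lemma estimate_iff_Tfun:
  assumes U: "U \<subseteq> test_functions" "\<And>u a. u \<in> U \<Longrightarrow> (\<lambda>x. u (a + x)) \<in> U"
  shows "(\<exists>c>0. \<forall>u\<in>U. tensor_Linf_norm l (deriv_tensor (\<lambda>x. u x - complex_projection JV k B u x)) \<le> ereal (c * L1_norm (diff_operator k B u)))
    \<longleftrightarrow> (\<exists>c>0. \<forall>u\<in>U. \<forall>is. length is = l \<longrightarrow> norm (Tfun is u) \<le> c * L1_norm (diff_operator k B u))"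
    (is "?A \<longleftrightarrow> ?B")
proof -
  let ?p = "(2 * pi) ^ CARD('n)"
  let ?v = "\<lambda>u x. u x - complex_projection JV k B u x"
  have p: "?p > 0" by simp
  have nrm: "norm (partial_derivs is (?v u) x) = (1 / ?p) * norm (Tfun is (\<lambda>y. u (x + y)))" if "u \<in> test_functions" for u x "is"
    unfolding Tfun_shift[OF that] complement_deriv[OF that] by (simp add: norm_J_funpow[OF JV])
  have cont: "continuous_on UNIV (\<lambda>x. tensor_norm l (deriv_tensor (?v u) x))" if u: "u \<in> test_functions" for u
  proof -
    have "smooth_on UNIV (?v u)"
      unfolding complement_projection[OF u]
      by (rule smooth_on_linear[OF open_UNIV bounded_linear_scaleR_right osc_smooth[OF JV PSF_rapid[OF u]]])
    then have "continuous_on UNIV (partial_derivs is (?v u))" for "is"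
      by (rule smooth_on_continuous[OF smooth_on_partial_derivs])
    then show ?thesis unfolding tensor_norm_def deriv_tensor_def by (intro continuous_intros)
  qed
  have fin: "finite {is :: 'n list. length is = l}" using finite_lists_length_eq[of "UNIV :: 'n set" l] by simp
  have L0: "0 \<le> L1_norm (diff_operator k B u)" for u unfolding L1_norm_def by (rule integral_nonneg_AE) auto
  show ?thesis
  proof
    assume ?A
    then obtain c where c: "c > 0" "\<And>u. u \<in> U \<Longrightarrow> tensor_Linf_norm l (deriv_tensor (?v u)) \<le> ereal (c * L1_norm (diff_operator k B u))" by blast
    have "norm (Tfun is u) \<le> (?p * c) * L1_norm (diff_operator k B u)" if u: "u \<in> U" and l: "length is = l" for u "is"
    proof -
      let ?b = "c * L1_norm (diff_operator k B u)"
      have ut: "u \<in> test_functions" using u U(1) by blast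
      have m: "(\<lambda>x. ereal (tensor_norm l (deriv_tensor (?v u) x))) \<in> borel_measurable lborel"
        using borel_measurable_continuous_onI[OF cont[OF ut]] by simp
      have "AE x in lborel. ereal (tensor_norm l (deriv_tensor (?v u) x)) \<le> esssup lborel (\<lambda>x. ereal (tensor_norm l (deriv_tensor (?v u) x)))"
        by (rule esssup_AE)
      then have AE: "AE x in lborel. tensor_norm l (deriv_tensor (?v u) x) \<le> ?b"
      proof eventually_elim
        case (elim x)
        then show ?case using order_trans[OF elim c(2)[OF u, unfolded tensor_Linf_norm_def]] by (simp only: ereal_less_eq)
      qed
      define O1 where "O1 = {x. ?b < tensor_norm l (deriv_tensor (?v u) x)}"
      have O: "open O1" unfolding O1_def using cont[OF ut] by (intro open_Collect_less continuous_intros) auto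
      moreover have "AE x in lborel. x \<notin> O1" using AE by eventually_elim (simp add: O1_def)
      ultimately have "O1 \<in> null_sets lborel" by (subst AE_iff_null_sets) (auto simp: borel_open)
      then have "O1 = {}"
        using O open_not_negligible[of O1] by (auto simp: negligible_iff_null_sets null_sets_completionI)
      then have le: "tensor_norm l (deriv_tensor (?v u) 0) \<le> ?b" by (auto simp: O1_def not_less)
      have "(norm (deriv_tensor (?v u) 0 is))\<^sup>2 \<le> (\<Sum>is | length is = l. (norm (deriv_tensor (?v u) 0 is))\<^sup>2)"
        by (rule member_le_sum) (use fin l in auto)
      then have "norm (deriv_tensor (?v u) 0 is) \<le> tensor_norm l (deriv_tensor (?v u) 0)"
        unfolding tensor_norm_def by (rule real_le_rsqrt)
      then have "(1 / ?p) * norm (Tfun is u) \<le> ?b" using le nrm[OF ut, of "is" 0] by (simp add: deriv_tensor_def)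
      then show ?thesis using p by (simp add: field_simps)
    qed
    then show ?B using c(1) p by (intro exI[of _ "?p * c"]) auto
  next
    assume ?B
    then obtain c where c: "c > 0" "\<And>u is. u \<in> U \<Longrightarrow> length is = l \<Longrightarrow> norm (Tfun is u) \<le> c * L1_norm (diff_operator k B u)" by blast
    \<comment> \<open>The square root of the number of components compares the Euclidean norm with
      the maximum; the added 1 makes positivity immediate.\<close>
    define M where "M = sqrt (real (card {is :: 'n list. length is = l})) + 1"
    have M: "M > 0" unfolding M_def by (intro add_nonneg_pos) auto
    have "tensor_Linf_norm l (deriv_tensor (?v u)) \<le> ereal ((M * ((1 / ?p) * c)) * L1_norm (diff_operator k B u))" if u: "u \<in> U" for u
    proof -
      have ut: "u \<in> test_functions" using u U(1) by blast
      let ?b = "(1 / ?p) * (c * L1_norm (diff_operator k B u))"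
      have b0: "?b \<ge> 0" using c(1) L0 p by (intro mult_nonneg_nonneg) auto
      have "tensor_norm l (deriv_tensor (?v u) x) \<le> M * ?b" for x
      proof -
        have "norm (deriv_tensor (?v u) x is) \<le> ?b" if "length is = l" for "is"
          using c(2)[OF U(2)[OF u] that, of x] p
          by (simp add: deriv_tensor_def nrm[OF ut] L1_norm_shift[OF ut] divide_right_mono)
        then have "(\<Sum>is | length is = l. (norm (deriv_tensor (?v u) x is))\<^sup>2) \<le> (\<Sum>is :: 'n list | length is = l. ?b\<^sup>2)"
          by (intro sum_mono power_mono) auto
        also have "\<dots> = real (card {is :: 'n list. length is = l}) * ?b\<^sup>2" by simp
        finally have "tensor_norm l (deriv_tensor (?v u) x) \<le> sqrt (real (card {is :: 'n list. length is = l}) * ?b\<^sup>2)"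
          unfolding tensor_norm_def by (rule real_sqrt_le_mono)
        also have "\<dots> = sqrt (real (card {is :: 'n list. length is = l})) * ?b"
          by (simp only: real_sqrt_mult real_sqrt_abs abs_of_nonneg[OF b0])
        also have "\<dots> \<le> M * ?b" using b0 by (intro mult_right_mono) (auto simp: M_def)
        finally show ?thesis .
      qed
      then have "AE x in lborel. ereal (tensor_norm l (deriv_tensor (?v u) x)) \<le> ereal (M * ?b)" by simp
      then have "esssup lborel (\<lambda>x. ereal (tensor_norm l (deriv_tensor (?v u) x))) \<le> ereal (M * ?b)"
        using borel_measurable_continuous_onI[OF cont[OF ut]] by (intro esssup_I) auto
      then show ?thesis by (simp add: tensor_Linf_norm_def mult.assoc)
    qed
    moreover have "0 < M * ((1 / ?p) * c)" using M c(1) p by (intro mult_pos_pos divide_pos_pos) auto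
    ultimately show ?A by blast
  qed
qed

lemma sufficiency:
  assumes cancel: "\<And>w is. w \<in> N \<Longrightarrow> length is = k - CARD('n) \<Longrightarrow> avg is w = 0"
  shows "\<exists>c>0. \<forall>u\<in>test_functions. \<forall>is. length is = k - CARD('n) \<longrightarrow> norm (Tfun is u) \<le> c * L1_norm (diff_operator k B u)"
proof -
  have each: "\<exists>C\<ge>0. \<forall>u\<in>test_functions. norm (Tfun is u) \<le> C * L1_norm (diff_operator k B u)" if l: "length is = k - CARD('n)" for "is"
  proof -
    obtain T where T: "linear T" "\<And>w. (LINT z|lborel. indicator annulus z *\<^sub>R
     (tens is z *\<^sub>R P z w - (1 / norm z ^ CARD('n)) *\<^sub>R T (w - S z (P z w)))) = 0"
      using corrected_kernel_exists[OF nk l cancel[OF _ l]] by blast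
    have Tb: "bounded_linear T" using T(1) by (simp add: linear_conv_bounded_linear)
    then obtain KT where KT: "KT > 0" "\<And>w. norm (T w) \<le> norm w * KT" using bounded_linear.pos_bounded by blast
    define Om where "Om z w = tens is z *\<^sub>R P z w - (1 / norm z ^ CARD('n)) *\<^sub>R T (w - S z (P z w))" for z w
    obtain K where K: "K \<ge> 0" "\<And>z w. z \<in> annulus \<Longrightarrow> norm (P z w) \<le> K * norm w" using P_bound_annulus by blast
    have bl: "linear (\<lambda>w. w - S z (P z w))" for z
      by (intro linear_compose_sub linear_ident) (use linear_compose[OF P_linear S_linear] in \<open>simp add: o_def\<close>)
    have "\<exists>C\<ge>0. \<forall>f. integrable lborel f \<longrightarrow> integrable lborel (\<lambda>\<xi>. Om \<xi> (osc JW (-1) f \<xi>)) \<longrightarrow>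
      norm (LINT \<xi>|lborel. Om \<xi> (osc JW (-1) f \<xi>)) \<le> C * (LINT x|lborel. norm (f x))"
    proof (rule bounded_kernel[OF JW, where K = "2 ^ length is * K + 2 * KT"])
      show "linear (Om z)" for z
        unfolding Om_def[abs_def] using linear_compose[OF bl[of z] T(1)]
        by (intro linear_compose_sub linear_compose_scale_right P_linear) (simp add: o_def)
      show "(\<lambda>z. Om z y) \<in> borel_measurable borel" for y
      proof -
        have "(\<lambda>z. S z (P z y)) \<in> borel_measurable borel" by (rule measurable_linear_apply[OF S_linear S_measurable P_measurable])
        then have "(\<lambda>z. T (y - S z (P z y))) \<in> borel_measurable borel"
          by (rule measurable_compose[OF borel_measurable_diff[OF borel_measurable_const] borel_measurable_continuous_onI[OF linear_continuous_on[OF Tb]]])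
        then show ?thesis unfolding Om_def by measurable
      qed
      show "0 \<le> 2 ^ length is * K + 2 * KT" using K(1) KT(1) by simp
      show "norm (Om z y) \<le> (2 ^ length is * K + 2 * KT) * norm y" if z: "z \<in> annulus" for z y
      proof -
        have 1: "norm (tens is z *\<^sub>R P z y) \<le> 2 ^ length is * (K * norm y)"
        proof -
          have "\<bar>tens is z\<bar> \<le> 2 ^ length is"
            using tens_bound[of "is" z] power_mono[of "norm z" 2 "length is"] z by (simp add: annulus_def)
          then show ?thesis using K(2)[OF z, of y] K(1) by (simp add: mult_mono)
        qed
        have 2: "norm ((1 / norm z ^ CARD('n)) *\<^sub>R T (y - S z (P z y))) \<le> 1 * (2 * norm y * KT)"
        proof -
          have "1 / norm z ^ CARD('n) \<le> 1" "0 \<le> 1 / norm z ^ CARD('n)"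
            using z one_le_power[of "norm z" "CARD('n)"] by (auto simp: annulus_def divide_le_eq)
          moreover have "norm (y - S z (P z y)) \<le> 2 * norm y"
            using norm_triangle_ineq4[of y "S z (P z y)"] norm_moore_penrose_MX[OF S_linear, of z y] by linarith
          then have "norm (T (y - S z (P z y))) \<le> 2 * norm y * KT"
            using order_trans[OF KT(2) mult_right_mono[OF _ less_imp_le[OF KT(1)]]] by blast
          ultimately show ?thesis unfolding norm_scaleR by (intro mult_mono) auto
        qed
        have "norm (Om z y) \<le> norm (tens is z *\<^sub>R P z y) + norm ((1 / norm z ^ CARD('n)) *\<^sub>R T (y - S z (P z y)))"
          unfolding Om_def by (rule norm_triangle_ineq4)
        also have "\<dots> \<le> 2 ^ length is * (K * norm y) + 1 * (2 * norm y * KT)" by (rule add_mono[OF 1 2])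
        finally show ?thesis by (simp add: algebra_simps)
      qed
      show "Om (t *\<^sub>R z) y = (1 / t ^ CARD('n)) *\<^sub>R Om z y" if t: "t > 0" for t z y
      proof -
        have "t ^ k = t ^ CARD('n) * t ^ length is" using nk l by (simp add: power_add[symmetric])
        then have a: "t ^ length is * (1 / t ^ k) = 1 / t ^ CARD('n)" using t by (simp add: field_simps)
        have b: "S (t *\<^sub>R z) (P (t *\<^sub>R z) y) = S z (P z y)"
          using t by (simp add: S_scale P_scale linear_scale[OF S_linear])
        have "tens is (t *\<^sub>R z) *\<^sub>R P (t *\<^sub>R z) y = (t ^ length is * (1 / t ^ k)) *\<^sub>R (tens is z *\<^sub>R P z y)"
          using t by (simp add: tens_scale P_scale mult.commute)
        then show ?thesis unfolding Om_def b a using t by (simp add: scaleR_diff_right power_mult_distrib)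
      qed
      show "(LINT z|lborel. indicator annulus z *\<^sub>R Om z y) = 0" for y unfolding Om_def by (rule T(2))
    qed
    then obtain C where C: "C \<ge> 0" "\<And>f. integrable lborel f \<Longrightarrow> integrable lborel (\<lambda>\<xi>. Om \<xi> (osc JW (-1) f \<xi>)) \<Longrightarrow>
      norm (LINT \<xi>|lborel. Om \<xi> (osc JW (-1) f \<xi>)) \<le> C * (LINT x|lborel. norm (f x))" by blast
    have "norm (Tfun is u) \<le> C * L1_norm (diff_operator k B u)" if u: "u \<in> test_functions" for u
    proof -
      \<comment> \<open>The iterate of order 3 k undoes the factor i^k, since 3 k + k = 4 k; norms
        are unchanged.\<close>
      let ?f = "\<lambda>x. (JW ^^ (3 * k)) (diff_operator k B u x)"
      have fi: "integrable lborel ?f" by (rule integrable_bounded_linear[OF J_funpow_linear[OF JW] diff_operator_integrable[OF u]])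
      have Ff: "osc JW (-1) ?f \<xi> = S \<xi> (osc JV (-1) u \<xi>)" for \<xi>
      proof -
        have "osc JW (-1) ?f \<xi> = (JW ^^ (3 * k)) (osc JW (-1) (diff_operator k B u) \<xi>)"
          by (rule osc_linear[OF JW diff_operator_integrable[OF u] J_funpow_linear[OF JW] rot_J_funpow[OF JW]])
        also have "\<dots> = (JW ^^ (3 * k + k)) (S \<xi> (osc JV (-1) u \<xi>))"
          by (simp only: osc_diff_operator[OF u] funpow_add o_apply)
        also have "3 * k + k = 4 * k" by simp
        finally show ?thesis by (simp only: J_power4[OF JW])
      qed
      \<comment> \<open>The transform of \<open>?f\<close> lies in the range of the symbol, where w
        - S P w = 0 and the corrected kernel agrees with the original one.\<close>
      have Om: "Om \<xi> (osc JW (-1) ?f \<xi>) = tens is \<xi> *\<^sub>R PSF u \<xi>" for \<xi>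
        unfolding Ff Om_def PSF_def by (simp add: moore_penrose_MXM[OF S_linear] linear_0[OF T(1)])
      have "norm (LINT \<xi>|lborel. Om \<xi> (osc JW (-1) ?f \<xi>)) \<le> C * (LINT x|lborel. norm (?f x))"
        by (rule C(2)[OF fi]) (unfold Om, rule rapid_integrable[OF tens_PSF_rapid[OF u]])
      then show ?thesis unfolding Om Tfun_def L1_norm_def by (simp add: norm_J_funpow[OF JW])
    qed
    then show ?thesis using C(1) by blast
  qed
  then obtain C where C: "\<And>is. length is = k - CARD('n) \<Longrightarrow> C is \<ge> 0"
    "\<And>is u. length is = k - CARD('n) \<Longrightarrow> u \<in> test_functions \<Longrightarrow> norm (Tfun is u) \<le> C is * L1_norm (diff_operator k B u)" by metis
  let ?I = "{is :: 'n list. length is = k - CARD('n)}"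
  have fin: "finite ?I" using finite_lists_length_eq[of "UNIV :: 'n set" "k - CARD('n)"] by simp
  have "norm (Tfun is u) \<le> (sum C ?I + 1) * L1_norm (diff_operator k B u)" if "u \<in> test_functions" "length is = k - CARD('n)" for u "is"
  proof -
    have L0: "0 \<le> L1_norm (diff_operator k B u)" unfolding L1_norm_def by (rule integral_nonneg_AE) auto
    have "C is \<le> sum C ?I" by (rule member_le_sum) (use fin C(1) that in auto)
    then have "C is * L1_norm (diff_operator k B u) \<le> (sum C ?I + 1) * L1_norm (diff_operator k B u)"
      using L0 by (intro mult_right_mono) auto
    then show ?thesis using C(2)[OF that(2,1)] by linarith
  qed
  moreover have "sum C ?I + 1 > 0" using C(1) by (intro add_nonneg_pos sum_nonneg) auto
  ultimately show ?thesis by blast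
qed

end

section \<open>Approximation by test functions\<close>

definition L1_lim :: "(nat \<Rightarrow> real^'n::finite \<Rightarrow> 'e::euclidean_space) \<Rightarrow> (real^'n \<Rightarrow> 'e) \<Rightarrow> bool" where
  "L1_lim F f \<longleftrightarrow> (\<forall>m. integrable lborel (F m)) \<and> integrable lborel f \<and>
     (\<lambda>m. LINT x|lborel. norm (F m x - f x)) \<longlonglongrightarrow> 0"

lemma L1_limI:
  assumes F: "\<And>m. integrable lborel (F m)" and f: "integrable lborel f"
    and i: "\<And>m. integrable lborel (b m)" and le: "\<And>m x. norm (F m x - f x) \<le> b m x"
    and b: "(\<lambda>m. LINT x|lborel. b m x) \<longlonglongrightarrow> 0"
  shows "L1_lim F f"
proof -
  have "(LINT x|lborel. norm (F m x - f x)) \<le> (LINT x|lborel. b m x)" for m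
    by (rule integral_mono[OF integrable_norm[OF Bochner_Integration.integrable_diff[OF F f]] i le])
  then have "(\<lambda>m. LINT x|lborel. norm (F m x - f x)) \<longlonglongrightarrow> 0"
    by (intro tendsto_sandwich[OF _ _ tendsto_const b]) auto
  then show ?thesis using F f by (simp add: L1_lim_def)
qed

lemma L1_lim_integrable:
  assumes "L1_lim F f"
  shows "integrable lborel (F m)" "integrable lborel f" "integrable lborel (\<lambda>x. norm (F m x - f x))"
    and L1_lim_tendsto: "(\<lambda>m. LINT x|lborel. norm (F m x - f x)) \<longlonglongrightarrow> 0"
  using assms by (auto simp: L1_lim_def)

lemma L1_lim_add:
  assumes F: "L1_lim F f" and G: "L1_lim G g" shows "L1_lim (\<lambda>m x. F m x + G m x) (\<lambda>x. f x + g x)"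
proof (rule L1_limI[where b = "\<lambda>m x. norm (F m x - f x) + norm (G m x - g x)"])
  show "norm (F m x + G m x - (f x + g x)) \<le> norm (F m x - f x) + norm (G m x - g x)" for m x
    by (rule norm_diff_triangle_ineq)
  show "(\<lambda>m. LINT x|lborel. norm (F m x - f x) + norm (G m x - g x)) \<longlonglongrightarrow> 0"
    using tendsto_add[OF L1_lim_tendsto[OF F] L1_lim_tendsto[OF G]] L1_lim_integrable[OF F] L1_lim_integrable[OF G]
    by (simp add: Bochner_Integration.integral_add)
qed (use L1_lim_integrable[OF F] L1_lim_integrable[OF G] in auto)

lemma L1_lim_scale:
  assumes F: "L1_lim F f" and c: "c \<longlonglongrightarrow> d" shows "L1_lim (\<lambda>m x. c m *\<^sub>R F m x) (\<lambda>x. d *\<^sub>R f x)"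
proof (rule L1_limI[where b = "\<lambda>m x. \<bar>c m\<bar> * norm (F m x - f x) + \<bar>c m - d\<bar> * norm (f x)"])
  show "norm (c m *\<^sub>R F m x - d *\<^sub>R f x) \<le> \<bar>c m\<bar> * norm (F m x - f x) + \<bar>c m - d\<bar> * norm (f x)" for m x
  proof -
    have "c m *\<^sub>R F m x - d *\<^sub>R f x = c m *\<^sub>R (F m x - f x) + (c m - d) *\<^sub>R f x" by (simp add: algebra_simps)
    then show ?thesis using norm_triangle_ineq[of "c m *\<^sub>R (F m x - f x)" "(c m - d) *\<^sub>R f x"] by simp
  qed
  have "(\<lambda>m. \<bar>c m\<bar> * (LINT x|lborel. norm (F m x - f x)) + \<bar>c m - d\<bar> * (LINT x|lborel. norm (f x))) \<longlonglongrightarrow> \<bar>d\<bar> * 0 + \<bar>d - d\<bar> * (LINT x|lborel. norm (f x))"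
    by (intro tendsto_intros c L1_lim_tendsto[OF F])
  then show "(\<lambda>m. LINT x|lborel. \<bar>c m\<bar> * norm (F m x - f x) + \<bar>c m - d\<bar> * norm (f x)) \<longlonglongrightarrow> 0"
    using L1_lim_integrable[OF F] by (simp add: Bochner_Integration.integral_add)
qed (use L1_lim_integrable[OF F] in auto)

lemma L1_lim_linear:
  assumes F: "L1_lim F f" and h: "bounded_linear h" shows "L1_lim (\<lambda>m x. h (F m x)) (\<lambda>x. h (f x))"
proof -
  obtain K where K: "K > 0" "\<And>v. norm (h v) \<le> norm v * K" using bounded_linear.pos_bounded[OF h] by blast
  show ?thesis
  proof (rule L1_limI[where b = "\<lambda>m x. norm (F m x - f x) * K"])
    show "norm (h (F m x) - h (f x)) \<le> norm (F m x - f x) * K" for m x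
      using K(2)[of "F m x - f x"] by (simp add: linear_diff[OF bounded_linear.linear[OF h]])
    show "(\<lambda>m. LINT x|lborel. norm (F m x - f x) * K) \<longlonglongrightarrow> 0"
      using tendsto_mult_left_zero[OF L1_lim_tendsto[OF F], of K] by simp
  qed (use L1_lim_integrable[OF F] integrable_bounded_linear[OF h] in auto)
qed

lemma L1_lim_sum:
  assumes "\<And>i. i \<in> I \<Longrightarrow> L1_lim (F i) (f i)" shows "L1_lim (\<lambda>m x. \<Sum>i\<in>I. F i m x) (\<lambda>x. \<Sum>i\<in>I. f i x)"
  using assms by (induction I rule: infinite_finite_induct) (auto simp: L1_lim_add, auto simp: L1_lim_def)

lemma L1_lim_norm:
  assumes F: "L1_lim F f" shows "(\<lambda>m. LINT x|lborel. norm (F m x)) \<longlonglongrightarrow> (LINT x|lborel. norm (f x))"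
proof (rule LIM_zero_cancel, rule Lim_null_comparison[OF _ L1_lim_tendsto[OF F]], rule eventuallyI)
  fix m
  have "(LINT x|lborel. norm (F m x)) - (LINT x|lborel. norm (f x)) = (LINT x|lborel. norm (F m x) - norm (f x))"
    using L1_lim_integrable[OF F] by (intro Bochner_Integration.integral_diff[symmetric]) auto
  also have "norm \<dots> \<le> (LINT x|lborel. norm (norm (F m x) - norm (f x)))" by (rule integral_norm_bound)
  also have "\<dots> \<le> (LINT x|lborel. norm (F m x - f x))"
    using L1_lim_integrable[OF F] by (intro integral_mono) (auto simp: norm_triangle_ineq3)
  finally show "norm ((LINT x|lborel. norm (F m x)) - (LINT x|lborel. norm (f x))) \<le> (LINT x|lborel. norm (F m x - f x))" .
qed

text \<open>The innermost derivative either passes to \<open>U\<close> or falls on the cutoff, where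
  dilation produces the factor 1 / (m + 1). In the second case a partial derivative of the cutoff
  takes the place of \<open>a\<close>, which is why the induction generalises over \<open>a\<close>;
  its L1 limit is multiplied by a null sequence.\<close>

lemma partial_derivs_cutoff_L1_lim:
  fixes a :: "real^'n::finite \<Rightarrow> real" and U :: "real^'n \<Rightarrow> 'e::euclidean_space"
  assumes "a \<in> test_functions" "smooth_on UNIV U" "\<And>is. integrable lborel (partial_derivs is U)"
  shows "L1_lim (\<lambda>m. partial_derivs is (\<lambda>x. a ((1 / (real m + 1)) *\<^sub>R x) *\<^sub>R U x)) (\<lambda>x. a 0 *\<^sub>R partial_derivs is U x)"
  using assms
proof (induction "is" arbitrary: a U rule: rev_induct)
  case Nil
  obtain C where C: "C \<ge> 0" "\<And>x. norm (a x) \<le> C" using test_function_bounded[OF Nil(1)] by blast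
  have [measurable]: "a \<in> borel_measurable borel" by (rule test_function_measurable[OF Nil(1)])
  have Ui: "integrable lborel U" using Nil(3)[of "[]"] by simp
  then have [measurable]: "U \<in> borel_measurable borel" by auto
  have ac: "isCont a 0" using test_function_continuous[OF Nil(1)] by (simp add: continuous_on_eq_continuous_at)
  have ai: "integrable lborel (\<lambda>x. a (c *\<^sub>R x) *\<^sub>R U x)" for c
    by (rule Bochner_Integration.integrable_bound[OF integrable_scaleR_right[OF Ui, of C]])
       (use C in \<open>auto intro!: mult_right_mono\<close>)
  have "L1_lim (\<lambda>m x. a ((1 / (real m + 1)) *\<^sub>R x) *\<^sub>R U x) (\<lambda>x. a 0 *\<^sub>R U x)"
  proof (rule L1_limI[where b = "\<lambda>m x. \<bar>a ((1 / (real m + 1)) *\<^sub>R x) - a 0\<bar> * norm (U x)"])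
    have bd: "\<bar>a y - a 0\<bar> \<le> 2 * C" for y using C(2)[of y] C(2)[of 0] by auto
    have dom: "norm (\<bar>a y - a 0\<bar> * norm (U x)) \<le> 2 * C * norm (U x)" for x y
      using bd[of y] by (simp add: abs_mult mult_right_mono)
    have i2: "integrable lborel (\<lambda>x. 2 * C * norm (U x))" using Ui by simp
    have lim: "(\<lambda>m. \<bar>a ((1 / (real m + 1)) *\<^sub>R x) - a 0\<bar> * norm (U x)) \<longlonglongrightarrow> 0" for x
    proof -
      have "(\<lambda>m. inverse (real (Suc m)) *\<^sub>R x) \<longlonglongrightarrow> 0 *\<^sub>R x"
        by (intro tendsto_intros LIMSEQ_inverse_real_of_nat)
      then have "(\<lambda>m. (1 / (real m + 1)) *\<^sub>R x) \<longlonglongrightarrow> 0" by (simp add: inverse_eq_divide add.commute)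
      from isCont_tendsto_compose[OF ac this] have "(\<lambda>m. a ((1 / (real m + 1)) *\<^sub>R x)) \<longlonglongrightarrow> a 0" .
      then have "(\<lambda>m. \<bar>a ((1 / (real m + 1)) *\<^sub>R x) - a 0\<bar> * norm (U x)) \<longlonglongrightarrow> \<bar>a 0 - a 0\<bar> * norm (U x)"
        by (intro tendsto_intros)
      then show ?thesis by simp
    qed
    show "integrable lborel (\<lambda>x. \<bar>a ((1 / (real m + 1)) *\<^sub>R x) - a 0\<bar> * norm (U x))" for m
      by (rule Bochner_Integration.integrable_bound[OF i2]) (use C(1) dom in \<open>auto simp: abs_mult\<close>)
    have "(\<lambda>m. LINT x|lborel. \<bar>a ((1 / (real m + 1)) *\<^sub>R x) - a 0\<bar> * norm (U x)) \<longlonglongrightarrow> (LINT x|(lborel :: (real^'n) measure). (0::real))"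
      by (rule integral_dominated_convergence[OF _ _ i2]) (use dom lim in auto)
    then show "(\<lambda>m. LINT x|lborel. \<bar>a ((1 / (real m + 1)) *\<^sub>R x) - a 0\<bar> * norm (U x)) \<longlonglongrightarrow> 0" by simp
    show "norm (a ((1 / (real m + 1)) *\<^sub>R x) *\<^sub>R U x - a 0 *\<^sub>R U x) \<le> \<bar>a ((1 / (real m + 1)) *\<^sub>R x) - a 0\<bar> * norm (U x)" for m x
      by (simp add: scaleR_diff_left[symmetric])
  qed (use ai Ui in auto)
  then show ?case by simp
next
  case (snoc i js)
  have as: "smooth_on UNIV a" using snoc.prems(1) by (simp add: test_functions_iff)
  let ?a' = "partial_deriv i a" and ?U' = "partial_deriv i U"
  have sm: "smooth_on UNIV (\<lambda>x. q (c *\<^sub>R x))" if "smooth_on UNIV q" for c and q :: "real^'n \<Rightarrow> real"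
    using smooth_on_affine[OF that, of 0 c] by simp
  have U's: "smooth_on UNIV ?U'" and a's: "smooth_on UNIV ?a'" using snoc.prems(2) as by (auto intro: smooth_on_partial)
  have split: "partial_derivs (js @ [i]) (\<lambda>x. a (c *\<^sub>R x) *\<^sub>R U x) =
    (\<lambda>x. partial_derivs js (\<lambda>x. a (c *\<^sub>R x) *\<^sub>R ?U' x) x + c *\<^sub>R partial_derivs js (\<lambda>x. ?a' (c *\<^sub>R x) *\<^sub>R U x) x)" for c
  proof -
    have "partial_deriv i (\<lambda>x. a (c *\<^sub>R x) *\<^sub>R U x) x = a (c *\<^sub>R x) *\<^sub>R ?U' x + c *\<^sub>R (?a' (c *\<^sub>R x) *\<^sub>R U x)" for x
      using partial_deriv_bilinear[OF open_UNIV bounded_bilinear_scaleR sm[OF as, of c] snoc.prems(2) UNIV_I, of i x]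
        partial_deriv_affine[OF smooth_on_differentiable[OF as], of i 0 c x] by simp
    then have "partial_deriv i (\<lambda>x. a (c *\<^sub>R x) *\<^sub>R U x) = (\<lambda>x. a (c *\<^sub>R x) *\<^sub>R ?U' x + c *\<^sub>R (?a' (c *\<^sub>R x) *\<^sub>R U x))" by blast
    moreover have s1: "smooth_on UNIV (\<lambda>x. a (c *\<^sub>R x) *\<^sub>R ?U' x)" and s2: "smooth_on UNIV (\<lambda>x. ?a' (c *\<^sub>R x) *\<^sub>R U x)"
      by (intro smooth_on_scaleR open_UNIV sm as U's a's snoc.prems(2))+
    moreover have "smooth_on UNIV (\<lambda>x. c *\<^sub>R (?a' (c *\<^sub>R x) *\<^sub>R U x))"
      by (rule smooth_on_linear[OF open_UNIV bounded_linear_scaleR_right s2])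
    ultimately show ?thesis
      by (simp only: partial_derivs_snoc partial_derivs_add partial_derivs_linear[OF bounded_linear_scaleR_right])
  qed
  have "(\<lambda>m. 1 / (real m + 1)) \<longlonglongrightarrow> 0"
    using LIMSEQ_inverse_real_of_nat by (simp add: inverse_eq_divide add.commute)
  moreover have "integrable lborel (partial_derivs is ?U')" for "is" using snoc.prems(3)[of "is @ [i]"] by (simp add: partial_derivs_snoc)
  ultimately have "L1_lim (\<lambda>m x. partial_derivs js (\<lambda>x. a ((1 / (real m + 1)) *\<^sub>R x) *\<^sub>R ?U' x) x +
      (1 / (real m + 1)) *\<^sub>R partial_derivs js (\<lambda>x. ?a' ((1 / (real m + 1)) *\<^sub>R x) *\<^sub>R U x) x)
    (\<lambda>x. a 0 *\<^sub>R partial_derivs js ?U' x + 0 *\<^sub>R (?a' 0 *\<^sub>R partial_derivs js U x))"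
    by (intro L1_lim_add L1_lim_scale snoc.IH test_function_partial snoc.prems U's) auto
  then show ?case unfolding split by (simp add: partial_derivs_snoc)
qed

lemma test_function_rapid:
  fixes u :: "real^'n::finite \<Rightarrow> 'e::euclidean_space"
  assumes u: "u \<in> test_functions" shows "rapid u"
proof -
  obtain R where R: "\<And>x. norm x > R \<Longrightarrow> u x = 0" using u by (auto simp: test_functions_iff)
  note [measurable] = test_function_measurable[OF u]
  have "integrable lborel (\<lambda>x. norm x ^ m * norm (u x))" for m
  proof (rule Bochner_Integration.integrable_bound)
    show "integrable lborel (\<lambda>x. \<bar>R\<bar> ^ m * norm (u x))" using test_function_integrable[OF u] by simp
    have "norm x ^ m * norm (u x) \<le> \<bar>R\<bar> ^ m * norm (u x)" for x
      using R[of x] by (cases "norm x \<le> R") (auto intro!: mult_right_mono power_mono)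
    then show "AE x in lborel. norm (norm x ^ m * norm (u x)) \<le> norm (\<bar>R\<bar> ^ m * norm (u x))"
      by (simp add: abs_mult)
  qed measurable
  then show ?thesis by (simp add: rapid_def)
qed

lemma plateau_test: "plateau \<in> test_functions"
  unfolding test_functions_iff using plateau_smooth plateau_eq_0 by (meson less_imp_le)

lemma plateau_cutoff_test:
  fixes U :: "real^'n::finite \<Rightarrow> 'e::euclidean_space"
  assumes U: "smooth_on UNIV U" and c: "c > 0"
  shows "(\<lambda>x. plateau (c *\<^sub>R x) *\<^sub>R U x) \<in> test_functions"
  unfolding test_functions_iff
proof (intro conjI exI[of _ "2 / c"] allI impI)
  show "smooth_on UNIV (\<lambda>x. plateau (c *\<^sub>R x) *\<^sub>R U x)"
    using smooth_on_scaleR[OF open_UNIV smooth_on_affine[OF plateau_smooth, of 0 c] U] by simp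
  fix x :: "real^'n" assume "norm x > 2 / c"
  then have "norm (c *\<^sub>R x) \<ge> 2" using c by (simp add: field_simps)
  then show "plateau (c *\<^sub>R x) *\<^sub>R U x = 0" by (simp add: plateau_eq_0)
qed

lemma smooth_on_Un:
  assumes "open A" "open B" "smooth_on A f" "smooth_on B f" shows "smooth_on (A \<union> B) f"
  using assms by (auto simp: smooth_on_iff differentiable_on_eq_differentiable_at open_Un)

text \<open>One term of the exponential series gives |x|^l \<le> l! exp |x|, and the exponential is
  absorbed by passing to a wider Gaussian.\<close>

lemma gauss_moment: "integrable lborel (\<lambda>x::real^'n::finite. gauss 1 x * norm x ^ l)"
proof (rule Bochner_Integration.integrable_bound[OF integrable_mult_right[OF gauss_integral(1)]])
  show "AE x::real^'n in lborel. norm (gauss 1 x * norm x ^ l) \<le> norm (fact l * exp 1 * gauss (1 / 2) x)"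
  proof (intro AE_I2)
    fix x :: "real^'n"
    have "norm x ^ l / fact l \<le> exp (norm x)"
    proof -
      have "(\<lambda>i. norm x ^ i /\<^sub>R fact i) sums exp (norm x)" by (rule exp_converges)
      then show ?thesis
        using sum_le_suminf[of "\<lambda>i. norm x ^ i /\<^sub>R fact i" "{l}"] by (auto simp: sums_iff divide_inverse mult.commute)
    qed
    then have "norm x ^ l \<le> fact l * exp (norm x)" by (simp add: field_simps)
    then have "gauss 1 x * norm x ^ l \<le> gauss 1 x * (fact l * exp (norm x))"
      using gauss_bounds(1)[of 1 x] by (intro mult_left_mono) auto
    also have "\<dots> = fact l * exp (norm x - (norm x)\<^sup>2 / 2)" 
    proof -
      have "exp (norm x - (norm x)\<^sup>2 / 2) = exp (norm x) * gauss 1 x" by (simp add: gauss_def exp_add[symmetric])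
      then show ?thesis by simp
    qed
    also have "\<dots> \<le> fact l * (exp 1 * gauss (1 / 2) x)"
    proof -
      \<comment> \<open>The difference of the two sides is ((3 |x| - 4)^2 + 8) / 24.\<close>
      have "norm x - (norm x)\<^sup>2 / 2 \<le> 1 + - (1 / 2 * norm x)\<^sup>2 / 2"
        using zero_le_power2[of "3 * norm x - 4"] by (simp add: power2_eq_square algebra_simps)
      then show ?thesis by (simp add: gauss_def exp_add[symmetric] power_divide)
    qed
    finally show "norm (gauss 1 x * norm x ^ l) \<le> norm (fact l * exp 1 * gauss (1 / 2) x)"
      using gauss_bounds(1)[of 1 x] gauss_bounds(1)[of "1/2" x] by (simp add: abs_mult mult.assoc)
  qed
qed auto

section \<open>Necessity of the cancellation condition\<close>

context complex_operator
begin

lemma diff_operator_osc: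
  assumes g: "rapid g"
  shows "diff_operator k B (osc JV 1 g) x = osc JW 1 (\<lambda>\<xi>. S \<xi> ((JV ^^ k) (g \<xi>))) x"
proof -
  have *: "integrable lborel (\<lambda>\<xi>. monomial \<alpha> \<xi> *\<^sub>R B \<alpha> ((JV ^^ k) (g \<xi>))) \<and>
      B \<alpha> (multi_deriv \<alpha> (osc JV 1 g) x) = osc JW 1 (\<lambda>\<xi>. monomial \<alpha> \<xi> *\<^sub>R B \<alpha> ((JV ^^ k) (g \<xi>))) x"
    if \<alpha>: "\<alpha> \<in> multi_indices k" for \<alpha>
  proof -
    obtain xs where xs: "multi_deriv \<alpha> (osc JV 1 g) = partial_derivs xs (osc JV 1 g)" "\<And>\<xi> v. mono_J JV 1 xs \<xi> v = monomial \<alpha> \<xi> *\<^sub>R (JV ^^ k) v"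
      using multi_deriv_symbol[OF \<alpha>] by blast
    have i: "integrable lborel (\<lambda>\<xi>. monomial \<alpha> \<xi> *\<^sub>R (JV ^^ k) (g \<xi>))"
      using rapid_integrable[OF rapid_mono_J[OF JV g, of 1 xs]] by (simp add: xs(2))
    have "multi_deriv \<alpha> (osc JV 1 g) x = osc JV 1 (\<lambda>\<xi>. monomial \<alpha> \<xi> *\<^sub>R (JV ^^ k) (g \<xi>)) x"
      by (simp add: xs osc_partial_derivs[OF JV g])
    then show ?thesis
      using osc_linear[OF JV i B_bounded_linear[OF \<alpha>] B_rot[OF \<alpha>], of 1 x] integrable_bounded_linear[OF B_bounded_linear[OF \<alpha>] i]
      by (simp add: linear_scale[OF B_linear[OF \<alpha>]])
  qed
  then show ?thesis unfolding diff_operator_def symbol_def by (subst osc_sum[OF JW]) auto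
qed

context
  fixes c :: real and "is" :: "'n list"
  assumes Tb: "\<And>u. u \<in> test_functions \<Longrightarrow> norm (Tfun is u) \<le> c * L1_norm (diff_operator k B u)"
begin

text \<open>By translation the estimate bounds the transform of the integrand at every point a.
  Integrating against a Gaussian in a, and moving the transform onto it with
  \<open>gauss_osc\<close>, inserts a Gaussian on the frequency side without changing the
  constant.\<close>

lemma mollified_bound:
  assumes u: "u \<in> test_functions"
  shows "norm (LINT \<xi>|lborel. gauss 1 \<xi> *\<^sub>R (tens is \<xi> *\<^sub>R PSF u \<xi>)) \<le> c * L1_norm (diff_operator k B u)"
proof -
  define h where "h = (\<lambda>\<xi>. tens is \<xi> *\<^sub>R PSF u \<xi>)"
  define b where "b = c * L1_norm (diff_operator k B u)"
  define q where "q = sqrt (2 * pi) ^ CARD('n)"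
  have q: "q > 0" by (simp add: q_def)
  have hi: "integrable lborel h" unfolding h_def by (rule rapid_integrable[OF tens_PSF_rapid[OF u]])
  then have [measurable]: "h \<in> borel_measurable borel" by auto
  have [measurable]: "osc JV 1 h \<in> borel_measurable borel" by (rule osc_measurable[OF JV]) simp
  have le: "norm (osc JV 1 h a) \<le> b" for a
    using Tb[OF test_function_shift[OF u, of a]] by (simp add: Tfun_shift[OF u] L1_norm_shift[OF u] h_def b_def)
  have gi: "integrable lborel (gauss 1 :: real^'n \<Rightarrow> real)" "(LINT x|lborel. gauss 1 (x::real^'n)) = q"
    using gauss_integral[of 1, where 'n = 'n] by (auto simp: q_def)
  have i1: "integrable lborel (\<lambda>y::real^'n. gauss 1 y * b)" using gi(1) by simp
  have le': "norm (gauss 1 y *\<^sub>R osc JV 1 h y) \<le> gauss 1 y * b" for y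
    using le[of y] gauss_bounds(1)[of 1 y] by (simp add: mult_left_mono)
  have "q *\<^sub>R (LINT \<xi>|lborel. gauss 1 \<xi> *\<^sub>R h \<xi>) = (LINT \<xi>|lborel. (q * gauss 1 \<xi>) *\<^sub>R h \<xi>)"
    by (simp only: scaleR_scaleR[symmetric] integral_scaleR_right)
  also have "\<dots> = (LINT y|lborel. gauss 1 y *\<^sub>R osc JV 1 h y)"
    using gauss_osc[OF JV hi, of 1 1] by (simp add: q_def)
  also have "norm \<dots> \<le> (LINT y|lborel. gauss 1 (y::real^'n) * b)"
  proof (rule Bochner_Integration.integral_norm_bound_integral[OF _ i1 le'])
    show "integrable lborel (\<lambda>y. gauss 1 y *\<^sub>R osc JV 1 h y)"
      by (rule Bochner_Integration.integrable_bound[OF i1]) (use le' in \<open>auto intro: order_trans[OF _ abs_ge_self]\<close>)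
  qed
  also have "\<dots> = q * b" using gi by simp
  finally show ?thesis using q by (simp add: h_def b_def)
qed

text \<open>L1 convergence of the \<open>u m\<close> gives pointwise convergence and a uniform bound
  of their transforms, but no common decay. The Gaussian times the polynomial growth of
  \<open>tens is\<close> provides the dominating function.\<close>

lemma mollified_limit_bound:
  assumes u: "\<And>m. u m \<in> test_functions" and U: "L1_lim u U" and f: "L1_lim (\<lambda>m. diff_operator k B (u m)) f"
  shows "norm (LINT \<xi>|lborel. gauss 1 \<xi> *\<^sub>R (tens is \<xi> *\<^sub>R P \<xi> (S \<xi> (osc JV (-1) U \<xi>)))) \<le> c * L1_norm f"
proof -
  have osc_lim: "(\<lambda>m. osc JV (-1) (u m) \<xi>) \<longlonglongrightarrow> osc JV (-1) U \<xi>" for \<xi>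
  proof (rule LIM_zero_cancel, rule Lim_null_comparison[OF eventuallyI L1_lim_tendsto[OF U]])
    fix m
    have "osc JV (-1) (u m) \<xi> - osc JV (-1) U \<xi> = osc JV (-1) (\<lambda>x. u m x - U x) \<xi>"
      by (rule osc_diff[OF JV L1_lim_integrable(1,2)[OF U], symmetric])
    then show "norm (osc JV (-1) (u m) \<xi> - osc JV (-1) U \<xi>) \<le> (LINT x|lborel. norm (u m x - U x))"
      using norm_osc_le[OF JV] by simp
  qed
  have "Bseq (\<lambda>m. LINT x|lborel. norm (u m x))" using L1_lim_norm[OF U] by (intro convergent_imp_Bseq convergentI)
  then obtain D where D: "\<And>m. norm (LINT x|lborel. norm (u m x)) \<le> D" by (auto simp: Bseq_def)
  have bd: "norm (PSF (u m) \<xi>) \<le> D" for m \<xi>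
    using norm_moore_penrose_XM[OF S_linear, of \<xi> "osc JV (-1) (u m) \<xi>"] norm_osc_le[OF JV, of "-1" "u m" \<xi>] D[of m]
    by (simp add: PSF_def)
  have [measurable]: "osc JV (-1) U \<in> borel_measurable borel"
    using L1_lim_integrable(2)[OF U] by (intro osc_measurable[OF JV]) auto
  have [measurable]: "(\<lambda>\<xi>. P \<xi> (S \<xi> (osc JV (-1) U \<xi>))) \<in> borel_measurable borel" by (rule PS_measurable) simp
  note PSF_measurable[OF u, measurable]
  have w: "integrable lborel (\<lambda>\<xi>::real^'n. (gauss 1 \<xi> * norm \<xi> ^ length is) * D)"
    by (intro integrable_mult_left gauss_moment)
  have "(\<lambda>m. LINT \<xi>|lborel. gauss 1 \<xi> *\<^sub>R (tens is \<xi> *\<^sub>R PSF (u m) \<xi>)) \<longlonglongrightarrow>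
    (LINT \<xi>|lborel. gauss 1 \<xi> *\<^sub>R (tens is \<xi> *\<^sub>R P \<xi> (S \<xi> (osc JV (-1) U \<xi>))))"
  proof (rule integral_dominated_convergence[OF _ _ w])
    show "AE \<xi> in lborel. (\<lambda>m. gauss 1 \<xi> *\<^sub>R (tens is \<xi> *\<^sub>R PSF (u m) \<xi>)) \<longlonglongrightarrow> gauss 1 \<xi> *\<^sub>R (tens is \<xi> *\<^sub>R P \<xi> (S \<xi> (osc JV (-1) U \<xi>)))"
    proof (intro AE_I2 tendsto_scaleR tendsto_const)
      fix \<xi>
      have "bounded_linear (\<lambda>v. P \<xi> (S \<xi> v))"
        using linear_compose[OF S_linear[of \<xi>] P_linear[of \<xi>]] by (simp add: o_def linear_conv_bounded_linear)
      from bounded_linear.tendsto[OF this osc_lim] show "(\<lambda>m. PSF (u m) \<xi>) \<longlonglongrightarrow> P \<xi> (S \<xi> (osc JV (-1) U \<xi>))"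
        unfolding PSF_def .
    qed
    show "AE \<xi> in lborel. norm (gauss 1 \<xi> *\<^sub>R (tens is \<xi> *\<^sub>R PSF (u m) \<xi>)) \<le> gauss 1 \<xi> * norm \<xi> ^ length is * D" for m
    proof (intro AE_I2)
      fix \<xi> :: "real^'n"
      have "\<bar>tens is \<xi>\<bar> * norm (PSF (u m) \<xi>) \<le> norm \<xi> ^ length is * D" by (intro mult_mono tens_bound bd) auto
      then show "norm (gauss 1 \<xi> *\<^sub>R (tens is \<xi> *\<^sub>R PSF (u m) \<xi>)) \<le> gauss 1 \<xi> * norm \<xi> ^ length is * D"
        using mult_left_mono[OF _ less_imp_le[OF gauss_bounds(1)]] by (simp add: abs_mult abs_of_pos[OF gauss_bounds(1)] mult.assoc)
    qed
  qed measurable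
  then have "(\<lambda>m. norm (LINT \<xi>|lborel. gauss 1 \<xi> *\<^sub>R (tens is \<xi> *\<^sub>R PSF (u m) \<xi>))) \<longlonglongrightarrow>
    norm (LINT \<xi>|lborel. gauss 1 \<xi> *\<^sub>R (tens is \<xi> *\<^sub>R P \<xi> (S \<xi> (osc JV (-1) U \<xi>))))" by (rule tendsto_norm)
  moreover have "(\<lambda>m. c * L1_norm (diff_operator k B (u m))) \<longlonglongrightarrow> c * L1_norm f"
    unfolding L1_norm_def by (intro tendsto_intros L1_lim_norm f)
  ultimately show ?thesis using mollified_bound[OF u] by (intro LIMSEQ_le) auto
qed

text \<open>The function \<open>U\<close> has transform \<phi> P w up to a power of i. As
  \<open>w\<close> lies in every range, S P w = w off the origin, so B(D) U is the inverse transform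
  of \<phi> w. That \<phi> vanishes near 0 makes the transform smooth there in spite of the
  singularity of P; \<open>U\<close> decays rapidly but need not have compact support, hence the
  cutoffs \<open>u m\<close>.\<close>

lemma localized_bound:
  fixes \<phi> :: "real^'n \<Rightarrow> real"
  assumes \<phi>: "\<phi> \<in> test_functions" and r: "r > 0" "\<And>\<xi>. norm \<xi> < r \<Longrightarrow> \<phi> \<xi> = 0" and w: "w \<in> N"
  shows "norm (LINT \<xi>|lborel. (gauss 1 \<xi> * \<phi> \<xi>) *\<^sub>R (tens is \<xi> *\<^sub>R P \<xi> w)) \<le>
    c * ((1 / (2 * pi) ^ CARD('n)) * (LINT x|lborel. norm (osc JW 1 (\<lambda>\<xi>. \<phi> \<xi> *\<^sub>R w) x)))"
proof -
  define q where "q = 1 / (2 * pi) ^ CARD('n)"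
  have q: "q > 0" by (simp add: q_def)
  \<comment> \<open>The iterate of order 3 k is multiplication by i^(-k) and cancels the factor i^k
    produced by the operator.\<close>
  define g where "g = (\<lambda>\<xi>. \<phi> \<xi> *\<^sub>R (JV ^^ (3 * k)) (P \<xi> w))"
  obtain R where \<phi>s: "smooth_on UNIV \<phi>" and R: "\<And>x. norm x > R \<Longrightarrow> \<phi> x = 0" using \<phi> by (auto simp: test_functions_iff)
  have Jk: "(JV ^^ k) ((JV ^^ (3 * k)) v) = v" for v
  proof -
    have "k + 3 * k = 4 * k" by simp
    then show ?thesis using J_power4[OF JV, of k v] by (metis funpow_add o_apply)
  qed
  note lJV = bounded_linear.linear[OF J_funpow_linear[OF JV]]
  have gt: "g \<in> test_functions"
    unfolding test_functions_iff
  proof (intro conjI exI[of _ R] allI impI)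
    have o1: "open (- {0::real^'n})" by (rule open_Compl) simp
    have "smooth_on (- {0}) (\<lambda>\<xi>. P \<xi> w)"
      using smooth_on_linear[OF o1 blinfun.bounded_linear_left Pb_smooth, of w] by (simp add: Pb_apply)
    then have "smooth_on (- {0}) g"
      unfolding g_def by (intro smooth_on_scaleR[OF o1] smooth_on_linear[OF o1 J_funpow_linear[OF JV]] smooth_on_subset[OF subset_UNIV \<phi>s])
    moreover have "smooth_on (ball 0 r) g"
      by (rule smooth_on_cong[OF open_ball _ smooth_on_const[OF open_ball, of 0 r 0]]) (auto simp: g_def r)
    ultimately have "smooth_on (- {0} \<union> ball 0 r) g" using o1 by (intro smooth_on_Un) auto
    also have "- {0} \<union> ball 0 r = (UNIV :: (real^'n) set)" using r(1) by auto
    finally show "smooth_on UNIV g" .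
  qed (auto simp: g_def R)
  define U where "U = (\<lambda>x. q *\<^sub>R osc JV 1 g x)"
  have or: "rapid (osc JV 1 g)" by (rule osc_test_rapid[OF JV gt]) simp
  have gr: "rapid g" by (rule test_function_rapid[OF gt])
  have os: "smooth_on UNIV (osc JV 1 g)" by (rule osc_smooth[OF JV gr])
  have Us: "smooth_on UNIV U" unfolding U_def by (rule smooth_on_linear[OF open_UNIV bounded_linear_scaleR_right os])
  have dU: "partial_derivs js U = (\<lambda>x. q *\<^sub>R partial_derivs js (osc JV 1 g) x)" for js
    unfolding U_def by (rule partial_derivs_linear[OF bounded_linear_scaleR_right os])
  have Ui: "integrable lborel (partial_derivs js U)" for js
  proof -
    have "(\<lambda>x. mono_J JV 1 js x (g x)) \<in> test_functions"
    proof (induction js)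
      case Nil show ?case using gt by (simp add: mono_J_def[OF JV])
    next
      case (Cons j js)
      have "smooth_on UNIV (\<lambda>x. (1 * x $ j) *\<^sub>R JV (mono_J JV 1 js x (g x)))"
        using Cons smooth_on_nth[OF open_UNIV, of j]
        by (intro smooth_on_scaleR[OF open_UNIV] smooth_on_linear[OF open_UNIV J_bounded_linear[OF JV]]) (auto simp: test_functions_iff)
      moreover have "\<exists>R. \<forall>x. norm x > R \<longrightarrow> mono_J JV 1 (j # js) x (g x) = 0" 
      proof -
        obtain R where "\<And>x. norm x > R \<Longrightarrow> mono_J JV 1 js x (g x) = 0" using Cons by (auto simp: test_functions_iff)
        then show ?thesis by (intro exI[of _ R]) (simp add: mono_J_Cons[OF JV] linear_0[OF J_linear[OF JV]])
      qed
      ultimately show ?case by (simp add: test_functions_iff mono_J_Cons[OF JV])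
    qed
    from rapid_integrable[OF osc_test_rapid[OF JV this, of 1]] show ?thesis
      unfolding dU osc_partial_derivs[OF JV gr] by simp
  qed
  define u where "u = (\<lambda>m x. plateau ((1 / (real m + 1)) *\<^sub>R x) *\<^sub>R U x)"
  have ut: "u m \<in> test_functions" for m unfolding u_def by (rule plateau_cutoff_test[OF Us]) simp
  have lim: "L1_lim (\<lambda>m. partial_derivs js (u m)) (partial_derivs js U)" for js
    using partial_derivs_cutoff_L1_lim[OF plateau_test Us Ui, of js] by (simp add: u_def plateau_eq_1)
  have Blim: "L1_lim (\<lambda>m. diff_operator k B (u m)) (diff_operator k B U)"
    unfolding diff_operator_def[abs_def]
  proof (rule L1_lim_sum, rule L1_lim_linear[OF _ B_bounded_linear])
    fix \<alpha> :: "'n multi_index"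
    obtain xs where "\<And>u :: real^'n \<Rightarrow> 'v. multi_deriv \<alpha> u = partial_derivs xs u" using multi_deriv_list[of \<alpha>, where 'e = 'v] by blast
    then show "L1_lim (\<lambda>m. multi_deriv \<alpha> (u m)) (multi_deriv \<alpha> U)" using lim by simp
  qed
  have oscU: "osc JV (-1) U \<xi> = g \<xi>" for \<xi>
    unfolding U_def osc_scaleR[OF JV] using osc_inversion[OF JV gt, of 1 \<xi>] by (simp add: q_def)
  have BU: "diff_operator k B U x = q *\<^sub>R osc JW 1 (\<lambda>\<xi>. \<phi> \<xi> *\<^sub>R w) x" for x
  proof -
    have "S \<xi> ((JV ^^ k) (g \<xi>)) = \<phi> \<xi> *\<^sub>R w" for \<xi>
    proof (cases "\<xi> = 0")
      case True
      then show ?thesis using r by (simp add: g_def linear_0[OF S_linear] linear_0[OF lJV])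
    next
      case False
      then show ?thesis using w unfolding N_iff
        by (simp add: Jk g_def linear_scale[OF lJV] linear_scale[OF S_linear])
    qed
    then have "diff_operator k B (osc JV 1 g) x = osc JW 1 (\<lambda>\<xi>. \<phi> \<xi> *\<^sub>R w) x" by (simp add: diff_operator_osc[OF gr])
    moreover have "diff_operator k B U x = q *\<^sub>R diff_operator k B (osc JV 1 g) x"
      unfolding diff_operator_def multi_deriv_def dU scaleR_sum_right
      by (intro sum.cong refl) (simp add: linear_scale[OF B_linear])
    ultimately show ?thesis by simp
  qed
  have "norm (LINT \<xi>|lborel. gauss 1 \<xi> *\<^sub>R (tens is \<xi> *\<^sub>R P \<xi> (S \<xi> (g \<xi>)))) \<le> c * L1_norm (diff_operator k B U)"
    using mollified_limit_bound[OF ut lim[of "[]", simplified] Blim] by (simp only: oscU)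
  moreover have "gauss 1 \<xi> *\<^sub>R (tens is \<xi> *\<^sub>R P \<xi> (S \<xi> (g \<xi>))) = (JV ^^ (3 * k)) ((gauss 1 \<xi> * \<phi> \<xi>) *\<^sub>R (tens is \<xi> *\<^sub>R P \<xi> w))" for \<xi>
  proof -
    have PJ: "P \<xi> ((JW ^^ m) y) = (JV ^^ m) (P \<xi> y)" for m y by (induction m) (auto simp: P_J)
    have "P \<xi> (S \<xi> (g \<xi>)) = \<phi> \<xi> *\<^sub>R (JV ^^ (3 * k)) (P \<xi> w)"
      unfolding g_def by (simp add: linear_scale[OF S_linear] linear_scale[OF P_linear] S_J_funpow PJ moore_penrose_XMX[OF S_linear])
    then show ?thesis by (simp add: linear_scale[OF lJV] ac_simps)
  qed
  \<comment> \<open>The iterate of order k is an inverse, so the integral commutes with the iterate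
    of order 3 k without a separate integrability proof.\<close>
  moreover have "(LINT \<xi>|lborel. (JV ^^ (3 * k)) ((gauss 1 \<xi> * \<phi> \<xi>) *\<^sub>R (tens is \<xi> *\<^sub>R P \<xi> w))) =
      (JV ^^ (3 * k)) (LINT \<xi>|lborel. (gauss 1 \<xi> * \<phi> \<xi>) *\<^sub>R (tens is \<xi> *\<^sub>R P \<xi> w))"
    by (rule integral_bounded_linear'[OF J_funpow_linear[OF JV] J_funpow_linear[OF JV, of k]]) (simp add: Jk)
  ultimately show ?thesis
    unfolding L1_norm_def BU by (simp add: norm_J_funpow[OF JV] q_def)
qed

end

text \<open>For fixed z in the annulus the substitution s = t |z| removes z from the radial
  integral, so that the double integral factorises; ln 2 is the normalisation of
  \<open>dil\<close>.\<close>

lemma integral_radial_kernel: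
  fixes r :: "real \<Rightarrow> real"
  assumes l: "length is = k - CARD('n)"
    and r: "integrable lborel (\<lambda>t. indicator {0<..} t * r t / t)" and [measurable]: "r \<in> borel_measurable borel"
    and h: "integrable lborel (\<lambda>\<xi>. r (norm \<xi>) *\<^sub>R (tens is \<xi> *\<^sub>R P \<xi> w))"
  shows "(LINT \<xi>|lborel. r (norm \<xi>) *\<^sub>R (tens is \<xi> *\<^sub>R P \<xi> w)) = ((LINT t|lborel. indicator {0<..} t * r t / t) / ln 2) *\<^sub>R avg is w"
proof -
  define f where "f t = indicator {0<..} t * r t / t" for t :: real
  define h where "h = (\<lambda>\<xi>. r (norm \<xi>) *\<^sub>R (tens is \<xi> *\<^sub>R P \<xi> w))"
  have fi: "integrable lborel f" using r by (simp add: f_def[abs_def])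
  have hi: "integrable lborel h" using assms(4) by (simp add: h_def)
  have inner: "(LINT t|lborel. dil (t, z) *\<^sub>R h (t *\<^sub>R z)) = ((LINT t|lborel. f t) / ln 2) *\<^sub>R (indicator annulus z *\<^sub>R (tens is z *\<^sub>R P z w))"
    for z :: "real^'n"
  proof (cases "z \<in> annulus")
    case True
    then have z: "norm z > 0" by (auto simp: annulus_def)
    have "dil (t, z) *\<^sub>R h (t *\<^sub>R z) = (norm z * f (0 + norm z * t)) *\<^sub>R ((1 / ln 2) *\<^sub>R (tens is z *\<^sub>R P z w))" for t
    proof (cases "t > 0")
      case t: True
      have "0 < CARD('n)" by simp
      then have "k = Suc ((CARD('n) - 1) + length is)" using nk l by linarith
      then have "t ^ k = t * (t ^ (CARD('n) - 1) * t ^ length is)" by (simp only: power_Suc power_add)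
      then have "t ^ (CARD('n) - 1) * (t ^ length is * (1 / t ^ k)) = 1 / t" using t by (simp add: field_simps)
      then have "(t ^ (CARD('n) - 1) * (t ^ length is * (1 / t ^ k))) * (r (norm z * t) / ln 2) = norm z * f (0 + norm z * t) * (1 / ln 2)"
        using t z by (simp add: f_def field_simps)
      moreover have "dil (t, z) *\<^sub>R h (t *\<^sub>R z) = ((t ^ (CARD('n) - 1) * (t ^ length is * (1 / t ^ k))) * (r (norm z * t) / ln 2)) *\<^sub>R (tens is z *\<^sub>R P z w)"
        using t True by (simp add: dil_def h_def tens_scale P_scale ac_simps)
      ultimately show ?thesis by simp
    qed (use z in \<open>auto simp: dil_def f_def zero_less_mult_iff\<close>)
    moreover have "integrable lborel (\<lambda>t. norm z * f (0 + norm z * t))"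
      using lborel_integrable_real_affine[OF fi, of "norm z" 0] z by (intro integrable_mult_right) auto
    moreover have "(LINT t|lborel. norm z * f (0 + norm z * t)) = (LINT t|lborel. f t)"
      using integral_lborel_scale[of f "norm z"] fi z by (simp add: borel_measurable_integrable)
    ultimately show ?thesis using True by simp
  qed (simp add: dil_def)
  have "(LINT \<xi>|lborel. h \<xi>) = (LINT p|(lborel \<Otimes>\<^sub>M lborel). dil p *\<^sub>R h (fst p *\<^sub>R snd p))"
    by (rule integral_dilation(2)[OF hi, symmetric])
  also have "\<dots> = (LINT z|lborel. (LINT t|lborel. dil (t, z) *\<^sub>R h (t *\<^sub>R z)))"
    using lborel_pair.integral_snd[of "\<lambda>t z. dil (t, z) *\<^sub>R h (t *\<^sub>R z)"] integral_dilation(1)[OF hi]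
    by (simp add: case_prod_beta')
  also have "\<dots> = ((LINT t|lborel. f t) / ln 2) *\<^sub>R avg is w" by (simp only: inner integral_scaleR_right avg_def)
  finally show ?thesis by (simp add: h_def f_def)
qed

lemma necessity:
  assumes l: "length is = k - CARD('n)" and c: "c > 0" and w: "w \<in> N"
    and Tb: "\<And>u. u \<in> test_functions \<Longrightarrow> norm (Tfun is u) \<le> c * L1_norm (diff_operator k B u)"
  shows "avg is w = 0"
proof -
  obtain i :: 'n where True by simp
  define e :: "real^'n" where "e = axis i 1"
  have e: "norm e = 1" by (simp add: e_def)
  define M where "M = (LINT x|lborel. norm (osc JW 1 (\<lambda>\<xi>::real^'n. plateau \<xi> *\<^sub>R w) x))"
  define C where "C = c * ((1 / (2 * pi) ^ CARD('n)) * (2 * M))"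
  have pw: "(\<lambda>\<xi>::real^'n. plateau (a *\<^sub>R \<xi>) *\<^sub>R w) \<in> test_functions" if "a > 0" for a
    by (rule plateau_cutoff_test[OF smooth_on_const[OF open_UNIV] that])
  have pt: "(\<lambda>\<xi>::real^'n. plateau (a *\<^sub>R \<xi>)) \<in> test_functions" if "a > 0" for a
    using plateau_cutoff_test[OF smooth_on_const[OF open_UNIV, of "1::real"] that] by simp
  have bound: "exp (- (1 / 2)) * s / ln 2 * norm (avg is w) \<le> C" if s: "s \<ge> 0" for s
  proof -
    \<comment> \<open>With this choice the interval [2 / R, 1] has logarithmic length
      \<open>s\<close>, so the lower bound grows linearly in the parameter.\<close>
    define R where "R = 2 * exp s"
    have R: "R \<ge> 2" "R > 0" using s by (auto simp: R_def)
    then have R1: "1 / R \<le> 1" "2 / R \<le> 1" "0 < 1 / R" "0 < 2 / R" by auto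
    define \<phi> where "\<phi> = (\<lambda>\<xi>::real^'n. plateau \<xi> - plateau (R *\<^sub>R \<xi>))"
    \<comment> \<open>The profile of the integrand along the unit vector \<open>e\<close>. Gaussian
      and plateau depend on the norm only, so \<open>rr\<close> recovers the function on the whole
      space.\<close>
    define r where "r t = gauss 1 (t *\<^sub>R e) * \<phi> (t *\<^sub>R e)" for t
    have \<phi>0: "\<phi> \<xi> = 0" if "norm \<xi> \<le> 1 / R" for \<xi>
    proof -
      have "norm (R *\<^sub>R \<xi>) \<le> 1" using that R by (simp add: field_simps)
      moreover have "norm \<xi> \<le> 1" using that R1 by linarith
      ultimately show ?thesis by (simp add: \<phi>_def plateau_eq_1)
    qed
    have \<phi>1: "\<phi> \<xi> = plateau \<xi>" if "norm \<xi> \<ge> 2 / R" for \<xi>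
      using that R by (simp add: \<phi>_def plateau_eq_0 field_simps)
    have \<phi>2: "\<phi> \<xi> = 0" if "norm \<xi> \<ge> 2" for \<xi>
    proof -
      have "2 / R \<le> norm \<xi>" using that R1 by linarith
      then show ?thesis using that by (simp add: \<phi>1 plateau_eq_0)
    qed
    have \<phi>_range: "0 \<le> \<phi> \<xi>" "\<phi> \<xi> \<le> 1" for \<xi>
    proof -
      have "norm \<xi> \<le> 1 \<or> 2 / R \<le> norm \<xi>" using R1 by linarith
      then show "0 \<le> \<phi> \<xi>" using plateau_range by (auto simp: \<phi>1) (auto simp: \<phi>_def plateau_eq_1)
      show "\<phi> \<xi> \<le> 1" using plateau_range[of \<xi>] plateau_range[of "R *\<^sub>R \<xi>"] by (simp add: \<phi>_def)
    qed
    have \<phi>t: "\<phi> \<in> test_functions"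
      unfolding test_functions_iff
    proof (intro conjI exI[of _ 2] allI impI)
      show "smooth_on UNIV \<phi>"
        unfolding \<phi>_def using smooth_on_affine[OF plateau_smooth, of 0 R] by (intro smooth_on_diff open_UNIV plateau_smooth) simp
    qed (simp add: \<phi>2)
    note [measurable] = test_function_measurable[OF \<phi>t]
    have rr: "r (norm \<xi>) = gauss 1 \<xi> * \<phi> \<xi>" for \<xi>
      using plateau_norm[of "norm \<xi> *\<^sub>R e" \<xi>] plateau_norm[of "R *\<^sub>R (norm \<xi> *\<^sub>R e)" "R *\<^sub>R \<xi>"] e
      by (simp add: r_def \<phi>_def gauss_def abs_mult)
    have r0: "0 \<le> r t" "r t \<le> 1" for t
      using \<phi>_range[of "t *\<^sub>R e"] gauss_bounds[of 1 "t *\<^sub>R e"] by (auto simp: r_def mult_le_one)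
    have [measurable]: "r \<in> borel_measurable borel" unfolding r_def[abs_def] by measurable
    have ri: "integrable lborel (\<lambda>t. indicator {0<..} t * r t / t)"
    proof (rule Bochner_Integration.integrable_bound)
      show "integrable lborel (\<lambda>t::real. R * indicator {0..2} t)" by (intro integrable_mult_right integrable_real_indicator) auto
      have "\<bar>indicator {0<..} t * r t / t\<bar> \<le> R * indicator {0..2} t" for t
      proof (cases "1 / R < t \<and> t < 2")
        case True
        then have t0: "t > 0" using R1 by linarith
        then have t: "t > 0" "1 / t \<le> R" using True R by (auto simp: field_simps)
        have "r t * (1 / t) \<le> 1 * R" using r0 t by (intro mult_mono) auto
        then show ?thesis using True t r0(1)[of t] by (simp add: abs_mult)
      next
        case False
        then have "t \<le> 0 \<or> r t = 0" using e by (auto simp: r_def not_less \<phi>0 \<phi>2)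
        then show ?thesis using R by (auto simp: indicator_def)
      qed
      then show "AE t in lborel. norm (indicator {0<..} t * r t / t) \<le> norm (R * indicator {0..2} t)"
        using R by (intro AE_I2) (simp add: abs_mult)
    qed measurable
    \<comment> \<open>On [2 / R, 1] the large bump is 1 and the small one is 0, so \<open>r\<close>
      is the bare Gaussian there, which is at least exp (- 1 / 2); the remaining integral of 1 / t
      equals \<open>s\<close>.\<close>
    have lower: "exp (- (1 / 2)) * s \<le> (LINT t|lborel. indicator {0<..} t * r t / t)"
    proof -
      have "has_bochner_integral lborel (\<lambda>t. (1 / t) * indicator {2 / R..1} t) (ln 1 - ln (2 / R))"
      proof (rule has_bochner_integral_FTC_Icc_nonneg)
        fix t :: real assume "t \<in> {2 / R..1}"
        then have "t > 0" using less_le_trans[OF R1(4)] by simp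
        then show "(ln has_real_derivative 1 / t) (at t)" by (auto intro!: derivative_eq_intros)
        show "0 \<le> 1 / t" using \<open>t > 0\<close> by simp
      qed (use R1 in auto)
      then have i: "integrable lborel (\<lambda>t. (1 / t) * indicator {2 / R..1} t)"
        and v: "(LINT t|lborel. (1 / t) * indicator {2 / R..1} t) = ln 1 - ln (2 / R)" by (auto simp: has_bochner_integral_iff)
      have "ln 1 - ln (2 / R) = s" by (simp add: R_def ln_div ln_mult)
      then have "exp (- (1 / 2)) * s = (LINT t|lborel. exp (- (1 / 2)) * ((1 / t) * indicator {2 / R..1} t))" 
        by (simp only: integral_mult_right_zero v)
      also have "\<dots> \<le> (LINT t|lborel. indicator {0<..} t * r t / t)"
      proof (rule integral_mono[OF integrable_mult_right[OF i] ri])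
        fix t :: real
        show "exp (- (1 / 2)) * ((1 / t) * indicator {2 / R..1} t) \<le> indicator {0<..} t * r t / t"
        proof (cases "t \<in> {2 / R..1}")
          case True
          then have t: "t > 0" "t \<le> 1" "2 / R \<le> t" using less_le_trans[OF R1(4)] by auto
          have "exp (- (1 / 2)) \<le> r t"
            using t e power_le_one[of t 2] by (simp add: r_def \<phi>1 plateau_eq_1 gauss_def)
          then show ?thesis using True t by (simp add: divide_right_mono)
        next
          case False
          then show ?thesis using r0(1)[of t] by (auto simp: indicator_def)
        qed
      qed
      finally show ?thesis .
    qed
    have J1: "norm (LINT \<xi>|lborel. (gauss 1 \<xi> * \<phi> \<xi>) *\<^sub>R (tens is \<xi> *\<^sub>R P \<xi> w)) \<le>
        c * ((1 / (2 * pi) ^ CARD('n)) * (LINT x|lborel. norm (osc JW 1 (\<lambda>\<xi>. \<phi> \<xi> *\<^sub>R w) x)))"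
      using R by (intro localized_bound[OF Tb \<phi>t _ _ w, of "1 / R"]) (auto intro: \<phi>0)
    \<comment> \<open>By \<open>osc_scale_L1\<close> the dilated bump contributes the same amount
      \<open>M\<close> as the original one; the bound does not depend on \<open>R\<close>.\<close>
    have J2: "(LINT x|lborel. norm (osc JW 1 (\<lambda>\<xi>. \<phi> \<xi> *\<^sub>R w) x)) \<le> 2 * M"
    proof -
      let ?a = "osc JW 1 (\<lambda>\<xi>::real^'n. plateau \<xi> *\<^sub>R w)" and ?b = "osc JW 1 (\<lambda>\<xi>::real^'n. plateau (R *\<^sub>R \<xi>) *\<^sub>R w)"
      have t: "(\<lambda>\<xi>::real^'n. plateau \<xi> *\<^sub>R w) \<in> test_functions" "(\<lambda>\<xi>::real^'n. plateau (R *\<^sub>R \<xi>) *\<^sub>R w) \<in> test_functions"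
        using pw[of 1] pw[of R] R by auto
      have ab: "osc JW 1 (\<lambda>\<xi>. \<phi> \<xi> *\<^sub>R w) x = ?a x - ?b x" for x
        unfolding \<phi>_def scaleR_diff_left by (rule osc_diff[OF JW test_function_integrable[OF t(1)] test_function_integrable[OF t(2)]])
      have i: "integrable lborel ?a" "integrable lborel ?b"
        by (rule rapid_integrable[OF osc_test_rapid[OF JW t(1)]] rapid_integrable[OF osc_test_rapid[OF JW t(2)]], simp)+
      have "(LINT x|lborel. norm (?b x)) = M"
        using osc_scale_L1[OF JW test_function_measurable[OF t(1)], of "1 / R" 1] R by (simp add: M_def)
      moreover have "(LINT x|lborel. norm (?a x - ?b x)) \<le> (LINT x|lborel. norm (?a x) + norm (?b x))"
        by (intro integral_mono integrable_norm Bochner_Integration.integrable_diff Bochner_Integration.integrable_add i norm_triangle_ineq4)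
      ultimately show ?thesis using i by (simp add: ab M_def Bochner_Integration.integral_add)
    qed
    have hi: "integrable lborel (\<lambda>\<xi>. r (norm \<xi>) *\<^sub>R (tens is \<xi> *\<^sub>R P \<xi> w))"
    proof (rule Bochner_Integration.integrable_bound)
      let ?K = "cball 0 2 - ball 0 (1 / R) :: (real^'n) set"
      have "continuous_on ?K (\<lambda>\<xi>. P \<xi> w)"
        by (rule continuous_on_subset[OF P_continuous[OF continuous_on_const]]) (use R1 in auto)
      then have "integrable lborel (\<lambda>\<xi>. indicator ?K \<xi> *\<^sub>R P \<xi> w)"
        by (intro borel_integrable_compact compact_diff) auto
      then show "integrable lborel (\<lambda>\<xi>. 2 ^ length is *\<^sub>R (indicator ?K \<xi> *\<^sub>R P \<xi> w))" by (rule integrable_scaleR_right)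
      have "\<bar>r (norm \<xi>)\<bar> * \<bar>tens is \<xi>\<bar> \<le> 2 ^ length is * indicator ?K \<xi>" for \<xi>
      proof (cases "\<xi> \<in> ?K")
        case True
        have "\<bar>tens is \<xi>\<bar> \<le> 2 ^ length is"
          using order_trans[OF tens_bound[of "is" \<xi>] power_mono[of "norm \<xi>" 2]] True by simp
        then have "\<bar>r (norm \<xi>)\<bar> * \<bar>tens is \<xi>\<bar> \<le> 1 * 2 ^ length is" using r0 by (intro mult_mono) auto
        then show ?thesis using True by simp
      next
        case False
        then have "norm \<xi> \<le> 1 / R \<or> 2 \<le> norm \<xi>" by auto
        then show ?thesis by (auto simp: rr \<phi>0 \<phi>2)
      qed
      then show "AE \<xi> in lborel. norm (r (norm \<xi>) *\<^sub>R (tens is \<xi> *\<^sub>R P \<xi> w)) \<le> norm (2 ^ length is *\<^sub>R (indicator ?K \<xi> *\<^sub>R P \<xi> w))"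
        by (intro AE_I2) (simp add: mult.assoc[symmetric] abs_mult mult_right_mono)
    qed measurable
    have "(LINT \<xi>|lborel. (gauss 1 \<xi> * \<phi> \<xi>) *\<^sub>R (tens is \<xi> *\<^sub>R P \<xi> w)) = ((LINT t|lborel. indicator {0<..} t * r t / t) / ln 2) *\<^sub>R avg is w"
      using integral_radial_kernel[OF l ri _ hi] by (simp add: rr)
    then have "((LINT t|lborel. indicator {0<..} t * r t / t) / ln 2) * norm (avg is w) =
        norm (LINT \<xi>|lborel. (gauss 1 \<xi> * \<phi> \<xi>) *\<^sub>R (tens is \<xi> *\<^sub>R P \<xi> w))"
      using lower s by (simp add: abs_of_nonneg[OF order_trans[OF _ lower]])
    also have "\<dots> \<le> C" unfolding C_def
      by (rule order_trans[OF J1]) (use J2 c in \<open>intro mult_left_mono; simp\<close>)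
    finally have "((LINT t|lborel. indicator {0<..} t * r t / t) / ln 2) * norm (avg is w) \<le> C" .
    moreover have "exp (- (1 / 2)) * s / ln 2 * norm (avg is w) \<le> ((LINT t|lborel. indicator {0<..} t * r t / t) / ln 2) * norm (avg is w)"
      using lower by (intro mult_right_mono divide_right_mono) auto
    ultimately show ?thesis by linarith
  qed
  show ?thesis
  proof (rule ccontr)
    assume "avg is w \<noteq> 0"
    then have a: "norm (avg is w) > 0" by simp
    have C0: "C \<ge> 0" using bound[of 0] by simp
    define s where "s = (C + 1) * ln 2 / (exp (- (1 / 2)) * norm (avg is w))"
    have "s \<ge> 0" unfolding s_def using C0 a by (intro divide_nonneg_nonneg mult_nonneg_nonneg) auto
    moreover have "exp (- (1 / 2)) * s / ln 2 * norm (avg is w) = C + 1" unfolding s_def using a by simp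
    ultimately show False using bound[of s] by simp
  qed
qed

end

section \<open>The equivalence for complex-linear operators\<close>

context complex_operator
begin

lemma Tfun_add_J:
  assumes a: "a \<in> test_functions" and b: "b \<in> test_functions"
  shows "Tfun is (\<lambda>x. a x + JV (b x)) = Tfun is a + JV (Tfun is b)"
proof -
  note ab = test_function_integrable[OF a] test_function_integrable[OF b]
  have Jb: "integrable lborel (\<lambda>x. JV (b x))" by (rule integrable_bounded_linear[OF J_bounded_linear[OF JV] ab(2)])
  have "osc JV (-1) (\<lambda>x. a x + JV (b x)) \<xi> = osc JV (-1) a \<xi> + JV (osc JV (-1) b \<xi>)" for \<xi>
    by (simp only: osc_add[OF JV ab(1) Jb] osc_J[OF JV ab(2)])
  then have "PSF (\<lambda>x. a x + JV (b x)) \<xi> = PSF a \<xi> + JV (PSF b \<xi>)" for \<xi>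
    by (simp add: PSF_def linear_add[OF S_linear] linear_add[OF P_linear] S_J P_J)
  then have "Tfun is (\<lambda>x. a x + JV (b x)) = (LINT \<xi>|lborel. tens is \<xi> *\<^sub>R PSF a \<xi> + JV (tens is \<xi> *\<^sub>R PSF b \<xi>))"
    by (simp add: Tfun_def scaleR_add_right J_scale[OF JV])
  also have "\<dots> = Tfun is a + JV (Tfun is b)"
    unfolding Tfun_def
    by (simp only: Bochner_Integration.integral_add[OF rapid_integrable[OF tens_PSF_rapid[OF a]]
          integrable_bounded_linear[OF J_bounded_linear[OF JV] rapid_integrable[OF tens_PSF_rapid[OF b]]]]
        integral_bounded_linear[OF J_bounded_linear[OF JV] rapid_integrable[OF tens_PSF_rapid[OF b]]])
  finally show ?thesis .
qed

text \<open>\<open>U\<close> is the class for which the estimate is posed: all test functions in the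
  complex case, the functions (u, 0) in the real case. Necessity works with general complex-valued
  functions; splitting them into real and imaginary parts, whose right-hand sides are no larger,
  costs a factor 2.\<close>

lemma estimate_iff_cancellation:
  assumes U: "U \<subseteq> test_functions" "\<And>u a. u \<in> U \<Longrightarrow> (\<lambda>x. u (a + x)) \<in> U"
    and split: "\<And>u. u \<in> test_functions \<Longrightarrow> u \<in> U \<or> (\<exists>a\<in>U. \<exists>b\<in>U. u = (\<lambda>x. a x + JV (b x)) \<and>
      L1_norm (diff_operator k B a) \<le> L1_norm (diff_operator k B u) \<and> L1_norm (diff_operator k B b) \<le> L1_norm (diff_operator k B u))"
  shows "(\<exists>c>0. \<forall>u\<in>U. tensor_Linf_norm (k - CARD('n)) (deriv_tensor (\<lambda>x. u x - complex_projection JV k B u x))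
      \<le> ereal (c * L1_norm (diff_operator k B u))) \<longleftrightarrow> cancellation_condition k B"
    (is "?A \<longleftrightarrow> _")
proof
  assume ?A
  then have "\<exists>c>0. \<forall>u\<in>U. \<forall>is. length is = k - CARD('n) \<longrightarrow> norm (Tfun is u) \<le> c * L1_norm (diff_operator k B u)"
    by (simp only: estimate_iff_Tfun[OF U])
  then obtain c where c: "c > 0" "\<And>u is. u \<in> U \<Longrightarrow> length is = k - CARD('n) \<Longrightarrow> norm (Tfun is u) \<le> c * L1_norm (diff_operator k B u)"
    by blast
  have "norm (Tfun is u) \<le> (2 * c) * L1_norm (diff_operator k B u)" if u: "u \<in> test_functions" and l: "length is = k - CARD('n)" for u "is"
  proof -
    have L0: "0 \<le> c * L1_norm (diff_operator k B u)"
      unfolding L1_norm_def using c(1) by (intro mult_nonneg_nonneg integral_nonneg_AE) auto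
    show ?thesis using split[OF u]
    proof
      assume "u \<in> U"
      then show ?thesis using c(2)[OF _ l] L0 by fastforce
    next
      assume "\<exists>a\<in>U. \<exists>b\<in>U. u = (\<lambda>x. a x + JV (b x)) \<and>
        L1_norm (diff_operator k B a) \<le> L1_norm (diff_operator k B u) \<and> L1_norm (diff_operator k B b) \<le> L1_norm (diff_operator k B u)"
      then obtain a b where ab: "a \<in> U" "b \<in> U" "u = (\<lambda>x. a x + JV (b x))"
        "L1_norm (diff_operator k B a) \<le> L1_norm (diff_operator k B u)" "L1_norm (diff_operator k B b) \<le> L1_norm (diff_operator k B u)" by blast
      have t: "a \<in> test_functions" "b \<in> test_functions" using ab U(1) by auto
      have "norm (Tfun is u) \<le> norm (Tfun is a) + norm (Tfun is b)"
        unfolding ab(3) Tfun_add_J[OF t] using norm_triangle_ineq[of "Tfun is a" "JV (Tfun is b)"] by (simp add: J_norm[OF JV])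
      also have "\<dots> \<le> c * L1_norm (diff_operator k B u) + c * L1_norm (diff_operator k B u)"
        using order_trans[OF c(2)[OF ab(1) l] mult_left_mono[OF ab(4) less_imp_le[OF c(1)]]]
          order_trans[OF c(2)[OF ab(2) l] mult_left_mono[OF ab(5) less_imp_le[OF c(1)]]] by (rule add_mono)
      finally show ?thesis by simp
    qed
  qed
  then show "cancellation_condition k B"
    unfolding cancellation_iff_avg[OF nk] using necessity[of _ "2 * c"] c(1) by auto
next
  assume "cancellation_condition k B"
  then have "\<And>w is. w \<in> N \<Longrightarrow> length is = k - CARD('n) \<Longrightarrow> avg is w = 0" unfolding cancellation_iff_avg[OF nk] by blast
  from sufficiency[OF this] have "\<exists>c>0. \<forall>u\<in>U. \<forall>is. length is = k - CARD('n) \<longrightarrow> norm (Tfun is u) \<le> c * L1_norm (diff_operator k B u)"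
    using U(1) by blast
  then show ?A by (simp only: estimate_iff_Tfun[OF U])
qed

end

section \<open>Complexification\<close>

lemma complexification_complex_structure: "complex_structure (complexification_J :: 'v::euclidean_space \<times> 'v \<Rightarrow> _)"
  unfolding complex_structure_def orthogonal_transformation_def complexification_J_def
  by (auto simp: linear_iff inner_prod_def)

lemma complexify_bounded_linear: "bounded_linear (complexify :: 'v::euclidean_space \<Rightarrow> _)"
  unfolding linear_conv_bounded_linear[symmetric] by (auto simp: complexify_def linear_iff)

lemma norm_complexify: "norm (complexify v) = norm v"
  by (simp add: complexify_def norm_Pair)

lemma symbol_complexified:
  "symbol k (\<lambda>\<alpha>. map_prod (B \<alpha>) (B \<alpha>)) \<xi> = map_prod (symbol k B \<xi>) (symbol k B \<xi>)"
  by (rule ext) (auto simp: symbol_def prod_eq_iff fst_sum snd_sum)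

lemma range_map_prod: "range (map_prod f g) = range f \<times> range g"
  by (auto simp: image_def)

text \<open>Serves the embedding of the real spaces into their complexifications and the two
  coordinate projections back.\<close>

lemma diff_operator_intertwine:
  fixes B :: "'n::finite multi_index \<Rightarrow> 'v::euclidean_space \<Rightarrow> 'w::euclidean_space"
  assumes h: "bounded_linear h" and h': "linear h'" and u: "smooth_on UNIV u"
    and eq: "\<And>\<alpha> v. \<alpha> \<in> multi_indices k \<Longrightarrow> B' \<alpha> (h v) = h' (B \<alpha> v)"
  shows "diff_operator k B' (\<lambda>x. h (u x)) = (\<lambda>x. h' (diff_operator k B u x))"
  unfolding diff_operator_def[abs_def] multi_deriv_def partial_derivs_linear[OF h u] linear_sum[OF h']
  by (intro ext sum.cong refl) (simp add: eq)

text \<open>The range of the complexified symbol is a product of two copies of the original range,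
  so the constant rank doubles.\<close>

lemma (in const_rank_operator) complexified_operator:
  assumes "CARD('n) \<le> k"
  shows "complex_operator (\<lambda>\<alpha>. map_prod (B \<alpha>) (B \<alpha>)) k complexification_J complexification_J"
proof (intro complex_operator.intro complex_operator_axioms.intro const_rank_operator.intro)
  show "linear (map_prod (B \<alpha>) (B \<alpha>))" if "\<alpha> \<in> multi_indices k" for \<alpha> by (rule linear_map_prod[OF B_linear[OF that]])
  obtain r where r: "\<And>\<xi>. \<xi> \<noteq> 0 \<Longrightarrow> dim (range (S \<xi>)) = r" using const_rank unfolding constant_rank_def by blast
  have "subspace (range (S \<xi>))" for \<xi> by (rule linear_subspace_image[OF S_linear subspace_UNIV])
  then have "dim (range (symbol k (\<lambda>\<alpha>. map_prod (B \<alpha>) (B \<alpha>)) \<xi>)) = r + r" if "\<xi> \<noteq> 0" for \<xi>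
    unfolding symbol_complexified range_map_prod by (subst dim_Times) (use r that in auto)
  then show "constant_rank k (\<lambda>\<alpha>. map_prod (B \<alpha>) (B \<alpha>))" unfolding constant_rank_def by blast
  show "map_prod (B \<alpha>) (B \<alpha>) (complexification_J v) = complexification_J (map_prod (B \<alpha>) (B \<alpha>) v)"
    if "\<alpha> \<in> multi_indices k" for \<alpha> v
    by (cases v) (simp add: complexification_J_def linear_neg[OF B_linear[OF that]])
qed (use assms complexification_complex_structure in auto)

text \<open>Ranges, pseudoinverse and averages all act componentwise on pairs, so the condition for
  (a, b) is the condition for a and for b; the pairs (w, 0) recover the real condition.\<close>

lemma (in const_rank_operator) cancellation_complexified:
  assumes nk: "CARD('n) \<le> k"
  shows "cancellation_condition k (\<lambda>\<alpha>. map_prod (B \<alpha>) (B \<alpha>)) \<longleftrightarrow> cancellation_condition k B"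
proof -
  interpret C: complex_operator "\<lambda>\<alpha>. map_prod (B \<alpha>) (B \<alpha>)" k complexification_J complexification_J
    by (rule complexified_operator[OF nk])
  have N: "(a, b) \<in> C.N \<longleftrightarrow> a \<in> N \<and> b \<in> N" for a b
    unfolding C.N_def N_def symbol_complexified range_map_prod by auto
  have "C.avg is (a, b) = (avg is a, avg is b)" for "is" a b
  proof -
    note i = C.avg_integrable[of "is" "(a, b)"]
    have "fst (C.avg is (a, b)) = avg is a" "snd (C.avg is (a, b)) = avg is b"
      unfolding C.avg_def avg_def integral_bounded_linear[OF bounded_linear_fst i, symmetric] integral_bounded_linear[OF bounded_linear_snd i, symmetric]
      by (simp_all add: symbol_complexified moore_penrose_map_prod[OF S_linear] C.tens_def tens_def)
    then show ?thesis by (simp add: prod_eq_iff)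
  qed
  moreover have "0 \<in> N" unfolding N_iff by (simp add: linear_0[OF S_linear] linear_0[OF P_linear])
  ultimately show ?thesis
    unfolding C.cancellation_iff_avg[OF nk] cancellation_iff_avg[OF nk]
  proof (intro iffI ballI allI impI)
    fix w :: 'w and "is" :: "'n list"
    assume avg: "\<And>is a b. C.avg is (a, b) = (avg is a, avg is b)" and "0 \<in> N" "w \<in> N"
      and C: "\<forall>w\<in>C.N. \<forall>is. length is = k - CARD('n) \<longrightarrow> C.avg is w = 0" and l: "length is = k - CARD('n)"
    then have "(w, 0) \<in> C.N" by (simp add: N)
    then have "C.avg is (w, 0) = 0" using C l by blast
    then show "avg is w = 0" by (simp add: avg zero_prod_def)
  next
    fix p :: "'w \<times> 'w" and "is" :: "'n list"
    assume avg: "\<And>is a b. C.avg is (a, b) = (avg is a, avg is b)" and p: "p \<in> C.N"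
      and A: "\<forall>w\<in>N. \<forall>is. length is = k - CARD('n) \<longrightarrow> avg is w = 0" and l: "length is = k - CARD('n)"
    obtain a b where ab: "p = (a, b)" by (cases p)
    then have "avg is a = 0" "avg is b = 0" using A l p N by auto
    then show "C.avg is p = 0" by (simp add: ab avg zero_prod_def)
  qed
qed

text \<open>On the functions (u, 0) the complexified operator has the same L1 norm and the same
  projection as the real one, so the real estimate is the complex estimate posed on this
  class.\<close>

lemma (in const_rank_operator) real_estimate_iff_cancellation:
  assumes nk: "CARD('n) \<le> k"
  shows "(\<exists>c>0. \<forall>u\<in>test_functions. tensor_Linf_norm (k - CARD('n)) (deriv_tensor (\<lambda>x. complexify (u x) - real_projection k B u x))
      \<le> ereal (c * L1_norm (diff_operator k B u))) \<longleftrightarrow> cancellation_condition k B"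
proof -
  let ?BC = "\<lambda>\<alpha>. map_prod (B \<alpha>) (B \<alpha>)"
  interpret C: complex_operator ?BC k complexification_J complexification_J
    by (rule complexified_operator[OF nk])
  define U where "U = (\<lambda>(u :: real^'n \<Rightarrow> 'v) x. complexify (u x)) ` test_functions"
  have smooth: "smooth_on UNIV (\<lambda>x. h (u x))" if "bounded_linear h" "u \<in> test_functions" for h u
    using that smooth_on_linear[OF open_UNIV] by (auto simp: test_functions_iff)
  have lin_test: "(\<lambda>x. h (u x)) \<in> test_functions" if h: "bounded_linear h" and u: "u \<in> test_functions"
    for h :: "'a::euclidean_space \<Rightarrow> 'b::euclidean_space" and u :: "real^'n \<Rightarrow> 'a"
    using smooth_on_linear[OF open_UNIV h] u linear_0[OF bounded_linear.linear[OF h]] unfolding test_functions_iff by metis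
  have BC: "diff_operator k ?BC (\<lambda>x. complexify (u x)) = (\<lambda>x. complexify (diff_operator k B u x))" if u: "u \<in> test_functions" for u
    using u by (intro diff_operator_intertwine[OF complexify_bounded_linear bounded_linear.linear[OF complexify_bounded_linear]])
      (auto simp: test_functions_iff complexify_def linear_0[OF B_linear])
  have L1: "L1_norm (diff_operator k ?BC (\<lambda>x. complexify (u x))) = L1_norm (diff_operator k B u)" if u: "u \<in> test_functions" for u
    unfolding BC[OF u] L1_norm_def norm_complexify ..
  have proj: "complex_projection complexification_J k ?BC (\<lambda>x. complexify (u x)) = real_projection k B u" for u
  proof -
    have "kernel_symbol k ?BC = (\<lambda>\<xi>. map_prod (kernel_symbol k B \<xi>) (kernel_symbol k B \<xi>))"
      by (intro ext) (auto simp: kernel_symbol_def symbol_complexified moore_penrose_map_prod[OF S_linear])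
    then show ?thesis by (simp add: complex_projection_def real_projection_def)
  qed
  have "(\<exists>c>0. \<forall>u\<in>U. tensor_Linf_norm (k - CARD('n)) (deriv_tensor (\<lambda>x. u x - complex_projection complexification_J k ?BC u x))
      \<le> ereal (c * L1_norm (diff_operator k ?BC u))) \<longleftrightarrow> cancellation_condition k ?BC"
  proof (rule C.estimate_iff_cancellation)
    show "U \<subseteq> test_functions" unfolding U_def using lin_test[OF complexify_bounded_linear] by blast
    show "(\<lambda>x. u (a + x)) \<in> U" if "u \<in> U" for u a
      using that test_function_shift unfolding U_def by fastforce
    fix u :: "real^'n \<Rightarrow> 'v \<times> 'v" assume u: "u \<in> test_functions"
    have f: "(\<lambda>x. fst (u x)) \<in> test_functions" and s: "(\<lambda>x. snd (u x)) \<in> test_functions"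
      by (rule lin_test[OF bounded_linear_fst u], rule lin_test[OF bounded_linear_snd u])
    have us: "smooth_on UNIV u" using u by (simp add: test_functions_iff)
    have Bf: "diff_operator k B (\<lambda>x. fst (u x)) = (\<lambda>x. fst (diff_operator k ?BC u x))"
      and Bs: "diff_operator k B (\<lambda>x. snd (u x)) = (\<lambda>x. snd (diff_operator k ?BC u x))"
      by (rule diff_operator_intertwine[OF bounded_linear_fst bounded_linear.linear[OF bounded_linear_fst] us]
          diff_operator_intertwine[OF bounded_linear_snd bounded_linear.linear[OF bounded_linear_snd] us], simp)+
    have i: "integrable lborel (diff_operator k ?BC u)" by (rule C.diff_operator_integrable[OF u])
    have n: "norm (fst p) \<le> norm p" "norm (snd p) \<le> norm p" for p :: "'w \<times> 'w"
      by (cases p, simp add: norm_fst_le norm_snd_le)+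
    have le: "L1_norm (diff_operator k B (\<lambda>x. fst (u x))) \<le> L1_norm (diff_operator k ?BC u)"
      "L1_norm (diff_operator k B (\<lambda>x. snd (u x))) \<le> L1_norm (diff_operator k ?BC u)"
      unfolding L1_norm_def Bf Bs
      by (rule integral_mono[OF integrable_norm[OF integrable_bounded_linear[OF bounded_linear_fst i]] integrable_norm[OF i] n(1)],
          rule integral_mono[OF integrable_norm[OF integrable_bounded_linear[OF bounded_linear_snd i]] integrable_norm[OF i] n(2)])
    have "u = (\<lambda>x. complexify (fst (u x)) + complexification_J (complexify (snd (u x))))"
      by (simp add: complexify_def complexification_J_def)
    moreover have "(\<lambda>x. complexify (fst (u x))) \<in> U" "(\<lambda>x. complexify (snd (u x))) \<in> U" 
      unfolding U_def by (rule image_eqI[OF refl f], rule image_eqI[OF refl s])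
    ultimately show "u \<in> U \<or> (\<exists>a\<in>U. \<exists>b\<in>U. u = (\<lambda>x. a x + complexification_J (b x)) \<and>
        L1_norm (diff_operator k ?BC a) \<le> L1_norm (diff_operator k ?BC u) \<and> L1_norm (diff_operator k ?BC b) \<le> L1_norm (diff_operator k ?BC u))"
      using le[folded L1[OF f] L1[OF s]]
      by - (rule disjI2, rule bexI[of _ "\<lambda>x. complexify (fst (u x))"], rule bexI[of _ "\<lambda>x. complexify (snd (u x))"], (intro conjI; assumption), assumption+)
  qed
  then show ?thesis
    unfolding cancellation_complexified[OF nk] U_def ball_simps proj
    by (simp add: L1)
qed

text \<open>The first conjunct treats real spaces, the second Hermitian spaces given as real spaces
  with complex structures. The rank is the real one in both; for complex-linear symbols it is twice
  the complex rank, so constancy means the same.\<close>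

theorem theorem5:
  fixes B :: "'n::finite multi_index \<Rightarrow> 'v::euclidean_space \<Rightarrow> 'w::euclidean_space"
    and k :: nat
  assumes "CARD('n) \<le> k"
    and "\<And>\<alpha>. \<alpha> \<in> multi_indices k \<Longrightarrow> linear (B \<alpha>)"
    and "constant_rank k B"
  shows
    "((\<exists>c>0. \<forall>u \<in> test_functions.
         tensor_Linf_norm (k - CARD('n))
           (deriv_tensor (\<lambda>x. complexify (u x) - real_projection k B u x))
         \<le> ereal (c * L1_norm (diff_operator k B u)))
       \<longleftrightarrow> cancellation_condition k B)
     \<and>
     (\<forall>J\<^sub>V J\<^sub>W. complex_structure J\<^sub>V \<longrightarrow> complex_structure J\<^sub>W \<longrightarrow>
        (\<forall>\<alpha>\<in>multi_indices k. \<forall>v. B \<alpha> (J\<^sub>V v) = J\<^sub>W (B \<alpha> v)) \<longrightarrow>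
        ((\<exists>c>0. \<forall>u \<in> test_functions.
            tensor_Linf_norm (k - CARD('n))
              (deriv_tensor (\<lambda>x. u x - complex_projection J\<^sub>V k B u x))
            \<le> ereal (c * L1_norm (diff_operator k B u)))
          \<longleftrightarrow> cancellation_condition k B))"
proof (intro conjI allI impI)
  interpret const_rank_operator B k by (rule const_rank_operator.intro[OF assms(2,3)])
  show "(\<exists>c>0. \<forall>u \<in> test_functions.
         tensor_Linf_norm (k - CARD('n))
           (deriv_tensor (\<lambda>x. complexify (u x) - real_projection k B u x))
         \<le> ereal (c * L1_norm (diff_operator k B u)))
       \<longleftrightarrow> cancellation_condition k B"
    by (rule real_estimate_iff_cancellation[OF assms(1)])
  fix J\<^sub>V :: "'v \<Rightarrow> 'v" and J\<^sub>W :: "'w \<Rightarrow> 'w"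
  assume J: "complex_structure J\<^sub>V" "complex_structure J\<^sub>W" "\<forall>\<alpha>\<in>multi_indices k. \<forall>v. B \<alpha> (J\<^sub>V v) = J\<^sub>W (B \<alpha> v)"
  interpret C: complex_operator B k J\<^sub>V J\<^sub>W 
    using J by (intro complex_operator.intro complex_operator_axioms.intro const_rank_operator.intro assms) auto
  show "(\<exists>c>0. \<forall>u \<in> test_functions.
            tensor_Linf_norm (k - CARD('n))
              (deriv_tensor (\<lambda>x. u x - complex_projection J\<^sub>V k B u x))
            \<le> ereal (c * L1_norm (diff_operator k B u)))
          \<longleftrightarrow> cancellation_condition k B"
    \<comment> \<open>The class is that of all test functions, so the splitting hypothesis holds by
      its first alternative.\<close>
    by (rule C.estimate_iff_cancellation) (auto intro: test_function_shift)
qed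

end
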